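(* Let $d\ge1$ and let $\mathcal A^\infty$, $b(f)$, $\tau$ and the heat semigroup $\mathcal T_t=e^{t\mathcal L_0}$ on $L^2(\mathcal A^\infty,\tau)\cong L^2(\mathbb R^{2d})$ be as defined in the context. For $f\in C_c^\infty(\mathbb R^{2d})$ put $$v(b(f))=\lim_{t\to0+}t^d\,\mathrm{Tr}(b(f)\,\mathcal T_t).$$ Then $v(b(f))=\int_{\mathbb R^{2d}}f(x)\,dx$.
   Context: On $h=L^2(\mathbb R^d)$ let $(U_\alpha g)(t)=g(t+\alpha)$ and $(V_\beta g)(t)=e^{it\cdot\beta}g(t)$ for $\alpha,\beta,t\in\mathbb R^d$, and for $x=(\alpha,\beta)\in\mathbb R^{2d}$ let $W_x=U_\alpha V_\beta e^{-\frac i2\alpha\cdot\beta}$, so that $W_xW_y=W_{x+y}e^{\frac i2p(x,y)}$ with $p(x,y)=x_1\cdot y_2-x_2\cdot y_1$ for $x=(x_1,x_2)$, $y=(y_1,y_2)$. The Fourier transform is $\hat f(k)=(2\pi)^{-d}\int_{\mathbb R^{2d}}e^{-ik\cdot x}f(x)\,dx$. For $f$ with $\hat f\in L^1(\mathbb R^{2d})$ let $b(f)=\int_{\mathbb R^{2d}}\hat f(x)W_x\,dx\in\mathcal B(h)$. One has $b(f)b(g)=b(f\odot g)$ with $\widehat{(f\odot g)}(x)=\int\hat f(x-x')\hat g(x')e^{\frac i2p(x,x')}dx'$. $\mathcal A^\infty$ is the $*$-algebra generated by $\{b(f):f\in C_c^\infty(\mathbb R^{2d})\}$, and $\tau(b(f))=\hat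 f(0)$ is a faithful trace on it. $\mathcal A^\infty$ acts by left multiplication on $\mathcal H=L^2(\mathcal A^\infty,\tau)$, and $f\mapsto b(f)$ extends to a unitary isomorphism $L^2(\mathbb R^{2d})\to\mathcal H$, by which the two spaces are identified. The canonical derivations are $\delta_j(b(f))=b(\partial_jf)$, $j=1,\dots,2d$, and the associated Lindbladian is $\mathcal L_0(b(f))=\frac12b(\Delta f)$, $f\in C_c^\infty(\mathbb R^{2d})$, $\Delta=\sum_{j=1}^{2d}\partial_j^2$; under the identification it extends to the negative selfadjoint operator $\frac12\Delta$ on $L^2(\mathbb R^{2d})$, and $\mathcal T_t=e^{t\mathcal L_0}$. $\mathrm{Tr}$ is the operator trace on $\mathcal H$. *)

theory Defs
  imports "HOL-Analysis.Analysis"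
begin

section \<open>The complex Hilbert space of square integrable functions on a Euclidean space\<close>

definition square_integrable :: "('a::euclidean_space \<Rightarrow> complex) \<Rightarrow> bool" where
  "square_integrable g \<longleftrightarrow>
     g \<in> borel_measurable lborel \<and> integrable lborel (\<lambda>t. (cmod (g t))\<^sup>2)"

definition ae_eq :: "('a::euclidean_space \<Rightarrow> complex) \<Rightarrow> ('a \<Rightarrow> complex) \<Rightarrow> bool" where
  "ae_eq g h \<longleftrightarrow> square_integrable g \<and> square_integrable h \<and> (AE t in lborel. g t = h t)"

lemma ae_eqI:
  assumes "square_integrable g" "\<And>t. g t = h t"
  shows "ae_eq g h"
proof -
  from assms(2) have "g = h" by (rule ext)
  with assms(1) show ?thesis by (simp add: ae_eq_def)
qed

lemma square_integrable_borel: "square_integrable g \<Longrightarrow> g \<in> borel_measurable borel"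
  by (simp add: square_integrable_def)

lemma square_integrable_zero: "square_integrable (\<lambda>t. 0)"
  by (simp add: square_integrable_def)

lemma square_integrable_mult:
  assumes "square_integrable g" and m: "m \<in> borel_measurable borel" and b: "\<And>t. cmod (m t) \<le> c"
  shows "square_integrable (\<lambda>t. m t * g t)"
proof -
  note [measurable] = square_integrable_borel[OF assms(1)] m
  have "integrable lborel (\<lambda>t. (cmod (m t * g t))\<^sup>2)"
  proof (rule Bochner_Integration.integrable_bound)
    show "integrable lborel (\<lambda>t. c\<^sup>2 * (cmod (g t))\<^sup>2)"
      using assms(1) by (simp add: square_integrable_def)
    have "(cmod (m t * g t))\<^sup>2 \<le> c\<^sup>2 * (cmod (g t))\<^sup>2" for t
      unfolding norm_mult power_mult_distrib
      by (intro mult_right_mono power_mono b) simp_all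
    then show "AE t in lborel. norm ((cmod (m t * g t))\<^sup>2) \<le> norm (c\<^sup>2 * (cmod (g t))\<^sup>2)"
      by simp
  qed measurable
  then show ?thesis by (simp add: square_integrable_def)
qed

lemma square_integrable_scale: "square_integrable g \<Longrightarrow> square_integrable (\<lambda>t. c * g t)"
  by (rule square_integrable_mult[of g "\<lambda>t. c" "cmod c"]) auto

lemma square_integrable_uminus: "square_integrable g \<Longrightarrow> square_integrable (\<lambda>t. - g t)"
  using square_integrable_scale[of g "-1"] by simp

lemma square_integrable_add:
  assumes "square_integrable g" "square_integrable h"
  shows "square_integrable (\<lambda>t. g t + h t)"
proof -
  note [measurable] = square_integrable_borel[OF assms(1)] square_integrable_borel[OF assms(2)]
  have "integrable lborel (\<lambda>t. (cmod (g t + h t))\<^sup>2)"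
  proof (rule Bochner_Integration.integrable_bound)
    show "integrable lborel (\<lambda>t. 2 * (cmod (g t))\<^sup>2 + 2 * (cmod (h t))\<^sup>2)"
      using assms by (simp add: square_integrable_def)
    have "(cmod (g t + h t))\<^sup>2 \<le> 2 * (cmod (g t))\<^sup>2 + 2 * (cmod (h t))\<^sup>2" for t
    proof -
      have "(cmod (g t + h t))\<^sup>2 \<le> (cmod (g t) + cmod (h t))\<^sup>2"
        by (simp add: norm_triangle_ineq power_mono)
      also have "\<dots> \<le> 2 * (cmod (g t))\<^sup>2 + 2 * (cmod (h t))\<^sup>2"
        using sum_squares_bound[of "cmod (g t)" "cmod (h t)"] by (simp add: power2_sum)
      finally show ?thesis .
    qed
    then show "AE t in lborel. norm ((cmod (g t + h t))\<^sup>2)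
        \<le> norm (2 * (cmod (g t))\<^sup>2 + 2 * (cmod (h t))\<^sup>2)"
      by simp
  qed measurable
  then show ?thesis by (simp add: square_integrable_def)
qed

lemma square_integrable_diff:
  "square_integrable g \<Longrightarrow> square_integrable h \<Longrightarrow> square_integrable (\<lambda>t. g t - h t)"
  using square_integrable_add[of g "\<lambda>t. - h t"] by (simp add: square_integrable_uminus)

lemmas square_integrable_intros = square_integrable_zero square_integrable_add
  square_integrable_diff square_integrable_uminus square_integrable_scale

lemma square_integrable_inner:
  assumes "square_integrable g" "square_integrable h"
  shows "integrable lborel (\<lambda>t. cnj (g t) * h t)"
proof -
  note [measurable] = square_integrable_borel[OF assms(1)] square_integrable_borel[OF assms(2)]
  have [measurable]: "(\<lambda>t. cnj (g t)) \<in> borel_measurable borel"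
    by (rule borel_measurable_continuous_on[where f = cnj]) (auto intro: continuous_intros)
  show ?thesis
  proof (rule Bochner_Integration.integrable_bound)
    show "integrable lborel (\<lambda>t. (cmod (g t))\<^sup>2 + (cmod (h t))\<^sup>2)"
      using assms by (simp add: square_integrable_def)
    have "cmod (g t) * cmod (h t) \<le> (cmod (g t))\<^sup>2 + (cmod (h t))\<^sup>2" for t
    proof -
      have "0 \<le> cmod (g t) * cmod (h t)" by simp
      then show ?thesis
        using sum_squares_bound[of "cmod (g t)" "cmod (h t)"] by linarith
    qed
    then show "AE t in lborel. norm (cnj (g t) * h t) \<le> norm ((cmod (g t))\<^sup>2 + (cmod (h t))\<^sup>2)"
      by (simp add: norm_mult)
  qed measurable
qed

lemma lborel_distr_translate: "distr lborel borel (\<lambda>t. t + a) = (lborel :: 'a::euclidean_space measure)"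
  using lborel_distr_plus[of a] by (simp add: add.commute[of _ a])

lemma square_integrable_translate:
  assumes "square_integrable g"
  shows "square_integrable (\<lambda>t. g (t + a))"
proof -
  note [measurable] = square_integrable_borel[OF assms]
  have "integrable (distr lborel borel (\<lambda>t. t + a)) (\<lambda>t. (cmod (g t))\<^sup>2)"
    using assms by (simp add: square_integrable_def lborel_distr_translate)
  then have "integrable lborel (\<lambda>t. (cmod (g (t + a)))\<^sup>2)"
    by (subst (asm) integrable_distr_eq) auto
  then show ?thesis by (simp add: square_integrable_def)
qed

lemma AE_translate:
  fixes a :: "'a::euclidean_space"
  assumes "AE t in lborel. P t"
  shows "AE t in lborel. P (t + a)"
proof -
  have "AE t in distr lborel borel (\<lambda>t. t + a). P t"
    using assms by (subst lborel_distr_translate)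
  then show ?thesis by (rule AE_distrD[rotated]) simp
qed

lemma ae_eq_translate: "ae_eq g h \<Longrightarrow> ae_eq (\<lambda>t. g (t + a)) (\<lambda>t. h (t + a))"
  unfolding ae_eq_def
  using square_integrable_translate[of g a] square_integrable_translate[of h a]
    AE_translate[of "\<lambda>t. g t = h t" a] by blast

quotient_type (overloaded) 'a l2 = "'a::euclidean_space \<Rightarrow> complex" / partial: ae_eq
proof (rule part_equivpI)
  show "\<exists>g. ae_eq g (g :: 'a \<Rightarrow> complex)"
    by (rule exI[of _ "\<lambda>t. 0"]) (simp add: ae_eq_def square_integrable_zero)
  show "symp (ae_eq :: ('a \<Rightarrow> complex) \<Rightarrow> _)"
    by (rule sympI) (auto simp: ae_eq_def)
  show "transp (ae_eq :: ('a \<Rightarrow> complex) \<Rightarrow> _)"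
    by (rule transpI) (auto simp: ae_eq_def)
qed

instantiation l2 :: (euclidean_space) real_vector
begin

lift_definition zero_l2 :: "'a l2" is "\<lambda>t. 0"
  by (simp add: ae_eq_def square_integrable_zero)

lift_definition plus_l2 :: "'a l2 \<Rightarrow> 'a l2 \<Rightarrow> 'a l2" is "\<lambda>g h t. g t + h t"
  by (auto simp: ae_eq_def square_integrable_add)

lift_definition uminus_l2 :: "'a l2 \<Rightarrow> 'a l2" is "\<lambda>g t. - g t"
  by (auto simp: ae_eq_def square_integrable_uminus)

lift_definition minus_l2 :: "'a l2 \<Rightarrow> 'a l2 \<Rightarrow> 'a l2" is "\<lambda>g h t. g t - h t"
  by (auto simp: ae_eq_def square_integrable_diff)

lift_definition scaleR_l2 :: "real \<Rightarrow> 'a l2 \<Rightarrow> 'a l2" is "\<lambda>r g t. complex_of_real r * g t"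
  by (auto simp: ae_eq_def square_integrable_scale)

instance
proof
  fix u v w :: "'a l2" and r s :: real
  show "u + v + w = u + (v + w)"
    by transfer (intro ae_eqI square_integrable_intros; simp add: ae_eq_def algebra_simps)
  show "u + v = v + u"
    by transfer (intro ae_eqI square_integrable_intros; simp add: ae_eq_def algebra_simps)
  show "0 + u = u"
    by transfer (intro ae_eqI square_integrable_intros; simp add: ae_eq_def algebra_simps)
  show "- u + u = 0"
    by transfer (intro ae_eqI square_integrable_intros; simp add: ae_eq_def algebra_simps)
  show "u - v = u + - v"
    by transfer (intro ae_eqI square_integrable_intros; simp add: ae_eq_def algebra_simps)
  show "r *\<^sub>R (u + v) = r *\<^sub>R u + r *\<^sub>R v"
    by transfer (intro ae_eqI square_integrable_intros; simp add: ae_eq_def algebra_simps)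
  show "(r + s) *\<^sub>R u = r *\<^sub>R u + s *\<^sub>R u"
    by transfer (intro ae_eqI square_integrable_intros; simp add: ae_eq_def algebra_simps)
  show "r *\<^sub>R s *\<^sub>R u = (r * s) *\<^sub>R u"
    by transfer (intro ae_eqI square_integrable_intros; simp add: ae_eq_def algebra_simps)
  show "1 *\<^sub>R u = u"
    by transfer (intro ae_eqI square_integrable_intros; simp add: ae_eq_def algebra_simps)
qed

end

lift_definition scaleC :: "complex \<Rightarrow> 'a::euclidean_space l2 \<Rightarrow> 'a l2" (infixr "*\<^sub>C" 75)
  is "\<lambda>c g t. c * g t"
  by (auto simp: ae_eq_def square_integrable_scale)

lift_definition cinner :: "'a::euclidean_space l2 \<Rightarrow> 'a l2 \<Rightarrow> complex"
  is "\<lambda>g h. \<integral>t. cnj (g t) * h t \<partial>lborel"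
  by (rule integral_cong_AE)
    (auto simp: ae_eq_def dest: square_integrable_inner intro: borel_measurable_integrable)

lemma cinner_commute: "cinner u v = cnj (cinner v u)"
  by transfer (simp add: mult.commute flip: Bochner_Integration.integral_cnj)

lemma cinner_add_left: "cinner (u + v) w = cinner u w + cinner v w"
  by transfer (auto simp: ae_eq_def distrib_right square_integrable_inner)

lemma cinner_scaleR_left: "cinner (r *\<^sub>R u) v = of_real r * cinner u v"
  by transfer (simp add: mult.assoc)

lemma cinner_self_raw: "(\<integral>t. cnj (g t) * g t \<partial>lborel) = of_real (\<integral>t. (cmod (g t))\<^sup>2 \<partial>lborel)"
  by (simp flip: integral_complex_of_real add: complex_norm_square mult.commute del: of_real_power)

lemma Re_cinner_self_nonneg: "0 \<le> Re (cinner u u)"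
  by transfer (simp add: cinner_self_raw)

lemma Re_cinner_self_eq_0: "Re (cinner u u) = 0 \<longleftrightarrow> u = 0"
proof (transfer, unfold cinner_self_raw)
  fix g :: "'a \<Rightarrow> complex"
  assume "ae_eq g g"
  then have sq: "square_integrable g"
    by (simp add: ae_eq_def)
  then have "(\<integral>t. (cmod (g t))\<^sup>2 \<partial>lborel) = 0 \<longleftrightarrow> (AE t in lborel. (cmod (g t))\<^sup>2 = 0)"
    by (intro integral_nonneg_eq_0_iff_AE) (auto simp: square_integrable_def)
  then show "Re (complex_of_real (\<integral>t. (cmod (g t))\<^sup>2 \<partial>lborel)) = 0 \<longleftrightarrow> ae_eq g (\<lambda>t. 0)"
    using sq by (simp add: ae_eq_def square_integrable_zero)
qed

instantiation l2 :: (euclidean_space) real_inner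
begin

definition inner_l2 :: "'a l2 \<Rightarrow> 'a l2 \<Rightarrow> real" where
  "inner_l2 u v = Re (cinner u v)"

definition norm_l2 :: "'a l2 \<Rightarrow> real" where
  "norm_l2 u = sqrt (inner u u)"

definition sgn_l2 :: "'a l2 \<Rightarrow> 'a l2" where
  "sgn_l2 u = u /\<^sub>R norm u"

definition dist_l2 :: "'a l2 \<Rightarrow> 'a l2 \<Rightarrow> real" where
  "dist_l2 u v = norm (u - v)"

definition uniformity_l2 :: "('a l2 \<times> 'a l2) filter" where
  "uniformity_l2 = (INF e\<in>{0<..}. principal {(u, v). dist u v < e})"

definition open_l2 :: "'a l2 set \<Rightarrow> bool" where
  "open_l2 U \<longleftrightarrow> (\<forall>u\<in>U. \<forall>\<^sub>F (u', v) in uniformity. u' = u \<longrightarrow> v \<in> U)"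

instance
proof
  fix u v w :: "'a l2" and r :: real
  show "inner u v = inner v u"
    unfolding inner_l2_def by (subst cinner_commute) simp
  show "inner (u + v) w = inner u w + inner v w"
    by (simp add: inner_l2_def cinner_add_left)
  show "inner (r *\<^sub>R u) v = r * inner u v"
    by (simp add: inner_l2_def cinner_scaleR_left)
  show "0 \<le> inner u u"
    by (simp add: inner_l2_def Re_cinner_self_nonneg)
  show "inner u u = 0 \<longleftrightarrow> u = 0"
    by (simp add: inner_l2_def Re_cinner_self_eq_0)
qed (rule norm_l2_def sgn_l2_def dist_l2_def uniformity_l2_def open_l2_def)+

end


section \<open>Orthonormal bases and the operator trace\<close>

definition bounded_clinear :: "('a::euclidean_space l2 \<Rightarrow> 'b::euclidean_space l2) \<Rightarrow> bool" where
  "bounded_clinear A \<longleftrightarrow> bounded_linear A \<and> (\<forall>c u. A (c *\<^sub>C u) = c *\<^sub>C A u)"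

text \<open>The form \<open>cinner\<close> is antilinear in its first argument.\<close>

definition adj :: "('a::euclidean_space l2 \<Rightarrow> 'a l2) \<Rightarrow> 'a l2 \<Rightarrow> 'a l2" where
  "adj A = (THE B. \<forall>u v. cinner u (A v) = cinner (B u) v)"

definition onb :: "'a::euclidean_space l2 set \<Rightarrow> bool" where
  "onb E \<longleftrightarrow> (\<forall>e\<in>E. \<forall>e'\<in>E. cinner e e' = (if e = e' then 1 else 0)) \<and>
     (\<forall>u. (\<forall>e\<in>E. cinner e u = 0) \<longrightarrow> u = 0)"

text \<open>
  The trace class operators are the products of two Hilbert-Schmidt operators; for them the sum
  over the diagonal converges unconditionally to the same value in every orthonormal basis.
\<close>

definition hilbert_schmidt :: "('a::euclidean_space l2 \<Rightarrow> 'a l2) \<Rightarrow> bool" where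
  "hilbert_schmidt A \<longleftrightarrow>
     bounded_clinear A \<and> (\<exists>E. onb E \<and> (\<lambda>e. (norm (A e))\<^sup>2) summable_on E)"

definition trace_class :: "('a::euclidean_space l2 \<Rightarrow> 'a l2) \<Rightarrow> bool" where
  "trace_class A \<longleftrightarrow> (\<exists>B C. hilbert_schmidt B \<and> hilbert_schmidt C \<and> A = B \<circ> C)"

definition op_trace :: "('a::euclidean_space l2 \<Rightarrow> 'a l2) \<Rightarrow> complex" where
  "op_trace A = (THE c. \<forall>E. onb E \<longrightarrow> ((\<lambda>e. cinner e (A e)) has_sum c) E)"

section \<open>Smooth functions\<close>

definition partial_deriv :: "'a::euclidean_space \<Rightarrow> ('a \<Rightarrow> complex) \<Rightarrow> 'a \<Rightarrow> complex" where
  "partial_deriv j f x = vector_derivative (\<lambda>s. f (x + s *\<^sub>R j)) (at 0)"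

primrec times_differentiable :: "nat \<Rightarrow> ('a::euclidean_space \<Rightarrow> complex) \<Rightarrow> bool" where
  "times_differentiable 0 f \<longleftrightarrow> True"
| "times_differentiable (Suc k) f \<longleftrightarrow>
     (\<forall>x. f differentiable (at x)) \<and> (\<forall>j\<in>Basis. times_differentiable k (partial_deriv j f))"

definition smooth :: "('a::euclidean_space \<Rightarrow> complex) \<Rightarrow> bool" where
  "smooth f \<longleftrightarrow> (\<forall>k. times_differentiable k f)"

definition test_function :: "('a::euclidean_space \<Rightarrow> complex) \<Rightarrow> bool" where
  "test_function f \<longleftrightarrow> smooth f \<and> compact (closure {x. f x \<noteq> 0})"

definition laplacian :: "('a::euclidean_space \<Rightarrow> complex) \<Rightarrow> 'a \<Rightarrow> complex" where
  "laplacian f x = (\<Sum>j\<in>Basis. partial_deriv j (partial_deriv j f) x)"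

section \<open>Weyl operators and the algebra they generate\<close>

type_synonym 'n phase = "(real^'n) \<times> (real^'n)"

type_synonym 'n op = "(real^'n) l2 \<Rightarrow> (real^'n) l2"

lift_definition weyl_U :: "'a::euclidean_space \<Rightarrow> 'a l2 \<Rightarrow> 'a l2" is "\<lambda>\<alpha> g t. g (t + \<alpha>)"
  by (rule ae_eq_translate)

lift_definition weyl_V :: "'a::euclidean_space \<Rightarrow> 'a l2 \<Rightarrow> 'a l2" is "\<lambda>\<beta> g t. cis (t \<bullet> \<beta>) * g t"
  unfolding ae_eq_def by (auto intro!: square_integrable_mult[where c = 1] simp: cis_conv_exp)

definition weyl :: "'n::finite phase \<Rightarrow> 'n op" where
  "weyl x g = cis (- (fst x \<bullet> snd x) / 2) *\<^sub>C weyl_U (fst x) (weyl_V (snd x) g)"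

definition fourier :: "('n::finite phase \<Rightarrow> complex) \<Rightarrow> 'n phase \<Rightarrow> complex" where
  "fourier f k =
     complex_of_real (1 / (2 * pi) ^ CARD('n)) * (\<integral>x. cis (- (k \<bullet> x)) * f x \<partial>lborel)"

text \<open>The operator-valued integral \<open>bop f = \<integral> fourier f x weyl x dx\<close> is understood weakly.\<close>

definition bop :: "('n::finite phase \<Rightarrow> complex) \<Rightarrow> 'n op" where
  "bop f = (THE B. bounded_clinear B \<and>
     (\<forall>u v. cinner u (B v) = (\<integral>x. fourier f x * cinner u (weyl x v) \<partial>lborel)))"

inductive_set A_inf :: "('n::finite op) set" where
  gen: "test_function f \<Longrightarrow> bop f \<in> A_inf"
| add: "a \<in> A_inf \<Longrightarrow> c \<in> A_inf \<Longrightarrow> (\<lambda>u. a u + c u) \<in> A_inf"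
| scale: "a \<in> A_inf \<Longrightarrow> (\<lambda>u. z *\<^sub>C a u) \<in> A_inf"
| mult: "a \<in> A_inf \<Longrightarrow> c \<in> A_inf \<Longrightarrow> a \<circ> c \<in> A_inf"
| star: "a \<in> A_inf \<Longrightarrow> adj a \<in> A_inf"

text \<open>
  Products of operators \<open>bop f\<close> with \<open>f\<close> a test function are again of the form \<open>bop g\<close>, but \<open>g\<close> need
  not have compact support.  Hence the trace \<open>\<tau>(bop g) = fourier g 0\<close> on \<open>A_inf\<close> is expressed
  through all \<open>g\<close> for which \<open>g\<close> and \<open>fourier g\<close> are integrable.
\<close>

definition tau :: "'n::finite op \<Rightarrow> complex" where
  "tau a = (THE c. \<exists>g. integrable lborel g \<and> integrable lborel (fourier g) \<and> a = bop g \<and> c = fourier g 0)"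

section \<open>The space \<open>L\<^sup>2(A_inf, \<tau>)\<close> and the heat semigroup on it\<close>

text \<open>
  The completion of \<open>A_inf\<close> for the inner product \<open>\<tau>(a\<^sup>* c)\<close> is identified with the square
  integrable functions on phase space by the unitary extending \<open>bop f \<mapsto> f\<close>.  As the test functions
  are dense, the vector \<open>gns_vec a\<close> that corresponds to \<open>a\<close> is determined by its inner products
  \<open>\<tau>(bop f\<^sup>* a)\<close> with the vectors of the \<open>bop f\<close>.
\<close>

definition gns_vec :: "'n::finite op \<Rightarrow> 'n phase l2" where
  "gns_vec a = (THE u. \<forall>f. test_function f \<longrightarrow> cinner (abs_l2 f) u = tau (adj (bop f) \<circ> a))"

definition left_mult :: "'n::finite op \<Rightarrow> 'n phase l2 \<Rightarrow> 'n phase l2" where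
  "left_mult a = (THE M. bounded_clinear M \<and> (\<forall>c\<in>A_inf. M (gns_vec c) = gns_vec (a \<circ> c)))"

text \<open>
  The strongly continuous semigroups of selfadjoint contractions are exactly the \<open>e\<^sup>t\<^sup>L\<close> with \<open>L\<close>
  negative selfadjoint, \<open>L\<close> being the generator.  The last clause says that the generator extends
  the Lindbladian \<open>bop f \<mapsto> bop (laplacian f) / 2\<close>, which has only one selfadjoint extension.  So the values
  of the semigroup at times \<open>t \<ge> 0\<close> are unique; those at \<open>t < 0\<close> are irrelevant and unspecified.
\<close>

definition is_heat_semigroup :: "(real \<Rightarrow> 'n::finite phase l2 \<Rightarrow> 'n phase l2) \<Rightarrow> bool" where
  "is_heat_semigroup T \<longleftrightarrow>
     (\<forall>t\<ge>0. bounded_clinear (T t) \<and> (\<forall>u. norm (T t u) \<le> norm u) \<and>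
        (\<forall>u v. cinner (T t u) v = cinner u (T t v))) \<and>
     (\<forall>u. T 0 u = u) \<and>
     (\<forall>s\<ge>0. \<forall>t\<ge>0. \<forall>u. T (s + t) u = T s (T t u)) \<and>
     (\<forall>u. ((\<lambda>t. T t u) \<longlongrightarrow> u) (at_right 0)) \<and>
     (\<forall>f. test_function f \<longrightarrow>
        ((\<lambda>t. (1 / t) *\<^sub>R (T t (gns_vec (bop f)) - gns_vec (bop f)))
          \<longlongrightarrow> (1 / 2) *\<^sub>R gns_vec (bop (laplacian f))) (at_right 0))"

definition heat :: "real \<Rightarrow> 'n::finite phase l2 \<Rightarrow> 'n phase l2" where
  "heat = (SOME T. is_heat_semigroup T)"

definition nc_volume :: "'n::finite op \<Rightarrow> complex" where
  "nc_volume a =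
     Lim (at_right 0) (\<lambda>t. complex_of_real (t ^ CARD('n)) * op_trace (left_mult a \<circ> heat t))"

end

theory Submission
  imports Defs "HOL-Probability.Characteristic_Functions"
begin

text \<open>
  Everything becomes explicit after a Fourier transform on phase space.  Under it \<open>L\<^sup>2(A_inf, \<tau>)\<close> is the space of
  square integrable functions of the frequency \<open>x\<close>, the heat semigroup is multiplication by
  \<open>exp (- t \<parallel>x\<parallel>\<^sup>2 / 2)\<close>, and left multiplication by \<open>bop f\<close> is convolution with \<open>fourier f\<close>, twisted by the Weyl
  cocycle.  The product has the kernel \<open>fourier f (x - x') exp (i p(x, x') / 2) exp (- t \<parallel>x'\<parallel>\<^sup>2 / 2)\<close>; as
  \<open>p(x, x) = 0\<close>, its integral over the diagonal is \<open>fourier f 0 (2 \<pi> / t)\<^sup>d = t\<^sup>- \<^sup>d \<integral>f\<close>.  So \<open>t\<^sup>d Tr\<close> does not even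
  depend on \<open>t\<close>.

  Three things have to be supplied.  First, the operators in the statement are given by definite descriptions, and
  have to be identified.  The symbols \<open>g\<close> for which \<open>g\<close> and \<open>fourier g\<close> are both integrable form a \<open>*\<close>-algebra
  under the Moyal product, because that product can be written as an average of translates of one factor against the
  integrable transform of the other (\<open>fourier_l1_moyal\<close>, \<open>A_inf_symbol\<close>).  The Weyl calculus is injective on
  integrable functions: conjugating by Weyl operators multiplies the matrix coefficients by characters, so the claim
  reduces to that for the Fourier transform, with the help of a coefficient that never vanishes (\<open>wop_injective\<close>).
  This determines \<open>tau\<close>, \<open>gns_vec\<close> and \<open>left_mult\<close> (\<open>tau_bop\<close>, \<open>gns_vec_bop\<close>, \<open>left_mult_bop\<close>).

  Second, the heat semigroup is unique.  If a vector is orthogonal to \<open>(1 - \<Delta>/2) f\<close> for all test functions \<open>f\<close>,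
  then by translating \<open>f\<close> its transform is annihilated by the transform of every bump, and so it is zero.  Hence the
  test functions determine the generator of any such semigroup \<open>T\<close> on the whole range of \<open>(1 - \<Delta>/2)\<inverse>\<close>; comparing
  with the Gaussian multipliers \<open>S\<close>, the function \<open>s \<mapsto> \<langle>T\<^bsub>t-s\<^esub> u, S\<^bsub>s\<^esub> w\<rangle>\<close> has derivative zero
  (\<open>heat_semigroup_unique\<close>).

  Third, trace class operators and traces.  In the representation that sends functions of the frequency \<open>x\<close> to
  functions of the position \<open>y\<close> the operator has the kernel \<open>exp (i x \<cdot> y) f (y + rot x / 2) exp (- t \<parallel>x\<parallel>\<^sup>2 / 2)\<close>.
  Since \<open>f\<close> has compact support, powers of \<open>\<parallel>y\<parallel>\<close> are controlled by powers of \<open>\<parallel>x\<parallel>\<close>, and these by the Gaussian;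
  derivatives in \<open>y\<close> only produce derivatives of \<open>f\<close> and powers of \<open>x\<close>.  So one can split off the Hilbert-Schmidt
  operator \<open>(1 - \<Delta>)\<^sup>- \<^sup>m (1 + \<parallel>y\<parallel>\<^sup>2)\<^sup>- \<^sup>m\<close> with \<open>m = 2 d\<close>, and the remaining factor is again given by a square integrable kernel
  (\<open>heat_kernel_factorisation\<close>).  For a product of two such operators the sum over an orthonormal basis is computed by
  Parseval's identity under the integral over \<open>y\<close> (\<open>Kop_trace_pairing\<close>, \<open>heat_kernel_trace\<close>).
\<close>

section \<open>Hilbert space geometry of the square integrable functions\<close>

lemma square_integrable_rep: "square_integrable (rep_l2 u)"
  using Quotient3_rep_reflp[OF Quotient3_l2, of u] by (simp add: ae_eq_def)

lemma abs_rep_l2 [simp]: "abs_l2 (rep_l2 u) = u"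
  by (rule Quotient3_abs_rep[OF Quotient3_l2])

lemma ae_eq_refl: "square_integrable g \<Longrightarrow> ae_eq g g"
  by (simp add: ae_eq_def)

lemma abs_l2_eq_iff:
  "square_integrable g \<Longrightarrow> square_integrable h \<Longrightarrow> abs_l2 g = abs_l2 h \<longleftrightarrow> (AE x in lborel. g x = h x)"
  using Quotient3_rel[OF Quotient3_l2, of g h] by (simp add: ae_eq_def)

lemma abs_l2_eqI:
  "square_integrable g \<Longrightarrow> square_integrable h \<Longrightarrow> AE x in lborel. g x = h x \<Longrightarrow> abs_l2 g = abs_l2 h"
  by (simp add: abs_l2_eq_iff)

lemma AE_rep_abs: "square_integrable g \<Longrightarrow> AE x in lborel. rep_l2 (abs_l2 g) x = g x"
  using abs_l2_eq_iff[OF square_integrable_rep[of "abs_l2 g"], of g] by simp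

lemma l2_cases: obtains g where "square_integrable g" "u = abs_l2 g"
  using square_integrable_rep[of u] abs_rep_l2[of u] by metis

lemma abs_l2_add:
  "square_integrable g \<Longrightarrow> square_integrable h \<Longrightarrow> abs_l2 g + abs_l2 h = abs_l2 (\<lambda>x. g x + h x)"
  by (rule plus_l2.abs_eq) (simp_all add: ae_eq_refl)

lemma abs_l2_diff:
  "square_integrable g \<Longrightarrow> square_integrable h \<Longrightarrow> abs_l2 g - abs_l2 h = abs_l2 (\<lambda>x. g x - h x)"
  by (rule minus_l2.abs_eq) (simp_all add: ae_eq_refl)

lemma abs_l2_scaleC: "square_integrable g \<Longrightarrow> c *\<^sub>C abs_l2 g = abs_l2 (\<lambda>x. c * g x)"
  by (rule scaleC.abs_eq) (simp_all add: ae_eq_refl)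

lemma abs_l2_scaleR: "square_integrable g \<Longrightarrow> r *\<^sub>R abs_l2 g = abs_l2 (\<lambda>x. complex_of_real r * g x)"
  by (rule scaleR_l2.abs_eq) (simp_all add: ae_eq_refl)

lemma abs_l2_zero: "abs_l2 (\<lambda>x. 0) = 0"
  by (simp add: zero_l2_def)

lemma cinner_abs:
  "square_integrable g \<Longrightarrow> square_integrable h \<Longrightarrow>
    cinner (abs_l2 g) (abs_l2 h) = (\<integral>t. cnj (g t) * h t \<partial>lborel)"
  by (rule cinner.abs_eq) (simp_all add: ae_eq_refl)

lemma AE_rep_add: "AE x in lborel. rep_l2 (u + v) x = rep_l2 u x + rep_l2 v x"
  using AE_rep_abs[OF square_integrable_add[OF square_integrable_rep square_integrable_rep], of u v]
  by (simp add: abs_l2_add[symmetric] square_integrable_rep)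

lemma AE_rep_scaleC: "AE x in lborel. rep_l2 (c *\<^sub>C u) x = c * rep_l2 u x"
  using AE_rep_abs[OF square_integrable_scale[OF square_integrable_rep], of c u]
  by (simp add: abs_l2_scaleC[symmetric] square_integrable_rep)

lemma scaleC_add_right: "c *\<^sub>C (u + v) = c *\<^sub>C u + c *\<^sub>C v"
  by transfer (intro ae_eqI square_integrable_intros; simp add: ae_eq_def algebra_simps)

lemma scaleC_add_left: "(c + d) *\<^sub>C u = c *\<^sub>C u + d *\<^sub>C u"
  by transfer (intro ae_eqI square_integrable_intros; simp add: ae_eq_def algebra_simps)

lemma scaleC_scaleC [simp]: "c *\<^sub>C (d *\<^sub>C u) = (c * d) *\<^sub>C u"
  by transfer (intro ae_eqI square_integrable_intros; simp add: ae_eq_def algebra_simps)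

lemma scaleC_one [simp]: "1 *\<^sub>C u = u"
  by transfer (intro ae_eqI square_integrable_intros; simp add: ae_eq_def algebra_simps)

lemma scaleC_zero_left [simp]: "0 *\<^sub>C u = 0"
  by transfer (intro ae_eqI square_integrable_intros; simp add: ae_eq_def algebra_simps)

lemma scaleC_zero_right [simp]: "c *\<^sub>C 0 = 0"
  by transfer (intro ae_eqI square_integrable_intros; simp add: ae_eq_def algebra_simps)

lemma scaleC_diff_left: "(c - d) *\<^sub>C u = c *\<^sub>C u - d *\<^sub>C u"
  by transfer (intro ae_eqI square_integrable_intros; simp add: ae_eq_def algebra_simps)

lemma scaleR_scaleC: "r *\<^sub>R u = complex_of_real r *\<^sub>C u"
  by transfer (intro ae_eqI square_integrable_intros; simp add: ae_eq_def algebra_simps)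

lemma cinner_scaleC_left [simp]: "cinner (c *\<^sub>C u) v = cnj c * cinner u v"
  by transfer (simp add: mult.assoc)

lemma cinner_scaleC_right [simp]: "cinner u (c *\<^sub>C v) = c * cinner u v"
  by (subst (1 2) cinner_commute) simp

lemma cinner_add_right: "cinner u (v + w) = cinner u v + cinner u w"
  by (subst (1 2 3) cinner_commute) (simp add: cinner_add_left)

lemma cinner_zero_left [simp]: "cinner 0 u = 0"
  using cinner_add_left[of 0 0 u] by simp

lemma cinner_zero_right [simp]: "cinner u 0 = 0"
  using cinner_add_right[of u 0 0] by simp

lemma cinner_uminus_left [simp]: "cinner (- u) v = - cinner u v"
  using cinner_add_left[of u "- u" v] by (simp add: add_eq_0_iff)

lemma cinner_uminus_right [simp]: "cinner u (- v) = - cinner u v"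
  using cinner_add_right[of u v "- v"] by (simp add: add_eq_0_iff)

lemma cinner_diff_left: "cinner (u - v) w = cinner u w - cinner v w"
  using cinner_add_left[of u "- v" w] by simp

lemma cinner_diff_right: "cinner u (v - w) = cinner u v - cinner u w"
  using cinner_add_right[of u v "- w"] by simp

lemma cinner_sum_left: "cinner (\<Sum>i\<in>I. f i) v = (\<Sum>i\<in>I. cinner (f i) v)"
  by (induction I rule: infinite_finite_induct) (simp_all add: cinner_add_left)

lemma cinner_sum_right: "cinner v (\<Sum>i\<in>I. f i) = (\<Sum>i\<in>I. cinner v (f i))"
  by (induction I rule: infinite_finite_induct) (simp_all add: cinner_add_right)

lemma cinner_self: "cinner u u = complex_of_real ((norm u)\<^sup>2)"
proof -
  have "Im (cinner u u) = 0"
    using cinner_commute[of u u] by (metis complex_cnj_cancel_iff Reals_cnj_iff complex_is_Real_iff)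
  moreover have "Re (cinner u u) = (norm u)\<^sup>2"
    by (simp add: power2_norm_eq_inner inner_l2_def)
  ultimately show ?thesis by (simp add: complex_eq_iff)
qed

lemma norm_scaleC [simp]: "norm (c *\<^sub>C u) = cmod c * norm u"
proof -
  have "cinner (c *\<^sub>C u) (c *\<^sub>C u) = complex_of_real ((cmod c)\<^sup>2) * cinner u u"
    by (simp add: complex_norm_square del: of_real_power)
  then have "complex_of_real ((norm (c *\<^sub>C u))\<^sup>2) = complex_of_real ((cmod c * norm u)\<^sup>2)"
    unfolding cinner_self by (simp add: power_mult_distrib)
  then have "(norm (c *\<^sub>C u))\<^sup>2 = (cmod c * norm u)\<^sup>2" by (simp only: of_real_eq_iff)
  then show ?thesis by (simp add: power2_eq_iff_nonneg)
qed

lemma norm_abs_l2: "square_integrable g \<Longrightarrow> (norm (abs_l2 g))\<^sup>2 = (\<integral>t. (cmod (g t))\<^sup>2 \<partial>lborel)"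
  using cinner_self[of "abs_l2 g"] unfolding cinner_abs cinner_self_raw of_real_eq_iff
  by (metis cinner_abs cinner_self cinner_self_raw of_real_eq_iff)

lemma cmod_cinner_le: "cmod (cinner u v) \<le> norm u * norm v"
proof (cases "cinner u v = 0")
  case False
  define c where "c = cnj (cinner u v) / cmod (cinner u v)"
  have c: "c * cinner u v = cmod (cinner u v)" "cmod c = 1"
    using False by (auto simp: c_def norm_divide complex_norm_square[symmetric] power2_eq_square mult.commute
        field_simps simp flip: of_real_mult)
  have "cmod (cinner u v) = Re (cinner u (c *\<^sub>C v))" by (simp add: c)
  also have "\<dots> = inner u (c *\<^sub>C v)" by (simp add: inner_l2_def)
  also have "\<dots> \<le> norm u * norm (c *\<^sub>C v)" by (rule norm_cauchy_schwarz)
  finally show ?thesis by (simp add: c)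
qed simp

lemma cmod_cinner_le': "cmod (cinner u v) \<le> norm v * norm u"
  using cmod_cinner_le[of u v] by (simp only: mult.commute)

lemma bounded_linear_cinner: "bounded_linear (cinner u)"
  by (rule bounded_linear_intro[where K = "norm u"])
    (simp_all add: cinner_add_right scaleR_scaleC scaleR_conv_of_real cmod_cinner_le')

lemma bounded_bilinear_cinner: "bounded_bilinear cinner"
  by standard (auto simp: cinner_add_left cinner_add_right scaleR_scaleC scaleR_conv_of_real
      intro!: exI[of _ 1] cmod_cinner_le)

lemmas tendsto_cinner = bounded_bilinear.tendsto[OF bounded_bilinear_cinner]
lemma cinner_eqI:
  assumes "\<And>u. cinner u v = cinner u w"
  shows "v = w"
proof -
  have "cinner (v - w) (v - w) = 0" using assms[of "v - w"] by (simp add: cinner_diff_right)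
  then show ?thesis by (simp add: cinner_self)
qed

lemma bounded_clinearI:
  assumes "\<And>u v. A (u + v) = A u + A v" "\<And>c u. A (c *\<^sub>C u) = c *\<^sub>C A u"
    and "\<And>u. norm (A u) \<le> K * norm u"
  shows "bounded_clinear A"
  unfolding bounded_clinear_def
  using assms by (auto intro!: bounded_linear_intro[where K = K] simp: scaleR_scaleC mult.commute)

lemma bounded_clinear_add: "bounded_clinear A \<Longrightarrow> A (u + v) = A u + A v"
  by (simp add: bounded_clinear_def bounded_linear.linear linear_add)

lemma bounded_clinear_diff: "bounded_clinear A \<Longrightarrow> A (u - v) = A u - A v"
  by (simp add: bounded_clinear_def bounded_linear.linear linear_diff)

lemma bounded_clinear_scaleC: "bounded_clinear A \<Longrightarrow> A (c *\<^sub>C u) = c *\<^sub>C A u"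
  by (simp add: bounded_clinear_def)

lemma bounded_clinear_scaleR: "bounded_clinear A \<Longrightarrow> A (c *\<^sub>R u) = c *\<^sub>R A u"
  by (simp add: bounded_clinear_def scaleR_scaleC)

lemma bounded_clinear_bounded: "bounded_clinear A \<Longrightarrow> \<exists>K\<ge>0. \<forall>u. norm (A u) \<le> K * norm u"
  unfolding bounded_clinear_def using bounded_linear.nonneg_bounded[of A] by (auto simp: mult.commute)

lemma bounded_clinear_compose:
  assumes "bounded_clinear A" "bounded_clinear B"
  shows "bounded_clinear (A \<circ> B)"
  using assms bounded_linear_compose[of A B] unfolding bounded_clinear_def comp_def by auto

text \<open>
  The weight \<open>2 ^ n\<close> lets summability of squares give geometric decay of the increments.
\<close>

lemma complete_cauchy_telescope:
  fixes a :: "nat \<Rightarrow> complex" and b :: "nat \<Rightarrow> real"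
  assumes "summable b" "\<And>n. (cmod (a (Suc n) - a n))\<^sup>2 * 2 ^ n \<le> b n"
  shows "convergent a"
proof -
  obtain C where "\<forall>x\<in>range b. norm x \<le> C"
    using summable_imp_bounded[OF assms(1)] unfolding bounded_iff by blast
  then have C: "b n \<le> C" for n by (auto simp: abs_le_iff)
  have le: "cmod (a (Suc n) - a n) \<le> sqrt C * (1 / sqrt 2) ^ n" for n
  proof -
    have "(cmod (a (Suc n) - a n))\<^sup>2 \<le> C / 2 ^ n"
      using order_trans[OF assms(2) C, of n] by (simp add: field_simps)
    then have "cmod (a (Suc n) - a n) \<le> sqrt (C / 2 ^ n)"
      by (simp add: real_le_rsqrt)
    then show ?thesis by (simp add: real_sqrt_divide power_divide real_sqrt_power)
  qed
  have "summable (\<lambda>n. sqrt C * (1 / sqrt 2) ^ n)"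
    by (intro summable_mult summable_geometric) simp
  then have "summable (\<lambda>n. a (Suc n) - a n)"
    by (rule summable_comparison_test') (use le in auto)
  then have "convergent (\<lambda>n. (\<Sum>i<n. a (Suc i) - a i) + a 0)"
    by (intro convergent_add convergent_const) (simp add: summable_iff_convergent)
  then show ?thesis by (simp add: sum_lessThan_telescope)
qed

text \<open>
  Riesz and Fischer: along a subsequence with \<open>\<Sum>n. 2\<^sup>n \<parallel>g\<^bsub>n+1\<^esub> - g\<^bsub>n\<^esub>\<parallel>\<^sup>2\<close> finite the representatives converge
  almost everywhere, and Fatou's lemma turns this into convergence in norm.
\<close>

lemma l2_Cauchy_convergent:
  fixes X :: "nat \<Rightarrow> 'a::euclidean_space l2"
  assumes "Cauchy X"
  shows "convergent X"
proof -
  have ex: "\<exists>N. \<forall>m\<ge>N. \<forall>n\<ge>N. norm (X m - X n) < (1/2) ^ k" for k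
    using CauchyD[OF assms, of "(1/2) ^ k"] by simp
  then obtain N where N: "\<And>k m n. m \<ge> N k \<Longrightarrow> n \<ge> N k \<Longrightarrow> norm (X m - X n) < (1/2) ^ k"
    by metis
  define r where "r = (\<lambda>k. k + (\<Sum>i\<le>k. N i))"
  have rN: "r k \<ge> N k" for k
    unfolding r_def using member_le_sum[of k "{..k}" N] by simp
  have r_mono: "strict_mono r"
    by (rule strict_mono_Suc_iff[THEN iffD2]) (simp add: r_def)
  define g where "g = (\<lambda>n. rep_l2 (X (r n)))"
  have gX: "X (r n) = abs_l2 (g n)" and sq: "square_integrable (g n)" for n
    by (simp_all add: g_def square_integrable_rep)
  note [measurable] = square_integrable_borel[OF sq]
  have nrm: "(\<integral>x. (cmod (g m x - g n x))\<^sup>2 \<partial>lborel) = (norm (X (r m) - X (r n)))\<^sup>2"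
    and int: "integrable lborel (\<lambda>x. (cmod (g m x - g n x))\<^sup>2)" for m n
    using norm_abs_l2[OF square_integrable_diff[OF sq[of m] sq[of n]]] square_integrable_diff[OF sq[of m] sq[of n]]
    by (auto simp: gX abs_l2_diff[OF sq sq] square_integrable_def)
  define D where "D = (\<lambda>n x. (cmod (g (Suc n) x - g n x))\<^sup>2 * 2 ^ n)"
  have ID: "(\<integral>x. D n x \<partial>lborel) \<le> (1/2) ^ n" for n
  proof -
    have "norm (X (r (Suc n)) - X (r n)) \<le> (1/2) ^ n"
      by (intro less_imp_le N rN order_trans[OF rN strict_mono_leD[OF r_mono]]) simp
    then have "(norm (X (r (Suc n)) - X (r n)))\<^sup>2 \<le> ((1/2) ^ n)\<^sup>2"
      by (rule power_mono) simp
    then have "(norm (X (r (Suc n)) - X (r n)))\<^sup>2 * 2 ^ n \<le> ((1/2) ^ n)\<^sup>2 * 2 ^ n"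
      by simp
    also have "\<dots> = (1/2) ^ n" by (simp add: power2_eq_square power_divide)
    finally show ?thesis by (simp add: D_def nrm)
  qed
  have "AE x in lborel. summable (\<lambda>n. D n x)"
  proof -
    have "(\<integral>\<^sup>+x. (\<Sum>n. ennreal (D n x)) \<partial>lborel) = (\<Sum>n. \<integral>\<^sup>+x. ennreal (D n x) \<partial>lborel)"
      unfolding D_def by (intro nn_integral_suminf) measurable
    also have "\<dots> \<le> (\<Sum>n. ennreal ((1/2) ^ n))"
    proof (intro suminf_le allI)
      fix n show "(\<integral>\<^sup>+x. ennreal (D n x) \<partial>lborel) \<le> ennreal ((1/2) ^ n)"
        using ID[of n] by (subst nn_integral_eq_integral) (auto simp: D_def int intro!: ennreal_leI)
    qed auto
    also have "\<dots> < \<infinity>"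
      by (subst suminf_ennreal2) (auto simp: summable_geometric)
    finally have "AE x in lborel. (\<Sum>n. ennreal (D n x)) \<noteq> \<infinity>"
      unfolding D_def by (intro nn_integral_PInf_AE) (auto simp: less_top)
    then show ?thesis
    proof (rule AE_mp, intro AE_I2 impI)
      fix x assume "(\<Sum>n. ennreal (D n x)) \<noteq> \<infinity>"
      then show "summable (\<lambda>n. D n x)"
        by (intro summable_suminf_not_top) (auto simp: D_def)
    qed
  qed
  then have conv: "AE x in lborel. convergent (\<lambda>n. g n x)"
    by (rule AE_mp) (auto intro!: AE_I2 complete_cauchy_telescope simp: D_def)
  define G where "G = (\<lambda>x. lim (\<lambda>n. g n x))"
  have G [measurable]: "G \<in> borel_measurable lborel"
    unfolding G_def by (rule borel_measurable_lim_metric) measurable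
  have lim: "AE x in lborel. (\<lambda>n. g n x) \<longlonglongrightarrow> G x"
    using conv by (rule AE_mp) (auto simp: G_def convergent_LIMSEQ_iff)
  have fatou: "(\<integral>\<^sup>+x. ennreal ((cmod (G x - g n x))\<^sup>2) \<partial>lborel) \<le> ennreal (((1/2) ^ n)\<^sup>2)" for n
  proof -
    have "(\<integral>\<^sup>+x. ennreal ((cmod (G x - g n x))\<^sup>2) \<partial>lborel)
        = (\<integral>\<^sup>+x. liminf (\<lambda>m. ennreal ((cmod (g m x - g n x))\<^sup>2)) \<partial>lborel)"
    proof (rule nn_integral_cong_AE, rule AE_mp[OF lim], intro AE_I2 impI)
      fix x assume "(\<lambda>m. g m x) \<longlonglongrightarrow> G x"
      then have "(\<lambda>m. ennreal ((cmod (g m x - g n x))\<^sup>2)) \<longlonglongrightarrow> ennreal ((cmod (G x - g n x))\<^sup>2)"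
        by (intro tendsto_ennrealI tendsto_intros)
      then show "ennreal ((cmod (G x - g n x))\<^sup>2) = liminf (\<lambda>m. ennreal ((cmod (g m x - g n x))\<^sup>2))"
        by (rule lim_imp_Liminf[symmetric, OF sequentially_bot])
    qed
    also have "\<dots> \<le> liminf (\<lambda>m. \<integral>\<^sup>+x. ennreal ((cmod (g m x - g n x))\<^sup>2) \<partial>lborel)"
      by (rule nn_integral_liminf) measurable
    also have "\<dots> \<le> ennreal (((1/2) ^ n)\<^sup>2)"
    proof (rule Liminf_le, simp, rule eventually_mono[OF eventually_ge_at_top[of n]])
      fix m assume "m \<ge> n"
      have "norm (X (r m) - X (r n)) \<le> (1/2) ^ n"
        by (rule less_imp_le[OF N[OF order_trans[OF rN strict_mono_leD[OF r_mono \<open>m \<ge> n\<close>]] rN]])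
      then have "(norm (X (r m) - X (r n)))\<^sup>2 \<le> ((1/2) ^ n)\<^sup>2"
        by (rule power_mono) simp
      then show "(\<integral>\<^sup>+x. ennreal ((cmod (g m x - g n x))\<^sup>2) \<partial>lborel) \<le> ennreal (((1/2) ^ n)\<^sup>2)"
        by (subst nn_integral_eq_integral) (auto simp: int nrm intro!: ennreal_leI)
    qed
    finally show ?thesis .
  qed
  have sqd: "square_integrable (\<lambda>x. G x - g n x)" for n
    unfolding square_integrable_def
    by (auto intro!: integrableI_bounded le_less_trans[OF fatou[of n]])
  have sqG: "square_integrable G"
    using square_integrable_add[OF sqd[of 0] sq[of 0]] by simp
  have "norm (abs_l2 G - X (r n)) \<le> (1/2) ^ n" for n
  proof -
    have "ennreal ((norm (abs_l2 G - X (r n)))\<^sup>2) \<le> ennreal (((1/2) ^ n)\<^sup>2)"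
      unfolding gX abs_l2_diff[OF sqG sq] norm_abs_l2[OF sqd]
      using fatou[of n] sqd[of n] by (subst nn_integral_eq_integral[symmetric]) (auto simp: square_integrable_def)
    then have "(norm (abs_l2 G - X (r n)))\<^sup>2 \<le> ((1/2) ^ n)\<^sup>2"
      by (subst (asm) ennreal_le_iff) auto
    then show ?thesis by (rule power2_le_imp_le) simp
  qed
  then have "norm (X (r n) - abs_l2 G) \<le> (1/2) ^ n" for n by (simp add: norm_minus_commute)
  then have "(\<lambda>n. X (r n) - abs_l2 G) \<longlonglongrightarrow> 0"
    by (intro Lim_null_comparison[OF _ LIMSEQ_power_zero[of "1/2::real"]] always_eventually) auto
  then have "(X \<circ> r) \<longlonglongrightarrow> abs_l2 G"
    using LIM_zero_iff[of "X \<circ> r" "abs_l2 G" sequentially] by (simp add: comp_def)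
  from Cauchy_converges_subseq[OF assms r_mono this] show ?thesis
    by (auto simp: convergent_def)
qed

instance l2 :: (euclidean_space) complete_space
  by standard (rule l2_Cauchy_convergent)

instance l2 :: (euclidean_space) banach ..


lemma subspace_closure:
  fixes S :: "'a::real_normed_vector set"
  assumes "subspace S"
  shows "subspace (closure S)"
  unfolding subspace_def
proof (intro conjI ballI allI)
  show "0 \<in> closure S" using subspace_0[OF assms] closure_subset by blast
  fix x y assume "x \<in> closure S" "y \<in> closure S"
  then obtain X Y where "\<And>n. X n \<in> S" "X \<longlonglongrightarrow> x" "\<And>n. Y n \<in> S" "Y \<longlonglongrightarrow> y"
    unfolding closure_sequential by blast
  then show "x + y \<in> closure S"
    unfolding closure_sequential
    by (intro exI[of _ "\<lambda>n. X n + Y n"] conjI allI tendsto_add subspace_add[OF assms])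
next
  fix c :: real and x assume "x \<in> closure S"
  then obtain X where "\<And>n. X n \<in> S" "X \<longlonglongrightarrow> x"
    unfolding closure_sequential by blast
  then show "c *\<^sub>R x \<in> closure S"
    unfolding closure_sequential
    by (intro exI[of _ "\<lambda>n. c *\<^sub>R X n"] conjI allI tendsto_scaleR tendsto_const subspace_scale[OF assms])
qed

text \<open>
  A sequence in the closure that minimises the distance to a point is Cauchy by the parallelogram law.  Its limit is
  the foot of the perpendicular, and the remainder is orthogonal to the subspace.
\<close>

lemma dense_of_orthogonal_trivial:
  fixes S :: "'a::{real_inner, complete_space} set"
  assumes S: "subspace S" and triv: "\<And>z. (\<And>s. s \<in> S \<Longrightarrow> inner s z = 0) \<Longrightarrow> z = 0"
  shows "closure S = UNIV"
proof -
  define C where "C = closure S"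
  have C: "subspace C" "closed C" "0 \<in> C" "C \<noteq> {}"
    using subspace_0[OF subspace_closure[OF S]] by (auto simp: C_def subspace_closure[OF S])
  have "x \<in> C" for x
  proof -
    define d where "d = infdist x C"
    have d_le: "d \<le> norm (x - y)" if "y \<in> C" for y
      using infdist_le[OF that, of x] by (simp add: d_def dist_norm)
    have "\<exists>y\<in>C. norm (x - y) < d + 1 / real (Suc n)" for n
    proof (rule ccontr)
      assume "\<not> ?thesis"
      then have "d + 1 / real (Suc n) \<le> infdist x C"
        unfolding infdist_notempty[OF C(4)] using C(4) by (intro cINF_greatest) (auto simp: dist_norm not_less)
      then show False by (simp add: d_def)
    qed
    then obtain y where y: "\<And>n. y n \<in> C" "\<And>n. norm (x - y n) < d + 1 / real (Suc n)"
      by metis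
    have d0: "0 \<le> d" by (simp add: d_def infdist_nonneg)
    have ylim: "(\<lambda>n. norm (x - y n)) \<longlonglongrightarrow> d"
    proof (rule tendsto_sandwich[of "\<lambda>n. d" _ _ "\<lambda>n. d + 1 / real (Suc n)"])
      show "(\<lambda>n. d + 1 / real (Suc n)) \<longlonglongrightarrow> d"
        using tendsto_add[OF tendsto_const LIMSEQ_inverse_real_of_nat, of d]
        by (simp add: inverse_eq_divide)
    qed (use y d_le in \<open>auto intro!: always_eventually less_imp_le\<close>)
    have par: "(norm (y m - y n))\<^sup>2 \<le> 2 * (norm (x - y m))\<^sup>2 + 2 * (norm (x - y n))\<^sup>2 - 4 * d\<^sup>2" for m n
    proof -
      have "(1/2) *\<^sub>R (y m + y n) \<in> C"
        using C(1) y by (intro subspace_scale subspace_add)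
      then have "d\<^sup>2 \<le> (norm (x - (1/2) *\<^sub>R (y m + y n)))\<^sup>2"
        by (intro power_mono d_le d0)
      moreover have "(norm (y m - y n))\<^sup>2 + 4 * (norm (x - (1/2) *\<^sub>R (y m + y n)))\<^sup>2
          = 2 * (norm (x - y m))\<^sup>2 + 2 * (norm (x - y n))\<^sup>2"
        by (simp add: power2_norm_eq_inner inner_diff_left inner_diff_right inner_add_left inner_add_right
            inner_commute algebra_simps)
      ultimately show ?thesis by linarith
    qed
    have "Cauchy y"
    proof (rule metric_CauchyI)
      fix e :: real assume e: "e > 0"
      have "(\<lambda>n. 2 * (norm (x - y n))\<^sup>2 - 2 * d\<^sup>2) \<longlonglongrightarrow> 2 * d\<^sup>2 - 2 * d\<^sup>2"
        by (intro tendsto_intros ylim)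
      then have "eventually (\<lambda>n. 2 * (norm (x - y n))\<^sup>2 - 2 * d\<^sup>2 < e\<^sup>2 / 2) sequentially"
        by (rule order_tendstoD) (use e in simp)
      then obtain N where N: "\<And>n. n \<ge> N \<Longrightarrow> 2 * (norm (x - y n))\<^sup>2 - 2 * d\<^sup>2 < e\<^sup>2 / 2"
        by (auto simp: eventually_sequentially)
      have "dist (y m) (y n) < e" if "m \<ge> N" "n \<ge> N" for m n
      proof -
        have "(norm (y m - y n))\<^sup>2 < e\<^sup>2"
          using par[of m n] N[OF that(1)] N[OF that(2)] by linarith
        then show ?thesis using e by (simp add: dist_norm power2_less_imp_less)
      qed
      then show "\<exists>M. \<forall>m\<ge>M. \<forall>n\<ge>M. dist (y m) (y n) < e" by blast
    qed
    then obtain p where p: "y \<longlonglongrightarrow> p" by (auto simp: Cauchy_convergent_iff convergent_def)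
    have pC: "p \<in> C" using C(2) y(1) p by (rule closed_sequentially)
    have np: "norm (x - p) = d"
      using ylim by (rule LIMSEQ_unique[rotated]) (intro tendsto_intros p)
    have "x - p = 0"
    proof (rule triv)
      fix s assume s: "s \<in> S"
      then have "s \<in> C" using closure_subset by (auto simp: C_def)
      define t where "t = inner s (x - p) / (norm s)\<^sup>2"
      have "p + t *\<^sub>R s \<in> C" using C(1) pC \<open>s \<in> C\<close> by (intro subspace_add subspace_scale)
      then have "(norm (x - p))\<^sup>2 \<le> (norm (x - (p + t *\<^sub>R s)))\<^sup>2"
        unfolding np by (intro power_mono d_le d0)
      also have "\<dots> = (norm (x - p))\<^sup>2 - 2 * t * inner s (x - p) + t\<^sup>2 * (norm s)\<^sup>2"
        by (simp add: power2_norm_eq_inner inner_diff_left inner_diff_right inner_add_left inner_add_right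
            inner_commute algebra_simps power2_eq_square[of t])
      also have "\<dots> = (norm (x - p))\<^sup>2 - (inner s (x - p))\<^sup>2 / (norm s)\<^sup>2"
        by (cases "s = 0") (simp_all add: t_def power2_eq_square field_simps)
      finally have "(inner s (x - p))\<^sup>2 / (norm s)\<^sup>2 \<le> 0" by simp
      then show "inner s (x - p) = 0"
        by (cases "s = 0") (simp_all add: divide_le_0_iff)
    qed
    then show "x \<in> C" using pC by simp
  qed
  then show ?thesis by (auto simp: C_def)
qed

definition csubspace :: "'a::euclidean_space l2 set \<Rightarrow> bool" where
  "csubspace S \<longleftrightarrow> 0 \<in> S \<and> (\<forall>u\<in>S. \<forall>v\<in>S. u + v \<in> S) \<and> (\<forall>c. \<forall>u\<in>S. c *\<^sub>C u \<in> S)"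

text \<open>Orthogonality for the real part of \<open>cinner\<close>, applied to \<open>s\<close> and \<open>\<i> s\<close>, is complex orthogonality.\<close>

lemma csubspace_dense:
  assumes S: "csubspace S" and triv: "\<And>z. (\<And>s. s \<in> S \<Longrightarrow> cinner s z = 0) \<Longrightarrow> z = 0"
  shows "closure S = UNIV"
proof (rule dense_of_orthogonal_trivial)
  show "subspace S"
    using S by (auto simp: csubspace_def subspace_def scaleR_scaleC)
  fix z assume z: "\<And>s. s \<in> S \<Longrightarrow> inner s z = 0"
  show "z = 0"
  proof (rule triv)
    fix s assume s: "s \<in> S"
    then have "\<i> *\<^sub>C s \<in> S" using S by (auto simp: csubspace_def)
    from z[OF this] z[OF s] show "cinner s z = 0"
      by (simp add: inner_l2_def complex_eq_iff)
  qed
qed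

lemma bounded_clinear_eq_on_dense:
  assumes "bounded_clinear A" "bounded_clinear B" and S: "closure S = UNIV"
    and eq: "\<And>s. s \<in> S \<Longrightarrow> A s = B s"
  shows "A = B"
proof
  fix u
  have "closed {u. A u = B u}"
    using assms(1,2) unfolding bounded_clinear_def
    by (intro closed_Collect_eq) (auto intro: linear_continuous_on)
  then have "closure S \<subseteq> {u. A u = B u}"
    by (intro closure_minimal) (use eq in auto)
  then show "A u = B u" using S by auto
qed

text \<open>
  The kernel of a nonzero functional is a proper closed subspace; a vector orthogonal to it represents the functional
  up to a factor.
\<close>

lemma riesz_representation:
  fixes \<phi> :: "'a::euclidean_space l2 \<Rightarrow> complex"
  assumes add: "\<And>u v. \<phi> (u + v) = \<phi> u + \<phi> v" and sc: "\<And>c u. \<phi> (c *\<^sub>C u) = c * \<phi> u"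
    and bd: "\<And>u. cmod (\<phi> u) \<le> K * norm u"
  shows "\<exists>w. \<forall>u. \<phi> u = cinner w u"
proof (cases "\<forall>u. \<phi> u = 0")
  case True
  then show ?thesis by (intro exI[of _ 0]) simp
next
  case False
  define N where "N = {u. \<phi> u = 0}"
  have bl: "bounded_linear \<phi>"
    by (rule bounded_linear_intro[where K = K])
      (auto simp: add sc scaleR_scaleC scaleR_conv_of_real mult.commute[of _ K] bd)
  have N: "csubspace N"
    using bounded_linear.linear[OF bl] by (auto simp: N_def csubspace_def add sc linear_0)
  have "closed N"
    unfolding N_def by (intro closed_Collect_eq linear_continuous_on[OF bl] continuous_intros)
  then have "closure N \<noteq> UNIV" using False by (auto simp: N_def)
  then obtain z where z: "\<And>s. s \<in> N \<Longrightarrow> cinner s z = 0" "z \<noteq> 0"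
    using csubspace_dense[OF N] by blast
  have \<phi>z: "\<phi> z \<noteq> 0"
    using z(1)[of z] z(2) by (auto simp: N_def cinner_self)
  define w where "w = (cnj (\<phi> z) / complex_of_real ((norm z)\<^sup>2)) *\<^sub>C z"
  have "\<phi> u = cinner w u" for u
  proof -
    have "\<phi> (u + (- (\<phi> u / \<phi> z)) *\<^sub>C z) = 0" using \<phi>z by (simp add: add sc)
    then have "cinner (u + (- (\<phi> u / \<phi> z)) *\<^sub>C z) z = 0" by (intro z) (simp add: N_def)
    then have "cinner z (u + (- (\<phi> u / \<phi> z)) *\<^sub>C z) = 0" by (subst cinner_commute) simp
    then have "cinner z u = \<phi> u / \<phi> z * complex_of_real ((norm z)\<^sup>2)"
      by (simp only: cinner_add_right cinner_scaleC_right cinner_self) (simp add: algebra_simps)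
    then show ?thesis using \<phi>z z(2) by (simp add: w_def)
  qed
  then show ?thesis by blast
qed

text \<open>
  Riesz representation in the first argument, for each fixed second one.  Weak integrals of operators are obtained
  in this way from the integrals of their matrix elements.
\<close>

lemma bounded_form_operator:
  fixes q :: "'b::euclidean_space l2 \<Rightarrow> 'a::euclidean_space l2 \<Rightarrow> complex"
  assumes "\<And>u u' v. q (u + u') v = q u v + q u' v" "\<And>c u v. q (c *\<^sub>C u) v = cnj c * q u v"
    and "\<And>u v v'. q u (v + v') = q u v + q u v'" "\<And>c u v. q u (c *\<^sub>C v) = c * q u v"
    and bd: "\<And>u v. cmod (q u v) \<le> K * norm u * norm v" and "0 \<le> K"
  shows "\<exists>B. bounded_clinear B \<and> (\<forall>u v. cinner u (B v) = q u v)"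
proof -
  have "\<exists>w. \<forall>u. cnj (q u v) = cinner w u" for v
    by (rule riesz_representation[where K = "K * norm v"])
      (use bd[of _ v] in \<open>auto simp: assms(1,2) ac_simps\<close>)
  then obtain B where B: "\<And>u v. cnj (q u v) = cinner (B v) u" by metis
  have B': "cinner u (B v) = q u v" for u v
    by (subst cinner_commute) (simp flip: B)
  have "bounded_clinear B"
  proof (rule bounded_clinearI[where K = K])
    fix v
    have "(norm (B v))\<^sup>2 = cmod (cinner (B v) (B v))" by (simp add: cinner_self norm_power)
    also have "\<dots> \<le> K * norm (B v) * norm v" unfolding B' by (rule bd)
    finally have "norm (B v) * norm (B v) \<le> norm (B v) * (K * norm v)"
      by (simp add: power2_eq_square ac_simps)
    then show "norm (B v) \<le> K * norm v"
      using \<open>0 \<le> K\<close> by (cases "B v = 0") simp_all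
  qed (rule cinner_eqI, simp add: B' cinner_add_right assms)+
  with B' show ?thesis by blast
qed

lemma adj_unique:
  assumes "\<And>u v. cinner u (A v) = cinner (B u) v"
  shows "adj A = B"
  unfolding adj_def
proof (rule the_equality)
  show "\<forall>u v. cinner u (A v) = cinner (B u) v" by (simp add: assms)
next
  fix C assume C: "\<forall>u v. cinner u (A v) = cinner (C u) v"
  have "C u = B u" for u
  proof (rule cinner_eqI)
    fix v show "cinner v (C u) = cinner v (B u)"
      using C assms by (metis cinner_commute)
  qed
  then show "C = B" by blast
qed

section \<open>Orthonormal bases\<close>

definition orthonormal :: "'a::euclidean_space l2 set \<Rightarrow> bool" where
  "orthonormal E \<longleftrightarrow> (\<forall>e\<in>E. \<forall>e'\<in>E. cinner e e' = (if e = e' then 1 else 0))"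

lemma onb_orthonormal: "onb E \<Longrightarrow> orthonormal E"
  by (simp add: onb_def orthonormal_def)

text \<open>
  The definition of an orthonormal basis asks for a trivial orthogonal complement, which is maximality among
  orthonormal sets, so Zorn's lemma applies.
\<close>

lemma ex_onb: "\<exists>E :: 'a::euclidean_space l2 set. onb E"
proof -
  have "\<exists>M\<in>{E. orthonormal E}. \<forall>X\<in>{E :: 'a l2 set. orthonormal E}. M \<subseteq> X \<longrightarrow> X = M"
  proof (rule subset_Zorn_nonempty)
    show "{E :: 'a l2 set. orthonormal E} \<noteq> {}"
      by (auto intro!: exI[of _ "{}"] simp: orthonormal_def)
    fix C assume C: "C \<noteq> {}" "subset.chain {E :: 'a l2 set. orthonormal E} C"
    show "\<Union>C \<in> {E. orthonormal E}"
      unfolding orthonormal_def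
    proof (safe)
      fix e e' X Y assume "e \<in> X" "X \<in> C" "e' \<in> Y" "Y \<in> C"
      moreover from this have "X \<subseteq> Y \<or> Y \<subseteq> X" "orthonormal X" "orthonormal Y"
        using C(2) by (auto simp: subset_chain_def)
      ultimately show "cinner e e' = (if e = e' then 1 else 0)"
        unfolding orthonormal_def by blast
    qed
  qed
  then obtain M :: "'a l2 set" where M: "orthonormal M" "\<And>X. orthonormal X \<Longrightarrow> M \<subseteq> X \<Longrightarrow> X = M"
    by auto
  have "u = 0" if u: "\<forall>e\<in>M. cinner e u = 0" for u
  proof (rule ccontr)
    assume "u \<noteq> 0"
    define w where "w = (1 / complex_of_real (norm u)) *\<^sub>C u"
    have "norm w = 1" using \<open>u \<noteq> 0\<close> by (simp add: w_def norm_divide)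
    then have ww: "cinner w w = 1" by (simp add: cinner_self)
    have w: "cinner e w = 0" "cinner w e = 0" if "e \<in> M" for e
      using u that cinner_commute[of u e] by (simp_all add: w_def)
    have "orthonormal (insert w M)"
      using M(1) w ww unfolding orthonormal_def by auto
    then have "w \<in> M" using M(2)[of "insert w M"] by blast
    with w ww show False by force
  qed
  then have "onb M" using M(1) by (auto simp: onb_def orthonormal_def)
  then show ?thesis by blast
qed

definition onproj :: "'a::euclidean_space l2 set \<Rightarrow> 'a l2 \<Rightarrow> 'a l2" where
  "onproj F u = (\<Sum>e\<in>F. cinner e u *\<^sub>C e)"

lemma onproj_diff: "onproj F (u - v) = onproj F u - onproj F v"
  by (simp add: onproj_def cinner_diff_right scaleC_diff_left sum_subtractf)

lemma cinner_onproj: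
  assumes "orthonormal E" "finite F" "F \<subseteq> E" "e \<in> F"
  shows "cinner e (onproj F u) = cinner e u"
proof -
  have "cinner e (onproj F u) = (\<Sum>e'\<in>F. if e' = e then cinner e u else 0)"
    unfolding onproj_def cinner_sum_right
    by (rule sum.cong) (use assms in \<open>auto simp: orthonormal_def subset_eq\<close>)
  then show ?thesis using assms by simp
qed

text \<open>Pythagoras; both Bessel's inequality and the minimality of projections are read off from it.\<close>

lemma norm_diff_onproj:
  assumes "orthonormal E" "finite F" "F \<subseteq> E"
  shows "(norm (u - onproj F u))\<^sup>2 = (norm u)\<^sup>2 - (\<Sum>e\<in>F. (cmod (cinner e u))\<^sup>2)"
proof -
  have p1: "cinner (onproj F u) w = (\<Sum>e\<in>F. cnj (cinner e u) * cinner e w)" for w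
    by (simp add: onproj_def cinner_sum_left)
  have p2: "cinner u (onproj F u) = (\<Sum>e\<in>F. cnj (cinner e u) * cinner e u)"
    unfolding onproj_def cinner_sum_right
    by (rule sum.cong) (auto simp: cinner_commute[of u] mult.commute)
  have "complex_of_real ((norm (u - onproj F u))\<^sup>2)
     = complex_of_real ((norm u)\<^sup>2) - (\<Sum>e\<in>F. cnj (cinner e u) * cinner e u)"
    unfolding cinner_self[symmetric] cinner_diff_left cinner_diff_right p1 p2
    using cinner_onproj[OF assms] by simp
  also have "\<dots> = complex_of_real ((norm u)\<^sup>2 - (\<Sum>e\<in>F. (cmod (cinner e u))\<^sup>2))"
    by (simp add: complex_norm_square mult.commute del: of_real_power)
  finally show ?thesis by (simp only: of_real_eq_iff)
qed

lemma bessel: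
  assumes "orthonormal E" "finite F" "F \<subseteq> E"
  shows "(\<Sum>e\<in>F. (cmod (cinner e u))\<^sup>2) \<le> (norm u)\<^sup>2"
  using norm_diff_onproj[OF assms, of u] zero_le_power2[of "norm (u - onproj F u)"] by linarith

text \<open>
  Finite combinations of basis vectors are dense because their orthogonal complement is trivial.  Once a combination
  \<open>w\<close> lies within distance \<open>r\<close> of \<open>u\<close>, every projection to a larger finite set does as well, as it fixes \<open>w\<close> and
  does not increase the norm of \<open>u - w\<close>.
\<close>

lemma onb_expansion:
  assumes E: "onb E"
  shows "((\<lambda>e. cinner e u *\<^sub>C e) has_sum u) E"
proof -
  note o = onb_orthonormal[OF E]
  define S where "S = {w. \<exists>F0. finite F0 \<and> F0 \<subseteq> E \<and> (\<forall>F. finite F \<longrightarrow> F0 \<subseteq> F \<longrightarrow> F \<subseteq> E \<longrightarrow> onproj F w = w)}"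
  have add: "onproj F (u + v) = onproj F u + onproj F v"
    and sc: "onproj F (c *\<^sub>C u) = c *\<^sub>C onproj F u" for F u v c
  proof -
    show "onproj F (u + v) = onproj F u + onproj F v"
      by (simp add: onproj_def cinner_add_right scaleC_add_left sum.distrib)
    show "onproj F (c *\<^sub>C u) = c *\<^sub>C onproj F u"
      unfolding onproj_def
    proof (induction F rule: infinite_finite_induct)
      case (insert e F)
      then show ?case by (simp add: scaleC_add_right)
    qed simp_all
  qed
  have "csubspace S"
    unfolding csubspace_def
  proof (intro conjI ballI allI)
    show "0 \<in> S" by (auto simp: S_def onproj_def intro!: exI[of _ "{}"])
    fix v w assume "v \<in> S" "w \<in> S"
    then obtain F1 F2 where 1: "finite F1" "F1 \<subseteq> E" "\<And>F. finite F \<Longrightarrow> F1 \<subseteq> F \<Longrightarrow> F \<subseteq> E \<Longrightarrow> onproj F v = v"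
      and 2: "finite F2" "F2 \<subseteq> E" "\<And>F. finite F \<Longrightarrow> F2 \<subseteq> F \<Longrightarrow> F \<subseteq> E \<Longrightarrow> onproj F w = w"
      by (auto simp: S_def)
    have "onproj F (v + w) = v + w" if "finite F" "F1 \<union> F2 \<subseteq> F" "F \<subseteq> E" for F
      using 1(3)[of F] 2(3)[of F] that by (simp add: add)
    with 1(1,2) 2(1,2) show "v + w \<in> S"
      unfolding S_def mem_Collect_eq by (intro exI[of _ "F1 \<union> F2"]) blast
  next
    fix c v assume "v \<in> S"
    then obtain F1 where 1: "finite F1" "F1 \<subseteq> E" "\<And>F. finite F \<Longrightarrow> F1 \<subseteq> F \<Longrightarrow> F \<subseteq> E \<Longrightarrow> onproj F v = v"
      by (auto simp: S_def)
    then show "c *\<^sub>C v \<in> S"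
      unfolding S_def mem_Collect_eq by (intro exI[of _ F1]) (simp add: sc)
  qed
  moreover have ES: "E \<subseteq> S"
  proof
    fix e assume e: "e \<in> E"
    have "onproj F e = e" if "finite F" "e \<in> F" "F \<subseteq> E" for F
    proof -
      have "onproj F e = (\<Sum>e'\<in>F. if e' = e then e else 0)"
        unfolding onproj_def
        by (rule sum.cong) (use o that e in \<open>auto simp: orthonormal_def subset_eq\<close>)
      then show ?thesis using that by simp
    qed
    then show "e \<in> S" using e by (auto simp: S_def intro!: exI[of _ "{e}"])
  qed
  ultimately have dense: "closure S = UNIV"
    by (intro csubspace_dense) (use E in \<open>auto simp: onb_def subset_eq\<close>)
  show ?thesis
    unfolding has_sum_def tendsto_iff eventually_finite_subsets_at_top
  proof (intro allI impI)
    fix r :: real assume r: "r > 0"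
    obtain w where w: "w \<in> S" "dist w u < r"
      using dense r closure_approachable[of u S] by auto
    then obtain F0 where F0: "finite F0" "F0 \<subseteq> E"
      "\<And>F. finite F \<Longrightarrow> F0 \<subseteq> F \<Longrightarrow> F \<subseteq> E \<Longrightarrow> onproj F w = w" by (auto simp: S_def)
    have "dist (onproj F u) u < r" if F: "finite F" "F0 \<subseteq> F" "F \<subseteq> E" for F
    proof -
      have eq: "u - onproj F u = (u - w) - onproj F (u - w)"
        using F0(3)[OF F] by (simp add: onproj_diff)
      have "(norm ((u - w) - onproj F (u - w)))\<^sup>2 \<le> (norm (u - w))\<^sup>2"
        unfolding norm_diff_onproj[OF o F(1,3)] by (simp add: sum_nonneg)
      then have "norm (u - onproj F u) \<le> norm (u - w)"
        unfolding eq by (rule power2_le_imp_le) simp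
      also have "\<dots> < r" using w(2) by (simp add: dist_norm norm_minus_commute)
      finally show ?thesis by (simp add: dist_norm norm_minus_commute)
    qed
    note near = this[unfolded onproj_def]
    show "\<exists>X. finite X \<and> X \<subseteq> E \<and>
        (\<forall>Y. finite Y \<and> X \<subseteq> Y \<and> Y \<subseteq> E \<longrightarrow> dist (\<Sum>e\<in>Y. cinner e u *\<^sub>C e) u < r)"
    proof (intro exI conjI allI impI)
      fix Y assume "finite Y \<and> F0 \<subseteq> Y \<and> Y \<subseteq> E"
      then show "dist (\<Sum>e\<in>Y. cinner e u *\<^sub>C e) u < r" by (elim conjE) (rule near)
    qed (fact F0)+
  qed
qed

lemma parseval:
  assumes E: "onb E"
  shows "((\<lambda>e. cinner u e * cinner e v) has_sum cinner u v) E"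
  using has_sum_bounded_linear[OF bounded_linear_cinner[of u] onb_expansion[OF E, of v]]
  by (simp add: mult.commute comp_def)

section \<open>Smooth functions and test functions\<close>

lemma partial_deriv_eq:
  assumes "(f has_derivative D) (at x)"
  shows "partial_deriv j f x = D j"
proof -
  have "((\<lambda>s. x + s *\<^sub>R j) has_derivative (\<lambda>s. s *\<^sub>R j)) (at (0::real))"
    by (auto intro!: derivative_eq_intros)
  from has_derivative_compose[OF this, of f D]
  have "((\<lambda>s. f (x + s *\<^sub>R j)) has_derivative (\<lambda>s. D (s *\<^sub>R j))) (at (0::real))"
    using assms by simp
  moreover have "D (s *\<^sub>R j) = s *\<^sub>R D j" for s
    using assms by (simp add: has_derivative_linear linear_scale)
  ultimately show ?thesis
    unfolding partial_deriv_def
    by (intro vector_derivative_at) (simp add: has_vector_derivative_def)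
qed

text \<open>
  Smoothness is coinductive: it suffices to exhibit a class of differentiable functions that contains \<open>f\<close> and is
  closed under partial derivatives, and only first derivatives have to be computed.
\<close>

lemma smooth_coinduct:
  assumes "P f"
    and step: "\<And>f. P f \<Longrightarrow> (\<forall>x. f differentiable (at x)) \<and> (\<forall>j\<in>Basis. P (partial_deriv j f))"
  shows "smooth f"
proof -
  have "P f \<Longrightarrow> times_differentiable k f" for k f
    by (induction k arbitrary: f) (use step in auto)
  with assms(1) show ?thesis by (simp add: smooth_def)
qed

lemma smooth_differentiable: "smooth f \<Longrightarrow> f differentiable (at x)"
  unfolding smooth_def using times_differentiable.simps(2)[of 0 f] by blast

lemma smooth_partial_deriv: "smooth f \<Longrightarrow> j \<in> Basis \<Longrightarrow> smooth (partial_deriv j f)"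
  unfolding smooth_def using times_differentiable.simps(2) by blast

lemma smooth_continuous_on: "smooth f \<Longrightarrow> continuous_on A f"
  by (meson smooth_differentiable continuous_at_imp_continuous_on differentiable_imp_continuous_within)

lemma smooth_borel: "smooth f \<Longrightarrow> f \<in> borel_measurable borel"
  by (intro borel_measurable_continuous_onI smooth_continuous_on)

lemma partial_deriv_add:
  assumes "f differentiable (at x)" "g differentiable (at x)"
  shows "partial_deriv j (\<lambda>x. f x + g x) x = partial_deriv j f x + partial_deriv j g x"
proof -
  obtain F G where "(f has_derivative F) (at x)" "(g has_derivative G) (at x)"
    using assms by (auto simp: differentiable_def)
  then show ?thesis
    using partial_deriv_eq[OF has_derivative_add[of f F "at x" g G]] partial_deriv_eq[of f F x]
      partial_deriv_eq[of g G x] by simp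
qed

lemma partial_deriv_cmult:
  fixes c :: complex
  assumes "f differentiable (at x)"
  shows "partial_deriv j (\<lambda>x. c * f x) x = c * partial_deriv j f x"
proof -
  obtain F where "(f has_derivative F) (at x)"
    using assms by (auto simp: differentiable_def)
  then show ?thesis
    using partial_deriv_eq[OF has_derivative_mult_right[of f F "at x" c]] partial_deriv_eq[of f F x]
    by simp
qed

lemma smooth_add:
  assumes "smooth f" "smooth g"
  shows "smooth (\<lambda>x. f x + g x)"
proof (rule smooth_coinduct[where P = "\<lambda>h. \<exists>f g. smooth f \<and> smooth g \<and> h = (\<lambda>x. f x + g x)"])
  show "\<exists>f' g'. smooth f' \<and> smooth g' \<and> (\<lambda>x. f x + g x) = (\<lambda>x. f' x + g' x)" using assms by blast
  fix h :: "'a \<Rightarrow> complex" assume "\<exists>f g. smooth f \<and> smooth g \<and> h = (\<lambda>x. f x + g x)"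
  then obtain f g where h: "smooth f" "smooth g" "h = (\<lambda>x. f x + g x)" by blast
  have "partial_deriv j h = (\<lambda>x. partial_deriv j f x + partial_deriv j g x)" for j
    unfolding h(3) by (rule ext) (intro partial_deriv_add smooth_differentiable h)
  then show "(\<forall>x. h differentiable at x) \<and> (\<forall>j\<in>Basis. \<exists>f g. smooth f \<and> smooth g \<and> partial_deriv j h = (\<lambda>x. f x + g x))"
    using smooth_partial_deriv h smooth_differentiable[OF h(1)] smooth_differentiable[OF h(2)]
      differentiable_add[of f _ g] by metis
qed

lemma smooth_cmult:
  assumes "smooth f"
  shows "smooth (\<lambda>x. c * f x)"
proof (rule smooth_coinduct[where P = "\<lambda>h. \<exists>f. smooth f \<and> h = (\<lambda>x. c * f x)"])
  show "\<exists>f'. smooth f' \<and> (\<lambda>x. c * f x) = (\<lambda>x. c * f' x)" using assms by blast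
  fix h :: "'a \<Rightarrow> complex" assume "\<exists>f. smooth f \<and> h = (\<lambda>x. c * f x)"
  then obtain f where h: "smooth f" "h = (\<lambda>x. c * f x)" by blast
  have "partial_deriv j h = (\<lambda>x. c * partial_deriv j f x)" for j
    unfolding h(2) by (rule ext) (intro partial_deriv_cmult smooth_differentiable h)
  then show "(\<forall>x. h differentiable at x) \<and> (\<forall>j\<in>Basis. \<exists>f. smooth f \<and> partial_deriv j h = (\<lambda>x. c * f x))"
    using smooth_partial_deriv h(1) differentiable_mult[OF differentiable_const[of c] smooth_differentiable[OF h(1)]]
    unfolding h(2) by metis
qed

lemma test_functionI:
  assumes "smooth f" "\<And>x. f x \<noteq> 0 \<Longrightarrow> norm x \<le> R"
  shows "test_function f"
  unfolding test_function_def
proof (intro conjI assms)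
  have "{x. f x \<noteq> 0} \<subseteq> cball 0 R" using assms(2) by auto
  then show "compact (closure {x. f x \<noteq> 0})"
    by (simp add: compact_closure bounded_subset[OF bounded_cball])
qed

lemma test_function_support:
  assumes "test_function f"
  obtains R where "R > 0" "\<And>x. f x \<noteq> 0 \<Longrightarrow> norm x \<le> R"
proof -
  have "bounded {x. f x \<noteq> 0}"
    using assms by (simp add: test_function_def compact_closure)
  then obtain R where "R > 0" "\<forall>x\<in>{x. f x \<noteq> 0}. norm x \<le> R"
    unfolding bounded_pos by blast
  with that show ?thesis by blast
qed

lemma test_function_smooth: "test_function f \<Longrightarrow> smooth f"
  by (simp add: test_function_def)

lemma test_function_add:
  assumes "test_function f" "test_function g"
  shows "test_function (\<lambda>x. f x + g x)"
proof -
  obtain R S where "\<And>x. f x \<noteq> 0 \<Longrightarrow> norm x \<le> R" "\<And>x. g x \<noteq> 0 \<Longrightarrow> norm x \<le> S"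
    using assms by (meson test_function_support)
  note RS = this
  show ?thesis
  proof (rule test_functionI[where R = "max R S", OF smooth_add[OF assms[THEN test_function_smooth]]])
    fix x assume "f x + g x \<noteq> 0"
    then have "f x \<noteq> 0 \<or> g x \<noteq> 0" by auto
    then show "norm x \<le> max R S" using RS by (auto simp: le_max_iff_disj)
  qed
qed

lemma test_function_cmult:
  assumes "test_function f"
  shows "test_function (\<lambda>x. c * f x)"
proof -
  obtain R where "\<And>x. f x \<noteq> 0 \<Longrightarrow> norm x \<le> R"
    using assms by (meson test_function_support)
  then show ?thesis
    by (intro test_functionI[where R = R, OF smooth_cmult[OF test_function_smooth[OF assms]]]) auto
qed

lemma test_function_partial_deriv:
  assumes "test_function f" "j \<in> Basis"
  shows "test_function (partial_deriv j f)"
proof -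
  obtain R where R: "\<And>x. f x \<noteq> 0 \<Longrightarrow> norm x \<le> R"
    using assms by (meson test_function_support)
  show ?thesis
  proof (rule test_functionI[where R = R])
    fix x assume "partial_deriv j f x \<noteq> 0"
    show "norm x \<le> R"
    proof (rule ccontr)
      assume "\<not> norm x \<le> R"
      then have x: "x \<in> - cball 0 R" by simp
      have "((\<lambda>x. 0) has_derivative (\<lambda>h. 0)) (at x)" by simp
      then have "(f has_derivative (\<lambda>h. 0)) (at x)"
        by (rule has_derivative_transform_within_open[of _ _ _ _ "- cball 0 R"])
          (use x R in \<open>auto simp: open_Compl\<close>)
      then have "partial_deriv j f x = 0" by (rule partial_deriv_eq)
      with \<open>partial_deriv j f x \<noteq> 0\<close> show False by simp
    qed
  qed (use assms in \<open>simp add: test_function_smooth smooth_partial_deriv\<close>)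
qed

lemma test_function_zero: "test_function (\<lambda>x::'a::euclidean_space. 0)"
proof (rule test_functionI[where R = 0])
  show "smooth (\<lambda>x::'a. 0)"
  proof (rule smooth_coinduct[where P = "\<lambda>h. h = (\<lambda>x. 0)"])
    fix h :: "'a \<Rightarrow> complex" assume h: "h = (\<lambda>x. 0)"
    have "partial_deriv j h = (\<lambda>x. 0)" for j
      unfolding h by (rule ext, rule partial_deriv_eq) (auto intro!: derivative_eq_intros)
    then show "(\<forall>x. h differentiable at x) \<and> (\<forall>j\<in>Basis. partial_deriv j h = (\<lambda>x. 0))"
      by (simp add: h)
  qed simp
qed simp

lemma test_function_sum:
  assumes "\<And>i. i \<in> I \<Longrightarrow> test_function (f i)"
  shows "test_function (\<lambda>x. \<Sum>i\<in>I. f i x)"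
  using assms
  by (induction I rule: infinite_finite_induct) (simp_all add: test_function_zero test_function_add)

lemma test_function_laplacian: "test_function f \<Longrightarrow> test_function (laplacian f)"
  unfolding laplacian_def[abs_def] by (intro test_function_sum test_function_partial_deriv)

lemma test_function_borel: "test_function f \<Longrightarrow> f \<in> borel_measurable borel"
  by (intro smooth_borel test_function_smooth)

lemma test_function_bounded:
  assumes "test_function f"
  obtains C where "C > 0" "\<And>x. cmod (f x) \<le> C"
proof -
  obtain R where R: "R > 0" "\<And>x. f x \<noteq> 0 \<Longrightarrow> norm x \<le> R" using test_function_support[OF assms] by metis
  have "compact (f ` cball 0 R)"
    by (intro compact_continuous_image smooth_continuous_on test_function_smooth assms) simp
  then have "bounded (f ` cball 0 R)" by (rule compact_imp_bounded)
  then obtain C where C: "C > 0" "\<And>y. y \<in> f ` cball 0 R \<Longrightarrow> norm y \<le> C"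
    unfolding bounded_pos by blast
  have "cmod (f x) \<le> C" for x
    using C R(2)[of x] by (cases "f x = 0") auto
  with C(1) that show ?thesis by blast
qed

lemma integrable_bounded_support:
  fixes f :: "'a::euclidean_space \<Rightarrow> 'b::{banach, second_countable_topology}"
  assumes "f \<in> borel_measurable borel" "\<And>x. norm (f x) \<le> C" "\<And>x. f x \<noteq> 0 \<Longrightarrow> norm x \<le> R"
  shows "integrable lborel f"
proof (rule Bochner_Integration.integrable_bound[of _ "\<lambda>x. C * indicator (cball 0 R) x"])
  show "integrable lborel (\<lambda>x::'a. C * indicator (cball 0 R) x)"
    by (intro integrable_mult_right integrable_real_indicator emeasure_lborel_cball_finite) simp
  have "norm (f x) \<le> \<bar>C * indicator (cball 0 R) x\<bar>" for x
    using assms(2,3)[of x] order_trans[OF norm_ge_zero assms(2)[of x]] by (cases "f x = 0") auto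
  then show "AE x in lborel. norm (f x) \<le> norm (C * indicator (cball 0 R) x)" by simp
qed (use assms in simp)

lemma test_function_integrable: "test_function f \<Longrightarrow> integrable lborel f"
  by (rule test_function_bounded, assumption, rule test_function_support, assumption,
      rule integrable_bounded_support[OF test_function_borel])

lemma test_function_square_integrable:
  assumes "test_function f"
  shows "square_integrable f"
proof -
  obtain C where C: "\<And>x. cmod (f x) \<le> C" using test_function_bounded[OF assms] by blast
  obtain R where R: "\<And>x. f x \<noteq> 0 \<Longrightarrow> norm x \<le> R" using test_function_support[OF assms] by blast
  note [measurable] = test_function_borel[OF assms]
  have "integrable lborel (\<lambda>x. (cmod (f x))\<^sup>2)"
    by (rule integrable_bounded_support[where C = "C\<^sup>2" and R = R]) (use R C in \<open>auto simp: power_mono\<close>)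
  then show ?thesis by (simp add: square_integrable_def)
qed

section \<open>Bump functions\<close>

text \<open>
  The factors \<open>s ^ m\<close> in the denominator make the family closed under differentiation.
\<close>

definition flat :: "nat \<Rightarrow> real \<Rightarrow> real" where
  "flat m s = (if s \<le> 0 then 0 else exp (- (1 / s)) / s ^ m)"

lemma flat_deriv: "(flat m has_real_derivative flat (m + 2) s - real m * flat (m + 1) s) (at s)"
proof -
  consider "s > 0" | "s < 0" | "s = 0" by linarith
  then show ?thesis
  proof cases
    case 1
    have "((\<lambda>s. exp (- (1 / s)) / s ^ m) has_real_derivative
        ((exp (- (1 / s)) * (1 / s\<^sup>2)) * s ^ m - exp (- (1 / s)) * (real m * s ^ (m - 1))) / (s ^ m * s ^ m)) (at s)"
      using 1 by (auto intro!: derivative_eq_intros simp: power2_eq_square field_simps)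
    also have "((exp (- (1 / s)) * (1 / s\<^sup>2)) * s ^ m - exp (- (1 / s)) * (real m * s ^ (m - 1))) / (s ^ m * s ^ m)
       = flat (m + 2) s - real m * flat (m + 1) s"
      using 1 by (cases m) (auto simp: flat_def power2_eq_square field_simps)
    finally show ?thesis
      by (rule has_field_derivative_transform_within_open[of _ _ _ "{0<..}"]) (use 1 in \<open>auto simp: flat_def\<close>)
  next
    case 2
    have "((\<lambda>s. 0) has_real_derivative 0) (at s)" by simp
    then have "(flat m has_real_derivative 0) (at s)"
      by (rule has_field_derivative_transform_within_open[of _ _ _ "{..<0}"]) (use 2 in \<open>auto simp: flat_def\<close>)
    with 2 show ?thesis by (simp add: flat_def)
  next
    case 3
    have "((\<lambda>h. flat m h / h) \<longlongrightarrow> 0) (at 0)"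
    proof (rule filterlim_split_at)
      show "((\<lambda>h. flat m h / h) \<longlongrightarrow> 0) (at_left 0)"
        by (rule tendsto_eventually) (auto simp: eventually_at_filter flat_def)
      have "((\<lambda>h::real. (inverse h) ^ (m + 1) / exp (inverse h)) \<longlongrightarrow> 0) (at_right 0)"
        by (rule filterlim_compose[OF tendsto_power_div_exp_0 filterlim_inverse_at_top_right])
      then show "((\<lambda>h. flat m h / h) \<longlongrightarrow> 0) (at_right 0)"
        by (rule Lim_transform_eventually)
          (auto simp: eventually_at_filter flat_def field_simps exp_minus)
    qed
    then have "(flat m has_real_derivative 0) (at 0)"
      by (simp add: DERIV_def flat_def)
    with 3 show ?thesis by (simp add: flat_def)
  qed
qed

text \<open>
  The algebra generated by flat functions of affine forms is closed under partial derivatives, by the product rule;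
  so \<open>smooth_coinduct\<close> applies to it.
\<close>

inductive flat_algebra :: "('a::euclidean_space \<Rightarrow> complex) \<Rightarrow> bool" where
  const: "flat_algebra (\<lambda>x. c)"
| flat: "flat_algebra (\<lambda>x. complex_of_real (flat m (c + x \<bullet> b)))"
| add: "flat_algebra f \<Longrightarrow> flat_algebra g \<Longrightarrow> flat_algebra (\<lambda>x. f x + g x)"
| mult: "flat_algebra f \<Longrightarrow> flat_algebra g \<Longrightarrow> flat_algebra (\<lambda>x. f x * g x)"

lemma flat_algebra_derivative:
  "flat_algebra f \<Longrightarrow> \<exists>D. (\<forall>x. (f has_derivative D x) (at x)) \<and> (\<forall>j. flat_algebra (\<lambda>x. D x j))"
proof (induction rule: flat_algebra.induct)
  case (const c)
  show ?case
    by (rule exI[of _ "\<lambda>x h. 0"]) (auto intro: flat_algebra.const)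
next
  case (flat m c b)
  let ?D = "\<lambda>x h. complex_of_real (flat (m + 2) (c + x \<bullet> b) - real m * flat (m + 1) (c + x \<bullet> b)) * complex_of_real (h \<bullet> b)"
  have "((\<lambda>x. complex_of_real (flat m (c + x \<bullet> b))) has_derivative ?D x) (at x)" for x
  proof -
    have "((\<lambda>x. c + x \<bullet> b) has_derivative (\<lambda>h. h \<bullet> b)) (at x)"
      by (auto intro!: derivative_eq_intros)
    from has_derivative_compose[OF this, of "flat m"]
    have "((\<lambda>x. flat m (c + x \<bullet> b)) has_derivative
        (\<lambda>h. (flat (m + 2) (c + x \<bullet> b) - real m * flat (m + 1) (c + x \<bullet> b)) * (h \<bullet> b))) (at x)"
      using flat_deriv[of m "c + x \<bullet> b"] by (simp add: has_field_derivative_def)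
    from has_derivative_of_real[OF this] show ?thesis by simp
  qed
  moreover have "flat_algebra (\<lambda>x. ?D x j)" for j
  proof -
    have "flat_algebra (\<lambda>x. (complex_of_real (flat (m + 2) (c + x \<bullet> b))
        + complex_of_real (- real m) * complex_of_real (flat (m + 1) (c + x \<bullet> b))) * complex_of_real (j \<bullet> b))"
      by (intro flat_algebra.intros)
    then show ?thesis by (simp add: algebra_simps)
  qed
  ultimately show ?case by (intro exI[of _ ?D] conjI allI)
next
  case (add f g)
  then obtain D D' where "\<forall>x. (f has_derivative D x) (at x)" "\<forall>j. flat_algebra (\<lambda>x. D x j)"
    "\<forall>x. (g has_derivative D' x) (at x)" "\<forall>j. flat_algebra (\<lambda>x. D' x j)" by blast
  then show ?case
    by (intro exI[of _ "\<lambda>x h. D x h + D' x h"]) (auto intro: has_derivative_add flat_algebra.intros)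
next
  case (mult f g)
  then obtain D D' where "\<forall>x. (f has_derivative D x) (at x)" "\<forall>j. flat_algebra (\<lambda>x. D x j)"
    "\<forall>x. (g has_derivative D' x) (at x)" "\<forall>j. flat_algebra (\<lambda>x. D' x j)" by blast
  with mult.hyps show ?case
    by (intro exI[of _ "\<lambda>x h. f x * D' x h + D x h * g x"]) (intro conjI allI has_derivative_mult flat_algebra.intros, simp_all)
qed

lemma flat_algebra_smooth:
  assumes "flat_algebra f"
  shows "smooth f"
proof (rule smooth_coinduct[where P = flat_algebra, OF assms])
  fix f :: "'a \<Rightarrow> complex" assume "flat_algebra f"
  from flat_algebra_derivative[OF this] obtain D
    where D: "\<And>x. (f has_derivative D x) (at x)" "\<And>j. flat_algebra (\<lambda>x. D x j)" by blast
  have "partial_deriv j f = (\<lambda>x. D x j)" for j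
    using D(1) by (auto intro: partial_deriv_eq)
  then show "(\<forall>x. f differentiable at x) \<and> (\<forall>j\<in>Basis. flat_algebra (partial_deriv j f))"
    using D by (auto simp: differentiable_def)
qed

text \<open>
  Steepening the sides of this product of flat functions by the factor \<open>n\<close> makes it tend to the indicator of the box.
\<close>

definition bump :: "real \<Rightarrow> 'a::euclidean_space \<Rightarrow> 'a \<Rightarrow> 'a \<Rightarrow> real" where
  "bump n l r x = (\<Prod>b\<in>Basis. flat 0 (n * ((x - l) \<bullet> b)) * flat 0 (n * ((r - x) \<bullet> b)))"

lemma flat_0_bounds: "0 \<le> flat 0 s" "flat 0 s \<le> 1"
  by (simp_all add: flat_def)

lemma bump_bounds: "0 \<le> bump n l r x" "bump n l r x \<le> 1"
  unfolding bump_def by (auto intro!: prod_nonneg prod_le_1 mult_le_one simp: flat_0_bounds)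

lemma bump_eq_0: "n > 0 \<Longrightarrow> x \<notin> box l r \<Longrightarrow> bump n l r x = 0"
  by (auto simp: bump_def box_def flat_def inner_diff_left mult_le_0_iff not_less)

lemma bump_pos: "n > 0 \<Longrightarrow> x \<in> box l r \<Longrightarrow> bump n l r x > 0"
  unfolding bump_def by (auto simp: box_def flat_def inner_diff_left mult_le_0_iff intro!: prod_pos)

lemma bump_tendsto: "(\<lambda>n. bump (real (Suc n)) l r x) \<longlonglongrightarrow> indicator (box l r) x"
proof (cases "x \<in> box l r")
  case True
  have "(\<lambda>n. flat 0 (real (Suc n) * c)) \<longlonglongrightarrow> 1" if "c > 0" for c
  proof -
    have "(\<lambda>n. exp (- (1 / c * inverse (real (Suc n))))) \<longlonglongrightarrow> exp (- (1 / c * 0))"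
      by (intro tendsto_intros LIMSEQ_inverse_real_of_nat)
    moreover have "flat 0 (real (Suc n) * c) = exp (- (1 / c * inverse (real (Suc n))))" for n
    proof -
      have "real (Suc n) * c > 0" using that by (intro mult_pos_pos) simp_all
      then show ?thesis by (simp add: flat_def divide_inverse not_le[symmetric] del: of_nat_Suc)
    qed
    ultimately show ?thesis by simp
  qed
  then have "(\<lambda>n. bump (real (Suc n)) l r x) \<longlonglongrightarrow> (\<Prod>b\<in>(Basis :: 'a set). 1 * 1)"
    unfolding bump_def using True
    by (intro tendsto_prod tendsto_mult) (auto simp: box_def inner_diff_left)
  then show ?thesis using True by simp
qed (simp add: bump_eq_0)

lemma flat_algebra_prod:
  "(\<And>i. i \<in> I \<Longrightarrow> flat_algebra (f i)) \<Longrightarrow> flat_algebra (\<lambda>x. \<Prod>i\<in>I. f i x)"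
  by (induction I rule: infinite_finite_induct) (auto intro: flat_algebra.intros)

lemma test_function_bump:
  assumes "n > 0"
  shows "test_function (\<lambda>x. complex_of_real (bump n l r x))"
proof -
  have "flat_algebra (\<lambda>x. \<Prod>b\<in>Basis. complex_of_real (flat 0 (- (n * (l \<bullet> b)) + x \<bullet> (n *\<^sub>R b)))
      * complex_of_real (flat 0 (n * (r \<bullet> b) + x \<bullet> (- n *\<^sub>R b))))"
    by (intro flat_algebra_prod flat_algebra.intros)
  then have "smooth (\<lambda>x. complex_of_real (bump n l r x))"
    by (intro flat_algebra_smooth) (simp add: bump_def inner_diff_left algebra_simps)
  moreover obtain R where "\<And>x. x \<in> box l r \<Longrightarrow> norm x \<le> R"
    using bounded_box[of l r] unfolding bounded_iff by blast
  ultimately show ?thesis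
    using bump_eq_0[OF assms] by (intro test_functionI[where R = R]) fastforce+
qed

text \<open>
  The boxes generate the Borel sets and are stable under intersection.  The complement step of the induction uses
  the integral over the whole space, which is a limit of integrals over cubes.
\<close>

lemma integral_boxes_zero_imp_AE_zero:
  fixes w :: "'a::euclidean_space \<Rightarrow> real"
  assumes w: "integrable lborel w" and box: "\<And>l r. (\<integral>x. indicator (box l r) x * w x \<partial>lborel) = 0"
  shows "AE x in lborel. w x = 0"
proof -
  have tot: "(\<integral>x. w x \<partial>lborel) = 0"
  proof (rule LIMSEQ_unique)
    show "(\<lambda>n. \<integral>x. indicator (box (- (real n *\<^sub>R One)) (real n *\<^sub>R One)) x * w x \<partial>lborel) \<longlonglongrightarrow> (\<integral>x. w x \<partial>lborel)"
    proof (rule integral_dominated_convergence[where w = "\<lambda>x. \<bar>w x\<bar>"])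
      show "AE x in lborel. (\<lambda>n. indicator (box (- (real n *\<^sub>R One)) (real n *\<^sub>R One)) x * w x) \<longlonglongrightarrow> w x"
      proof (intro AE_I2 tendsto_eventually)
        fix x :: 'a
        obtain N where N: "norm x < real N" using reals_Archimedean2 by blast
        have "x \<in> box (- (real n *\<^sub>R One)) (real n *\<^sub>R One)" if "n \<ge> N" for n
        proof -
          have "- real n < x \<bullet> b \<and> x \<bullet> b < real n" if "b \<in> Basis" for b
            using Basis_le_norm[OF that, of x] N \<open>n \<ge> N\<close> by linarith
          then show ?thesis by (simp add: box_def)
        qed
        then show "eventually (\<lambda>n. indicator (box (- (real n *\<^sub>R One)) (real n *\<^sub>R One)) x * w x = w x) sequentially"
          by (intro eventually_sequentiallyI[of N]) simp
      qed
    qed (use w in \<open>auto simp: indicator_def\<close>)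
  qed (simp add: box)
  have zero: "(\<integral>x. indicator A x * w x \<partial>lborel) = 0" if "A \<in> sets borel" for A
  proof -
    have int: "integrable lborel (\<lambda>x. indicator A x * w x)" if "A \<in> sets borel" for A
      using integrable_mult_indicator[OF _ w, of A] that by simp
    have "Int_stable (range (\<lambda>(a, b). box a b :: 'a set))"
      by (auto simp: Int_stable_def box_Int_box)
    moreover have "range (\<lambda>(a, b). box a b :: 'a set) \<subseteq> Pow UNIV" by auto
    moreover have "A \<in> sigma_sets UNIV (range (\<lambda>(a, b). box a b))"
      using that unfolding borel_eq_box by simp
    ultimately show ?thesis
    proof (induction rule: sigma_sets_induct_disjoint)
      case (basic A) then show ?case by (auto simp: box)
    next
      case empty then show ?case by simp
    next
      case (compl A)
      then have [measurable]: "A \<in> sets borel" by (simp add: borel_eq_box)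
      have "(\<integral>x. indicator (UNIV - A) x * w x \<partial>lborel) = (\<integral>x. w x - indicator A x * w x \<partial>lborel)"
        by (rule Bochner_Integration.integral_cong) (auto simp: indicator_def)
      also have "\<dots> = 0"
        using compl int[of A] w by (simp add: tot)
      finally show ?case .
    next
      case (union F)
      then have [measurable]: "\<And>i. F i \<in> sets borel" by (simp add: borel_eq_box subset_eq)
      have "(\<lambda>i. indicator (F i) x * w x) sums (indicator (\<Union>(range F)) x * w x)" for x
        by (intro sums_mult2 indicator_sums) (use union in \<open>auto simp: disjoint_family_on_def\<close>)
      have ind: "(\<integral>x. (\<Sum>i<n. indicator (F i) x * w x) \<partial>lborel) = 0" for n
        using union int by (subst Bochner_Integration.integral_sum) auto
      have "(\<lambda>n. \<integral>x. (\<Sum>i<n. indicator (F i) x * w x) \<partial>lborel) \<longlonglongrightarrow> (\<integral>x. indicator (\<Union>(range F)) x * w x \<partial>lborel)"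
      proof (rule integral_dominated_convergence[where w = "\<lambda>x. \<bar>w x\<bar>"])
        show "AE x in lborel. (\<lambda>n. \<Sum>i<n. indicator (F i) x * w x) \<longlonglongrightarrow> indicator (\<Union>(range F)) x * w x"
          using \<open>\<And>x. (\<lambda>i. indicator (F i) x * w x) sums (indicator (\<Union>(range F)) x * w x)\<close>
          by (simp add: sums_def)
        fix n
        have eq: "(\<Sum>i<n. indicator (F i) x * w x) = indicator (\<Union>i<n. F i) x * w x" for x
          unfolding sum_distrib_right[symmetric]
          by (subst indicator_UN_disjoint) (use union in \<open>auto simp: disjoint_family_on_def\<close>)
        show "AE x in lborel. norm (\<Sum>i<n. indicator (F i) x * w x) \<le> \<bar>w x\<bar>"
          unfolding eq by (intro AE_I2) (simp add: indicator_def)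
      qed (use w in auto)
      then show ?case
        unfolding ind by (simp add: LIMSEQ_const_iff)
    qed
  qed
  show ?thesis
  proof (rule density_unique_real[OF w, of "\<lambda>x. 0"])
    fix A assume "A \<in> sets (lborel :: 'a measure)"
    then show "(LINT x:A|lborel. w x) = (LINT x:A|lborel. 0)"
      using zero[of A] by (simp add: set_lebesgue_integral_def)
  qed simp
qed

text \<open>
  The integral over a box is the limit of integrals against bumps.  As \<open>w\<close> need not be integrable, the argument is
  carried out for its restrictions to cubes.
\<close>

lemma AE_zero_if_orthogonal_to_tests:
  fixes w :: "'a::euclidean_space \<Rightarrow> complex"
  assumes loc: "\<And>l r. integrable lborel (\<lambda>x. indicator (box l r) x * w x)"
    and orth: "\<And>f. test_function f \<Longrightarrow> (\<integral>x. cnj (f x) * w x \<partial>lborel) = 0"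
  shows "AE x in lborel. w x = 0"
proof -
  have box: "(\<integral>x. indicator (box l r) x * w x \<partial>lborel) = 0" for l r :: 'a
  proof -
    have "(\<lambda>n. \<integral>x. complex_of_real (bump (real (Suc n)) l r x) * (indicator (box l r) x * w x) \<partial>lborel)
        \<longlonglongrightarrow> (\<integral>x. indicator (box l r) x * w x \<partial>lborel)"
    proof (rule integral_dominated_convergence[where w = "\<lambda>x. cmod (indicator (box l r) x * w x)"])
      show "AE x in lborel. (\<lambda>n. complex_of_real (bump (real (Suc n)) l r x) * (indicator (box l r) x * w x))
          \<longlonglongrightarrow> indicator (box l r) x * w x"
      proof (intro AE_I2)
        fix x
        have "(\<lambda>n. complex_of_real (bump (real (Suc n)) l r x) * (indicator (box l r) x * w x))
          \<longlonglongrightarrow> complex_of_real (indicator (box l r) x) * (indicator (box l r) x * w x)"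
          by (intro tendsto_mult tendsto_of_real bump_tendsto tendsto_const)
        also have "complex_of_real (indicator (box l r) x) * (indicator (box l r) x * w x) = indicator (box l r) x * w x"
          by (simp add: indicator_def)
        finally show "(\<lambda>n. complex_of_real (bump (real (Suc n)) l r x) * (indicator (box l r) x * w x))
          \<longlonglongrightarrow> indicator (box l r) x * w x" .
      qed
      fix n
      have "cmod (complex_of_real (bump (real (Suc n)) l r x) * z) \<le> cmod z" for x z
        using bump_bounds[of "real (Suc n)" l r x]
        by (simp add: norm_mult mult_left_le_one_le)
      then show "AE x in lborel. norm (complex_of_real (bump (real (Suc n)) l r x) * (indicator (box l r) x * w x))
          \<le> cmod (indicator (box l r) x * w x)" by blast
      show "(\<lambda>x. complex_of_real (bump (real (Suc n)) l r x) * (indicator (box l r) x * w x)) \<in> borel_measurable lborel"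
        using test_function_borel[OF test_function_bump[of "real (Suc n)" l r]] borel_measurable_integrable[OF loc[of l r]]
        by (simp only: measurable_lborel2 borel_measurable_times)
    qed (use loc in \<open>auto intro: borel_measurable_integrable\<close>)
    moreover have "(\<integral>x. complex_of_real (bump (real (Suc n)) l r x) * (indicator (box l r) x * w x) \<partial>lborel) = 0" for n
    proof -
      have "(\<integral>x. complex_of_real (bump (real (Suc n)) l r x) * (indicator (box l r) x * w x) \<partial>lborel)
        = (\<integral>x. cnj (complex_of_real (bump (real (Suc n)) l r x)) * w x \<partial>lborel)"
        by (rule Bochner_Integration.integral_cong) (auto simp: indicator_def bump_eq_0)
      also have "\<dots> = 0" by (intro orth test_function_bump) simp
      finally show ?thesis .
    qed
    ultimately show ?thesis by (simp add: LIMSEQ_const_iff)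
  qed
  have loc_zero: "AE x in lborel. indicator (box a b) x * w x = 0" for a b :: 'a
  proof -
    have eq: "indicator (box l r) x * (indicator (box a b) x * w x)
       = indicator (box (\<Sum>i\<in>Basis. max (l \<bullet> i) (a \<bullet> i) *\<^sub>R i) (\<Sum>i\<in>Basis. min (r \<bullet> i) (b \<bullet> i) *\<^sub>R i)) x * w x" for l r x
      by (auto simp: box_Int_box[symmetric] indicator_def)
    have z: "(\<integral>x. indicator (box l r) x * (indicator (box a b) x * w x) \<partial>lborel) = 0"
      and i: "integrable lborel (\<lambda>x. indicator (box l r) x * (indicator (box a b) x * w x))" for l r
      unfolding eq by (rule box loc)+
    have "AE x in lborel. Re (indicator (box a b) x * w x) = 0"
    proof (rule integral_boxes_zero_imp_AE_zero)
      fix l r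
      have "(\<integral>x. indicator (box l r) x * Re (indicator (box a b) x * w x) \<partial>lborel)
         = (\<integral>x. Re (indicator (box l r) x * (indicator (box a b) x * w x)) \<partial>lborel)"
        by (rule Bochner_Integration.integral_cong) (auto simp: indicator_def)
      also have "\<dots> = 0" using z i by (subst integral_Re) auto
      finally show "(\<integral>x. indicator (box l r) x * Re (indicator (box a b) x * w x) \<partial>lborel) = 0" .
    qed (rule integrable_Re[OF loc])
    moreover have "AE x in lborel. Im (indicator (box a b) x * w x) = 0"
    proof (rule integral_boxes_zero_imp_AE_zero)
      fix l r
      have "(\<integral>x. indicator (box l r) x * Im (indicator (box a b) x * w x) \<partial>lborel)
         = (\<integral>x. Im (indicator (box l r) x * (indicator (box a b) x * w x)) \<partial>lborel)"
        by (rule Bochner_Integration.integral_cong) (auto simp: indicator_def)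
      also have "\<dots> = 0" using z i by (subst integral_Im) auto
      finally show "(\<integral>x. indicator (box l r) x * Im (indicator (box a b) x * w x) \<partial>lborel) = 0" .
    qed (rule integrable_Im[OF loc])
    ultimately show ?thesis by eventually_elim (simp add: complex_eq_iff)
  qed
  have "AE x in lborel. \<forall>n. indicator (box (- (real n *\<^sub>R One)) (real n *\<^sub>R One)) x * w x = 0"
    unfolding AE_all_countable by (intro allI loc_zero)
  then show ?thesis
  proof eventually_elim
    case (elim x)
    obtain N where N: "norm x < real N" using reals_Archimedean2 by blast
    have "- real N < x \<bullet> b \<and> x \<bullet> b < real N" if "b \<in> Basis" for b
      using Basis_le_norm[OF that, of x] N by linarith
    then have "x \<in> box (- (real N *\<^sub>R One)) (real N *\<^sub>R One)" by (simp add: box_def)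
    with elim[rule_format, of N] show ?case by simp
  qed
qed

section \<open>Gaussian integrals\<close>

lemma measurable_cis [measurable]: "cis \<in> borel_measurable borel"
  by (intro borel_measurable_continuous_onI) (auto simp: cis_conv_exp intro!: continuous_intros)

lemma measurable_cnj [measurable]: "cnj \<in> borel_measurable borel"
  by (intro borel_measurable_continuous_onI continuous_intros)

lemma lborel_prod_Basis:
  fixes h :: "'a::euclidean_space \<Rightarrow> real \<Rightarrow> 'b::{real_normed_field, banach, second_countable_topology}"
  assumes h: "\<And>b. b \<in> Basis \<Longrightarrow> integrable lborel (h b)"
  shows "integrable lborel (\<lambda>x. \<Prod>b\<in>Basis. h b (x \<bullet> b))"
    and "(\<integral>x. (\<Prod>b\<in>Basis. h b (x \<bullet> b)) \<partial>lborel) = (\<Prod>b\<in>Basis. \<integral>t. h b t \<partial>lborel)"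
proof -
  interpret product_sigma_finite "\<lambda>_::'a. lborel :: real measure" by standard
  have [measurable]: "h b \<in> borel_measurable borel" if "b \<in> Basis" for b
    using h[OF that] by simp
  have m: "(\<lambda>f. \<Sum>b\<in>Basis. f b *\<^sub>R b) \<in> measurable (\<Pi>\<^sub>M b\<in>(Basis::'a set). lborel) borel"
    by measurable
  have m2: "(\<lambda>x. \<Prod>b\<in>Basis. h b (x \<bullet> b)) \<in> borel_measurable borel"
    by measurable
  show "integrable lborel (\<lambda>x. \<Prod>b\<in>Basis. h b (x \<bullet> b))"
    unfolding lborel_eq[where 'a = 'a]
    by (subst integrable_distr_eq[OF m m2])
      (simp add: inner_sum_left_Basis product_integrable_prod h cong: prod.cong)
  show "(\<integral>x. (\<Prod>b\<in>Basis. h b (x \<bullet> b)) \<partial>lborel) = (\<Prod>b\<in>Basis. \<integral>t. h b t \<partial>lborel)"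
    unfolding lborel_eq[where 'a = 'a]
    by (subst integral_distr[OF m m2])
      (simp add: inner_sum_left_Basis product_integral_prod h cong: prod.cong)
qed

text \<open>
  This is the characteristic function of the standard normal distribution, rescaled.
\<close>

lemma gaussian_fourier_1d:
  fixes t e :: real
  assumes "e > 0"
  shows "integrable lborel (\<lambda>k. cis (t * k) * complex_of_real (exp (- e * k\<^sup>2 / 2)))"
    and "(\<integral>k. cis (t * k) * complex_of_real (exp (- e * k\<^sup>2 / 2)) \<partial>lborel)
        = complex_of_real (sqrt (2 * pi / e) * exp (- t\<^sup>2 / (2 * e)))"
proof -
  have std: "integrable lborel (\<lambda>x. cis (u * x) * complex_of_real (exp (- x\<^sup>2 / 2)))"
    "(\<integral>x. cis (u * x) * complex_of_real (exp (- x\<^sup>2 / 2)) \<partial>lborel) = complex_of_real (sqrt (2 * pi) * exp (- u\<^sup>2 / 2))" for u :: real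
  proof -
    have re: "integrable lborel (\<lambda>x::real. exp (- x\<^sup>2 / 2))"
    proof -
      have "integrable lborel (\<lambda>x. sqrt (2 * pi) * std_normal_density x)"
        by (intro integrable_mult_right) (auto intro: integrable_normal_density)
      then show ?thesis by (simp add: std_normal_density_def)
    qed
    show "integrable lborel (\<lambda>x. cis (u * x) * complex_of_real (exp (- x\<^sup>2 / 2)))"
      by (rule Bochner_Integration.integrable_bound[OF re]) (auto simp: norm_mult)
    have "complex_of_real (exp (- (u^2) / 2)) = char std_normal_distribution u"
      by (simp add: char_std_normal_distribution)
    also have "\<dots> = (\<integral>x. std_normal_density x *\<^sub>R iexp (u * x) \<partial>lborel)"
      unfolding char_def by (subst integral_density) auto
    also have "\<dots> = (\<integral>x. complex_of_real (1 / sqrt (2 * pi)) * (cis (u * x) * complex_of_real (exp (- x\<^sup>2 / 2))) \<partial>lborel)"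
      by (rule Bochner_Integration.integral_cong)
        (auto simp: std_normal_density_def scaleR_conv_of_real cis_conv_exp)
    also have "\<dots> = complex_of_real (1 / sqrt (2 * pi)) * (\<integral>x. cis (u * x) * complex_of_real (exp (- x\<^sup>2 / 2)) \<partial>lborel)"
      by simp
    finally show "(\<integral>x. cis (u * x) * complex_of_real (exp (- x\<^sup>2 / 2)) \<partial>lborel) = complex_of_real (sqrt (2 * pi) * exp (- u\<^sup>2 / 2))"
      by (simp add: field_simps)
  qed
  define c where "c = sqrt e"
  have c: "c > 0" "c\<^sup>2 = e" using assms by (auto simp: c_def)
  have eq: "cis (t / c * (0 + c * k)) * complex_of_real (exp (- (0 + c * k)\<^sup>2 / 2))
      = cis (t * k) * complex_of_real (exp (- e * k\<^sup>2 / 2))" for k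
    using c by (simp add: power_mult_distrib)
  show "integrable lborel (\<lambda>k. cis (t * k) * complex_of_real (exp (- e * k\<^sup>2 / 2)))"
    using lborel_integrable_real_affine[OF std(1)[of "t / c"], of c 0] c(1) unfolding eq by simp
  have "complex_of_real (sqrt (2 * pi) * exp (- (t / c)\<^sup>2 / 2))
     = c *\<^sub>R (\<integral>k. cis (t * k) * complex_of_real (exp (- e * k\<^sup>2 / 2)) \<partial>lborel)"
    unfolding std(2)[symmetric]
    by (subst lborel_integral_real_affine[where c = c and t = 0]) (use c(1) in \<open>simp_all only: eq, simp_all\<close>)
  then show "(\<integral>k. cis (t * k) * complex_of_real (exp (- e * k\<^sup>2 / 2)) \<partial>lborel)
        = complex_of_real (sqrt (2 * pi / e) * exp (- t\<^sup>2 / (2 * e)))"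
    using c by (simp add: real_sqrt_divide power_divide c_def[symmetric] scaleR_conv_of_real field_simps)
qed

lemma norm_power2_Basis: "(norm (x::'a::euclidean_space))\<^sup>2 = (\<Sum>b\<in>Basis. (x \<bullet> b)\<^sup>2)"
  using euclidean_inner[of x x] by (simp add: power2_norm_eq_inner power2_eq_square[of "_ \<bullet> _"])

lemma cis_sum: "finite I \<Longrightarrow> cis (\<Sum>i\<in>I. f i) = (\<Prod>i\<in>I. cis (f i))"
  by (induction I rule: finite_induct) (simp_all add: cis_mult[symmetric])

lemma gaussian_fourier:
  fixes x :: "'a::euclidean_space"
  assumes e: "e > 0"
  shows "integrable lborel (\<lambda>k. cis (x \<bullet> k) * complex_of_real (exp (- e * (norm k)\<^sup>2 / 2)))"
    and "(\<integral>k. cis (x \<bullet> k) * complex_of_real (exp (- e * (norm k)\<^sup>2 / 2)) \<partial>lborel)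
        = complex_of_real (sqrt (2 * pi / e) ^ DIM('a) * exp (- (norm x)\<^sup>2 / (2 * e)))"
proof -
  have eq: "cis (x \<bullet> k) * complex_of_real (exp (- e * (norm k)\<^sup>2 / 2))
     = (\<Prod>b\<in>Basis. cis ((x \<bullet> b) * (k \<bullet> b)) * complex_of_real (exp (- e * (k \<bullet> b)\<^sup>2 / 2)))" for k
    unfolding norm_power2_Basis euclidean_inner[of x k]
    by (simp add: cis_sum prod.distrib sum_distrib_left sum_divide_distrib exp_sum sum_negf[symmetric] del: sum_negf)
  note int = gaussian_fourier_1d[OF e]
  show "integrable lborel (\<lambda>k. cis (x \<bullet> k) * complex_of_real (exp (- e * (norm k)\<^sup>2 / 2)))"
    unfolding eq using lborel_prod_Basis(1)[of "\<lambda>b k. cis ((x \<bullet> b) * k) * complex_of_real (exp (- e * k\<^sup>2 / 2))", OF int(1)] .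
  have "(\<integral>k. cis (x \<bullet> k) * complex_of_real (exp (- e * (norm k)\<^sup>2 / 2)) \<partial>lborel)
      = (\<Prod>b\<in>(Basis::'a set). complex_of_real (sqrt (2 * pi / e) * exp (- (x \<bullet> b)\<^sup>2 / (2 * e))))"
    unfolding eq lborel_prod_Basis(2)[of "\<lambda>b k. cis ((x \<bullet> b) * k) * complex_of_real (exp (- e * k\<^sup>2 / 2))", OF int(1)] int(2) ..
  also have "\<dots> = complex_of_real (sqrt (2 * pi / e) ^ DIM('a) * exp (- (norm x)\<^sup>2 / (2 * e)))"
    unfolding norm_power2_Basis
    by (simp add: prod.distrib sum_divide_distrib exp_sum sum_negf[symmetric] del: sum_negf)
  finally show "(\<integral>k. cis (x \<bullet> k) * complex_of_real (exp (- e * (norm k)\<^sup>2 / 2)) \<partial>lborel)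
        = complex_of_real (sqrt (2 * pi / e) ^ DIM('a) * exp (- (norm x)\<^sup>2 / (2 * e)))" .
qed

lemma gaussian_integral:
  assumes e: "e > 0"
  shows "integrable lborel (\<lambda>k::'a::euclidean_space. exp (- e * (norm k)\<^sup>2 / 2))"
    and "(\<integral>k. exp (- e * (norm (k::'a))\<^sup>2 / 2) \<partial>lborel) = sqrt (2 * pi / e) ^ DIM('a)"
  using integrable_Re[OF gaussian_fourier(1)[OF e, of "0::'a"]] gaussian_fourier(2)[OF e, of "0::'a"]
  by (simp_all add: of_real_eq_iff flip: of_real_power of_real_mult)

text \<open>
  The exponent is large enough for \<open>decay\<close> to be integrable and, as \<open>decay \<le> 1\<close>, also square integrable.  Its
  reciprocal is a polynomial, the symbol of a power of \<open>1 - \<Delta>\<close>.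
\<close>

definition decay :: "'a::euclidean_space \<Rightarrow> real" where
  "decay x = 1 / (1 + (norm x)\<^sup>2) ^ DIM('a)"

lemma decay_pos: "0 < decay x"
  by (simp add: decay_def add_pos_nonneg)

lemma decay_le_1: "decay x \<le> 1"
  by (simp add: decay_def add_pos_nonneg one_le_power)

lemma decay_measurable [measurable]: "decay \<in> borel_measurable borel"
  unfolding decay_def[abs_def] by measurable

lemma integrable_inverse_1_plus_square: "integrable lborel (\<lambda>t::real. 1 / (1 + t\<^sup>2))"
proof -
  have "(\<integral>\<^sup>+t. ennreal (1 / (1 + t\<^sup>2)) * indicator {0..} t \<partial>lborel) = ennreal (pi / 2 - arctan 0)"
    by (rule nn_integral_FTC_atLeast)
      (auto intro!: derivative_eq_intros tendsto_arctan_at_top simp: inverse_eq_divide)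
  moreover have "ennreal (norm (indicator {0..} t * (1 / (1 + t\<^sup>2)))) = ennreal (1 / (1 + t\<^sup>2)) * indicator {0..} t"
    for t :: real by (auto simp: indicator_def)
  ultimately have half: "integrable lborel (\<lambda>t::real. indicator {0..} t * (1 / (1 + t\<^sup>2)))"
    by (intro integrableI_bounded) simp_all
  have "integrable lborel (\<lambda>t::real. indicator {0..} (0 + - 1 * t) * (1 / (1 + (0 + - 1 * t)\<^sup>2)))"
    by (rule lborel_integrable_real_affine[OF half]) simp
  from Bochner_Integration.integrable_add[OF half this] show ?thesis
  proof (rule Bochner_Integration.integrable_bound)
  qed (auto simp: indicator_def)
qed

lemma decay_integrable: "integrable lborel (decay :: 'a::euclidean_space \<Rightarrow> real)"
proof (rule Bochner_Integration.integrable_bound)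
  show "integrable lborel (\<lambda>x::'a. \<Prod>b\<in>Basis. 1 / (1 + (x \<bullet> b)\<^sup>2))"
    by (rule lborel_prod_Basis(1)) (rule integrable_inverse_1_plus_square)
  have "decay x \<le> (\<Prod>b\<in>Basis. 1 / (1 + (x \<bullet> b)\<^sup>2))" for x :: 'a
  proof -
    have "(\<Prod>b\<in>Basis. 1 + (x \<bullet> b)\<^sup>2) \<le> (\<Prod>b\<in>(Basis::'a set). 1 + (norm x)\<^sup>2)"
      by (intro prod_mono conjI add_left_mono) (auto intro!: add_nonneg_nonneg power2_le_iff_abs_le[THEN iffD2] Basis_le_norm)
    moreover have "0 < (\<Prod>b\<in>Basis. 1 + (x \<bullet> b)\<^sup>2)"
      by (intro prod_pos ballI add_pos_nonneg) simp_all
    ultimately show ?thesis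
      by (simp add: decay_def prod_dividef frac_le)
  qed
  then have "norm (decay x) \<le> norm (\<Prod>b\<in>Basis. 1 / (1 + (x \<bullet> b)\<^sup>2))" for x :: 'a
    unfolding real_norm_def abs_of_pos[OF decay_pos] by (rule order_trans[OF _ abs_ge_self])
  then show "AE x::'a in lborel. norm (decay x) \<le> norm (\<Prod>b\<in>Basis. 1 / (1 + (x \<bullet> b)\<^sup>2))"
    by (rule AE_I2)
qed simp

lemma decay_square_integrable: "square_integrable (\<lambda>x. complex_of_real (decay x))"
proof -
  have "integrable lborel (\<lambda>x::'a. (decay x)\<^sup>2)"
  proof (rule Bochner_Integration.integrable_bound[OF decay_integrable])
    have "(decay x)\<^sup>2 \<le> decay x" for x :: 'a
      using decay_pos[of x] decay_le_1[of x] by (simp add: power2_eq_square)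
    then show "AE x::'a in lborel. norm ((decay x)\<^sup>2) \<le> norm (decay x)"
      by (intro AE_I2) (simp add: order_trans[OF _ abs_ge_self])
  qed simp
  then show ?thesis by (simp add: square_integrable_def)
qed

section \<open>Lebesgue measure under translations, scalings and shears\<close>

lemma lborel_integral_translate:
  fixes f :: "'a::euclidean_space \<Rightarrow> 'b::{banach, second_countable_topology}"
  assumes "f \<in> borel_measurable borel"
  shows "(\<integral>x. f (x + a) \<partial>lborel) = (\<integral>x. f x \<partial>lborel)"
proof -
  have "(\<integral>x. f x \<partial>lborel) = (\<integral>x. f x \<partial>distr lborel borel (\<lambda>t. t + a))"
    by (simp only: lborel_distr_translate)
  also have "\<dots> = (\<integral>x. f (x + a) \<partial>lborel)"
    by (rule integral_distr) (use assms in auto)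
  finally show ?thesis ..
qed

lemma lborel_integrable_translate:
  fixes f :: "'a::euclidean_space \<Rightarrow> 'b::{banach, second_countable_topology}"
  assumes "integrable lborel f"
  shows "integrable lborel (\<lambda>x. f (x + a))"
proof -
  have "integrable (distr lborel borel (\<lambda>t. t + a)) f"
    using assms by (simp only: lborel_distr_translate)
  then show ?thesis using assms by (subst (asm) integrable_distr_eq) auto
qed

lemma lborel_integral_scale:
  fixes f :: "'a::euclidean_space \<Rightarrow> 'b::{banach, second_countable_topology}"
  assumes [measurable]: "f \<in> borel_measurable borel" and c: "c \<noteq> 0"
  shows "(\<integral>x. f x \<partial>lborel) = \<bar>c\<bar> ^ DIM('a) *\<^sub>R (\<integral>x. f (y + c *\<^sub>R x) \<partial>lborel)"
proof -
  have "(\<integral>x. f x \<partial>lborel) = (\<integral>x. f x \<partial>density (distr lborel borel (\<lambda>x. y + c *\<^sub>R x)) (\<lambda>_. ennreal (\<bar>c\<bar> ^ DIM('a))))"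
    by (subst lborel_affine[OF c, of y]) simp
  also have "\<dots> = (\<integral>x. \<bar>c\<bar> ^ DIM('a) *\<^sub>R f x \<partial>distr lborel borel (\<lambda>x. y + c *\<^sub>R x))"
    by (rule integral_density) auto
  also have "\<dots> = \<bar>c\<bar> ^ DIM('a) *\<^sub>R (\<integral>x. f (y + c *\<^sub>R x) \<partial>lborel)"
    by (subst integral_distr) auto
  finally show ?thesis .
qed

text \<open>
  Every exchange of integrals below is over such an integrand: convolutions, translates and plain products differ
  only in the shift \<open>l\<close>, and phases and bounded factors go into \<open>m\<close>.
\<close>

lemma integrable_pair_shear:
  fixes f :: "'a::euclidean_space \<Rightarrow> 'c::{real_normed_field, banach, second_countable_topology}"
    and g :: "'b::euclidean_space \<Rightarrow> 'c" and m :: "'b \<times> 'a \<Rightarrow> 'c"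
  assumes f: "integrable lborel f" and g: "integrable lborel g"
    and [measurable]: "l \<in> borel_measurable borel" "m \<in> borel_measurable (borel \<Otimes>\<^sub>M borel)" and m: "\<And>p. norm (m p) \<le> K"
  shows "integrable (lborel \<Otimes>\<^sub>M lborel) (\<lambda>(y, x). m (y, x) * (f (x + l y) * g y))"
proof (rule lborel_pair.Fubini_integrable)
  have [measurable]: "f \<in> borel_measurable borel" "g \<in> borel_measurable borel"
    using f g by simp_all
  show "(\<lambda>(y, x). m (y, x) * (f (x + l y) * g y)) \<in> borel_measurable (lborel \<Otimes>\<^sub>M lborel)"
    by measurable
  have le: "norm (m p * (f z * g y)) \<le> K * norm (f z * g y)" for p z y
    unfolding norm_mult[of "m p"] by (intro mult_right_mono m norm_ge_zero)
  have K: "0 \<le> K" using norm_ge_zero m by (rule order_trans)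
  have int: "integrable lborel (\<lambda>x. K * norm (f (x + l y) * g y))" for y
    by (intro integrable_mult_right integrable_norm integrable_mult_left lborel_integrable_translate f)
  have int': "integrable lborel (\<lambda>x. m (y, x) * (f (x + l y) * g y))" for y
    by (rule Bochner_Integration.integrable_bound[OF int[of y]])
      (auto intro!: AE_I2 order_trans[OF le abs_ge_self])
  then show "AE y in lborel. integrable lborel (\<lambda>x. case (y, x) of (y, x) \<Rightarrow> m (y, x) * (f (x + l y) * g y))"
    by simp
  show "integrable lborel (\<lambda>y. \<integral>x. norm (case (y, x) of (y, x) \<Rightarrow> m (y, x) * (f (x + l y) * g y)) \<partial>lborel)"
  proof (rule Bochner_Integration.integrable_bound)
    show "integrable lborel (\<lambda>y. K * (\<integral>x. norm (f x) \<partial>lborel) * norm (g y))"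
      using g by (intro integrable_mult_right integrable_norm)
    have "(\<integral>x. norm (m (y, x) * (f (x + l y) * g y)) \<partial>lborel) \<le> K * (\<integral>x. norm (f x) \<partial>lborel) * norm (g y)" for y
    proof -
      have "(\<integral>x. norm (m (y, x) * (f (x + l y) * g y)) \<partial>lborel) \<le> (\<integral>x. K * norm (f (x + l y) * g y) \<partial>lborel)"
        by (intro integral_mono integrable_norm int int' le)
      also have "\<dots> = K * (\<integral>x. norm (f (x + l y)) \<partial>lborel) * norm (g y)"
        by (simp add: norm_mult)
      also have "(\<integral>x. norm (f (x + l y)) \<partial>lborel) = (\<integral>x. norm (f x) \<partial>lborel)"
        by (rule lborel_integral_translate) simp
      finally show ?thesis .
    qed
    then show "AE y in lborel. norm (\<integral>x. norm (case (y, x) of (y, x) \<Rightarrow> m (y, x) * (f (x + l y) * g y)) \<partial>lborel)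
       \<le> norm (K * (\<integral>x. norm (f x) \<partial>lborel) * norm (g y))"
      using K by (auto simp: integral_nonneg_AE)
  qed measurable
qed

section \<open>The Fourier transform on phase space\<close>

text \<open>
  The sign \<open>s\<close> is \<open>-1\<close> for the Fourier transform and \<open>1\<close> for its inverse, which thus share their proofs.  The
  constant makes both unitary, phase space having dimension \<open>2 * CARD('n)\<close>.
\<close>

definition fts :: "real \<Rightarrow> ('n::finite phase \<Rightarrow> complex) \<Rightarrow> 'n phase \<Rightarrow> complex" where
  "fts s f k = complex_of_real (1 / (2 * pi) ^ CARD('n)) * (\<integral>x. cis (s * (k \<bullet> x)) * f x \<partial>lborel)"

lemma fourier_eq_fts: "fourier f = fts (- 1) f"
  by (simp add: fourier_def fts_def fun_eq_iff)

lemma DIM_phase: "DIM('n::finite phase) = 2 * CARD('n)"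
  by simp

lemma fts_measurable [measurable]:
  assumes [measurable]: "f \<in> borel_measurable borel"
  shows "fts s f \<in> borel_measurable borel"
  unfolding fts_def[abs_def] by measurable

lemma integrable_cis_mult:
  assumes "integrable lborel f"
  shows "integrable lborel (\<lambda>x::'a::euclidean_space. cis (s * (k \<bullet> x)) * f x)"
  by (rule Bochner_Integration.integrable_bound[OF assms]) (use assms in \<open>auto simp: norm_mult\<close>)

lemma fts_bound:
  fixes f :: "'n::finite phase \<Rightarrow> complex"
  assumes "integrable lborel f"
  shows "cmod (fts s f k) \<le> 1 / (2 * pi) ^ CARD('n) * (\<integral>x. cmod (f x) \<partial>lborel)"
proof -
  have "cmod (\<integral>x. cis (s * (k \<bullet> x)) * f x \<partial>lborel) \<le> (\<integral>x. cmod (cis (s * (k \<bullet> x)) * f x) \<partial>lborel)"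
    by (rule integral_norm_bound)
  then show ?thesis by (simp add: fts_def norm_mult norm_divide norm_power divide_right_mono)
qed

lemma fts_add:
  assumes "integrable lborel f" "integrable lborel g"
  shows "fts s (\<lambda>x. f x + g x) k = fts s f k + fts s g k"
  using assms by (simp add: fts_def distrib_left integrable_cis_mult)

lemma fts_diff:
  assumes "integrable lborel f" "integrable lborel g"
  shows "fts s (\<lambda>x. f x - g x) k = fts s f k - fts s g k"
  using assms by (simp add: fts_def right_diff_distrib integrable_cis_mult)

lemma fts_cmult: "fts s (\<lambda>x. c * f x) k = c * fts s f k"
  by (simp add: fts_def mult.left_commute[of _ c])

lemma fts_cong_AE:
  assumes "f \<in> borel_measurable borel" "g \<in> borel_measurable borel" "AE x in lborel. f x = g x"
  shows "fts s f = fts s g"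
proof
  fix k
  have "(\<integral>x. cis (s * (k \<bullet> x)) * f x \<partial>lborel) = (\<integral>x. cis (s * (k \<bullet> x)) * g x \<partial>lborel)"
    by (rule integral_cong_AE) (use assms in auto)
  then show "fts s f k = fts s g k" by (simp add: fts_def)
qed

lemma cnj_fts: "cnj (fts s f k) = fts (- s) (\<lambda>x. cnj (f x)) k"
  by (simp add: fts_def cis_cnj flip: Bochner_Integration.integral_cnj)

lemma integrable_product_pair:
  fixes u :: "'a::euclidean_space \<Rightarrow> complex" and w :: "'b::euclidean_space \<Rightarrow> complex"
  assumes "integrable lborel u" "integrable lborel w"
    and "m \<in> borel_measurable (borel \<Otimes>\<^sub>M borel)" "\<And>p. cmod (m p) \<le> K"
  shows "integrable (lborel \<Otimes>\<^sub>M lborel) (\<lambda>(k, x). m (k, x) * (u x * w k))"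
  using integrable_pair_shear[where l = "\<lambda>_. 0" and K = K, OF assms(1,2) _ assms(3,4)] by simp

lemma fts_mult_formula:
  assumes u: "integrable lborel u" and w: "integrable lborel w"
  shows "(\<integral>k. fts s u k * w k \<partial>lborel) = (\<integral>x. u x * fts s w x \<partial>lborel)"
proof -
  define c where "c = complex_of_real (1 / (2 * pi) ^ CARD('a))"
  have i: "integrable (lborel \<Otimes>\<^sub>M lborel) (\<lambda>(k, x). cis (s * (k \<bullet> x)) * (u x * w k))"
    using integrable_product_pair[OF u w, of "\<lambda>p. cis (s * (fst p \<bullet> snd p))" 1] by simp
  have "(\<integral>k. fts s u k * w k \<partial>lborel) = (\<integral>k. c * (\<integral>x. cis (s * (k \<bullet> x)) * (u x * w k) \<partial>lborel) \<partial>lborel)"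
    by (simp add: fts_def c_def mult.assoc flip: Bochner_Integration.integral_mult_left_zero)
  also have "\<dots> = c * (\<integral>k. (\<integral>x. cis (s * (k \<bullet> x)) * (u x * w k) \<partial>lborel) \<partial>lborel)"
    by simp
  also have "(\<integral>k. (\<integral>x. cis (s * (k \<bullet> x)) * (u x * w k) \<partial>lborel) \<partial>lborel)
     = (\<integral>x. (\<integral>k. cis (s * (k \<bullet> x)) * (u x * w k) \<partial>lborel) \<partial>lborel)"
    using lborel_pair.Fubini_integral[of "\<lambda>k x. cis (s * (k \<bullet> x)) * (u x * w k)", OF i] ..
  also have "\<dots> = (\<integral>x. u x * (\<integral>k. cis (s * (x \<bullet> k)) * w k \<partial>lborel) \<partial>lborel)"
    by (simp add: inner_commute mult.left_commute[of "u _"] flip: Bochner_Integration.integral_mult_right_zero)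
  also have "c * \<dots> = (\<integral>x. u x * fts s w x \<partial>lborel)"
    unfolding fts_def c_def[symmetric] by (simp add: mult.left_commute[of _ c])
  finally show ?thesis .
qed

lemma gaussian_fts:
  fixes x y :: "'n::finite phase"
  assumes e: "e > 0" and s: "s * s = 1"
  shows "fts s (\<lambda>k. cis (- (s * (y \<bullet> k))) * complex_of_real (exp (- e * (norm k)\<^sup>2 / 2))) x
    = complex_of_real (exp (- (norm (x - y))\<^sup>2 / (2 * e)) / e ^ CARD('n))"
proof -
  have s1: "\<bar>s\<bar> = 1" using s by (metis abs_mult_self_eq abs_square_eq_1 power2_eq_square)
  have eq: "cis (s * (x \<bullet> k)) * (cis (- (s * (y \<bullet> k))) * complex_of_real (exp (- e * (norm k)\<^sup>2 / 2)))
     = cis ((s *\<^sub>R (x - y)) \<bullet> k) * complex_of_real (exp (- e * (norm k)\<^sup>2 / 2))" for k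
    unfolding mult.assoc[symmetric] cis_mult by (simp add: inner_diff_left right_diff_distrib)
  have sq: "sqrt (2 * pi / e) ^ DIM('n phase) = (2 * pi / e) ^ CARD('n)"
    unfolding DIM_phase power_mult using e by simp
  show ?thesis
    unfolding fts_def eq gaussian_fourier(2)[OF e] sq
    using e by (simp add: s1 power_divide power_mult_distrib)
qed

text \<open>
  The multiplication formula, with a modulated Gaussian as the second factor: regularising the transform averages
  \<open>u\<close> around \<open>y\<close> with the heat kernel.
\<close>

lemma fts_gaussian_regularised:
  fixes u :: "'n::finite phase \<Rightarrow> complex"
  assumes u: "integrable lborel u" and e: "e > 0" and s: "s * s = 1"
  shows "(\<integral>k. fts s u k * (cis (- (s * (y \<bullet> k))) * complex_of_real (exp (- e * (norm k)\<^sup>2 / 2))) \<partial>lborel)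
    = (\<integral>x. u x * complex_of_real (exp (- (norm (x - y))\<^sup>2 / (2 * e)) / e ^ CARD('n)) \<partial>lborel)"
proof -
  have "integrable lborel (\<lambda>k. cis (- (s * (y \<bullet> k))) * complex_of_real (exp (- e * (norm k)\<^sup>2 / 2)))"
    using integrable_cis_mult[of "\<lambda>k. complex_of_real (exp (- e * (norm k)\<^sup>2 / 2))" "- s" y]
      gaussian_integral(1)[OF e, where 'a = "'n phase"] by simp
  from fts_mult_formula[OF u this, of s] show ?thesis
    unfolding gaussian_fts[OF e s] .
qed

lemma gaussian_heat_kernel:
  assumes e: "e > 0"
  shows "integrable lborel (\<lambda>x::'n::finite phase. exp (- (norm x)\<^sup>2 / (2 * e)) / e ^ CARD('n))"
    and "(\<integral>x. exp (- (norm (x::'n phase))\<^sup>2 / (2 * e)) / e ^ CARD('n) \<partial>lborel) = (2 * pi) ^ CARD('n)"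
proof -
  have e': "1 / e > 0" using e by simp
  have eq: "- (norm x)\<^sup>2 / (2 * e) = - (1 / e) * (norm x)\<^sup>2 / 2" for x :: "'n phase" by simp
  show "integrable lborel (\<lambda>x::'n phase. exp (- (norm x)\<^sup>2 / (2 * e)) / e ^ CARD('n))"
    unfolding eq by (intro integrable_divide gaussian_integral(1)[OF e'])
  have "sqrt (2 * pi / (1 / e)) ^ DIM('n phase) = (2 * pi * e) ^ CARD('n)"
    unfolding DIM_phase power_mult using e by simp
  then show "(\<integral>x. exp (- (norm (x::'n phase))\<^sup>2 / (2 * e)) / e ^ CARD('n) \<partial>lborel) = (2 * pi) ^ CARD('n)"
    unfolding eq using e gaussian_integral(2)[OF e', where 'a = "'n phase"] by (simp add: power_mult_distrib)
qed

text \<open>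
  The inequality half of Plancherel's theorem: regularising with a Gaussian turns the norm of the transform into a
  double integral of \<open>u\<close> against the heat kernel, which has mass 1 in each variable, so Schur's test applies.
\<close>

lemma fts_regularised_bound:
  fixes u :: "'n::finite phase \<Rightarrow> complex"
  assumes u: "integrable lborel u" and sq: "square_integrable u" and e: "e > 0" and s: "s * s = 1"
  shows "(\<integral>k. (cmod (fts s u k))\<^sup>2 * exp (- e * (norm k)\<^sup>2 / 2) \<partial>lborel) \<le> (\<integral>x. (cmod (u x))\<^sup>2 \<partial>lborel)"
    and "integrable lborel (\<lambda>k. (cmod (fts s u k))\<^sup>2 * exp (- e * (norm k)\<^sup>2 / 2))"
proof -
  define c where "c = 1 / (2 * pi) ^ CARD('n)"
  define P where "P = (\<lambda>x::'n phase. exp (- (norm x)\<^sup>2 / (2 * e)) / e ^ CARD('n))"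
  define G where "G = (\<lambda>k::'n phase. exp (- e * (norm k)\<^sup>2 / 2))"
  define N where "N = (\<integral>x. (cmod (u x))\<^sup>2 \<partial>lborel)"
  have [measurable]: "u \<in> borel_measurable borel" using u by simp
  have [measurable]: "P \<in> borel_measurable borel" "G \<in> borel_measurable borel"
    unfolding P_def G_def by measurable
  have c: "c > 0" by (simp add: c_def)
  have P: "integrable lborel P" "(\<integral>x. P x \<partial>lborel) = 1 / c" "\<And>x. P x \<ge> 0" "\<And>x. P (- x) = P x"
    using gaussian_heat_kernel[OF e, where 'n = 'n] e by (simp_all add: P_def c_def)
  have G: "integrable lborel G" "\<And>k. G k \<ge> 0"
    using gaussian_integral(1)[OF e, where 'a = "'n phase"] by (simp_all add: G_def)
  have sqi: "integrable lborel (\<lambda>x. (cmod (u x))\<^sup>2)" using sq by (simp add: square_integrable_def)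
  define B where "B = c * (\<integral>x. cmod (u x) \<partial>lborel)"
  have B: "cmod (fts s u k) \<le> B" for k
    unfolding B_def c_def by (rule fts_bound[OF u])
  have wint: "integrable lborel (\<lambda>k. cnj (fts s u k) * complex_of_real (G k))"
  proof (rule Bochner_Integration.integrable_bound)
    show "integrable lborel (\<lambda>k. B * G k)" by (intro integrable_mult_right G)
    show "AE k in lborel. norm (cnj (fts s u k) * complex_of_real (G k)) \<le> norm (B * G k)"
    proof (rule AE_I2)
      fix k
      have "cmod (fts s u k) * G k \<le> B * G k" by (intro mult_right_mono B G)
      then show "norm (cnj (fts s u k) * complex_of_real (G k)) \<le> norm (B * G k)"
        using G(2)[of k] by (simp add: norm_mult)
    qed
  qed measurable
  have fw: "fts s (\<lambda>k. cnj (fts s u k) * complex_of_real (G k)) y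
      = complex_of_real c * (\<integral>x. cnj (u x) * complex_of_real (P (x - y)) \<partial>lborel)" for y
  proof -
    have "(\<integral>k. cis (s * (y \<bullet> k)) * (cnj (fts s u k) * complex_of_real (G k)) \<partial>lborel)
        = cnj (\<integral>k. fts s u k * (cis (- (s * (y \<bullet> k))) * complex_of_real (G k)) \<partial>lborel)"
      by (simp add: cis_cnj ac_simps flip: Bochner_Integration.integral_cnj)
    also have "\<dots> = cnj (\<integral>x. u x * complex_of_real (P (x - y)) \<partial>lborel)"
      unfolding G_def P_def fts_gaussian_regularised[OF u e s] ..
    also have "\<dots> = (\<integral>x. cnj (u x) * complex_of_real (P (x - y)) \<partial>lborel)"
      by (simp flip: Bochner_Integration.integral_cnj)
    finally show ?thesis by (simp add: fts_def c_def)
  qed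
  have real: "complex_of_real ((cmod (fts s u k))\<^sup>2 * G k) = fts s u k * (cnj (fts s u k) * complex_of_real (G k))" for k
    by (simp add: complex_norm_square mult.assoc del: of_real_power)
  have sqint: "integrable lborel (\<lambda>k. (cmod (fts s u k))\<^sup>2 * G k)"
  proof (rule Bochner_Integration.integrable_bound)
    show "integrable lborel (\<lambda>k. B\<^sup>2 * G k)" by (intro integrable_mult_right G)
    show "AE k in lborel. norm ((cmod (fts s u k))\<^sup>2 * G k) \<le> norm (B\<^sup>2 * G k)"
    proof (rule AE_I2)
      fix k
      have "(cmod (fts s u k))\<^sup>2 * G k \<le> B\<^sup>2 * G k" by (intro mult_right_mono power_mono B G) simp
      then show "norm ((cmod (fts s u k))\<^sup>2 * G k) \<le> norm (B\<^sup>2 * G k)"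
        using G(2)[of k] by simp
    qed
  qed measurable
  then show "integrable lborel (\<lambda>k. (cmod (fts s u k))\<^sup>2 * exp (- e * (norm k)\<^sup>2 / 2))"
    by (simp add: G_def)
  define H where "H = (\<lambda>(y, x). ((cmod (u y))\<^sup>2 + (cmod (u x))\<^sup>2) / 2 * P (x - y))"
  define \<Phi> where "\<Phi> = (\<lambda>(y, x). u y * (cnj (u x) * complex_of_real (P (x - y))))"
  have i1: "integrable (lborel \<Otimes>\<^sub>M lborel) (\<lambda>(y, x). P (x - y) * (cmod (u y))\<^sup>2)"
    using integrable_pair_shear[OF P(1) sqi, of uminus "\<lambda>_. 1" 1] by simp
  have i2: "integrable (lborel \<Otimes>\<^sub>M lborel) (\<lambda>(y, x). P (x - y) * (cmod (u x))\<^sup>2)"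
  proof -
    have "(\<lambda>(x, y). P (y - x) * (cmod (u y))\<^sup>2) = (\<lambda>(y, x). P (x - y) * (cmod (u x))\<^sup>2)"
      by (rule refl)
    moreover have "P (y - x) = P (x - y)" for x y using P(4)[of "x - y"] by simp
    ultimately show ?thesis
      using lborel_pair.integrable_product_swap[OF i1] by (simp add: split_beta')
  qed
  have H: "integrable (lborel \<Otimes>\<^sub>M lborel) H"
    using integrable_mult_left[OF Bochner_Integration.integrable_add[OF i1 i2], of "1/2"]
    by (simp add: H_def split_beta' algebra_simps add_divide_distrib)
  have le: "norm (\<Phi> p) \<le> H p" for p
  proof -
    obtain y x where p: "p = (y, x)" by (cases p)
    have "cmod (u y) * cmod (u x) \<le> ((cmod (u y))\<^sup>2 + (cmod (u x))\<^sup>2) / 2"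
      using sum_squares_bound[of "cmod (u y)" "cmod (u x)"] by simp
    from mult_right_mono[OF this P(3)[of "x - y"]] show ?thesis
      using P(3) by (simp add: p \<Phi>_def H_def norm_mult mult.assoc)
  qed
  have \<Phi>: "integrable (lborel \<Otimes>\<^sub>M lborel) \<Phi>"
    by (rule Bochner_Integration.integrable_bound[OF H])
      (auto simp: \<Phi>_def split_beta' intro!: AE_I2 order_trans[OF le[unfolded \<Phi>_def split_beta'] abs_ge_self])
  have IH: "integral\<^sup>L (lborel \<Otimes>\<^sub>M lborel) H = N / c"
  proof -
    have Px: "(\<integral>x. P (x - y) \<partial>lborel) = 1 / c" for y
      using lborel_integral_translate[of P "- y"] P(2) by simp
    have a1: "(\<integral>p. (case p of (y, x) \<Rightarrow> P (x - y) * (cmod (u y))\<^sup>2) \<partial>(lborel \<Otimes>\<^sub>M lborel)) = N / c"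
      using lborel_pair.integral_fst'[OF i1] by (simp add: Px N_def)
    have Py: "(\<integral>y. P (x - y) \<partial>lborel) = 1 / c" for x
      using Px[of x] P(4)[of "x - _"] by simp
    have a2: "(\<integral>p. (case p of (y, x) \<Rightarrow> P (x - y) * (cmod (u x))\<^sup>2) \<partial>(lborel \<Otimes>\<^sub>M lborel)) = N / c"
      using lborel_pair.integral_snd[of "\<lambda>y x. P (x - y) * (cmod (u x))\<^sup>2", OF i2] by (simp add: Py N_def)
    have "H = (\<lambda>p. ((case p of (y, x) \<Rightarrow> P (x - y) * (cmod (u y))\<^sup>2) + (case p of (y, x) \<Rightarrow> P (x - y) * (cmod (u x))\<^sup>2)) / 2)"
      by (auto simp: H_def fun_eq_iff algebra_simps add_divide_distrib)
    then show ?thesis using i1 i2 a1 a2 by simp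
  qed
  have "complex_of_real (\<integral>k. (cmod (fts s u k))\<^sup>2 * G k \<partial>lborel)
      = (\<integral>k. fts s u k * (cnj (fts s u k) * complex_of_real (G k)) \<partial>lborel)"
    unfolding real[symmetric] by (rule integral_complex_of_real[symmetric])
  also have "\<dots> = (\<integral>y. u y * (complex_of_real c * (\<integral>x. cnj (u x) * complex_of_real (P (x - y)) \<partial>lborel)) \<partial>lborel)"
    unfolding fts_mult_formula[OF u wint] fw ..
  also have "\<dots> = complex_of_real c * (\<integral>y. (\<integral>x. \<Phi> (y, x) \<partial>lborel) \<partial>lborel)"
    by (simp add: \<Phi>_def mult.left_commute[of _ "complex_of_real c"])
  also have "(\<integral>y. (\<integral>x. \<Phi> (y, x) \<partial>lborel) \<partial>lborel) = integral\<^sup>L (lborel \<Otimes>\<^sub>M lborel) \<Phi>"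
    by (rule lborel_pair.integral_fst'[OF \<Phi>])
  finally have eq: "complex_of_real (\<integral>k. (cmod (fts s u k))\<^sup>2 * G k \<partial>lborel) = complex_of_real c * integral\<^sup>L (lborel \<Otimes>\<^sub>M lborel) \<Phi>" .
  have "(\<integral>k. (cmod (fts s u k))\<^sup>2 * G k \<partial>lborel) \<le> cmod (complex_of_real c * integral\<^sup>L (lborel \<Otimes>\<^sub>M lborel) \<Phi>)"
    unfolding eq[symmetric] norm_of_real by (rule abs_ge_self)
  also have "\<dots> = c * cmod (integral\<^sup>L (lborel \<Otimes>\<^sub>M lborel) \<Phi>)" using c by (simp add: norm_mult)
  also have "\<dots> \<le> c * (\<integral>p. norm (\<Phi> p) \<partial>(lborel \<Otimes>\<^sub>M lborel))"
    using c by (intro mult_left_mono integral_norm_bound) simp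
  also have "\<dots> \<le> c * integral\<^sup>L (lborel \<Otimes>\<^sub>M lborel) H"
    using c by (intro mult_left_mono integral_mono integrable_norm \<Phi> H le) simp_all
  also have "\<dots> = N" using c by (simp add: IH)
  finally show "(\<integral>k. (cmod (fts s u k))\<^sup>2 * exp (- e * (norm k)\<^sup>2 / 2) \<partial>lborel) \<le> (\<integral>x. (cmod (u x))\<^sup>2 \<partial>lborel)"
    by (simp add: G_def N_def)
qed

text \<open>
  Fatou's lemma removes the regularisation.
\<close>

lemma fts_contraction:
  fixes u :: "'n::finite phase \<Rightarrow> complex"
  assumes u: "integrable lborel u" and sq: "square_integrable u" and s: "s * s = 1"
  shows "square_integrable (fts s u)" "norm (abs_l2 (fts s u)) \<le> norm (abs_l2 u)"
proof -
  have [measurable]: "u \<in> borel_measurable borel" using u by simp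
  define N where "N = (\<integral>x. (cmod (u x))\<^sup>2 \<partial>lborel)"
  have "(\<integral>\<^sup>+k. ennreal ((cmod (fts s u k))\<^sup>2) \<partial>lborel)
      = (\<integral>\<^sup>+k. liminf (\<lambda>n. ennreal ((cmod (fts s u k))\<^sup>2 * exp (- (inverse (real (Suc n))) * (norm k)\<^sup>2 / 2))) \<partial>lborel)"
  proof (rule nn_integral_cong)
    fix k :: "'n phase"
    have "(\<lambda>n. ennreal ((cmod (fts s u k))\<^sup>2 * exp (- (inverse (real (Suc n))) * (norm k)\<^sup>2 / 2)))
       \<longlonglongrightarrow> ennreal ((cmod (fts s u k))\<^sup>2 * exp (- 0 * (norm k)\<^sup>2 / 2))"
      by (intro tendsto_ennrealI tendsto_intros LIMSEQ_inverse_real_of_nat) simp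
    from lim_imp_Liminf[OF sequentially_bot this]
    show "ennreal ((cmod (fts s u k))\<^sup>2)
       = liminf (\<lambda>n. ennreal ((cmod (fts s u k))\<^sup>2 * exp (- (inverse (real (Suc n))) * (norm k)\<^sup>2 / 2)))"
      by simp
  qed
  also have "\<dots> \<le> liminf (\<lambda>n. \<integral>\<^sup>+k. ennreal ((cmod (fts s u k))\<^sup>2 * exp (- (inverse (real (Suc n))) * (norm k)\<^sup>2 / 2)) \<partial>lborel)"
    by (rule nn_integral_liminf) measurable
  also have "\<dots> \<le> ennreal N"
  proof (rule Liminf_le, simp, rule always_eventually, rule allI)
    fix n
    have e: "inverse (real (Suc n)) > 0" by simp
    show "(\<integral>\<^sup>+k. ennreal ((cmod (fts s u k))\<^sup>2 * exp (- (inverse (real (Suc n))) * (norm k)\<^sup>2 / 2)) \<partial>lborel) \<le> ennreal N"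
      unfolding N_def using fts_regularised_bound[OF u sq e s]
      by (subst nn_integral_eq_integral) (auto intro!: ennreal_leI)
  qed
  finally have le: "(\<integral>\<^sup>+k. ennreal ((cmod (fts s u k))\<^sup>2) \<partial>lborel) \<le> ennreal N" .
  then show sqf: "square_integrable (fts s u)"
    unfolding square_integrable_def by (auto intro!: integrableI_bounded le_less_trans[OF le])
  have "ennreal ((norm (abs_l2 (fts s u)))\<^sup>2) \<le> ennreal ((norm (abs_l2 u))\<^sup>2)"
    unfolding norm_abs_l2[OF sqf] norm_abs_l2[OF sq] N_def[symmetric]
    using le sqf by (subst nn_integral_eq_integral[symmetric]) (auto simp: square_integrable_def)
  then have "(norm (abs_l2 (fts s u)))\<^sup>2 \<le> (norm (abs_l2 u))\<^sup>2"
    by (subst (asm) ennreal_le_iff) auto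
  then show "norm (abs_l2 (fts s u)) \<le> norm (abs_l2 u)" by (rule power2_le_imp_le) simp
qed

section \<open>Fourier transforms of test functions\<close>

lemma has_vector_derivative_quotient:
  fixes g :: "real \<Rightarrow> 'b::real_normed_vector"
  shows "(g has_vector_derivative d) (at x) \<longleftrightarrow> ((\<lambda>h. (g (x + h) - g x) /\<^sub>R h) \<longlongrightarrow> d) (at 0)"
proof -
  have "norm (g (x + h) - g x - h *\<^sub>R d) / norm h = norm ((g (x + h) - g x) /\<^sub>R h - d)" if "h \<noteq> 0" for h
  proof -
    have "(g (x + h) - g x) /\<^sub>R h - d = (g (x + h) - g x - h *\<^sub>R d) /\<^sub>R h"
      using that by (simp add: scaleR_diff_right)
    then show ?thesis by (simp add: divide_inverse mult.commute)
  qed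
  then have "((\<lambda>h. norm (g (x + h) - g x - h *\<^sub>R d) / norm h) \<longlongrightarrow> 0) (at 0)
      \<longleftrightarrow> ((\<lambda>h. norm ((g (x + h) - g x) /\<^sub>R h - d)) \<longlongrightarrow> 0) (at 0)"
    by (intro filterlim_cong) (auto simp: eventually_at_filter)
  then show ?thesis
    unfolding has_vector_derivative_def has_derivative_at
    by (simp add: bounded_linear_scaleR_left tendsto_norm_zero_iff Lim_null[symmetric] LIM_zero_iff)
qed

lemma smooth_line_derivative:
  assumes "smooth f"
  shows "((\<lambda>t. f (x + t *\<^sub>R j)) has_vector_derivative partial_deriv j f (x + t *\<^sub>R j)) (at t)"
proof -
  obtain D where D: "(f has_derivative D) (at (x + t *\<^sub>R j))"
    using smooth_differentiable[OF assms] by (auto simp: differentiable_def)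
  have "((\<lambda>t. x + t *\<^sub>R j) has_derivative (\<lambda>s. s *\<^sub>R j)) (at t)"
    by (auto intro!: derivative_eq_intros)
  from has_derivative_compose[OF this D]
  have "((\<lambda>t. f (x + t *\<^sub>R j)) has_derivative (\<lambda>s. D (s *\<^sub>R j))) (at t)" .
  moreover have "D (s *\<^sub>R j) = s *\<^sub>R partial_deriv j f (x + t *\<^sub>R j)" for s
    using D by (simp add: has_derivative_linear linear_scale partial_deriv_eq[OF D])
  ultimately show ?thesis by (simp add: has_vector_derivative_def)
qed

text \<open>
  The transform of a partial derivative is computed from the transforms of difference quotients, so
  translation invariance of the integral takes the place of integration by parts.
\<close>

lemma fts_partial_deriv:
  fixes f :: "'n::finite phase \<Rightarrow> complex"
  assumes f: "test_function f" and j: "j \<in> Basis"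
  shows "fts s (partial_deriv j f) k = - \<i> * complex_of_real (s * (k \<bullet> j)) * fts s f k"
proof -
  have sm: "smooth f" using f by (rule test_function_smooth)
  have g: "test_function (partial_deriv j f)" by (rule test_function_partial_deriv[OF f j])
  obtain C where C: "C > 0" "\<And>x. cmod (partial_deriv j f x) \<le> C" using test_function_bounded[OF g] by blast
  obtain R where R: "R > 0" "\<And>x. f x \<noteq> 0 \<Longrightarrow> norm x \<le> R" using test_function_support[OF f] by blast
  note [measurable] = test_function_borel[OF f] test_function_borel[OF g]
  have fint: "integrable lborel f" using f by (rule test_function_integrable)
  define h where "h = (\<lambda>n. inverse (real (Suc n)))"
  have h: "0 < h n" "h n \<le> 1" for n
    by (simp_all add: h_def inverse_le_1_iff)
  have h0: "h \<longlonglongrightarrow> 0" unfolding h_def by (rule LIMSEQ_inverse_real_of_nat)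
  have hat: "filterlim h (at 0) sequentially"
    using h0 h(1) by (auto simp: filterlim_at less_imp_neq[symmetric])
  define q where "q = (\<lambda>n x. (f (x + h n *\<^sub>R j) - f x) / complex_of_real (h n))"
  have [measurable]: "q n \<in> borel_measurable borel" for n unfolding q_def by measurable
  have qlim: "(\<lambda>n. q n x) \<longlonglongrightarrow> partial_deriv j f x" for x
  proof -
    have "((\<lambda>t. f (x + t *\<^sub>R j)) has_vector_derivative partial_deriv j f x) (at 0)"
      using smooth_line_derivative[OF sm, of x j 0] by simp
    then have "((\<lambda>t. (f (x + t *\<^sub>R j) - f x) /\<^sub>R t) \<longlongrightarrow> partial_deriv j f x) (at 0)"
      by (simp add: has_vector_derivative_quotient)
    from filterlim_compose[OF this hat] show ?thesis
      by (simp add: q_def scaleR_conv_of_real divide_inverse mult.commute)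
  qed
  have qle: "cmod (q n x) \<le> C" for n x
  proof -
    have der: "((\<lambda>t. f (x + t *\<^sub>R j)) has_derivative (\<lambda>s. s *\<^sub>R partial_deriv j f (x + t *\<^sub>R j))) (at t)" for t
      using smooth_line_derivative[OF sm, of x j t] by (simp add: has_vector_derivative_def)
    have "continuous_on {0..h n} (\<lambda>t. f (x + t *\<^sub>R j))"
      by (intro continuous_at_imp_continuous_on ballI has_derivative_continuous[OF der])
    from mvt_general[OF h(1) this der] obtain t
      where t: "cmod (f (x + h n *\<^sub>R j) - f (x + 0 *\<^sub>R j)) \<le> cmod ((h n - 0) *\<^sub>R partial_deriv j f (x + t *\<^sub>R j))"
      by blast
    have "h n * cmod (partial_deriv j f (x + t *\<^sub>R j)) \<le> h n * C"
      using h(1)[of n] by (intro mult_left_mono C(2)) simp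
    moreover have "cmod (f (x + h n *\<^sub>R j) - f x) \<le> h n * cmod (partial_deriv j f (x + t *\<^sub>R j))"
      using t h(1)[of n] by simp
    ultimately have "cmod (f (x + h n *\<^sub>R j) - f x) \<le> h n * C" by (rule order_trans[rotated])
    then show ?thesis using h(1)[of n] by (simp add: q_def norm_divide field_simps)
  qed
  have qsupp: "norm x \<le> R + 1" if "q n x \<noteq> 0" for n x
  proof -
    have "f (x + h n *\<^sub>R j) \<noteq> 0 \<or> f x \<noteq> 0" using that by (auto simp: q_def)
    then show ?thesis
    proof
      assume "f (x + h n *\<^sub>R j) \<noteq> 0"
      then have "norm (x + h n *\<^sub>R j) \<le> R" by (rule R)
      moreover have "norm (h n *\<^sub>R j) \<le> 1" using h[of n] j by simp
      moreover have "norm x \<le> norm (x + h n *\<^sub>R j) + norm (h n *\<^sub>R j)"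
        using norm_triangle_ineq4[of "x + h n *\<^sub>R j" "h n *\<^sub>R j"] by simp
      ultimately show ?thesis by linarith
    next
      assume "f x \<noteq> 0" then show ?thesis using R(2)[of x] by simp
    qed
  qed
  have lim1: "(\<lambda>n. \<integral>x. cis (s * (k \<bullet> x)) * q n x \<partial>lborel) \<longlonglongrightarrow> (\<integral>x. cis (s * (k \<bullet> x)) * partial_deriv j f x \<partial>lborel)"
  proof (rule integral_dominated_convergence[where w = "\<lambda>x. C * indicator (cball 0 (R + 1)) x"])
    show "integrable lborel (\<lambda>x::'n phase. C * indicator (cball 0 (R + 1)) x)"
      by (intro integrable_mult_right integrable_real_indicator emeasure_lborel_cball_finite) simp
    show "AE x in lborel. (\<lambda>n. cis (s * (k \<bullet> x)) * q n x) \<longlonglongrightarrow> cis (s * (k \<bullet> x)) * partial_deriv j f x"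
      by (intro AE_I2 tendsto_mult tendsto_const qlim)
    show "AE x in lborel. norm (cis (s * (k \<bullet> x)) * q n x) \<le> C * indicator (cball 0 (R + 1)) x" for n
    proof (rule AE_I2)
      fix x
      show "norm (cis (s * (k \<bullet> x)) * q n x) \<le> C * indicator (cball 0 (R + 1)) x"
        using qle[of n x] qsupp[of n x] C(1) by (cases "q n x = 0") (auto simp: norm_mult indicator_def)
    qed
  qed measurable
  have "(\<integral>x. cis (s * (k \<bullet> x)) * q n x \<partial>lborel)
      = (cis (- (s * (k \<bullet> j)) * h n) - 1) / complex_of_real (h n) * (\<integral>x. cis (s * (k \<bullet> x)) * f x \<partial>lborel)" for n
  proof -
    have i: "integrable lborel (\<lambda>x. cis (s * (k \<bullet> x)) * f x)" by (rule integrable_cis_mult[OF fint])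
    have i': "integrable lborel (\<lambda>x. cis (s * (k \<bullet> x)) * f (x + h n *\<^sub>R j))"
      by (intro integrable_cis_mult lborel_integrable_translate fint)
    have "(\<integral>x. cis (s * (k \<bullet> x)) * f (x + h n *\<^sub>R j) \<partial>lborel)
        = (\<integral>x. (\<lambda>x. cis (s * (k \<bullet> (x - h n *\<^sub>R j))) * f x) (x + h n *\<^sub>R j) \<partial>lborel)" by simp
    also have "\<dots> = (\<integral>x. cis (s * (k \<bullet> (x - h n *\<^sub>R j))) * f x \<partial>lborel)"
      by (rule lborel_integral_translate) measurable
    also have "\<dots> = (\<integral>x. cis (- (s * (k \<bullet> j)) * h n) * (cis (s * (k \<bullet> x)) * f x) \<partial>lborel)"
      unfolding mult.assoc[symmetric] cis_mult by (simp add: inner_diff_right algebra_simps)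
    finally have "(\<integral>x. cis (s * (k \<bullet> x)) * f (x + h n *\<^sub>R j) \<partial>lborel)
        = cis (- (s * (k \<bullet> j)) * h n) * (\<integral>x. cis (s * (k \<bullet> x)) * f x \<partial>lborel)" by simp
    moreover have "(\<integral>x. cis (s * (k \<bullet> x)) * q n x \<partial>lborel)
       = (\<integral>x. cis (s * (k \<bullet> x)) * f (x + h n *\<^sub>R j) - cis (s * (k \<bullet> x)) * f x \<partial>lborel) / complex_of_real (h n)"
      by (simp add: q_def algebra_simps diff_divide_distrib flip: Bochner_Integration.integral_divide_zero)
    ultimately show ?thesis using i i' by (simp add: left_diff_distrib)
  qed
  moreover have "(\<lambda>n. (cis (- (s * (k \<bullet> j)) * h n) - 1) / complex_of_real (h n) * (\<integral>x. cis (s * (k \<bullet> x)) * f x \<partial>lborel))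
     \<longlonglongrightarrow> (- \<i> * complex_of_real (s * (k \<bullet> j))) * (\<integral>x. cis (s * (k \<bullet> x)) * f x \<partial>lborel)"
  proof (intro tendsto_mult tendsto_const)
    define a where "a = - (s * (k \<bullet> j))"
    have "((\<lambda>t. exp (\<i> * complex_of_real a * t)) has_field_derivative \<i> * complex_of_real a) (at (complex_of_real 0))"
      by (auto intro!: derivative_eq_intros)
    from has_vector_derivative_real_field[OF this, of UNIV]
    have "((\<lambda>t. (cis (a * t) - 1) /\<^sub>R t) \<longlongrightarrow> \<i> * complex_of_real a) (at 0)"
      unfolding has_vector_derivative_quotient by (simp add: cis_conv_exp mult.assoc)
    from filterlim_compose[OF this hat]
    show "(\<lambda>n. (cis (- (s * (k \<bullet> j)) * h n) - 1) / complex_of_real (h n)) \<longlonglongrightarrow> - \<i> * complex_of_real (s * (k \<bullet> j))"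
      by (simp add: a_def scaleR_conv_of_real divide_inverse mult.commute)
  qed
  ultimately have "(\<integral>x. cis (s * (k \<bullet> x)) * partial_deriv j f x \<partial>lborel)
     = (- \<i> * complex_of_real (s * (k \<bullet> j))) * (\<integral>x. cis (s * (k \<bullet> x)) * f x \<partial>lborel)"
    using LIMSEQ_unique[OF lim1] by presburger
  then show ?thesis by (simp add: fts_def mult.left_commute)
qed


lemma fts_laplacian:
  fixes f :: "'n::finite phase \<Rightarrow> complex"
  assumes f: "test_function f" and s: "s * s = 1"
  shows "fts s (laplacian f) k = - complex_of_real ((norm k)\<^sup>2) * fts s f k"
proof -
  have t: "test_function (partial_deriv j (partial_deriv j f))" if "j \<in> Basis" for j
    using f that by (intro test_function_partial_deriv)
  have sum: "fts s (\<lambda>x. \<Sum>j\<in>J. partial_deriv j (partial_deriv j f) x) k = (\<Sum>j\<in>J. fts s (partial_deriv j (partial_deriv j f)) k)"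
    if "finite J" "J \<subseteq> Basis" for J
    using that
  proof (induction J rule: finite_induct)
    case empty then show ?case by (simp add: fts_def)
  next
    case (insert j J)
    then show ?case
      using fts_add[of "partial_deriv j (partial_deriv j f)" "\<lambda>x. \<Sum>j\<in>J. partial_deriv j (partial_deriv j f) x" s k]
      by (simp add: t test_function_integrable test_function_sum subset_eq)
  qed
  have "fts s (laplacian f) k = (\<Sum>j\<in>Basis. fts s (partial_deriv j (partial_deriv j f)) k)"
    unfolding laplacian_def[abs_def] by (rule sum) simp_all
  also have "\<dots> = (\<Sum>j\<in>Basis. - complex_of_real ((k \<bullet> j)\<^sup>2) * fts s f k)"
  proof (rule sum.cong[OF refl])
    fix j :: "'n phase" assume j: "j \<in> Basis"
    have "fts s (partial_deriv j (partial_deriv j f)) k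
        = - complex_of_real (s * s * (k \<bullet> j)\<^sup>2) * fts s f k"
      by (simp add: fts_partial_deriv j f test_function_partial_deriv power2_eq_square algebra_simps)
    then show "fts s (partial_deriv j (partial_deriv j f)) k = - complex_of_real ((k \<bullet> j)\<^sup>2) * fts s f k"
      by (simp add: s)
  qed
  also have "\<dots> = - complex_of_real ((norm k)\<^sup>2) * fts s f k"
    unfolding norm_power2_Basis[of k] by (simp add: sum_distrib_right sum_negf)
  finally show ?thesis .
qed

text \<open>
  A power of \<open>1 - \<Delta>\<close> applied to \<open>f\<close> is a witness.
\<close>

lemma test_function_one_minus_laplacian_power:
  assumes f: "test_function f" and s: "s * s = 1"
  shows "\<exists>g. test_function g \<and> (\<forall>k. fts s g k = complex_of_real ((1 + (norm k)\<^sup>2) ^ m) * fts s f k)"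
proof (induction m)
  case 0
  then show ?case using f by auto
next
  case (Suc m)
  then obtain g where g: "test_function g" "\<And>k. fts s g k = complex_of_real ((1 + (norm k)\<^sup>2) ^ m) * fts s f k"
    by auto
  have L: "test_function (\<lambda>x. (- 1) * laplacian g x)"
    by (intro test_function_cmult test_function_laplacian g)
  have "fts s (\<lambda>x. g x + (- 1) * laplacian g x) k = complex_of_real ((1 + (norm k)\<^sup>2) ^ Suc m) * fts s f k" for k
    unfolding fts_add[OF test_function_integrable[OF g(1)] test_function_integrable[OF L]] fts_cmult
      fts_laplacian[OF g(1) s] g(2)
    by (simp add: algebra_simps)
  with test_function_add[OF g(1) L] show ?case by blast
qed

lemma fts_test_decay:
  assumes f: "test_function f" and s: "s * s = 1"
  obtains C where "\<And>k. cmod (fts s f k) \<le> C * decay k"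
proof -
  obtain g where g: "test_function g" "\<And>k. fts s g k = complex_of_real ((1 + (norm k)\<^sup>2) ^ DIM('a phase)) * fts s f k"
    using test_function_one_minus_laplacian_power[OF f s] by blast
  define C where "C = 1 / (2 * pi) ^ CARD('a) * (\<integral>x. cmod (g x) \<partial>lborel)"
  have "cmod (fts s f k) \<le> C * decay k" for k
  proof -
    have p: "0 < (1 + (norm k)\<^sup>2) ^ DIM('a phase)" by (simp add: add_pos_nonneg)
    have "(1 + (norm k)\<^sup>2) ^ DIM('a phase) * cmod (fts s f k) = cmod (fts s g k)"
      unfolding g(2) norm_mult norm_of_real abs_of_pos[OF p] ..
    also have "\<dots> \<le> C" unfolding C_def by (rule fts_bound[OF test_function_integrable[OF g(1)]])
    finally show ?thesis using p by (simp add: decay_def field_simps)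
  qed
  with that show ?thesis by blast
qed

lemma fts_test_integrable:
  assumes f: "test_function f" and s: "s * s = 1"
  shows "integrable lborel (fts s f)"
proof -
  obtain C where C: "\<And>k. cmod (fts s f k) \<le> C * decay k" using fts_test_decay[OF f s] by blast
  note [measurable] = test_function_borel[OF f]
  show ?thesis
    by (rule Bochner_Integration.integrable_bound[OF integrable_mult_right[OF decay_integrable, of C]])
      (auto intro!: AE_I2 order_trans[OF C abs_ge_self])
qed

lemma fts_square_integrable_test:
  assumes f: "test_function f" and s: "s * s = 1"
  shows "square_integrable (fts s f)"
  by (rule fts_contraction) (use f s in \<open>simp_all add: test_function_integrable test_function_square_integrable\<close>)

text \<open>
  After scaling, the Gaussian averages of \<open>f\<close> are integrals of \<open>f (y + r z)\<close> against a fixed Gaussian, which tend to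
  \<open>f y\<close> by continuity as \<open>r\<close> tends to 0.
\<close>

lemma fts_inversion:
  fixes f :: "'n::finite phase \<Rightarrow> complex"
  assumes f: "test_function f" and s: "s * s = 1"
  shows "fts (- s) (fts s f) y = f y"
proof -
  obtain C where C: "C > 0" "\<And>x. cmod (f x) \<le> C" using test_function_bounded[OF f] by blast
  note [measurable] = test_function_borel[OF f]
  have fint: "integrable lborel f" using f by (rule test_function_integrable)
  have fint': "integrable lborel (fts s f)" by (rule fts_test_integrable[OF f s])
  define r where "r = (\<lambda>n. inverse (real (Suc n)))"
  have r: "r n > 0" for n by (simp add: r_def)
  have r0: "r \<longlonglongrightarrow> 0" unfolding r_def by (rule LIMSEQ_inverse_real_of_nat)
  have lhs: "(\<lambda>n. \<integral>k. fts s f k * (cis (- (s * (y \<bullet> k))) * complex_of_real (exp (- (r n)\<^sup>2 * (norm k)\<^sup>2 / 2))) \<partial>lborel)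
     \<longlonglongrightarrow> (\<integral>k. fts s f k * (cis (- (s * (y \<bullet> k))) * complex_of_real (exp (- 0\<^sup>2 * (norm k)\<^sup>2 / 2))) \<partial>lborel)"
  proof (rule integral_dominated_convergence[where w = "\<lambda>k. cmod (fts s f k)"])
    show "AE k in lborel. (\<lambda>n. fts s f k * (cis (- (s * (y \<bullet> k))) * complex_of_real (exp (- (r n)\<^sup>2 * (norm k)\<^sup>2 / 2))))
        \<longlonglongrightarrow> fts s f k * (cis (- (s * (y \<bullet> k))) * complex_of_real (exp (- 0\<^sup>2 * (norm k)\<^sup>2 / 2)))"
      by (intro AE_I2 tendsto_intros r0) simp
    show "AE k in lborel. norm (fts s f k * (cis (- (s * (y \<bullet> k))) * complex_of_real (exp (- (r n)\<^sup>2 * (norm k)\<^sup>2 / 2)))) \<le> cmod (fts s f k)" for n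
      by (intro AE_I2) (auto simp: norm_mult intro!: mult_left_le)
    show "integrable lborel (\<lambda>k. cmod (fts s f k))" using fint' by (rule integrable_norm)
  qed measurable
  have eq: "(\<integral>k. fts s f k * (cis (- (s * (y \<bullet> k))) * complex_of_real (exp (- (r n)\<^sup>2 * (norm k)\<^sup>2 / 2))) \<partial>lborel)
     = (\<integral>z. f (y + r n *\<^sub>R z) * complex_of_real (exp (- (norm z)\<^sup>2 / 2)) \<partial>lborel)" for n
  proof -
    have e: "(r n)\<^sup>2 > 0" using r[of n] by simp
    have "(\<integral>k. fts s f k * (cis (- (s * (y \<bullet> k))) * complex_of_real (exp (- (r n)\<^sup>2 * (norm k)\<^sup>2 / 2))) \<partial>lborel)
      = (\<integral>x. f x * complex_of_real (exp (- (norm (x - y))\<^sup>2 / (2 * (r n)\<^sup>2)) / ((r n)\<^sup>2) ^ CARD('n)) \<partial>lborel)"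
      by (rule fts_gaussian_regularised[OF fint e s])
    also have "\<dots> = \<bar>r n\<bar> ^ DIM('n phase) *\<^sub>R (\<integral>z. f (y + r n *\<^sub>R z) *
        complex_of_real (exp (- (norm (y + r n *\<^sub>R z - y))\<^sup>2 / (2 * (r n)\<^sup>2)) / ((r n)\<^sup>2) ^ CARD('n)) \<partial>lborel)"
      by (rule lborel_integral_scale) (measurable, use r[of n] in simp)
    also have "\<dots> = (\<integral>z. \<bar>r n\<bar> ^ DIM('n phase) *\<^sub>R (f (y + r n *\<^sub>R z) *
        complex_of_real (exp (- (norm (y + r n *\<^sub>R z - y))\<^sup>2 / (2 * (r n)\<^sup>2)) / ((r n)\<^sup>2) ^ CARD('n))) \<partial>lborel)"
      by simp
    also have "\<dots> = (\<integral>z. f (y + r n *\<^sub>R z) * complex_of_real (exp (- (norm z)\<^sup>2 / 2)) \<partial>lborel)"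
    proof (rule Bochner_Integration.integral_cong[OF refl])
      fix z :: "'n phase"
      have "\<bar>r n\<bar> ^ DIM('n phase) = ((r n)\<^sup>2) ^ CARD('n)" unfolding DIM_phase power_mult by simp
      then show "\<bar>r n\<bar> ^ DIM('n phase) *\<^sub>R (f (y + r n *\<^sub>R z) *
          complex_of_real (exp (- (norm (y + r n *\<^sub>R z - y))\<^sup>2 / (2 * (r n)\<^sup>2)) / ((r n)\<^sup>2) ^ CARD('n)))
        = f (y + r n *\<^sub>R z) * complex_of_real (exp (- (norm z)\<^sup>2 / 2))"
        using r[of n] by (simp add: scaleR_conv_of_real power_mult_distrib)
    qed
    finally show ?thesis .
  qed
  have gi: "integrable lborel (\<lambda>z::'n phase. exp (- (norm z)\<^sup>2 / 2))"
    and gI: "(\<integral>z. exp (- (norm (z::'n phase))\<^sup>2 / 2) \<partial>lborel) = (2 * pi) ^ CARD('n)"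
    using gaussian_heat_kernel[of 1, where 'n = 'n] by simp_all
  have rhs: "(\<lambda>n. \<integral>z. f (y + r n *\<^sub>R z) * complex_of_real (exp (- (norm z)\<^sup>2 / 2)) \<partial>lborel)
     \<longlonglongrightarrow> (\<integral>z. f y * complex_of_real (exp (- (norm (z::'n phase))\<^sup>2 / 2)) \<partial>lborel)"
  proof (rule integral_dominated_convergence[where w = "\<lambda>z. C * exp (- (norm z)\<^sup>2 / 2)"])
    have "isCont f x" for x
      by (intro differentiable_imp_continuous_within smooth_differentiable test_function_smooth f)
    then have "(\<lambda>n. f (y + r n *\<^sub>R z)) \<longlonglongrightarrow> f (y + 0 *\<^sub>R z)" for z
      by (rule isCont_tendsto_compose) (intro tendsto_intros r0)
    then show "AE z in lborel. (\<lambda>n. f (y + r n *\<^sub>R z) * complex_of_real (exp (- (norm z)\<^sup>2 / 2)))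
       \<longlonglongrightarrow> f y * complex_of_real (exp (- (norm z)\<^sup>2 / 2))"
      by (intro AE_I2 tendsto_mult tendsto_const) simp
    show "AE z in lborel. norm (f (y + r n *\<^sub>R z) * complex_of_real (exp (- (norm z)\<^sup>2 / 2))) \<le> C * exp (- (norm z)\<^sup>2 / 2)" for n
      using C(2) by (intro AE_I2) (simp add: norm_mult)
    show "integrable lborel (\<lambda>z::'n phase. C * exp (- (norm z)\<^sup>2 / 2))" by (intro integrable_mult_right gi)
  qed measurable
  have "(\<integral>k. fts s f k * cis (- (s * (y \<bullet> k))) \<partial>lborel)
      = (\<integral>z. f y * complex_of_real (exp (- (norm (z::'n phase))\<^sup>2 / 2)) \<partial>lborel)"
    using LIMSEQ_unique[OF lhs[unfolded eq] rhs] by simp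
  also have "\<dots> = f y * complex_of_real ((2 * pi) ^ CARD('n))"
    by (simp only: Bochner_Integration.integral_mult_right_zero integral_complex_of_real gI)
  finally have "(\<integral>k. fts s f k * cis (- (s * (y \<bullet> k))) \<partial>lborel) = f y * complex_of_real ((2 * pi) ^ CARD('n))" .
  then show ?thesis by (simp add: fts_def mult.commute[of "cis _"])
qed

section \<open>The Fourier transform as a unitary operator\<close>

text \<open>
  Inversion writes a test function as a transform, and the multiplication formula moves that transform to \<open>w\<close>; so
  \<open>w\<close> is orthogonal to all test functions.
\<close>

lemma fts_injective:
  fixes w :: "'n::finite phase \<Rightarrow> complex"
  assumes w: "integrable lborel w" and s: "s * s = 1" and z: "AE k in lborel. fts s w k = 0"
  shows "AE x in lborel. w x = 0"
proof (rule AE_zero_if_orthogonal_to_tests)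
  have [measurable]: "w \<in> borel_measurable borel" using w by simp
  show "integrable lborel (\<lambda>x. indicator (box l r) x * w x)" for l r :: "'n phase"
    by (rule Bochner_Integration.integrable_bound[OF w]) (auto simp: indicator_def)
  fix f :: "'n phase \<Rightarrow> complex" assume f: "test_function f"
  note [measurable] = test_function_borel[OF f]
  have g: "integrable lborel (\<lambda>k. cnj (fts s f k))" by (simp add: fts_test_integrable[OF f s])
  have "cnj (f x) = fts s (\<lambda>k. cnj (fts s f k)) x" for x
    using cnj_fts[of "- s" "fts s f" x] fts_inversion[OF f s, of x] by simp
  then have "(\<integral>x. cnj (f x) * w x \<partial>lborel) = (\<integral>x. fts s (\<lambda>k. cnj (fts s f k)) x * w x \<partial>lborel)" by simp
  also have "\<dots> = (\<integral>k. cnj (fts s f k) * fts s w k \<partial>lborel)" by (rule fts_mult_formula[OF g w])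
  also have "\<dots> = (\<integral>k. 0 \<partial>(lborel :: 'n phase measure))"
    by (rule integral_cong_AE) (use z in \<open>auto simp: borel_measurable_times\<close>)
  finally show "(\<integral>x. cnj (f x) * w x \<partial>lborel) = 0" by simp
qed

lemma norm_le_square_plus_1: "norm z \<le> (norm z)\<^sup>2 + 1"
proof -
  have "2 * norm z \<le> (norm z)\<^sup>2 + 1" using sum_squares_bound[of "norm z" 1] by simp
  then show ?thesis using norm_ge_zero[of z] by linarith
qed

lemma cinner_tests_eq_0:
  fixes u :: "'a::euclidean_space l2"
  assumes "\<And>f. test_function f \<Longrightarrow> cinner (abs_l2 f) u = 0"
  shows "u = 0"
proof -
  obtain w where w: "square_integrable w" "u = abs_l2 w" by (rule l2_cases)
  note [measurable] = square_integrable_borel[OF w(1)]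
  have "AE x in lborel. w x = 0"
  proof (rule AE_zero_if_orthogonal_to_tests)
    fix l r :: 'a
    show "integrable lborel (\<lambda>x. indicator (box l r) x * w x)"
    proof (rule Bochner_Integration.integrable_bound)
      show "integrable lborel (\<lambda>x. (cmod (w x))\<^sup>2 + indicator (box l r) x)"
        using w(1) by (intro Bochner_Integration.integrable_add integrable_real_indicator)
          (auto simp: square_integrable_def emeasure_lborel_box_eq)
      have "norm (w x) \<le> (cmod (w x))\<^sup>2 + 1" for x
        by (rule norm_le_square_plus_1)
      then show "AE x in lborel. norm (indicator (box l r) x * w x) \<le> norm ((cmod (w x))\<^sup>2 + indicator (box l r) x)"
        by (intro AE_I2) (auto simp: indicator_def)
    qed measurable
  next
    fix f :: "'a \<Rightarrow> complex" assume "test_function f"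
    with assms[of f] show "(\<integral>x. cnj (f x) * w x \<partial>lborel) = 0"
      by (simp add: w cinner_abs test_function_square_integrable)
  qed
  then show ?thesis
    unfolding w(2) abs_l2_zero[symmetric]
    by (intro abs_l2_eqI w square_integrable_zero)
qed

definition tests_l2 :: "'a::euclidean_space l2 set" where
  "tests_l2 = abs_l2 ` {f. test_function f}"

lemma csubspace_tests: "csubspace tests_l2"
  unfolding csubspace_def tests_l2_def
proof (intro conjI ballI allI)
  show "0 \<in> abs_l2 ` {f :: 'a \<Rightarrow> complex. test_function f}"
    using abs_l2_zero test_function_zero by force
next
  fix u v :: "'a l2" assume "u \<in> abs_l2 ` {f. test_function f}" "v \<in> abs_l2 ` {f. test_function f}"
  then show "u + v \<in> abs_l2 ` {f. test_function f}"
    by (auto simp: abs_l2_add test_function_square_integrable intro!: imageI test_function_add)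
next
  fix c and u :: "'a l2" assume "u \<in> abs_l2 ` {f. test_function f}"
  then show "c *\<^sub>C u \<in> abs_l2 ` {f. test_function f}"
    by (auto simp: abs_l2_scaleC test_function_square_integrable intro!: imageI test_function_cmult)
qed

lemma tests_dense: "closure tests_l2 = UNIV"
  by (rule csubspace_dense[OF csubspace_tests]) (auto simp: tests_l2_def intro: cinner_tests_eq_0)

definition trunc :: "nat \<Rightarrow> 'a::euclidean_space l2 \<Rightarrow> 'a \<Rightarrow> complex" where
  "trunc n u x = indicator (cball 0 (real n)) x * rep_l2 u x"

lemma measurable_rep [measurable]: "rep_l2 u \<in> borel_measurable borel"
  by (rule square_integrable_borel[OF square_integrable_rep])

lemma trunc_measurable [measurable]: "trunc n u \<in> borel_measurable borel"
  unfolding trunc_def[abs_def]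
  by (intro borel_measurable_times borel_measurable_indicator measurable_rep) simp

lemma trunc_square_integrable: "square_integrable (trunc n u)"
  unfolding trunc_def[abs_def]
  by (rule square_integrable_mult[OF square_integrable_rep, where c = 1]) (auto simp: indicator_def)

lemma trunc_integrable: "integrable lborel (trunc n u)"
proof (rule Bochner_Integration.integrable_bound)
  show "integrable lborel (\<lambda>x. (cmod (rep_l2 u x))\<^sup>2 + indicator (cball 0 (real n)) x)"
    using square_integrable_rep[of u]
    by (intro Bochner_Integration.integrable_add integrable_real_indicator emeasure_lborel_cball_finite)
      (auto simp: square_integrable_def)
  have "norm (rep_l2 u x) \<le> (cmod (rep_l2 u x))\<^sup>2 + 1" for x
    by (rule norm_le_square_plus_1)
  then show "AE x in lborel. norm (trunc n u x) \<le> norm ((cmod (rep_l2 u x))\<^sup>2 + indicator (cball 0 (real n)) x)"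
    by (intro AE_I2) (auto simp: indicator_def trunc_def)
qed measurable

lemma trunc_tendsto: "(\<lambda>n. abs_l2 (trunc n u)) \<longlonglongrightarrow> u"
proof -
  have "(\<lambda>n. \<integral>x. (cmod (rep_l2 u x - trunc n u x))\<^sup>2 \<partial>lborel) \<longlonglongrightarrow> (\<integral>x. 0 \<partial>(lborel :: 'a measure))"
  proof (rule integral_dominated_convergence[where w = "\<lambda>x. (cmod (rep_l2 u x))\<^sup>2"])
    show "integrable lborel (\<lambda>x. (cmod (rep_l2 u x))\<^sup>2)"
      using square_integrable_rep[of u] by (simp add: square_integrable_def)
    show "AE x in lborel. (\<lambda>n. (cmod (rep_l2 u x - trunc n u x))\<^sup>2) \<longlonglongrightarrow> 0"
    proof (intro AE_I2 tendsto_eventually)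
      fix x :: 'a
      obtain N where "norm x \<le> real N" using real_arch_simple by blast
      then show "eventually (\<lambda>n. (cmod (rep_l2 u x - trunc n u x))\<^sup>2 = 0) sequentially"
        by (intro eventually_sequentiallyI[of N]) (auto simp: trunc_def)
    qed
    show "AE x in lborel. norm ((cmod (rep_l2 u x - trunc n u x))\<^sup>2) \<le> (cmod (rep_l2 u x))\<^sup>2" for n
      by (intro AE_I2) (auto simp: trunc_def indicator_def)
  qed measurable
  moreover have "(\<integral>x. (cmod (rep_l2 u x - trunc n u x))\<^sup>2 \<partial>lborel) = (norm (u - abs_l2 (trunc n u)))\<^sup>2" for n
    using norm_abs_l2[OF square_integrable_diff[OF square_integrable_rep trunc_square_integrable], of u n u]
    by (simp add: abs_l2_diff[symmetric] square_integrable_rep trunc_square_integrable)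
  ultimately have "(\<lambda>n. sqrt ((norm (u - abs_l2 (trunc n u)))\<^sup>2)) \<longlonglongrightarrow> sqrt 0"
    by (intro tendsto_real_sqrt) simp
  then have "(\<lambda>n. norm (u - abs_l2 (trunc n u))) \<longlonglongrightarrow> 0" by simp
  then have "(\<lambda>n. norm (abs_l2 (trunc n u) - u)) \<longlonglongrightarrow> 0" by (simp add: norm_minus_commute)
  then show ?thesis by (rule LIM_zero_cancel[OF tendsto_norm_zero_cancel])
qed

text \<open>
  Truncations are integrable and square integrable, so their transforms are given by the integral; the limit exists
  by contractivity and completeness.
\<close>

definition FT :: "real \<Rightarrow> 'n::finite phase l2 \<Rightarrow> 'n phase l2" where
  "FT s u = lim (\<lambda>n. abs_l2 (fts s (trunc n u)))"

lemma fts_norm_diff_le: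
  assumes "integrable lborel f" "square_integrable f" "integrable lborel g" "square_integrable g" "s * s = 1"
  shows "norm (abs_l2 (fts s f) - abs_l2 (fts s g)) \<le> norm (abs_l2 f - abs_l2 g)"
proof -
  have "fts s (\<lambda>x. f x - g x) = (\<lambda>k. fts s f k - fts s g k)"
    using assms by (simp add: fun_eq_iff fts_diff)
  then show ?thesis
    using fts_contraction[of "\<lambda>x. f x - g x" s] assms
    by (simp add: abs_l2_diff fts_contraction square_integrable_diff)
qed

lemma FT_lim:
  assumes s: "s * s = 1"
  shows "(\<lambda>n. abs_l2 (fts s (trunc n u))) \<longlonglongrightarrow> FT s u"
proof -
  have "Cauchy (\<lambda>n. abs_l2 (fts s (trunc n u)))"
  proof (rule metric_CauchyI)
    fix e :: real assume "e > 0"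
    have "Cauchy (\<lambda>n. abs_l2 (trunc n u))" by (rule LIMSEQ_imp_Cauchy[OF trunc_tendsto])
    then obtain M where M: "\<And>m n. m \<ge> M \<Longrightarrow> n \<ge> M \<Longrightarrow> dist (abs_l2 (trunc m u)) (abs_l2 (trunc n u)) < e"
      using \<open>e > 0\<close> by (meson metric_CauchyD)
    have "dist (abs_l2 (fts s (trunc m u))) (abs_l2 (fts s (trunc n u))) < e" if "m \<ge> M" "n \<ge> M" for m n
      using M[OF that] fts_norm_diff_le[OF trunc_integrable trunc_square_integrable trunc_integrable trunc_square_integrable s,
        of m u n u] unfolding dist_norm by linarith
    then show "\<exists>M. \<forall>m\<ge>M. \<forall>n\<ge>M. dist (abs_l2 (fts s (trunc m u))) (abs_l2 (fts s (trunc n u))) < e" by blast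
  qed
  then show ?thesis unfolding FT_def by (simp add: Cauchy_convergent_iff convergent_LIMSEQ_iff)
qed

lemma FT_abs:
  assumes s: "s * s = 1" and g: "integrable lborel g" "square_integrable g"
  shows "FT s (abs_l2 g) = abs_l2 (fts s g)"
proof (rule LIMSEQ_unique[OF FT_lim[OF s]])
  have "(\<lambda>n. norm (abs_l2 (trunc n (abs_l2 g)) - abs_l2 g)) \<longlonglongrightarrow> 0"
    by (intro tendsto_norm_zero LIM_zero trunc_tendsto)
  then have "(\<lambda>n. abs_l2 (fts s (trunc n (abs_l2 g))) - abs_l2 (fts s g)) \<longlonglongrightarrow> 0"
    by (rule Lim_null_comparison[rotated])
      (intro always_eventually allI fts_norm_diff_le trunc_integrable trunc_square_integrable g s)
  then show "(\<lambda>n. abs_l2 (fts s (trunc n (abs_l2 g)))) \<longlonglongrightarrow> abs_l2 (fts s g)"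
    by (rule LIM_zero_cancel)
qed

lemma FT_bounded_clinear:
  assumes s: "s * s = 1"
  shows "bounded_clinear (FT s)"
proof (rule bounded_clinearI[where K = 1])
  note sq = fts_contraction(1)[OF trunc_integrable trunc_square_integrable s]
  fix u v :: "'n::finite phase l2" and c :: complex
  have "abs_l2 (fts s (trunc n (u + v))) = abs_l2 (fts s (trunc n u)) + abs_l2 (fts s (trunc n v))" for n
  proof -
    have "fts s (trunc n (u + v)) = fts s (\<lambda>x. trunc n u x + trunc n v x)"
      by (rule fts_cong_AE[OF trunc_measurable borel_measurable_add[OF trunc_measurable trunc_measurable]])
        (use AE_rep_add[of u v] in \<open>auto simp: trunc_def distrib_left\<close>)
    also have "\<dots> = (\<lambda>k. fts s (trunc n u) k + fts s (trunc n v) k)"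
      by (simp add: fun_eq_iff fts_add trunc_integrable)
    finally show ?thesis by (simp add: abs_l2_add sq)
  qed
  then have "(\<lambda>n. abs_l2 (fts s (trunc n (u + v)))) \<longlonglongrightarrow> FT s u + FT s v"
    using tendsto_add[OF FT_lim[OF s, of u] FT_lim[OF s, of v]] by simp
  then show "FT s (u + v) = FT s u + FT s v" by (rule LIMSEQ_unique[OF FT_lim[OF s]])
  have "abs_l2 (fts s (trunc n (c *\<^sub>C u))) = c *\<^sub>C abs_l2 (fts s (trunc n u))" for n
  proof -
    have "fts s (trunc n (c *\<^sub>C u)) = fts s (\<lambda>x. c * trunc n u x)"
      by (rule fts_cong_AE[OF trunc_measurable borel_measurable_times[OF borel_measurable_const trunc_measurable]])
        (use AE_rep_scaleC[of c u] in \<open>auto simp: trunc_def\<close>)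
    also have "\<dots> = (\<lambda>k. c * fts s (trunc n u) k)"
      by (simp add: fun_eq_iff fts_cmult)
    finally show ?thesis by (simp add: abs_l2_scaleC sq)
  qed
  moreover have "(\<lambda>n. c *\<^sub>C abs_l2 (fts s (trunc n u))) \<longlonglongrightarrow> c *\<^sub>C FT s u"
  proof -
    have "bounded_linear (\<lambda>u :: 'n phase l2. c *\<^sub>C u)"
      by (rule bounded_linear_intro[where K = "cmod c"]) (simp_all add: scaleC_add_right scaleR_scaleC mult.commute)
    from bounded_linear.tendsto[OF this FT_lim[OF s]] show ?thesis .
  qed
  ultimately show "FT s (c *\<^sub>C u) = c *\<^sub>C FT s u"
    by (intro LIMSEQ_unique[OF FT_lim[OF s]]) simp
  have "norm (FT s u) \<le> norm u"
  proof (rule LIMSEQ_le[OF tendsto_norm[OF FT_lim[OF s]] tendsto_norm[OF trunc_tendsto]])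
    show "\<exists>N. \<forall>n\<ge>N. norm (abs_l2 (fts s (trunc n u))) \<le> norm (abs_l2 (trunc n u))"
      using fts_contraction(2)[OF trunc_integrable trunc_square_integrable s] by blast
  qed
  then show "norm (FT s u) \<le> 1 * norm u" by simp
qed

lemma FT_adjoint:
  assumes s: "s * s = 1"
  shows "cinner (FT s u) v = cinner u (FT (- s) v)"
proof (rule LIMSEQ_unique)
  have s': "- s * - s = 1" using s by simp
  show "(\<lambda>n. cinner (abs_l2 (fts s (trunc n u))) (abs_l2 (trunc n v))) \<longlonglongrightarrow> cinner (FT s u) v"
    by (intro tendsto_cinner FT_lim s trunc_tendsto)
  have "cinner (abs_l2 (fts s (trunc n u))) (abs_l2 (trunc n v)) = cinner (abs_l2 (trunc n u)) (abs_l2 (fts (- s) (trunc n v)))" for n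
  proof -
    have "integrable lborel (\<lambda>x. cnj (trunc n u x))" by (simp add: trunc_integrable)
    from fts_mult_formula[OF this trunc_integrable, of "- s" n v] show ?thesis
      by (simp add: cinner_abs trunc_square_integrable cnj_fts
        fts_contraction(1)[OF trunc_integrable trunc_square_integrable s]
        fts_contraction(1)[OF trunc_integrable trunc_square_integrable s'])
  qed
  then show "(\<lambda>n. cinner (abs_l2 (fts s (trunc n u))) (abs_l2 (trunc n v))) \<longlonglongrightarrow> cinner u (FT (- s) v)"
    using tendsto_cinner[OF trunc_tendsto FT_lim[OF s']] by simp
qed

text \<open>
  Inversion holds on test functions, and by the adjoint relation a vector \<open>FT (- s) (FT s u) - u\<close> is orthogonal to
  all of them.
\<close>

lemma FT_inverse:
  assumes s: "s * s = 1"
  shows "FT (- s) (FT s u) = u"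
proof -
  have s': "- s * - s = 1" using s by simp
  have "cinner (abs_l2 f) (FT (- s) (FT s u) - u) = 0" if f: "test_function f" for f
  proof -
    note fi = test_function_integrable[OF f] test_function_square_integrable[OF f]
    have "cinner (abs_l2 f) (FT (- s) (FT s u)) = cinner (FT (- s) (FT s (abs_l2 f))) u"
      by (simp only: FT_adjoint[OF s'] FT_adjoint[OF s] minus_minus)
    also have "FT (- s) (FT s (abs_l2 f)) = abs_l2 (fts (- s) (fts s f))"
      by (simp add: FT_abs[OF s fi] FT_abs[OF s' fts_test_integrable[OF f s] fts_square_integrable_test[OF f s]])
    also have "fts (- s) (fts s f) = f" by (rule ext) (rule fts_inversion[OF f s])
    finally show ?thesis by (simp add: cinner_diff_right)
  qed
  then have "FT (- s) (FT s u) - u = 0" by (rule cinner_tests_eq_0)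
  then show ?thesis by simp
qed

lemma FT_isometry:
  assumes s: "s * s = 1"
  shows "cinner (FT s u) (FT s v) = cinner u v"
  by (simp add: FT_adjoint[OF s] FT_inverse[OF s])

lemma FT_norm:
  assumes s: "s * s = 1"
  shows "norm (FT s u) = norm u"
  using FT_isometry[OF s, of u u] unfolding cinner_self of_real_eq_iff by simp

lemma integrable_boundI:
  fixes f :: "'a \<Rightarrow> 'b::{banach, second_countable_topology}"
  assumes "integrable M g" "f \<in> borel_measurable M" "\<And>x. norm (f x) \<le> g x"
  shows "integrable M f"
  by (rule Bochner_Integration.integrable_bound[OF assms(1,2)])
    (use assms(3) in \<open>auto intro!: AE_I2 order_trans[OF _ abs_ge_self]\<close>)

section \<open>Averages of contractions\<close>

text \<open>
  Two families of this kind occur: the Weyl operators, and their transport to the Fourier side of the space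
  \<open>L\<^sup>2(A_inf, \<tau>)\<close> on which they act by left multiplication.
\<close>

definition contraction_family :: "('z::euclidean_space \<Rightarrow> 'a::euclidean_space l2 \<Rightarrow> 'a l2) \<Rightarrow> bool" where
  "contraction_family \<Omega> \<longleftrightarrow> (\<forall>z u v. \<Omega> z (u + v) = \<Omega> z u + \<Omega> z v) \<and> (\<forall>z c u. \<Omega> z (c *\<^sub>C u) = c *\<^sub>C \<Omega> z u) \<and>
     (\<forall>z u. norm (\<Omega> z u) \<le> norm u) \<and> (\<forall>u v. (\<lambda>z. cinner u (\<Omega> z v)) \<in> borel_measurable borel)"

definition average :: "('z::euclidean_space \<Rightarrow> 'a::euclidean_space l2 \<Rightarrow> 'a l2) \<Rightarrow> ('z \<Rightarrow> complex) \<Rightarrow> 'a l2 \<Rightarrow> 'a l2" where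
  "average \<Omega> \<phi> = (THE B. bounded_clinear B \<and> (\<forall>u v. cinner u (B v) = (\<integral>z. \<phi> z * cinner u (\<Omega> z v) \<partial>lborel)))"

lemma average_integrable:
  assumes \<Omega>: "contraction_family \<Omega>" and \<phi>: "integrable lborel \<phi>"
  shows "integrable lborel (\<lambda>z. \<phi> z * cinner u (\<Omega> z v))"
    and "cmod (\<integral>z. \<phi> z * cinner u (\<Omega> z v) \<partial>lborel) \<le> (\<integral>z. cmod (\<phi> z) \<partial>lborel) * norm u * norm v"
proof -
  have [measurable]: "(\<lambda>z. cinner u (\<Omega> z v)) \<in> borel_measurable borel" "\<phi> \<in> borel_measurable borel"
    using \<Omega> \<phi> by (simp_all add: contraction_family_def)
  have le: "cmod (\<phi> z * cinner u (\<Omega> z v)) \<le> cmod (\<phi> z) * (norm u * norm v)" for z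
    unfolding norm_mult
    by (intro mult_left_mono order_trans[OF cmod_cinner_le] norm_ge_zero)
      (use \<Omega> in \<open>simp_all add: contraction_family_def\<close>)
  have i: "integrable lborel (\<lambda>z. cmod (\<phi> z) * (norm u * norm v))"
    by (intro integrable_mult_left integrable_norm \<phi>)
  show int: "integrable lborel (\<lambda>z. \<phi> z * cinner u (\<Omega> z v))"
    by (rule integrable_boundI[OF i _ le]) measurable
  have "cmod (\<integral>z. \<phi> z * cinner u (\<Omega> z v) \<partial>lborel) \<le> (\<integral>z. cmod (\<phi> z * cinner u (\<Omega> z v)) \<partial>lborel)"
    by (rule integral_norm_bound)
  also have "\<dots> \<le> (\<integral>z. cmod (\<phi> z) * (norm u * norm v) \<partial>lborel)"
    by (intro integral_mono integrable_norm int i le)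
  finally show "cmod (\<integral>z. \<phi> z * cinner u (\<Omega> z v) \<partial>lborel) \<le> (\<integral>z. cmod (\<phi> z) \<partial>lborel) * norm u * norm v"
    by (simp add: mult.assoc)
qed

lemma contraction_family_measurable:
  "contraction_family \<Omega> \<Longrightarrow> (\<lambda>z. cinner u (\<Omega> z v)) \<in> borel_measurable borel"
  by (simp add: contraction_family_def)

lemma average_eqI:
  assumes "bounded_clinear B" "\<And>u v. cinner u (B v) = (\<integral>z. \<phi> z * cinner u (\<Omega> z v) \<partial>lborel)"
  shows "average \<Omega> \<phi> = B"
  unfolding average_def
proof (rule the_equality)
  fix C assume "bounded_clinear C \<and> (\<forall>u v. cinner u (C v) = (\<integral>z. \<phi> z * cinner u (\<Omega> z v) \<partial>lborel))"
  then have "C v = B v" for v by (intro cinner_eqI) (simp add: assms)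
  then show "C = B" by blast
qed (use assms in blast)

lemma average_props:
  assumes \<Omega>: "contraction_family \<Omega>" and \<phi>: "integrable lborel \<phi>"
  shows average_bounded: "bounded_clinear (average \<Omega> \<phi>)"
    and cinner_average: "cinner u (average \<Omega> \<phi> v) = (\<integral>z. \<phi> z * cinner u (\<Omega> z v) \<partial>lborel)"
proof -
  note i = average_integrable(1)[OF \<Omega> \<phi>]
  have "\<exists>B. bounded_clinear B \<and> (\<forall>u v. cinner u (B v) = (\<integral>z. \<phi> z * cinner u (\<Omega> z v) \<partial>lborel))"
  proof (rule bounded_form_operator)
    show "cmod (\<integral>z. \<phi> z * cinner u (\<Omega> z v) \<partial>lborel) \<le> (\<integral>z. cmod (\<phi> z) \<partial>lborel) * norm u * norm v" for u v
      by (rule average_integrable(2)[OF \<Omega> \<phi>])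
  qed (use i \<Omega> in \<open>simp_all add: contraction_family_def cinner_add_left cinner_add_right distrib_left
      mult.left_commute[of "\<phi> _"]\<close>)
  then obtain B where B: "bounded_clinear B" "\<And>u v. cinner u (B v) = (\<integral>z. \<phi> z * cinner u (\<Omega> z v) \<partial>lborel)"
    by blast
  have "average \<Omega> \<phi> = B" by (rule average_eqI[OF B])
  with B show "bounded_clinear (average \<Omega> \<phi>)"
    "cinner u (average \<Omega> \<phi> v) = (\<integral>z. \<phi> z * cinner u (\<Omega> z v) \<partial>lborel)" by simp_all
qed

section \<open>Weyl operators\<close>

text \<open>
  The symplectic form of phase space is \<open>p(x, y) = x \<bullet> rot y\<close>.
\<close>

definition rot :: "'n::finite phase \<Rightarrow> 'n phase" where
  "rot x = (snd x, - fst x)"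

lemma rot_add: "rot (x + y) = rot x + rot y" and rot_diff: "rot (x - y) = rot x - rot y"
  and rot_uminus: "rot (- x) = - rot x" and rot_rot [simp]: "rot (rot x) = - x" and rot_zero [simp]: "rot 0 = 0"
  by (simp_all add: rot_def prod_eq_iff)

lemma inner_rot: "x \<bullet> rot y = - (y \<bullet> rot x)"
  by (simp add: rot_def inner_prod_def inner_commute)

lemma inner_rot_self [simp]: "x \<bullet> rot x = 0"
  using inner_rot[of x x] by simp

lemma rot_measurable [measurable]: "rot \<in> borel_measurable borel"
  unfolding rot_def[abs_def]
  by (intro borel_measurable_continuous_onI continuous_intros)

lemma measurable_fst_borel [measurable]: "fst \<in> borel_measurable (borel :: ('a::euclidean_space \<times> 'b::euclidean_space) measure)"
  and measurable_snd_borel [measurable]: "snd \<in> borel_measurable (borel :: ('a \<times> 'b) measure)"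
  by (intro borel_measurable_continuous_onI continuous_intros)+

lemma weyl_abs:
  assumes "square_integrable g"
  shows "square_integrable (\<lambda>t. cis (t \<bullet> snd x + fst x \<bullet> snd x / 2) * g (t + fst x))"
    and "weyl x (abs_l2 g) = abs_l2 (\<lambda>t. cis (t \<bullet> snd x + fst x \<bullet> snd x / 2) * g (t + fst x))"
proof -
  show "square_integrable (\<lambda>t. cis (t \<bullet> snd x + fst x \<bullet> snd x / 2) * g (t + fst x))"
    by (rule square_integrable_mult[OF square_integrable_translate[OF assms], where c = 1]) auto
  have V: "square_integrable (\<lambda>t. cis (t \<bullet> snd x) * g t)"
    by (rule square_integrable_mult[OF assms, where c = 1]) auto
  have "weyl_U (fst x) (weyl_V (snd x) (abs_l2 g)) = abs_l2 (\<lambda>t. cis ((t + fst x) \<bullet> snd x) * g (t + fst x))"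
    by (simp add: weyl_V.abs_eq[OF ae_eq_refl[OF assms]] weyl_U.abs_eq[OF ae_eq_refl[OF V]])
  then have "weyl x (abs_l2 g) = abs_l2 (\<lambda>t. cis (- (fst x \<bullet> snd x) / 2) * (cis ((t + fst x) \<bullet> snd x) * g (t + fst x)))"
    using abs_l2_scaleC[OF square_integrable_translate[OF V], of "cis (- (fst x \<bullet> snd x) / 2)" "fst x"]
    by (simp add: weyl_def)
  also have "(\<lambda>t. cis (- (fst x \<bullet> snd x) / 2) * (cis ((t + fst x) \<bullet> snd x) * g (t + fst x)))
     = (\<lambda>t. cis (t \<bullet> snd x + fst x \<bullet> snd x / 2) * g (t + fst x))"
    unfolding mult.assoc[symmetric] cis_mult by (simp add: inner_add_left field_simps)
  finally show "weyl x (abs_l2 g) = abs_l2 (\<lambda>t. cis (t \<bullet> snd x + fst x \<bullet> snd x / 2) * g (t + fst x))" .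
qed

lemma weyl_add: "weyl x (u + v) = weyl x u + weyl x v"
proof -
  obtain g h where g: "square_integrable g" "u = abs_l2 g" and h: "square_integrable h" "v = abs_l2 h"
    by (metis l2_cases)
  show ?thesis
    by (simp add: g h abs_l2_add weyl_abs square_integrable_add distrib_left)
qed

lemma weyl_scaleC: "weyl x (c *\<^sub>C u) = c *\<^sub>C weyl x u"
proof -
  obtain g where g: "square_integrable g" "u = abs_l2 g" by (metis l2_cases)
  show ?thesis
    by (simp add: g abs_l2_scaleC weyl_abs square_integrable_scale mult.left_commute)
qed

lemma weyl_zero [simp]: "weyl 0 u = u"
proof -
  obtain g where g: "square_integrable g" "u = abs_l2 g" by (metis l2_cases)
  show ?thesis by (simp add: g weyl_abs)
qed

text \<open>
  The canonical commutation relations in Weyl's form.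
\<close>

lemma weyl_weyl: "weyl x (weyl y u) = cis ((x \<bullet> rot y) / 2) *\<^sub>C weyl (x + y) u"
proof -
  obtain g where g: "square_integrable g" "u = abs_l2 g" by (metis l2_cases)
  have eq: "cis (t \<bullet> snd x + fst x \<bullet> snd x / 2) * (cis ((t + fst x) \<bullet> snd y + fst y \<bullet> snd y / 2) * g (t + fst x + fst y))
     = cis ((x \<bullet> rot y) / 2) * (cis (t \<bullet> snd (x + y) + fst (x + y) \<bullet> snd (x + y) / 2) * g (t + fst (x + y)))" for t
    unfolding mult.assoc[symmetric] cis_mult
    by (simp add: rot_def inner_prod_def inner_add_left inner_add_right inner_commute field_simps)
  show ?thesis
    unfolding g(2) weyl_abs(2)[OF g(1)] weyl_abs(2)[OF weyl_abs(1)[OF g(1)]] abs_l2_scaleC[OF weyl_abs(1)[OF g(1)]] eq ..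
qed

lemma weyl_adjoint: "cinner u (weyl x v) = cinner (weyl (- x) u) v"
proof -
  obtain g h where g: "square_integrable g" "u = abs_l2 g" and h: "square_integrable h" "v = abs_l2 h"
    by (metis l2_cases)
  note [measurable] = square_integrable_borel[OF g(1)] square_integrable_borel[OF h(1)]
  have "cinner u (weyl x v) = (\<integral>t. (\<lambda>t. cnj (g (t - fst x)) * (cis ((t - fst x) \<bullet> snd x + fst x \<bullet> snd x / 2) * h t)) (t + fst x) \<partial>lborel)"
    by (simp add: g h weyl_abs cinner_abs)
  also have "\<dots> = (\<integral>t. cnj (g (t - fst x)) * (cis ((t - fst x) \<bullet> snd x + fst x \<bullet> snd x / 2) * h t) \<partial>lborel)"
    by (rule lborel_integral_translate) measurable
  also have "\<dots> = (\<integral>t. cnj (cis (t \<bullet> snd (- x) + fst (- x) \<bullet> snd (- x) / 2) * g (t + fst (- x))) * h t \<partial>lborel)"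
  proof (rule Bochner_Integration.integral_cong[OF refl])
    fix t
    have e: "(t - fst x) \<bullet> snd x + fst x \<bullet> snd x / 2 = - (t \<bullet> snd (- x) + fst (- x) \<bullet> snd (- x) / 2)"
      by (simp add: inner_diff_left)
    show "cnj (g (t - fst x)) * (cis ((t - fst x) \<bullet> snd x + fst x \<bullet> snd x / 2) * h t)
      = cnj (cis (t \<bullet> snd (- x) + fst (- x) \<bullet> snd (- x) / 2) * g (t + fst (- x))) * h t"
      unfolding e by (simp add: cis_cnj)
  qed
  also have "\<dots> = cinner (weyl (- x) u) v"
    unfolding g(2) h(2) weyl_abs(2)[OF g(1)] by (rule cinner_abs[symmetric, OF weyl_abs(1)[OF g(1)] h(1)])
  finally show ?thesis .
qed

lemma norm_weyl [simp]: "norm (weyl x u) = norm u"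
proof -
  have "cinner (weyl x u) (weyl x u) = cinner (weyl (- x) (weyl x u)) u" by (rule weyl_adjoint)
  also have "weyl (- x) (weyl x u) = u"
    unfolding weyl_weyl by (simp add: cis_conv_exp)
  finally show ?thesis unfolding cinner_self of_real_eq_iff by simp
qed

lemma weyl_family: "contraction_family weyl"
  unfolding contraction_family_def
proof (intro conjI allI)
  fix u v :: "(real^'a) l2"
  obtain g h where g: "square_integrable g" "u = abs_l2 g" and h: "square_integrable h" "v = abs_l2 h"
    by (metis l2_cases)
  note [measurable] = square_integrable_borel[OF g(1)] square_integrable_borel[OF h(1)]
  have "(\<lambda>x. cinner u (weyl x v)) = (\<lambda>x. \<integral>t. cnj (g t) * (cis (t \<bullet> snd x + fst x \<bullet> snd x / 2) * h (t + fst x)) \<partial>lborel)"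
    by (simp add: g h weyl_abs cinner_abs)
  also have "\<dots> \<in> borel_measurable borel" by measurable
  finally show "(\<lambda>x. cinner u (weyl x v)) \<in> borel_measurable borel" .
qed (simp_all add: weyl_add weyl_scaleC)

section \<open>Products, adjoints and injectivity of the Weyl calculus\<close>

abbreviation wop :: "('n::finite phase \<Rightarrow> complex) \<Rightarrow> 'n op" where
  "wop \<equiv> average weyl"

lemma bop_eq_wop: "bop f = wop (fourier f)"
  by (simp add: bop_def average_def)

text \<open>
  The class of symbols on which everything is computed.  It contains the test functions and, unlike these, is closed
  under products.
\<close>

definition fourier_l1 :: "('n::finite phase \<Rightarrow> complex) \<Rightarrow> bool" where
  "fourier_l1 f \<longleftrightarrow> integrable lborel f \<and> integrable lborel (fourier f)"

lemma test_function_fourier_l1: "test_function f \<Longrightarrow> fourier_l1 f"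
  by (simp add: fourier_l1_def test_function_integrable fourier_eq_fts fts_test_integrable)

text \<open>
  Convolution twisted by the cocycle of the Weyl operators.
\<close>

definition tconv :: "('n::finite phase \<Rightarrow> complex) \<Rightarrow> ('n phase \<Rightarrow> complex) \<Rightarrow> 'n phase \<Rightarrow> complex" where
  "tconv \<phi> \<psi> x = (\<integral>y. cis ((x \<bullet> rot y) / 2) * (\<phi> (x - y) * \<psi> y) \<partial>lborel)"

lemma tconv_pair_integrable:
  assumes "integrable lborel \<phi>" "integrable lborel \<psi>"
  shows "integrable (lborel \<Otimes>\<^sub>M lborel) (\<lambda>(y, x). cis ((x \<bullet> rot y) / 2) * (\<phi> (x - y) * \<psi> y))"
  using integrable_pair_shear[OF assms, of uminus "\<lambda>p. cis ((snd p \<bullet> rot (fst p)) / 2)" 1] by simp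

lemma tconv_integrable:
  assumes "integrable lborel \<phi>" "integrable lborel \<psi>"
  shows "integrable lborel (tconv \<phi> \<psi>)"
  unfolding tconv_def[abs_def]
  using lborel_pair.integrable_snd[of "\<lambda>y x. cis ((x \<bullet> rot y) / 2) * (\<phi> (x - y) * \<psi> y)", OF tconv_pair_integrable[OF assms]]
  by simp

text \<open>Substituting \<open>z = x + y\<close> in the double integral for a product of two averages of Weyl operators.\<close>

lemma wop_comp:
  fixes \<phi> \<psi> :: "'n::finite phase \<Rightarrow> complex"
  assumes \<phi>: "integrable lborel \<phi>" and \<psi>: "integrable lborel \<psi>"
  shows "wop \<phi> \<circ> wop \<psi> = wop (tconv \<phi> \<psi>)"
proof (rule average_eqI[symmetric])
  note \<Omega> = weyl_family
  show "bounded_clinear (wop \<phi> \<circ> wop \<psi>)"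
    by (intro bounded_clinear_compose average_bounded \<Omega> \<phi> \<psi>)
  fix u v :: "(real^'n) l2"
  define S where "S = (\<lambda>z. cinner u (weyl z v))"
  have [measurable]: "S \<in> borel_measurable borel" "\<phi> \<in> borel_measurable borel" "\<psi> \<in> borel_measurable borel"
    using \<phi> \<psi> contraction_family_measurable[OF \<Omega>] by (simp_all add: S_def)
  have S: "cmod (S z) \<le> norm u * norm v" for z
    unfolding S_def by (rule order_trans[OF cmod_cinner_le]) simp
  define F where "F = (\<lambda>x y. cis ((x \<bullet> rot y) / 2) * S (x + y) * (\<phi> x * \<psi> y))"
  have WW: "cinner (weyl (- x) u) (weyl y v) = cis ((x \<bullet> rot y) / 2) * S (x + y)" for x y
    unfolding weyl_adjoint[symmetric] weyl_weyl S_def by simp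
  have F: "integrable (lborel \<Otimes>\<^sub>M lborel) (\<lambda>(y, x). F x y)"
    using integrable_pair_shear[OF \<phi> \<psi>, of "\<lambda>_. 0" "\<lambda>(y, x). cis ((x \<bullet> rot y) / 2) * S (x + y)" "norm u * norm v"] S
    by (simp add: F_def norm_mult split_beta')
  have F': "integrable (lborel \<Otimes>\<^sub>M lborel) (\<lambda>(y, z). F (z - y) y)"
    using integrable_pair_shear[OF \<phi> \<psi>, of uminus "\<lambda>(y, z). cis ((z \<bullet> rot y) / 2) * S z" "norm u * norm v"] S
    by (simp add: F_def norm_mult split_beta' inner_diff_left)
  have "cinner u ((wop \<phi> \<circ> wop \<psi>) v) = (\<integral>x. \<phi> x * cinner (weyl (- x) u) (wop \<psi> v) \<partial>lborel)"
    by (simp add: cinner_average[OF \<Omega> \<phi>] weyl_adjoint)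
  also have "\<dots> = (\<integral>x. (\<integral>y. F x y \<partial>lborel) \<partial>lborel)"
  proof (rule Bochner_Integration.integral_cong[OF refl])
    fix x
    have "F x y = \<phi> x * (\<psi> y * (cis ((x \<bullet> rot y) / 2) * S (x + y)))" for y
      by (simp add: F_def)
    then show "\<phi> x * cinner (weyl (- x) u) (wop \<psi> v) = (\<integral>y. F x y \<partial>lborel)"
      unfolding cinner_average[OF \<Omega> \<psi>] WW by (simp only: Bochner_Integration.integral_mult_right_zero)
  qed
  also have "\<dots> = (\<integral>y. (\<integral>x. F x y \<partial>lborel) \<partial>lborel)"
    by (rule lborel_pair.Fubini_integral[OF F])
  also have "\<dots> = (\<integral>y. (\<integral>z. F (z - y) y \<partial>lborel) \<partial>lborel)"
  proof -
    have "(\<integral>z. F (z + - y) y \<partial>lborel) = (\<integral>x. F x y \<partial>lborel)" for y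
      by (rule lborel_integral_translate) (unfold F_def, measurable)
    then show ?thesis by simp
  qed
  also have "\<dots> = (\<integral>z. (\<integral>y. F (z - y) y \<partial>lborel) \<partial>lborel)"
    by (rule lborel_pair.Fubini_integral[OF F', symmetric])
  also have "\<dots> = (\<integral>z. tconv \<phi> \<psi> z * cinner u (weyl z v) \<partial>lborel)"
  proof (rule Bochner_Integration.integral_cong[OF refl])
    fix z
    have "F (z - y) y = cis ((z \<bullet> rot y) / 2) * (\<phi> (z - y) * \<psi> y) * S z" for y
      by (simp add: F_def inner_diff_left)
    then show "(\<integral>y. F (z - y) y \<partial>lborel) = tconv \<phi> \<psi> z * cinner u (weyl z v)"
      unfolding tconv_def by (simp only: S_def Bochner_Integration.integral_mult_left_zero)
  qed
  finally show "cinner u ((wop \<phi> \<circ> wop \<psi>) v) = (\<integral>z. tconv \<phi> \<psi> z * cinner u (weyl z v) \<partial>lborel)" .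
qed

lemma lborel_integral_reflect:
  fixes f :: "'a::euclidean_space \<Rightarrow> complex"
  assumes "f \<in> borel_measurable borel"
  shows "(\<integral>x. f (y - x) \<partial>lborel) = (\<integral>x. f x \<partial>lborel)"
  using lborel_integral_scale[OF assms, of "-1" y] by simp

lemma lborel_integrable_reflect:
  fixes f :: "'a::euclidean_space \<Rightarrow> complex"
  assumes "integrable lborel f"
  shows "integrable lborel (\<lambda>x. f (y - x))"
proof -
  have [measurable]: "f \<in> borel_measurable borel" using assms by simp
  have "integrable (density (distr lborel borel (\<lambda>x. y + (- 1) *\<^sub>R x)) (\<lambda>_. ennreal (\<bar>- 1\<bar> ^ DIM('a)))) f"
    using assms lborel_affine[of "-1" y] by simp
  then have "integrable (distr lborel borel (\<lambda>x. y + (- 1) *\<^sub>R x)) f"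
    by (simp add: density_1)
  then show ?thesis by (subst (asm) integrable_distr_eq) auto
qed

lemma adj_wop:
  fixes \<phi> :: "'n::finite phase \<Rightarrow> complex"
  assumes \<phi>: "integrable lborel \<phi>"
  shows "adj (wop \<phi>) = wop (\<lambda>x. cnj (\<phi> (- x)))"
proof (rule adj_unique)
  note \<Omega> = weyl_family
  have i: "integrable lborel (\<lambda>x. cnj (\<phi> (- x)))"
    using lborel_integrable_reflect[OF \<phi>, of 0] by simp
  fix u v :: "(real^'n) l2"
  have [measurable]: "(\<lambda>z. cinner u (weyl z v)) \<in> borel_measurable borel" "\<phi> \<in> borel_measurable borel"
    using \<phi> contraction_family_measurable[OF \<Omega>] by simp_all
  have "cinner (wop (\<lambda>x. cnj (\<phi> (- x))) u) v = cnj (\<integral>x. cnj (\<phi> (- x)) * cinner v (weyl x u) \<partial>lborel)"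
    by (subst cinner_commute) (simp add: cinner_average[OF \<Omega> i])
  also have "\<dots> = (\<integral>x. \<phi> (- x) * cnj (cinner v (weyl x u)) \<partial>lborel)"
    by (simp flip: Bochner_Integration.integral_cnj)
  also have "\<dots> = (\<integral>x. (\<lambda>x. \<phi> x * cinner u (weyl x v)) (0 - x) \<partial>lborel)"
  proof -
    have "cnj (cinner v (weyl x u)) = cinner u (weyl (0 - x) v)" for x
      using weyl_adjoint[of u "- x" v] cinner_commute[of "weyl x u" v] by simp
    then show ?thesis by simp
  qed
  also have "\<dots> = (\<integral>x. \<phi> x * cinner u (weyl x v) \<partial>lborel)"
    by (rule lborel_integral_reflect) measurable
  finally show "cinner u (wop \<phi> v) = cinner (wop (\<lambda>x. cnj (\<phi> (- x))) u) v"
    by (simp add: cinner_average[OF \<Omega> \<phi>])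
qed

text \<open>Completing the square shows that the matrix coefficient of a Gaussian is a Gaussian on phase space.\<close>

lemma ex_weyl_coefficient_nonzero:
  "\<exists>v :: (real^'n::finite) l2. \<forall>x. cinner v (weyl x v) \<noteq> 0"
proof -
  define g where "g = (\<lambda>t::real^'n. complex_of_real (exp (- (norm t)\<^sup>2 / 2)))"
  have "integrable lborel (\<lambda>t::real^'n. (exp (- (norm t)\<^sup>2 / 2))\<^sup>2)"
    using gaussian_integral(1)[of 2, where 'a = "real^'n"] by (simp add: exp_double[symmetric] power2_eq_square exp_add[symmetric])
  then have g: "square_integrable g"
    by (simp add: square_integrable_def g_def)
  have [measurable]: "g \<in> borel_measurable borel" by (rule square_integrable_borel[OF g])
  have "cinner (abs_l2 g) (weyl x (abs_l2 g)) \<noteq> 0" for x :: "'n phase"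
  proof -
    define a where "a = (1/2) *\<^sub>R fst x"
    have "cinner (abs_l2 g) (weyl x (abs_l2 g))
       = (\<integral>t. (\<lambda>s. complex_of_real (exp (- (norm a)\<^sup>2)) * (cis (snd x \<bullet> s) * complex_of_real (exp (- 2 * (norm s)\<^sup>2 / 2)))) (t + a) \<partial>lborel)"
      unfolding weyl_abs(2)[OF g] cinner_abs[OF g weyl_abs(1)[OF g]]
    proof (rule Bochner_Integration.integral_cong[OF refl])
      fix t :: "real^'n"
      have n: "(norm t)\<^sup>2 / 2 + (norm (t + fst x))\<^sup>2 / 2 = (norm a)\<^sup>2 + (norm (t + a))\<^sup>2"
        by (simp add: a_def power2_norm_eq_inner inner_add_left inner_add_right inner_commute field_simps)
      have c: "t \<bullet> snd x + fst x \<bullet> snd x / 2 = snd x \<bullet> (t + a)"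
        by (simp add: a_def inner_add_right inner_commute)
      have "exp (- (norm t)\<^sup>2 / 2) * exp (- (norm (t + fst x))\<^sup>2 / 2) = exp (- (norm a)\<^sup>2) * exp (- 2 * (norm (t + a))\<^sup>2 / 2)"
        unfolding exp_add[symmetric] using n by simp
      then have "complex_of_real (exp (- (norm t)\<^sup>2 / 2)) * complex_of_real (exp (- (norm (t + fst x))\<^sup>2 / 2))
          = complex_of_real (exp (- (norm a)\<^sup>2)) * complex_of_real (exp (- 2 * (norm (t + a))\<^sup>2 / 2))"
        by (metis of_real_mult)
      then show "cnj (g t) * (cis (t \<bullet> snd x + fst x \<bullet> snd x / 2) * g (t + fst x))
        = (\<lambda>s. complex_of_real (exp (- (norm a)\<^sup>2)) * (cis (snd x \<bullet> s) * complex_of_real (exp (- 2 * (norm s)\<^sup>2 / 2)))) (t + a)"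
        unfolding c g_def by (simp add: mult.left_commute[of _ "cis _"])
    qed
    also have "\<dots> = (\<integral>s. complex_of_real (exp (- (norm a)\<^sup>2)) * (cis (snd x \<bullet> s) * complex_of_real (exp (- 2 * (norm s)\<^sup>2 / 2))) \<partial>lborel)"
      by (rule lborel_integral_translate) measurable
    also have "\<dots> = complex_of_real (exp (- (norm a)\<^sup>2)) * complex_of_real (sqrt (2 * pi / 2) ^ DIM(real^'n) * exp (- (norm (snd x))\<^sup>2 / (2 * 2)))"
      unfolding Bochner_Integration.integral_mult_right_zero by (subst gaussian_fourier(2)) simp_all
    finally show ?thesis by simp
  qed
  then show ?thesis by blast
qed

text \<open>
  Conjugation by \<open>weyl w\<close> multiplies \<open>weyl x\<close> by the character \<open>cis (x \<bullet> rot w)\<close>.  So if two averages agree, then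
  the difference of the symbols, times a fixed matrix coefficient, has vanishing Fourier transform.
\<close>

lemma wop_injective:
  assumes \<phi>: "integrable lborel \<phi>" and \<psi>: "integrable lborel \<psi>" and eq: "wop \<phi> = wop \<psi>"
  shows "AE x in lborel. \<phi> x = \<psi> x"
proof -
  note \<Omega> = weyl_family
  obtain g :: "(real^'a) l2" where g: "\<And>x. cinner g (weyl x g) \<noteq> 0"
    using ex_weyl_coefficient_nonzero by blast
  define a where "a = (\<lambda>x. cinner g (weyl x g))"
  have int: "integrable lborel (\<lambda>x. (\<phi> x - \<psi> x) * a x)"
    unfolding a_def by (intro average_integrable \<Omega> Bochner_Integration.integrable_diff \<phi> \<psi>)
  have "fts 1 (\<lambda>x. (\<phi> x - \<psi> x) * a x) k = 0" for k
  proof -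
    define w where "w = - rot k"
    have conj: "cinner (weyl w g) (weyl x (weyl w g)) = cis (1 * (k \<bullet> x)) * a x" for x
    proof -
      have "cinner (weyl w g) (weyl x (weyl w g)) = cinner g (weyl (- w) (weyl x (weyl w g)))"
        using weyl_adjoint[of g "- w"] by simp
      also have "\<dots> = cis (x \<bullet> rot w) * a x"
        unfolding weyl_weyl weyl_scaleC scaleC_scaleC cis_mult a_def cinner_scaleC_right
        using inner_rot[of w x] by (simp add: rot_add inner_add_right)
      also have "x \<bullet> rot w = 1 * (k \<bullet> x)" by (simp add: w_def rot_uminus inner_commute)
      finally show ?thesis .
    qed
    have "(\<integral>x. \<phi> x * (cis (1 * (k \<bullet> x)) * a x) \<partial>lborel) = (\<integral>x. \<psi> x * (cis (1 * (k \<bullet> x)) * a x) \<partial>lborel)"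
      using cinner_average[OF \<Omega> \<phi>, of "weyl w g" "weyl w g"] cinner_average[OF \<Omega> \<psi>, of "weyl w g" "weyl w g"]
      unfolding conj eq by simp
    moreover have "integrable lborel (\<lambda>x. \<phi> x * (cis (1 * (k \<bullet> x)) * a x))" "integrable lborel (\<lambda>x. \<psi> x * (cis (1 * (k \<bullet> x)) * a x))"
      using average_integrable(1)[OF \<Omega> \<phi>, of "weyl w g" "weyl w g"] average_integrable(1)[OF \<Omega> \<psi>, of "weyl w g" "weyl w g"]
      unfolding conj by simp_all
    ultimately have "(\<integral>x. \<phi> x * (cis (1 * (k \<bullet> x)) * a x) - \<psi> x * (cis (1 * (k \<bullet> x)) * a x) \<partial>lborel) = 0"
      by simp
    then show ?thesis by (simp add: fts_def algebra_simps)
  qed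
  then have "AE x in lborel. (\<phi> x - \<psi> x) * a x = 0"
    by (intro fts_injective[OF int, of 1]) simp_all
  then show ?thesis by eventually_elim (use g in \<open>simp add: a_def\<close>)
qed

section \<open>The symbols of the Weyl algebra and its trace\<close>

text \<open>
  The product \<open>f \<odot> g\<close>, with \<open>g\<close> expanded into plane waves: the product of \<open>f\<close> with the plane wave of frequency
  \<open>x\<close> is that plane wave times the translate of \<open>f\<close> by \<open>- rot x / 2\<close>.  In this form it is visibly integrable if
  \<open>f\<close> and \<open>fourier g\<close> are.
\<close>

definition moyal :: "('n::finite phase \<Rightarrow> complex) \<Rightarrow> ('n phase \<Rightarrow> complex) \<Rightarrow> 'n phase \<Rightarrow> complex" where
  "moyal f g y = (\<integral>x. cis (x \<bullet> y) * (f (y + (1/2) *\<^sub>R rot x) * fourier g x) \<partial>lborel)"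

lemma fourier_plane_wave_shift:
  fixes h :: "'n::finite phase \<Rightarrow> complex"
  assumes [measurable]: "h \<in> borel_measurable borel"
  shows "fourier (\<lambda>y. cis (x \<bullet> y) * h (y + (1/2) *\<^sub>R rot x)) k = cis ((k \<bullet> rot x) / 2) * fourier h (k - x)"
proof -
  have "(\<integral>y. cis (- (k \<bullet> y)) * (cis (x \<bullet> y) * h (y + (1/2) *\<^sub>R rot x)) \<partial>lborel)
     = (\<integral>y. (\<lambda>y. cis ((k \<bullet> rot x) / 2) * (cis (- ((k - x) \<bullet> y)) * h y)) (y + (1/2) *\<^sub>R rot x) \<partial>lborel)"
    unfolding mult.assoc[symmetric] cis_mult
    by (rule Bochner_Integration.integral_cong) (simp_all add: inner_add_right inner_diff_left algebra_simps)
  also have "\<dots> = (\<integral>y. cis ((k \<bullet> rot x) / 2) * (cis (- ((k - x) \<bullet> y)) * h y) \<partial>lborel)"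
    by (rule lborel_integral_translate) measurable
  finally show ?thesis by (simp add: fourier_def)
qed

lemma moyal_props:
  fixes f g :: "'n::finite phase \<Rightarrow> complex"
  assumes f: "integrable lborel f" and g: "integrable lborel (fourier g)"
  shows moyal_integrable: "integrable lborel (moyal f g)"
    and fourier_moyal: "fourier (moyal f g) = tconv (fourier f) (fourier g)"
proof -
  have [measurable]: "f \<in> borel_measurable borel" "fourier g \<in> borel_measurable borel" using f g by simp_all
  have i: "integrable (lborel \<Otimes>\<^sub>M lborel) (\<lambda>(x, y). cis (x \<bullet> y) * (f (y + (1/2) *\<^sub>R rot x) * fourier g x))"
    using integrable_pair_shear[OF f g, of "\<lambda>x. (1/2) *\<^sub>R rot x" "\<lambda>p. cis (fst p \<bullet> snd p)" 1] by simp
  show "integrable lborel (moyal f g)"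
    unfolding moyal_def[abs_def]
    using lborel_pair.integrable_snd[of "\<lambda>x y. cis (x \<bullet> y) * (f (y + (1/2) *\<^sub>R rot x) * fourier g x)", OF i] .
  show "fourier (moyal f g) = tconv (fourier f) (fourier g)"
  proof
    fix k
    define c where "c = complex_of_real (1 / (2 * pi) ^ CARD('n))"
    have i': "integrable (lborel \<Otimes>\<^sub>M lborel) (\<lambda>(x, y). cis (- (k \<bullet> y)) * (cis (x \<bullet> y) * (f (y + (1/2) *\<^sub>R rot x) * fourier g x)))"
      using integrable_pair_shear[OF f g, of "\<lambda>x. (1/2) *\<^sub>R rot x" "\<lambda>p. cis (- (k \<bullet> snd p)) * cis (fst p \<bullet> snd p)" 1]
      by (simp add: mult.assoc norm_mult)
    have "fourier (moyal f g) k = c * (\<integral>y. (\<integral>x. cis (- (k \<bullet> y)) * (cis (x \<bullet> y) * (f (y + (1/2) *\<^sub>R rot x) * fourier g x)) \<partial>lborel) \<partial>lborel)"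
      by (simp add: fourier_def[of "moyal f g"] moyal_def c_def)
    also have "(\<integral>y. (\<integral>x. cis (- (k \<bullet> y)) * (cis (x \<bullet> y) * (f (y + (1/2) *\<^sub>R rot x) * fourier g x)) \<partial>lborel) \<partial>lborel)
       = (\<integral>x. (\<integral>y. cis (- (k \<bullet> y)) * (cis (x \<bullet> y) * (f (y + (1/2) *\<^sub>R rot x) * fourier g x)) \<partial>lborel) \<partial>lborel)"
      by (rule lborel_pair.Fubini_integral[OF i'])
    also have "c * \<dots> = (\<integral>x. c * ((\<integral>y. cis (- (k \<bullet> y)) * (cis (x \<bullet> y) * f (y + (1/2) *\<^sub>R rot x)) \<partial>lborel) * fourier g x) \<partial>lborel)"
      by (simp add: mult.assoc flip: Bochner_Integration.integral_mult_left_zero)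
    also have "\<dots> = (\<integral>x. fourier (\<lambda>y. cis (x \<bullet> y) * f (y + (1/2) *\<^sub>R rot x)) k * fourier g x \<partial>lborel)"
      unfolding fourier_def[of "\<lambda>y. cis (_ \<bullet> y) * f (y + _)"] c_def[symmetric] mult.assoc ..
    also have "\<dots> = tconv (fourier f) (fourier g) k"
      unfolding fourier_plane_wave_shift[OF \<open>f \<in> borel_measurable borel\<close>] tconv_def by (simp add: mult.assoc)
    finally show "fourier (moyal f g) k = tconv (fourier f) (fourier g) k" .
  qed
qed

lemma fourier_l1_moyal: "fourier_l1 f \<Longrightarrow> fourier_l1 g \<Longrightarrow> fourier_l1 (moyal f g)"
  by (simp add: fourier_l1_def moyal_integrable fourier_moyal tconv_integrable)

lemma bop_comp: "fourier_l1 f \<Longrightarrow> fourier_l1 g \<Longrightarrow> bop f \<circ> bop g = bop (moyal f g)"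
  by (simp add: fourier_l1_def bop_eq_wop fourier_moyal wop_comp)

lemma fourier_cnj: "fourier (\<lambda>x. cnj (f x)) k = cnj (fourier f (- k))"
  by (simp add: fourier_def cis_cnj flip: Bochner_Integration.integral_cnj)

lemma fourier_l1_cnj: "fourier_l1 f \<Longrightarrow> fourier_l1 (\<lambda>x. cnj (f x))"
  using lborel_integrable_reflect[of "fourier f" 0]
  by (simp add: fourier_l1_def fourier_cnj[abs_def])

lemma adj_bop: "fourier_l1 f \<Longrightarrow> adj (bop f) = bop (\<lambda>x. cnj (f x))"
  by (simp add: fourier_l1_def bop_eq_wop adj_wop fourier_cnj[abs_def])

lemma fourier_add:
  "integrable lborel f \<Longrightarrow> integrable lborel g \<Longrightarrow> fourier (\<lambda>x. f x + g x) = (\<lambda>k. fourier f k + fourier g k)"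
  by (simp add: fun_eq_iff fourier_eq_fts fts_add)

lemma fourier_cmult: "fourier (\<lambda>x. c * f x) = (\<lambda>k. c * fourier f k)"
  by (simp add: fun_eq_iff fourier_eq_fts fts_cmult)

lemma fourier_l1_add: "fourier_l1 f \<Longrightarrow> fourier_l1 g \<Longrightarrow> fourier_l1 (\<lambda>x. f x + g x)"
  and fourier_l1_cmult: "fourier_l1 f \<Longrightarrow> fourier_l1 (\<lambda>x. c * f x)"
  by (simp_all add: fourier_l1_def fourier_add fourier_cmult)

text \<open>
  Products of generators leave the test functions, but not the class \<open>fourier_l1\<close>, on which \<open>tau\<close> and \<open>gns_vec\<close> are
  determined.
\<close>

lemma A_inf_symbol: "a \<in> A_inf \<Longrightarrow> \<exists>g. fourier_l1 g \<and> a = bop g"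
proof (induction rule: A_inf.induct)
  case (gen f)
  then show ?case using test_function_fourier_l1 by blast
next
  case (add a c)
  then obtain f g where fg: "fourier_l1 f" "a = bop f" "fourier_l1 g" "c = bop g" by blast
  then have i: "integrable lborel (fourier f)" "integrable lborel (fourier g)"
    "integrable lborel f" "integrable lborel g" by (simp_all add: fourier_l1_def)
  note ff = fourier_add[OF i(3,4)]
  have "bop (\<lambda>x. f x + g x) = (\<lambda>u. a u + c u)"
    unfolding fg bop_eq_wop ff
  proof (rule average_eqI)
    show "bounded_clinear (\<lambda>u. wop (fourier f) u + wop (fourier g) u)"
    proof -
      have b: "bounded_clinear (wop (fourier f))" "bounded_clinear (wop (fourier g))"
        by (intro average_bounded weyl_family i)+
      then have "bounded_linear (\<lambda>u. wop (fourier f) u + wop (fourier g) u)"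
        unfolding bounded_clinear_def by (intro bounded_linear_add) blast+
      with b show ?thesis by (simp add: bounded_clinear_def scaleC_add_right)
    qed
    show "cinner u (wop (fourier f) v + wop (fourier g) v) = (\<integral>z. (fourier f z + fourier g z) * cinner u (weyl z v) \<partial>lborel)" for u v
      using average_integrable(1)[OF weyl_family i(1), of u v] average_integrable(1)[OF weyl_family i(2), of u v]
      by (simp add: cinner_add_right cinner_average[OF weyl_family] i distrib_right)
  qed
  with fourier_l1_add[OF fg(1,3)] show ?case by (intro exI[of _ "\<lambda>x. f x + g x"]) simp
next
  case (scale a z)
  then obtain f where fg: "fourier_l1 f" "a = bop f" by blast
  then have i: "integrable lborel (fourier f)" by (simp add: fourier_l1_def)
  have b: "bounded_clinear (wop (fourier f))" by (intro average_bounded weyl_family i)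
  have "bop (\<lambda>x. z * f x) = (\<lambda>u. z *\<^sub>C a u)"
    unfolding fg bop_eq_wop fourier_cmult
  proof (rule average_eqI)
    obtain K where K: "\<And>u. norm (wop (fourier f) u) \<le> K * norm u" using bounded_clinear_bounded[OF b] by blast
    show "bounded_clinear (\<lambda>u. z *\<^sub>C wop (fourier f) u)"
    proof (rule bounded_clinearI[where K = "cmod z * K"])
      show "norm (z *\<^sub>C wop (fourier f) u) \<le> cmod z * K * norm u" for u
        using mult_left_mono[OF K[of u], of "cmod z"] by (simp add: mult.assoc)
    qed (simp_all add: bounded_clinear_add[OF b] bounded_clinear_scaleC[OF b] scaleC_add_right mult.commute)
    show "cinner u (z *\<^sub>C wop (fourier f) v) = (\<integral>x. z * fourier f x * cinner u (weyl x v) \<partial>lborel)" for u v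
      by (simp add: cinner_average[OF weyl_family i] mult.assoc)
  qed
  with fourier_l1_cmult[OF fg(1)] show ?case by (intro exI[of _ "\<lambda>x. z * f x"]) simp
next
  case (mult a c)
  then show ?case using bop_comp fourier_l1_moyal by blast
next
  case (star a)
  then show ?case using adj_bop fourier_l1_cnj by blast
qed

text \<open>
  The transforms of two symbols of the same operator agree almost everywhere, by injectivity of the Weyl calculus; that
  they agree at 0 follows from injectivity of the Fourier transform, which makes the symbols themselves agree almost
  everywhere.
\<close>

lemma tau_bop:
  assumes g: "fourier_l1 g"
  shows "tau (bop g) = fourier g 0"
  unfolding tau_def
proof (rule the_equality)
  show "\<exists>h. integrable lborel h \<and> integrable lborel (fourier h) \<and> bop g = bop h \<and> fourier g 0 = fourier h 0"
    using g by (auto simp: fourier_l1_def)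
  fix c assume "\<exists>h. integrable lborel h \<and> integrable lborel (fourier h) \<and> bop g = bop h \<and> c = fourier h 0"
  then obtain h where h: "integrable lborel h" "integrable lborel (fourier h)" "bop g = bop h" "c = fourier h 0" by blast
  have gi: "integrable lborel g" "integrable lborel (fourier g)" using g by (simp_all add: fourier_l1_def)
  have "AE x in lborel. fourier g x = fourier h x"
    using h(3) by (intro wop_injective gi(2) h(2)) (simp add: bop_eq_wop)
  then have "AE x in lborel. fts (- 1) (\<lambda>x. g x - h x) x = 0"
    by eventually_elim (simp add: fts_diff gi h fourier_eq_fts)
  then have "AE x in lborel. g x - h x = 0"
    by (rule fts_injective[OF Bochner_Integration.integrable_diff[OF gi(1) h(1)], rotated]) simp
  then have "fts (- 1) g = fts (- 1) h"
    by (intro fts_cong_AE) (use gi h in auto)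
  then show "c = fourier g 0" by (simp add: h fourier_eq_fts)
qed

lemma square_integrable_bounded_integrable:
  assumes g: "integrable lborel g" and b: "\<And>x. cmod (g x) \<le> C"
  shows "square_integrable g"
proof -
  have [measurable]: "g \<in> borel_measurable borel" using g by simp
  have "integrable lborel (\<lambda>x. (cmod (g x))\<^sup>2)"
  proof (rule Bochner_Integration.integrable_bound)
    show "integrable lborel (\<lambda>x. C * cmod (g x))" using g by (intro integrable_mult_right integrable_norm)
    have "(cmod (g x))\<^sup>2 \<le> C * cmod (g x)" for x
      unfolding power2_eq_square by (intro mult_right_mono b norm_ge_zero)
    then show "AE x in lborel. norm ((cmod (g x))\<^sup>2) \<le> norm (C * cmod (g x))"
      by (auto intro!: AE_I2 order_trans[OF _ abs_ge_self])
  qed measurable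
  then show ?thesis by (simp add: square_integrable_def)
qed

lemma fourier_l1_square_integrable: "fourier_l1 g \<Longrightarrow> square_integrable (fourier g)"
  unfolding fourier_l1_def fourier_eq_fts
  by (elim conjE) (rule square_integrable_bounded_integrable[OF _ fts_bound])

text \<open>
  The defining inner products are \<open>\<tau>(bop f\<^sup>* bop g)\<close>, the value at 0 of a twisted convolution, hence inner products of
  \<open>fourier f\<close> and \<open>fourier g\<close>.
\<close>

lemma gns_vec_bop:
  assumes g: "fourier_l1 g"
  shows "gns_vec (bop g) = FT 1 (abs_l2 (fourier g))"
  unfolding gns_vec_def
proof (rule the_equality)
  note sg = fourier_l1_square_integrable[OF g]
  have eq: "cinner (abs_l2 f) (FT 1 (abs_l2 (fourier g))) = tau (adj (bop f) \<circ> bop g)" if f: "test_function f" for f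
  proof -
    note fl = test_function_fourier_l1[OF f]
    have "cinner (abs_l2 f) (FT 1 (abs_l2 (fourier g))) = cinner (FT (- 1) (abs_l2 f)) (abs_l2 (fourier g))"
      by (simp add: FT_adjoint[of "- 1"])
    also have "FT (- 1) (abs_l2 f) = abs_l2 (fourier f)"
      unfolding fourier_eq_fts by (rule FT_abs) (simp_all add: f test_function_integrable test_function_square_integrable)
    also have "cinner (abs_l2 (fourier f)) (abs_l2 (fourier g)) = (\<integral>x. cnj (fourier f x) * fourier g x \<partial>lborel)"
      by (rule cinner_abs[OF fourier_l1_square_integrable[OF fl] sg])
    also have "\<dots> = tconv (fourier (\<lambda>x. cnj (f x))) (fourier g) 0"
      by (simp add: tconv_def fourier_cnj)
    also have "\<dots> = fourier (moyal (\<lambda>x. cnj (f x)) g) 0"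
      using g fourier_l1_cnj[OF fl] by (subst fourier_moyal) (simp_all add: fourier_l1_def)
    also have "\<dots> = tau (adj (bop f) \<circ> bop g)"
      by (simp add: adj_bop[OF fl] bop_comp[OF fourier_l1_cnj[OF fl] g] tau_bop fourier_l1_moyal fourier_l1_cnj fl g)
    finally show ?thesis .
  qed
  then show "\<forall>f. test_function f \<longrightarrow> cinner (abs_l2 f) (FT 1 (abs_l2 (fourier g))) = tau (adj (bop f) \<circ> bop g)" by blast
  fix u assume "\<forall>f. test_function f \<longrightarrow> cinner (abs_l2 f) u = tau (adj (bop f) \<circ> bop g)"
  with eq have "u - FT 1 (abs_l2 (fourier g)) = 0"
    by (intro cinner_tests_eq_0) (simp add: cinner_diff_right)
  then show "u = FT 1 (abs_l2 (fourier g))" by simp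
qed

lemma gns_vec_test:
  assumes f: "test_function f"
  shows "gns_vec (bop f) = abs_l2 f"
proof -
  have "abs_l2 (fourier f) = FT (- 1) (abs_l2 f)"
    unfolding fourier_eq_fts by (rule FT_abs[symmetric]) (simp_all add: f test_function_integrable test_function_square_integrable)
  then show ?thesis using FT_inverse[of "- 1" "abs_l2 f"]
    by (simp add: gns_vec_bop[OF test_function_fourier_l1[OF f]])
qed

section \<open>Left multiplication\<close>

text \<open>
  Left multiplication by \<open>weyl z\<close>, read off on Fourier transforms.
\<close>

definition twist :: "'n::finite phase \<Rightarrow> 'n phase l2 \<Rightarrow> 'n phase l2" where
  "twist z v = abs_l2 (\<lambda>x. cis ((z \<bullet> rot x) / 2) * rep_l2 v (x - z))"

lemma twist_square_integrable:
  assumes "square_integrable g"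
  shows "square_integrable (\<lambda>x. cis ((z \<bullet> rot x) / 2) * g (x - z))"
  using square_integrable_mult[OF square_integrable_translate[OF assms, of "- z"], of "\<lambda>x. cis ((z \<bullet> rot x) / 2)" 1]
  by simp

lemma twist_abs:
  assumes g: "square_integrable g"
  shows "twist z (abs_l2 g) = abs_l2 (\<lambda>x. cis ((z \<bullet> rot x) / 2) * g (x - z))"
  unfolding twist_def
proof (rule abs_l2_eqI)
  have "AE x in lborel. rep_l2 (abs_l2 g) (x + - z) = g (x + - z)"
    by (rule AE_translate) (rule AE_rep_abs[OF g])
  then show "AE x in lborel. cis (z \<bullet> rot x / 2) * rep_l2 (abs_l2 g) (x - z) = cis (z \<bullet> rot x / 2) * g (x - z)"
    by eventually_elim simp
qed (intro twist_square_integrable g square_integrable_rep)+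

lemma twist_family: "contraction_family twist"
  unfolding contraction_family_def
proof (intro conjI allI)
  fix u v :: "'a phase l2" and z c
  obtain g h where g: "square_integrable g" "u = abs_l2 g" and h: "square_integrable h" "v = abs_l2 h"
    by (metis l2_cases)
  note [measurable] = square_integrable_borel[OF g(1)] square_integrable_borel[OF h(1)]
  show "twist z (u + v) = twist z u + twist z v"
    by (simp add: g h abs_l2_add twist_abs twist_square_integrable square_integrable_add distrib_left)
  show "twist z (c *\<^sub>C u) = c *\<^sub>C twist z u"
    by (simp add: g abs_l2_scaleC twist_abs twist_square_integrable square_integrable_scale mult.left_commute)
  have "(norm (twist z u))\<^sup>2 = (\<integral>x. (cmod (g (x + - z)))\<^sup>2 \<partial>lborel)"
    unfolding g(2) twist_abs[OF g(1)] norm_abs_l2[OF twist_square_integrable[OF g(1)]] by (simp add: norm_mult)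
  also have "\<dots> = (norm u)\<^sup>2"
    unfolding g(2) norm_abs_l2[OF g(1)] by (rule lborel_integral_translate) measurable
  finally show "norm (twist z u) \<le> norm u" by simp
  have "(\<lambda>z. cinner u (twist z v)) = (\<lambda>z. \<integral>x. cnj (g x) * (cis ((z \<bullet> rot x) / 2) * h (x - z)) \<partial>lborel)"
    by (simp add: g h twist_abs cinner_abs twist_square_integrable)
  also have "\<dots> \<in> borel_measurable borel" by measurable
  finally show "(\<lambda>z. cinner u (twist z v)) \<in> borel_measurable borel" .
qed

lemma tconv_bound:
  assumes "\<And>x. cmod (\<phi> x) \<le> C" "integrable lborel \<psi>" "\<phi> \<in> borel_measurable borel"
  shows "cmod (tconv \<phi> \<psi> x) \<le> C * (\<integral>x. cmod (\<psi> x) \<partial>lborel)"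
proof -
  have [measurable]: "\<psi> \<in> borel_measurable borel" "\<phi> \<in> borel_measurable borel" using assms by simp_all
  have le: "cmod (cis ((x \<bullet> rot y) / 2) * (\<phi> (x - y) * \<psi> y)) \<le> C * cmod (\<psi> y)" for y
    using mult_right_mono[OF assms(1)[of "x - y"], of "cmod (\<psi> y)"] by (simp add: norm_mult)
  have i: "integrable lborel (\<lambda>y. C * cmod (\<psi> y))" using assms by (intro integrable_mult_right integrable_norm)
  have i': "integrable lborel (\<lambda>y. cis ((x \<bullet> rot y) / 2) * (\<phi> (x - y) * \<psi> y))"
    by (rule Bochner_Integration.integrable_bound[OF i]) (auto intro!: AE_I2 order_trans[OF le abs_ge_self])
  have "cmod (tconv \<phi> \<psi> x) \<le> (\<integral>y. cmod (cis ((x \<bullet> rot y) / 2) * (\<phi> (x - y) * \<psi> y)) \<partial>lborel)"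
    unfolding tconv_def by (rule integral_norm_bound)
  also have "\<dots> \<le> (\<integral>y. C * cmod (\<psi> y) \<partial>lborel)"
    by (intro integral_mono integrable_norm i i' le)
  finally show ?thesis by simp
qed

text \<open>
  The average is defined through its matrix elements.  Testing it against bounded functions is enough, and makes the
  double integral absolutely convergent.
\<close>

lemma average_twist_abs:
  assumes \<phi>: "integrable lborel \<phi>" "\<And>x. cmod (\<phi> x) \<le> C" and \<psi>: "integrable lborel \<psi>" "square_integrable \<psi>"
  shows "square_integrable (tconv \<phi> \<psi>)" "average twist \<phi> (abs_l2 \<psi>) = abs_l2 (tconv \<phi> \<psi>)"
proof -
  note \<Omega> = twist_family
  have [measurable]: "\<phi> \<in> borel_measurable borel" "\<psi> \<in> borel_measurable borel" using \<phi> \<psi> by simp_all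
  show sq: "square_integrable (tconv \<phi> \<psi>)"
    by (rule square_integrable_bounded_integrable[OF tconv_integrable[OF \<phi>(1) \<psi>(1)] tconv_bound[OF \<phi>(2) \<psi>(1)]]) simp
  have "cinner (abs_l2 f) (average twist \<phi> (abs_l2 \<psi>) - abs_l2 (tconv \<phi> \<psi>)) = 0" if f: "test_function f" for f
  proof -
    note sf = test_function_square_integrable[OF f]
    note [measurable] = test_function_borel[OF f]
    obtain K where K: "\<And>x. cmod (f x) \<le> K" using test_function_bounded[OF f] by blast
    define F where "F = (\<lambda>z x. cnj (f x) * cis ((z \<bullet> rot x) / 2) * (\<psi> (x - z) * \<phi> z))"
    have F: "integrable (lborel \<Otimes>\<^sub>M lborel) (\<lambda>(z, x). F z x)"
      using integrable_pair_shear[OF \<psi>(1) \<phi>(1), of uminus "\<lambda>(z, x). cnj (f x) * cis ((z \<bullet> rot x) / 2)" K] K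
      by (simp add: F_def split_beta' norm_mult)
    have "cinner (abs_l2 f) (average twist \<phi> (abs_l2 \<psi>)) = (\<integral>z. (\<integral>x. F z x \<partial>lborel) \<partial>lborel)"
      unfolding cinner_average[OF \<Omega> \<phi>(1)] twist_abs[OF \<psi>(2)] cinner_abs[OF sf twist_square_integrable[OF \<psi>(2)]] F_def
      by (simp add: mult.commute[of "\<phi> _"] mult.assoc flip: Bochner_Integration.integral_mult_left_zero)
    also have "\<dots> = (\<integral>x. (\<integral>z. F z x \<partial>lborel) \<partial>lborel)"
      using lborel_pair.Fubini_integral[of F, OF F] ..
    also have "\<dots> = (\<integral>x. cnj (f x) * tconv \<phi> \<psi> x \<partial>lborel)"
    proof (rule Bochner_Integration.integral_cong[OF refl])
      fix x
      have "(\<integral>z. F z x \<partial>lborel) = cnj (f x) * (\<integral>z. cis ((z \<bullet> rot x) / 2) * (\<psi> (x - z) * \<phi> z) \<partial>lborel)"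
        by (simp add: F_def mult.assoc)
      also have "(\<integral>z. cis ((z \<bullet> rot x) / 2) * (\<psi> (x - z) * \<phi> z) \<partial>lborel)
         = (\<integral>y. cis (((x - y) \<bullet> rot x) / 2) * (\<psi> (x - (x - y)) * \<phi> (x - y)) \<partial>lborel)"
        by (rule lborel_integral_reflect[of _ x, symmetric]) measurable
      also have "\<dots> = tconv \<phi> \<psi> x"
        unfolding tconv_def by (simp add: inner_rot[of _ x] rot_diff inner_diff_right mult.commute[of "\<psi> _"])
      finally show "(\<integral>z. F z x \<partial>lborel) = cnj (f x) * tconv \<phi> \<psi> x" .
    qed
    also have "\<dots> = cinner (abs_l2 f) (abs_l2 (tconv \<phi> \<psi>))"
      by (rule cinner_abs[symmetric, OF sf sq])
    finally show ?thesis by (simp add: cinner_diff_right)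
  qed
  then have "average twist \<phi> (abs_l2 \<psi>) - abs_l2 (tconv \<phi> \<psi>) = 0" by (rule cinner_tests_eq_0)
  then show "average twist \<phi> (abs_l2 \<psi>) = abs_l2 (tconv \<phi> \<psi>)" by simp
qed

text \<open>
  On vectors of elements of \<open>A_inf\<close> the formula is the twisted convolution of symbols; uniqueness holds because already
  the vectors of the generators are dense.
\<close>

lemma left_mult_bop:
  assumes f: "test_function f"
  shows "left_mult (bop f) = FT 1 \<circ> average twist (fourier f) \<circ> FT (- 1)" (is "_ = ?M")
  unfolding left_mult_def
proof (rule the_equality)
  note fl = test_function_fourier_l1[OF f]
  have \<phi>: "integrable lborel (fourier f)" using fl by (simp add: fourier_l1_def)
  have M: "bounded_clinear ?M"
    by (intro bounded_clinear_compose FT_bounded_clinear average_bounded[OF twist_family \<phi>]) simp_all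
  moreover have "?M (gns_vec c) = gns_vec (bop f \<circ> c)" if c: "c \<in> A_inf" for c
  proof -
    obtain g where g: "fourier_l1 g" "c = bop g" using A_inf_symbol[OF c] by blast
    have gi: "integrable lborel (fourier g)" using g by (simp add: fourier_l1_def)
    have bd: "cmod (fourier f x) \<le> 1 / (2 * pi) ^ CARD('a) * (\<integral>x. cmod (f x) \<partial>lborel)" for x
      unfolding fourier_eq_fts using fl by (intro fts_bound) (simp add: fourier_l1_def)
    have "?M (gns_vec c) = FT 1 (average twist (fourier f) (abs_l2 (fourier g)))"
      by (simp add: g gns_vec_bop FT_inverse[of 1, simplified])
    also have "average twist (fourier f) (abs_l2 (fourier g)) = abs_l2 (tconv (fourier f) (fourier g))"
      by (rule average_twist_abs(2)[OF \<phi> bd gi fourier_l1_square_integrable[OF g(1)]])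
    also have "tconv (fourier f) (fourier g) = fourier (moyal f g)"
      using fl gi by (simp add: fourier_l1_def fourier_moyal)
    also have "FT 1 (abs_l2 (fourier (moyal f g))) = gns_vec (bop f \<circ> c)"
      by (simp add: g bop_comp[OF fl g(1)] gns_vec_bop fourier_l1_moyal fl)
    finally show ?thesis .
  qed
  ultimately show "bounded_clinear ?M \<and> (\<forall>c\<in>A_inf. ?M (gns_vec c) = gns_vec (bop f \<circ> c))" by blast
  fix M assume M': "bounded_clinear M \<and> (\<forall>c\<in>A_inf. M (gns_vec c) = gns_vec (bop f \<circ> c))"
  show "M = ?M"
  proof (rule bounded_clinear_eq_on_dense[OF _ M tests_dense])
    fix u :: "'a phase l2" assume "u \<in> tests_l2"
    then obtain h where h: "test_function h" "u = abs_l2 h" by (auto simp: tests_l2_def)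
    then have "u = gns_vec (bop h)" "bop h \<in> A_inf" by (simp_all add: gns_vec_test A_inf.gen)
    with M' \<open>\<And>c. c \<in> A_inf \<Longrightarrow> ?M (gns_vec c) = gns_vec (bop f \<circ> c)\<close> show "M u = ?M u" by simp
  qed (use M' in blast)
qed

section \<open>Multiplication operators\<close>

definition bounded_borel :: "('a::euclidean_space \<Rightarrow> real) \<Rightarrow> bool" where
  "bounded_borel m \<longleftrightarrow> m \<in> borel_measurable borel \<and> (\<exists>C. \<forall>x. \<bar>m x\<bar> \<le> C)"

definition mulop :: "('a::euclidean_space \<Rightarrow> real) \<Rightarrow> 'a l2 \<Rightarrow> 'a l2" where
  "mulop m u = abs_l2 (\<lambda>x. complex_of_real (m x) * rep_l2 u x)"

lemma bounded_borelI: "m \<in> borel_measurable borel \<Longrightarrow> (\<And>x. \<bar>m x\<bar> \<le> C) \<Longrightarrow> bounded_borel m"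
  by (auto simp: bounded_borel_def)

lemma bounded_borel_measurable: "bounded_borel m \<Longrightarrow> m \<in> borel_measurable borel"
  by (simp add: bounded_borel_def)

lemma bounded_borel_mult: 
  assumes "bounded_borel m" "bounded_borel m'"
  shows "bounded_borel (\<lambda>x. m x * m' x)"
proof -
  obtain C C' where C: "\<And>x. \<bar>m x\<bar> \<le> C" "\<And>x. \<bar>m' x\<bar> \<le> C'" using assms by (auto simp: bounded_borel_def)
  have "0 \<le> C" using C(1) abs_ge_zero order_trans by blast
  then have "\<bar>m x * m' x\<bar> \<le> C * C'" for x
    unfolding abs_mult by (intro mult_mono C) simp_all
  with assms show ?thesis by (auto simp: bounded_borel_def)
qed

lemma bounded_borel_diff:
  assumes "bounded_borel m" "bounded_borel m'"
  shows "bounded_borel (\<lambda>x. m x - m' x)"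
proof -
  obtain C C' where C: "\<And>x. \<bar>m x\<bar> \<le> C" "\<And>x. \<bar>m' x\<bar> \<le> C'" using assms by (auto simp: bounded_borel_def)
  have "\<bar>m x - m' x\<bar> \<le> C + C'" for x using C(1)[of x] C(2)[of x] by linarith
  with assms show ?thesis by (auto simp: bounded_borel_def)
qed

lemma bounded_borel_const: "bounded_borel (\<lambda>x. c)"
  by (auto simp: bounded_borel_def)

lemma mulop_square_integrable:
  assumes "bounded_borel m" "square_integrable g"
  shows "square_integrable (\<lambda>x. complex_of_real (m x) * g x)"
proof -
  obtain C where "\<And>x. \<bar>m x\<bar> \<le> C" using assms(1) by (auto simp: bounded_borel_def)
  then show ?thesis
    using bounded_borel_measurable[OF assms(1)]
    by (intro square_integrable_mult[OF assms(2), where c = C]) auto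
qed

lemma mulop_abs:
  assumes m: "bounded_borel m" and g: "square_integrable g"
  shows "mulop m (abs_l2 g) = abs_l2 (\<lambda>x. complex_of_real (m x) * g x)"
  unfolding mulop_def
proof (rule abs_l2_eqI)
  show "AE x in lborel. complex_of_real (m x) * rep_l2 (abs_l2 g) x = complex_of_real (m x) * g x"
    using AE_rep_abs[OF g] by eventually_elim simp
qed (intro mulop_square_integrable m g square_integrable_rep)+

lemma mulop_norm_le:
  assumes m: "m \<in> borel_measurable borel" and C: "\<And>x. \<bar>m x\<bar> \<le> C"
  shows "norm (mulop m u) \<le> C * norm u"
proof -
  obtain g where g: "square_integrable g" "u = abs_l2 g" by (metis l2_cases)
  have b: "bounded_borel m" using assms by (rule bounded_borelI)
  have C0: "0 \<le> C" using C abs_ge_zero order_trans by blast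
  have i: "integrable lborel (\<lambda>x. (cmod (g x))\<^sup>2)" using g(1) by (simp add: square_integrable_def)
  have "(norm (mulop m u))\<^sup>2 = (\<integral>x. (cmod (complex_of_real (m x) * g x))\<^sup>2 \<partial>lborel)"
    unfolding g(2) mulop_abs[OF b g(1)] by (rule norm_abs_l2[OF mulop_square_integrable[OF b g(1)]])
  also have "\<dots> \<le> (\<integral>x. C\<^sup>2 * (cmod (g x))\<^sup>2 \<partial>lborel)"
  proof (rule integral_mono)
    show "integrable lborel (\<lambda>x. (cmod (complex_of_real (m x) * g x))\<^sup>2)"
      using mulop_square_integrable[OF b g(1)] by (simp add: square_integrable_def)
    show "integrable lborel (\<lambda>x. C\<^sup>2 * (cmod (g x))\<^sup>2)" by (intro integrable_mult_right i)
    show "(cmod (complex_of_real (m x) * g x))\<^sup>2 \<le> C\<^sup>2 * (cmod (g x))\<^sup>2" for x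
      unfolding norm_mult power_mult_distrib norm_of_real by (intro mult_right_mono power_mono C) simp_all
  qed
  also have "\<dots> = (C * norm u)\<^sup>2"
    unfolding g(2) by (simp add: power_mult_distrib norm_abs_l2[OF g(1)])
  finally show ?thesis by (rule power2_le_imp_le) (simp add: C0)
qed

lemma mulop_bounded_clinear:
  assumes m: "bounded_borel m"
  shows "bounded_clinear (mulop m)"
proof -
  obtain C where C: "\<And>x. \<bar>m x\<bar> \<le> C" using m by (auto simp: bounded_borel_def)
  show ?thesis
  proof (rule bounded_clinearI[where K = C])
    fix u v :: "'a l2" and c
    obtain g h where g: "square_integrable g" "u = abs_l2 g" and h: "square_integrable h" "v = abs_l2 h"
      by (metis l2_cases)
    note i = mulop_square_integrable[OF m]
    show "mulop m (u + v) = mulop m u + mulop m v"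
      by (simp add: g h abs_l2_add mulop_abs[OF m] i square_integrable_add distrib_left)
    show "mulop m (c *\<^sub>C u) = c *\<^sub>C mulop m u"
      by (simp add: g abs_l2_scaleC mulop_abs[OF m] i square_integrable_scale mult.left_commute)
    show "norm (mulop m u) \<le> C * norm u"
      by (rule mulop_norm_le[OF bounded_borel_measurable[OF m] C])
  qed
qed

lemma mulop_mulop:
  assumes m: "bounded_borel m" "bounded_borel m'"
  shows "mulop m (mulop m' u) = mulop (\<lambda>x. m x * m' x) u"
proof -
  obtain g where g: "square_integrable g" "u = abs_l2 g" by (metis l2_cases)
  show ?thesis
    unfolding g(2) mulop_abs[OF m(2) g(1)] mulop_abs[OF m(1) mulop_square_integrable[OF m(2) g(1)]]
      mulop_abs[OF bounded_borel_mult[OF m] g(1)] by (simp add: mult.assoc)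
qed

lemma mulop_diff:
  assumes m: "bounded_borel m" "bounded_borel m'"
  shows "mulop m u - mulop m' u = mulop (\<lambda>x. m x - m' x) u"
proof -
  obtain g where g: "square_integrable g" "u = abs_l2 g" by (metis l2_cases)
  show ?thesis
    unfolding g(2) mulop_abs[OF m(2) g(1)] mulop_abs[OF m(1) g(1)] mulop_abs[OF bounded_borel_diff[OF m] g(1)]
      abs_l2_diff[OF mulop_square_integrable[OF m(1) g(1)] mulop_square_integrable[OF m(2) g(1)]]
    by (simp add: left_diff_distrib)
qed

lemma mulop_const: "mulop (\<lambda>x. c) u = c *\<^sub>R u"
proof -
  obtain g where g: "square_integrable g" "u = abs_l2 g" by (metis l2_cases)
  show ?thesis by (simp add: g mulop_abs bounded_borel_const abs_l2_scaleR)
qed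

lemma mulop_symmetric:
  assumes m: "bounded_borel m"
  shows "cinner (mulop m u) v = cinner u (mulop m v)"
proof -
  obtain g h where g: "square_integrable g" "u = abs_l2 g" and h: "square_integrable h" "v = abs_l2 h"
    by (metis l2_cases)
  note i = mulop_square_integrable[OF m]
  show ?thesis
    unfolding g(2) h(2) mulop_abs[OF m g(1)] mulop_abs[OF m h(1)] cinner_abs[OF i[OF g(1)] h(1)] cinner_abs[OF g(1) i[OF h(1)]]
    by (simp add: ac_simps)
qed

lemma mulop_tendsto:
  fixes M :: "real \<Rightarrow> 'a::euclidean_space \<Rightarrow> real"
  assumes M: "\<And>t. t > 0 \<Longrightarrow> M t \<in> borel_measurable borel" "\<And>t x. t > 0 \<Longrightarrow> \<bar>M t x\<bar> \<le> C"
    and m: "m \<in> borel_measurable borel" "\<And>x. \<bar>m x\<bar> \<le> C"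
    and lim: "\<And>x. ((\<lambda>t. M t x) \<longlongrightarrow> m x) (at_right 0)"
  shows "((\<lambda>t. mulop (M t) u) \<longlongrightarrow> mulop m u) (at_right 0)"
  unfolding tendsto_at_iff_sequentially
proof (intro allI impI)
  fix X :: "nat \<Rightarrow> real" assume X: "\<forall>i. X i \<in> {0<..} - {0}" "X \<longlonglongrightarrow> 0"
  then have X0: "X i > 0" for i by auto
  obtain g where g: "square_integrable g" "u = abs_l2 g" by (metis l2_cases)
  note [measurable] = square_integrable_borel[OF g(1)] M(1)[OF X0] m(1)
  have bb: "bounded_borel (M (X n))" "bounded_borel m" for n
    by (rule bounded_borelI[OF M(1)[OF X0] M(2)[OF X0]], rule bounded_borelI[OF m])
  have Xlim: "(\<lambda>n. M (X n) x) \<longlonglongrightarrow> m x" for x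
    using lim[of x] X unfolding tendsto_at_iff_sequentially by (auto simp: comp_def)
  have "(\<lambda>n. \<integral>x. (M (X n) x - m x)\<^sup>2 * (cmod (g x))\<^sup>2 \<partial>lborel) \<longlonglongrightarrow> (\<integral>x. 0 \<partial>(lborel :: 'a measure))"
  proof (rule integral_dominated_convergence[where w = "\<lambda>x. (C + C)\<^sup>2 * (cmod (g x))\<^sup>2"])
    show "integrable lborel (\<lambda>x. (C + C)\<^sup>2 * (cmod (g x))\<^sup>2)"
      using g(1) by (intro integrable_mult_right) (simp add: square_integrable_def)
    have "(\<lambda>n. (M (X n) x - m x)\<^sup>2 * (cmod (g x))\<^sup>2) \<longlonglongrightarrow> (m x - m x)\<^sup>2 * (cmod (g x))\<^sup>2" for x
      by (intro tendsto_intros Xlim)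
    then show "AE x in lborel. (\<lambda>n. (M (X n) x - m x)\<^sup>2 * (cmod (g x))\<^sup>2) \<longlonglongrightarrow> 0" by simp
    show "AE x in lborel. norm ((M (X n) x - m x)\<^sup>2 * (cmod (g x))\<^sup>2) \<le> (C + C)\<^sup>2 * (cmod (g x))\<^sup>2" for n
    proof (rule AE_I2)
      fix x
      have "\<bar>M (X n) x - m x\<bar> \<le> C + C" using M(2)[OF X0, of n x] m(2)[of x] by linarith
      from power_mono[OF this, of 2] have "(M (X n) x - m x)\<^sup>2 \<le> (C + C)\<^sup>2" by simp
      from mult_right_mono[OF this, of "(cmod (g x))\<^sup>2"]
      show "norm ((M (X n) x - m x)\<^sup>2 * (cmod (g x))\<^sup>2) \<le> (C + C)\<^sup>2 * (cmod (g x))\<^sup>2" by simp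
    qed
  qed measurable
  moreover have "(\<integral>x. (M (X n) x - m x)\<^sup>2 * (cmod (g x))\<^sup>2 \<partial>lborel) = (norm (mulop (M (X n)) u - mulop m u))\<^sup>2" for n
    unfolding mulop_diff[OF bb] g(2) mulop_abs[OF bounded_borel_diff[OF bb] g(1)]
      norm_abs_l2[OF mulop_square_integrable[OF bounded_borel_diff[OF bb] g(1)]]
    by (simp only: norm_mult norm_of_real power_mult_distrib power2_abs)
  ultimately have "(\<lambda>n. sqrt ((norm (mulop (M (X n)) u - mulop m u))\<^sup>2)) \<longlonglongrightarrow> sqrt 0"
    by (intro tendsto_real_sqrt) simp
  then have "(\<lambda>n. norm (mulop (M (X n)) u - mulop m u)) \<longlonglongrightarrow> 0" by simp
  then have "(\<lambda>n. mulop (M (X n)) u) \<longlonglongrightarrow> mulop m u"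
    by (rule LIM_zero_cancel[OF tendsto_norm_zero_cancel])
  then show "((\<lambda>t. mulop (M t) u) \<circ> X) \<longlonglongrightarrow> mulop m u" by (simp add: comp_def)
qed

section \<open>The heat semigroup as a Fourier multiplier\<close>

definition gauss :: "real \<Rightarrow> 'a::euclidean_space \<Rightarrow> real" where
  "gauss t k = exp (- t * (norm k)\<^sup>2 / 2)"

definition fmult :: "('n::finite phase \<Rightarrow> real) \<Rightarrow> 'n phase l2 \<Rightarrow> 'n phase l2" where
  "fmult m u = FT 1 (mulop m (FT (- 1) u))"

definition gauss_semigroup :: "real \<Rightarrow> 'n::finite phase l2 \<Rightarrow> 'n phase l2" where
  "gauss_semigroup t = fmult (gauss t)"

text \<open>
  The symbol of \<open>(1 - \<Delta>/2)\<inverse>\<close>.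
\<close>

definition resolvent_symbol :: "'a::euclidean_space \<Rightarrow> real" where
  "resolvent_symbol k = 1 / (1 + (norm k)\<^sup>2 / 2)"

definition res :: "'n::finite phase l2 \<Rightarrow> 'n phase l2" where
  "res = fmult resolvent_symbol"

lemma gauss_measurable [measurable]: "gauss t \<in> borel_measurable borel"
  unfolding gauss_def[abs_def] by measurable

lemma gauss_pos: "0 < gauss t k" by (simp add: gauss_def)

lemma gauss_le_1: "0 \<le> t \<Longrightarrow> gauss t k \<le> 1"
  by (simp add: gauss_def)

lemma bounded_borel_gauss: "0 \<le> t \<Longrightarrow> bounded_borel (gauss t)"
  by (rule bounded_borelI[where C = 1]) (simp_all add: gauss_le_1 less_imp_le[OF gauss_pos])

lemma resolvent_symbol_bounds: "0 < resolvent_symbol k" "resolvent_symbol k \<le> 1"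
  by (simp_all add: resolvent_symbol_def add_pos_nonneg)

lemma resolvent_symbol_measurable [measurable]: "resolvent_symbol \<in> borel_measurable borel"
  unfolding resolvent_symbol_def[abs_def] by measurable

lemma bounded_borel_resolvent_symbol: "bounded_borel resolvent_symbol"
  by (rule bounded_borelI[where C = 1]) (simp_all add: resolvent_symbol_bounds less_imp_le)

lemma FT_FT [simp]: "FT 1 (FT (- 1) u) = u" "FT (- 1) (FT 1 u) = u"
  using FT_inverse[of "- 1" u] FT_inverse[of 1 u] by simp_all

lemma bounded_clinear_FT: "bounded_clinear (FT 1)" "bounded_clinear (FT (- 1))"
  by (simp_all add: FT_bounded_clinear)

lemma FT_adj: "cinner (FT 1 u) v = cinner u (FT (- 1) v)" "cinner (FT (- 1) u) v = cinner u (FT 1 v)"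
  using FT_adjoint[of 1 u v] FT_adjoint[of "- 1" u v] by simp_all

lemma FT_norms [simp]: "norm (FT 1 u) = norm u" "norm (FT (- 1) u) = norm u"
  by (simp_all add: FT_norm)

lemma fmult_bounded_clinear: "bounded_borel m \<Longrightarrow> bounded_clinear (fmult m)"
  using bounded_clinear_compose[OF bounded_clinear_FT(1) bounded_clinear_compose[OF mulop_bounded_clinear bounded_clinear_FT(2)]]
  by (simp add: comp_def fmult_def[abs_def])

lemma fmult_fmult: "bounded_borel m \<Longrightarrow> bounded_borel m' \<Longrightarrow> fmult m (fmult m' u) = fmult (\<lambda>x. m x * m' x) u"
  by (simp add: fmult_def mulop_mulop)

lemma fmult_diff:
  "bounded_borel m \<Longrightarrow> bounded_borel m' \<Longrightarrow> fmult m u - fmult m' u = fmult (\<lambda>x. m x - m' x) u"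
  by (simp add: fmult_def mulop_diff flip: bounded_clinear_diff[OF bounded_clinear_FT(1)])

lemma fmult_const: "fmult (\<lambda>x. c) u = c *\<^sub>R u"
  by (simp add: fmult_def mulop_const bounded_clinear_scaleR[OF bounded_clinear_FT(1)])

lemma fmult_symmetric: "bounded_borel m \<Longrightarrow> cinner (fmult m u) v = cinner u (fmult m v)"
  by (simp add: fmult_def FT_adj mulop_symmetric)

lemma fmult_norm_le:
  assumes "m \<in> borel_measurable borel" "\<And>x. \<bar>m x\<bar> \<le> C"
  shows "norm (fmult m u) \<le> C * norm u"
  using mulop_norm_le[OF assms, of "FT (- 1) u"] by (simp add: fmult_def)

lemma fmult_tendsto:
  fixes M :: "real \<Rightarrow> 'n::finite phase \<Rightarrow> real"
  assumes "\<And>t. t > 0 \<Longrightarrow> M t \<in> borel_measurable borel" "\<And>t x. t > 0 \<Longrightarrow> \<bar>M t x\<bar> \<le> C"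
    and "m \<in> borel_measurable borel" "\<And>x. \<bar>m x\<bar> \<le> C" "\<And>x. ((\<lambda>t. M t x) \<longlongrightarrow> m x) (at_right 0)"
  shows "((\<lambda>t. fmult (M t) u) \<longlongrightarrow> fmult m u) (at_right 0)"
proof -
  have "bounded_linear (FT 1 :: 'n phase l2 \<Rightarrow> _)" using bounded_clinear_FT(1)[where 'a = 'n] by (simp add: bounded_clinear_def)
  from bounded_linear.tendsto[OF this mulop_tendsto[of M C m, OF assms]] show ?thesis by (simp add: fmult_def)
qed

lemma res_bounded_clinear: "bounded_clinear res"
  unfolding res_def by (intro fmult_bounded_clinear bounded_borel_resolvent_symbol)

lemma gauss_semigroup_res: "0 \<le> t \<Longrightarrow> gauss_semigroup t (res z) = res (gauss_semigroup t z)"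
  by (simp add: gauss_semigroup_def res_def fmult_fmult bounded_borel_gauss bounded_borel_resolvent_symbol mult.commute)

text \<open>
  On the range of the resolvent \<open>res = (1 - \<Delta>/2)\<inverse>\<close> the generator is \<open>\<Delta>/2 = 1 - (1 - \<Delta>/2)\<close>; the difference
  quotients are multiplied by bounded symbols there.
\<close>

lemma gauss_semigroup_generator:
  "((\<lambda>t. (1 / t) *\<^sub>R (gauss_semigroup t (res z) - res z)) \<longlongrightarrow> res z - z) (at_right 0)"
proof -
  define M where "M = (\<lambda>t (k :: 'a phase). (gauss t k - 1) / t * resolvent_symbol k)"
  define m where "m = (\<lambda>k :: 'a phase. resolvent_symbol k - 1)"
  note bb = bounded_borel_resolvent_symbol bounded_borel_const
  have meas: "M t \<in> borel_measurable borel" "m \<in> borel_measurable borel" for t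
    unfolding M_def m_def by measurable
  have quot: "((\<lambda>t. (exp (- t * a) - 1) / t) \<longlongrightarrow> - a) (at_right 0)" for a :: real
  proof -
    have "((\<lambda>t. exp (- t * a)) has_real_derivative - a) (at 0)"
      by (auto intro!: derivative_eq_intros)
    then have "((\<lambda>t. (exp (- t * a) - 1) / t) \<longlongrightarrow> - a) (at 0)" by (simp add: DERIV_def)
    then show ?thesis by (rule tendsto_within_subset) simp
  qed
  have g: "gauss t k = exp (- t * ((norm k)\<^sup>2 / 2))" for t and k :: "'a phase" by (simp add: gauss_def)
  have m_eq: "m k = - ((norm k)\<^sup>2 / 2) * resolvent_symbol k" for k
  proof -
    have "1 + (norm k)\<^sup>2 / 2 \<noteq> 0" by (simp add: add_nonneg_eq_0_iff)
    then show ?thesis unfolding m_def resolvent_symbol_def by (simp add: field_simps)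
  qed
  have "((\<lambda>t. fmult (M t) z) \<longlongrightarrow> fmult m z) (at_right 0)"
  proof (rule fmult_tendsto[where C = 1])
    fix t :: real and k :: "'a phase" assume t: "t > 0"
    have a: "0 \<le> (norm k)\<^sup>2 / 2" by simp
    have "1 + - t * ((norm k)\<^sup>2 / 2) \<le> gauss t k" unfolding g by (rule exp_ge_add_one_self)
    then have "1 - gauss t k \<le> t * ((norm k)\<^sup>2 / 2)" by simp
    moreover have "gauss t k \<le> 1" using t by (simp add: gauss_le_1)
    ultimately have "\<bar>(gauss t k - 1) / t\<bar> \<le> (norm k)\<^sup>2 / 2"
      using t by (simp add: field_simps abs_if)
    then have "\<bar>M t k\<bar> \<le> (norm k)\<^sup>2 / 2 * resolvent_symbol k"
      unfolding M_def abs_mult abs_of_pos[OF resolvent_symbol_bounds(1)]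
      using resolvent_symbol_bounds(1)[of k] by (intro mult_right_mono) simp_all
    also have "\<dots> \<le> 1"
      using m_eq[of k] resolvent_symbol_bounds(1)[of k] unfolding m_def by linarith
    finally show "\<bar>M t k\<bar> \<le> 1" .
  next
    fix k :: "'a phase"
    show "\<bar>m k\<bar> \<le> 1" using resolvent_symbol_bounds[of k] by (simp add: m_def)
    show "((\<lambda>t. M t k) \<longlongrightarrow> m k) (at_right 0)"
      unfolding m_eq M_def g by (intro tendsto_mult tendsto_const quot)
  qed (simp_all add: meas)
  moreover have "fmult m z = res z - z"
    using fmult_diff[OF bb, of z 1] by (simp add: m_def res_def fmult_const)
  moreover have "fmult (M t) z = (1 / t) *\<^sub>R (gauss_semigroup t (res z) - res z)" if "t > 0" for t
  proof -
    have gb: "bounded_borel (gauss t :: 'a phase \<Rightarrow> real)" using that by (simp add: bounded_borel_gauss)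
    have b: "bounded_borel (\<lambda>k::'a phase. (gauss t k - 1) * resolvent_symbol k)"
      by (intro bounded_borel_mult bounded_borel_diff gb bb)
    have "gauss_semigroup t (res z) - res z = fmult (\<lambda>k. gauss t k * resolvent_symbol k - resolvent_symbol k) z"
      by (simp add: gauss_semigroup_def res_def fmult_fmult gb bb fmult_diff bounded_borel_mult)
    also have "(\<lambda>k. gauss t k * resolvent_symbol k - resolvent_symbol k) = (\<lambda>k. (gauss t k - 1) * resolvent_symbol k)"
      by (simp add: left_diff_distrib)
    finally have "(1 / t) *\<^sub>R (gauss_semigroup t (res z) - res z) = fmult (\<lambda>k. 1 / t) (fmult (\<lambda>k. (gauss t k - 1) * resolvent_symbol k) z)"
      by (simp only: fmult_const)
    also have "\<dots> = fmult (\<lambda>k. 1 / t * ((gauss t k - 1) * resolvent_symbol k)) z"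
      by (rule fmult_fmult[OF bounded_borel_const b])
    also have "(\<lambda>k. 1 / t * ((gauss t k - 1) * resolvent_symbol k)) = M t"
      by (simp add: M_def)
    finally show ?thesis by simp
  qed
  ultimately show ?thesis
    by (auto elim!: Lim_transform_eventually simp: eventually_at_filter)
qed

definition shifted_laplacian :: "('n::finite phase \<Rightarrow> complex) \<Rightarrow> 'n phase \<Rightarrow> complex" where
  "shifted_laplacian f x = f x + (- 1 / 2) * laplacian f x"

lemma test_function_shifted_laplacian: "test_function f \<Longrightarrow> test_function (shifted_laplacian f)"
  unfolding shifted_laplacian_def[abs_def]
  by (intro test_function_add test_function_cmult test_function_laplacian)

lemma fourier_shifted_laplacian:
  assumes f: "test_function f"
  shows "fourier (shifted_laplacian f) k = complex_of_real (1 + (norm k)\<^sup>2 / 2) * fourier f k"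
proof -
  have "fourier (shifted_laplacian f) k = fourier f k + (- 1 / 2) * fourier (laplacian f) k"
    unfolding shifted_laplacian_def[abs_def]
      fourier_add[OF test_function_integrable[OF f] test_function_integrable[OF test_function_cmult[OF test_function_laplacian[OF f]]]]
      fourier_cmult ..
  also have "fourier (laplacian f) k = - complex_of_real ((norm k)\<^sup>2) * fourier f k"
    unfolding fourier_eq_fts by (rule fts_laplacian[OF f]) simp
  finally show ?thesis by (simp add: algebra_simps)
qed

lemma FT_test: "test_function f \<Longrightarrow> FT (- 1) (abs_l2 f) = abs_l2 (fourier f)"
  unfolding fourier_eq_fts by (rule FT_abs) (simp_all add: test_function_integrable test_function_square_integrable)

lemma fourier_test_square_integrable: "test_function f \<Longrightarrow> square_integrable (fourier f)"
  by (simp add: fourier_l1_square_integrable test_function_fourier_l1)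

lemma res_shifted_laplacian:
  assumes f: "test_function f"
  shows "res (abs_l2 (shifted_laplacian f)) = abs_l2 f"
proof -
  note g = test_function_shifted_laplacian[OF f]
  have "(\<lambda>x. complex_of_real (resolvent_symbol x) * fourier (shifted_laplacian f) x) = fourier f"
  proof
    fix k :: "'a phase"
    have "1 + (norm k)\<^sup>2 / 2 \<noteq> 0" by (simp add: add_nonneg_eq_0_iff)
    then have "resolvent_symbol k * (1 + (norm k)\<^sup>2 / 2) = 1" by (simp add: resolvent_symbol_def)
    then have "complex_of_real (resolvent_symbol k) * complex_of_real (1 + (norm k)\<^sup>2 / 2) = 1"
      by (metis of_real_1 of_real_mult)
    then show "complex_of_real (resolvent_symbol k) * fourier (shifted_laplacian f) k = fourier f k"
      unfolding fourier_shifted_laplacian[OF f] mult.assoc[symmetric] by simp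
  qed
  then have "mulop resolvent_symbol (abs_l2 (fourier (shifted_laplacian f))) = FT (- 1) (abs_l2 f)"
    by (simp add: mulop_abs[OF bounded_borel_resolvent_symbol fourier_test_square_integrable[OF g]] FT_test[OF f])
  then show ?thesis by (simp add: res_def fmult_def FT_test[OF g])
qed

lemma res_shifted_laplacian_diff:
  assumes f: "test_function f"
  shows "res (abs_l2 (shifted_laplacian f)) - abs_l2 (shifted_laplacian f) = (1 / 2) *\<^sub>R abs_l2 (laplacian f)"
proof -
  note l = test_function_laplacian[OF f]
  have "abs_l2 (shifted_laplacian f) = abs_l2 f + (- 1 / 2) *\<^sub>C abs_l2 (laplacian f)"
    unfolding shifted_laplacian_def[abs_def]
    unfolding abs_l2_scaleC[OF test_function_square_integrable[OF l]]
    by (rule abs_l2_add[symmetric]) (intro test_function_square_integrable test_function_cmult f l)+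
  then show ?thesis unfolding res_shifted_laplacian[OF f] by (simp add: scaleR_scaleC scaleC_diff_left[of 0 "1/2", simplified])
qed

lemma gauss_is_heat_semigroup: "is_heat_semigroup gauss_semigroup"
  unfolding is_heat_semigroup_def
proof (intro conjI allI impI)
  fix t :: real assume t: "t \<ge> 0"
  note b = bounded_borel_gauss[OF t]
  show "bounded_clinear (gauss_semigroup t)" unfolding gauss_semigroup_def by (rule fmult_bounded_clinear[OF b])
  show "norm (gauss_semigroup t u) \<le> norm u" for u :: "'a phase l2"
    unfolding gauss_semigroup_def using fmult_norm_le[of "gauss t" 1 u] t
    by (simp add: gauss_le_1 less_imp_le[OF gauss_pos])
  show "cinner (gauss_semigroup t u) v = cinner u (gauss_semigroup t v)" for u v :: "'a phase l2"
    unfolding gauss_semigroup_def by (rule fmult_symmetric[OF b])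
next
  show "gauss_semigroup 0 u = u" for u :: "'a phase l2"
    using fmult_const[of 1 u] by (simp add: gauss_semigroup_def gauss_def[abs_def])
next
  fix s t :: real and u :: "'a phase l2" assume st: "0 \<le> s" "0 \<le> t"
  have "gauss (s + t) = (\<lambda>k :: 'a phase. gauss s k * gauss t k)"
    by (simp add: gauss_def fun_eq_iff exp_add[symmetric] field_simps)
  then show "gauss_semigroup (s + t) u = gauss_semigroup s (gauss_semigroup t u)"
    using st by (simp add: gauss_semigroup_def fmult_fmult bounded_borel_gauss)
next
  fix u :: "'a phase l2"
  have "((\<lambda>t. fmult (gauss t) u) \<longlongrightarrow> fmult (\<lambda>k. 1) u) (at_right 0)"
  proof (rule fmult_tendsto[where C = 1])
    fix k :: "'a phase"
    have "((\<lambda>t. exp (- t * (norm k)\<^sup>2 / 2)) \<longlongrightarrow> exp (- 0 * (norm k)\<^sup>2 / 2)) (at_right 0)"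
      by (intro tendsto_intros) simp
    then show "((\<lambda>t. gauss t k) \<longlongrightarrow> 1) (at_right 0)" by (simp add: gauss_def)
  qed (simp_all add: gauss_le_1 less_imp_le[OF gauss_pos])
  then show "((\<lambda>t. gauss_semigroup t u) \<longlongrightarrow> u) (at_right 0)"
    by (simp add: gauss_semigroup_def fmult_const)
next
  fix f :: "'a phase \<Rightarrow> complex" assume f: "test_function f"
  show "((\<lambda>t. (1 / t) *\<^sub>R (gauss_semigroup t (gns_vec (bop f)) - gns_vec (bop f))) \<longlongrightarrow> (1 / 2) *\<^sub>R gns_vec (bop (laplacian f))) (at_right 0)"
    unfolding gns_vec_test[OF f] gns_vec_test[OF test_function_laplacian[OF f]]
    using gauss_semigroup_generator[of "abs_l2 (shifted_laplacian f)"]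
    unfolding res_shifted_laplacian_diff[OF f] unfolding res_shifted_laplacian[OF f] .
qed


section \<open>Uniqueness of the heat semigroup\<close>

lemma bump_translate: "bump n l r (x - a) = bump n (l + a) (r + a) x"
  by (simp add: bump_def algebra_simps)

text \<open>On the support of a narrow bump the real part of \<open>cis (- (k \<bullet> x))\<close> is positive.\<close>

lemma fourier_bump_nonzero:
  fixes k :: "'n::finite phase"
  shows "\<exists>n. fourier (\<lambda>x. complex_of_real (bump 1 (- (inverse (real (Suc n)) *\<^sub>R One)) (inverse (real (Suc n)) *\<^sub>R One) x)) k \<noteq> 0"
proof -
  obtain n where n: "norm k * real DIM('n phase) < real n" using reals_Archimedean2 by blast
  define \<epsilon> where "\<epsilon> = inverse (real (Suc n))"
  have \<epsilon>: "\<epsilon> > 0" by (simp add: \<epsilon>_def)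
  define \<eta> where "\<eta> = bump 1 (- (\<epsilon> *\<^sub>R One)) (\<epsilon> *\<^sub>R One :: 'n phase)"
  have t: "test_function (\<lambda>x. complex_of_real (\<eta> x))" unfolding \<eta>_def by (rule test_function_bump) simp
  have \<eta>0: "0 \<le> \<eta> x" "\<eta> x \<noteq> 0 \<Longrightarrow> x \<in> box (- (\<epsilon> *\<^sub>R One)) (\<epsilon> *\<^sub>R One)"
    "x \<in> box (- (\<epsilon> *\<^sub>R One)) (\<epsilon> *\<^sub>R One) \<Longrightarrow> 0 < \<eta> x" for x
    unfolding \<eta>_def using bump_eq_0[of 1 x "- (\<epsilon> *\<^sub>R One)" "\<epsilon> *\<^sub>R One"] zero_less_one
    by (blast intro: bump_bounds bump_pos)+
  have small: "\<bar>k \<bullet> x\<bar> < 1" if x: "x \<in> box (- (\<epsilon> *\<^sub>R One)) (\<epsilon> *\<^sub>R One)" for x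
  proof -
    have "norm x \<le> (\<Sum>b\<in>Basis. \<bar>x \<bullet> b\<bar>)" by (rule norm_le_l1)
    also have "\<dots> \<le> (\<Sum>b\<in>(Basis :: 'n phase set). \<epsilon>)"
    proof (rule sum_mono)
      fix b :: "'n phase" assume "b \<in> Basis"
      with x have "- \<epsilon> < x \<bullet> b" "x \<bullet> b < \<epsilon>" by (auto simp: box_def)
      then show "\<bar>x \<bullet> b\<bar> \<le> \<epsilon>" by linarith
    qed
    finally have "norm x \<le> real DIM('n phase) * \<epsilon>" by simp
    then have "norm k * norm x \<le> norm k * (real DIM('n phase) * \<epsilon>)" by (rule mult_left_mono) simp
    also have "\<dots> < real (Suc n) * \<epsilon>"
      using n \<epsilon> unfolding mult.assoc[symmetric] by (intro mult_strict_right_mono) simp_all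
    also have "\<dots> = 1" by (simp add: \<epsilon>_def)
    finally show ?thesis using Cauchy_Schwarz_ineq2[of k x] by linarith
  qed
  have pos: "0 < cos (k \<bullet> x)" if "x \<in> box (- (\<epsilon> *\<^sub>R One)) (\<epsilon> *\<^sub>R One)" for x
    using small[OF that] pi_gt3 by (intro cos_gt_zero_pi) linarith+
  define h where "h = (\<lambda>x. cos (k \<bullet> x) * \<eta> x)"
  have h0: "0 \<le> h x" for x
    using \<eta>0(1,2)[of x] pos[of x] by (cases "\<eta> x = 0") (auto simp: h_def)
  have re: "Re (cis (- (k \<bullet> x)) * complex_of_real (\<eta> x)) = h x" for x
    by (simp add: h_def)
  have i: "integrable lborel (\<lambda>x. cis (- (k \<bullet> x)) * complex_of_real (\<eta> x))"
    using integrable_cis_mult[OF test_function_integrable[OF t], of "- 1" k] by simp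
  have hi: "integrable lborel h" using integrable_Re[OF i] unfolding re .
  have "(\<integral>x. h x \<partial>lborel) \<noteq> 0"
  proof
    assume "(\<integral>x. h x \<partial>lborel) = 0"
    then have "AE x in lborel. h x = 0"
      using hi h0 by (subst (asm) integral_nonneg_eq_0_iff_AE) auto
    then have "AE x in lborel. x \<notin> box (- (\<epsilon> *\<^sub>R One)) (\<epsilon> *\<^sub>R One :: 'n phase)"
    proof eventually_elim
      case (elim x)
      then show ?case using pos[of x] \<eta>0(3)[of x] by (auto simp: h_def)
    qed
    then have z: "emeasure lborel (box (- (\<epsilon> *\<^sub>R One)) (\<epsilon> *\<^sub>R One :: 'n phase)) = 0"
      by (subst (asm) AE_iff_measurable[OF _ refl]) auto
    define P where "P = (\<Prod>b\<in>(Basis :: 'n phase set). (\<epsilon> *\<^sub>R One - - (\<epsilon> *\<^sub>R One)) \<bullet> b)"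
    have "0 < P" unfolding P_def
      using \<epsilon> by (intro prod_pos ballI) (simp only: inner_diff_left inner_minus_left inner_scaleR_left inner_sum_left_Basis, simp)
    moreover have "emeasure lborel (box (- (\<epsilon> *\<^sub>R One)) (\<epsilon> *\<^sub>R One :: 'n phase)) = ennreal P"
      unfolding P_def using \<epsilon> by (intro emeasure_lborel_box) (simp only: inner_minus_left inner_scaleR_left inner_sum_left_Basis, simp)
    ultimately show False using z by (simp add: ennreal_eq_0_iff)
  qed
  moreover have "Re (\<integral>x. cis (- (k \<bullet> x)) * complex_of_real (\<eta> x) \<partial>lborel) = (\<integral>x. h x \<partial>lborel)"
    unfolding re[symmetric] by (rule integral_Re[symmetric, OF i])
  ultimately have "(\<integral>x. cis (- (k \<bullet> x)) * complex_of_real (\<eta> x) \<partial>lborel) \<noteq> 0" by auto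
  then have "fourier (\<lambda>x. complex_of_real (\<eta> x)) k \<noteq> 0" by (simp add: fourier_def)
  then show ?thesis unfolding \<eta>_def \<epsilon>_def by blast
qed

lemma fourier_translate:
  assumes "f \<in> borel_measurable borel"
  shows "fourier (\<lambda>x. f (x - a)) k = cis (- (k \<bullet> a)) * fourier f k"
proof -
  note [measurable] = assms
  have "(\<integral>x. cis (- (k \<bullet> x)) * f (x - a) \<partial>lborel) = (\<integral>x. (\<lambda>x. cis (- (k \<bullet> (x + a))) * f x) (x + - a) \<partial>lborel)" by simp
  also have "\<dots> = (\<integral>x. cis (- (k \<bullet> (x + a))) * f x \<partial>lborel)"
    by (rule lborel_integral_translate) measurable
  also have "\<dots> = (\<integral>x. cis (- (k \<bullet> a)) * (cis (- (k \<bullet> x)) * f x) \<partial>lborel)"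
    unfolding mult.assoc[symmetric] cis_mult by (simp add: inner_add_right algebra_simps)
  finally show ?thesis by (simp add: fourier_def)
qed

text \<open>
  A vector orthogonal to this range is orthogonal to \<open>(1 - \<Delta>/2) f\<close> for all translates of a bump \<open>f\<close>.  So the product
  of its transform with \<open>(1 + \<parallel>k\<parallel>\<^sup>2 / 2) fourier f k\<close> is integrable with vanishing Fourier transform, hence zero; and at
  every frequency some bump has a nonzero transform.
\<close>

lemma shifted_laplacian_range_dense:
  "closure (abs_l2 ` shifted_laplacian ` {f :: 'n::finite phase \<Rightarrow> complex. test_function f}) = UNIV"
  (is "closure ?S = _")
proof (rule csubspace_dense)
  note sq = test_function_square_integrable[OF test_function_shifted_laplacian]
  have res_inj: "abs_l2 (shifted_laplacian f) + abs_l2 (shifted_laplacian g) = abs_l2 (shifted_laplacian (\<lambda>x. f x + g x))"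
    if "test_function f" "test_function g" for f g :: "'n phase \<Rightarrow> complex"
  proof -
    have "laplacian (\<lambda>x. f x + g x) x = laplacian f x + laplacian g x" for x
    proof -
      have "partial_deriv j (\<lambda>x. f x + g x) = (\<lambda>x. partial_deriv j f x + partial_deriv j g x)" for j
        by (rule ext) (intro partial_deriv_add smooth_differentiable test_function_smooth that)
      then show ?thesis
        using that by (simp add: laplacian_def sum.distrib partial_deriv_add smooth_differentiable test_function_smooth test_function_partial_deriv)
    qed
    then show ?thesis
      unfolding abs_l2_add[OF sq[OF that(1)] sq[OF that(2)]] unfolding shifted_laplacian_def[abs_def]
      by (simp add: algebra_simps add_divide_distrib)
  qed
  have res_sc: "c *\<^sub>C abs_l2 (shifted_laplacian f) = abs_l2 (shifted_laplacian (\<lambda>x. c * f x))"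
    if "test_function f" for f :: "'n phase \<Rightarrow> complex" and c
  proof -
    have "laplacian (\<lambda>x. c * f x) x = c * laplacian f x" for x
    proof -
      have "partial_deriv j (\<lambda>x. c * f x) = (\<lambda>x. c * partial_deriv j f x)" for j
        by (rule ext) (intro partial_deriv_cmult smooth_differentiable test_function_smooth that)
      then show ?thesis
        using that by (simp add: laplacian_def sum_distrib_left partial_deriv_cmult smooth_differentiable test_function_smooth test_function_partial_deriv)
    qed
    then show ?thesis
      unfolding abs_l2_scaleC[OF sq[OF that]] unfolding shifted_laplacian_def[abs_def]
      by (simp add: algebra_simps)
  qed
  show "csubspace ?S"
    unfolding csubspace_def
  proof (intro conjI ballI allI)
    have "0 *\<^sub>C abs_l2 (shifted_laplacian (\<lambda>x. 0)) \<in> ?S"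
      unfolding res_sc[OF test_function_zero] by (intro imageI) (simp add: test_function_zero)
    then show "0 \<in> ?S" by simp
  next
    fix u v assume "u \<in> ?S" "v \<in> ?S"
    then obtain f g :: "'n phase \<Rightarrow> complex" where fg: "test_function f" "test_function g"
      "u = abs_l2 (shifted_laplacian f)" "v = abs_l2 (shifted_laplacian g)" by blast
    show "u + v \<in> ?S" unfolding fg(3,4) res_inj[OF fg(1,2)] by (intro imageI) (simp add: test_function_add fg)
  next
    fix c u assume "u \<in> ?S"
    then obtain f :: "'n phase \<Rightarrow> complex" where f: "test_function f" "u = abs_l2 (shifted_laplacian f)" by blast
    show "c *\<^sub>C u \<in> ?S" unfolding f(2) res_sc[OF f(1)] by (intro imageI) (simp add: test_function_cmult f)
  qed
  fix v :: "'n phase l2" assume v: "\<And>s. s \<in> ?S \<Longrightarrow> cinner s v = 0"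
  obtain V where V: "square_integrable V" "FT (- 1) v = abs_l2 V" by (metis l2_cases)
  note [measurable] = square_integrable_borel[OF V(1)]
  have ann: "AE k in lborel. fourier f k * V k = 0" if f: "\<exists>n l r. n > 0 \<and> f = (\<lambda>x. complex_of_real (bump n l r x))" for f :: "'n phase \<Rightarrow> complex"
  proof -
    obtain n l r where n: "n > 0" "f = (\<lambda>x. complex_of_real (bump n l r x))" using f by blast
    have tf: "test_function f" unfolding n(2) by (rule test_function_bump[OF n(1)])
    note tg = test_function_shifted_laplacian[OF tf]
    define W where "W = (\<lambda>k. cnj (fourier (shifted_laplacian f) k) * V k)"
    have W: "integrable lborel W"
      unfolding W_def by (rule square_integrable_inner[OF fourier_test_square_integrable[OF tg] V(1)])
    have "fts 1 W a = 0" for a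
    proof -
      define fa where "fa = (\<lambda>x. f (x - a))"
      have ta: "test_function fa"
        unfolding fa_def n(2) bump_translate by (rule test_function_bump[OF n(1)])
      note tga = test_function_shifted_laplacian[OF ta]
      have "abs_l2 (shifted_laplacian fa) \<in> ?S" using ta by blast
      then have "0 = cinner (abs_l2 (shifted_laplacian fa)) v" using v by simp
      also have "\<dots> = cinner (FT (- 1) (abs_l2 (shifted_laplacian fa))) (FT (- 1) v)"
        by (simp add: FT_adj)
      also have "\<dots> = (\<integral>k. cnj (fourier (shifted_laplacian fa) k) * V k \<partial>lborel)"
        unfolding V(2) FT_test[OF tga] by (rule cinner_abs[OF fourier_test_square_integrable[OF tga] V(1)])
      also have "\<dots> = (\<integral>k. cis (1 * (a \<bullet> k)) * W k \<partial>lborel)"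
      proof (rule Bochner_Integration.integral_cong[OF refl])
        fix k
        have "fourier (shifted_laplacian fa) k = cis (- (k \<bullet> a)) * fourier (shifted_laplacian f) k"
          unfolding fourier_shifted_laplacian[OF ta] fourier_shifted_laplacian[OF tf]
          unfolding fa_def fourier_translate[OF test_function_borel[OF tf]] by simp
        then show "cnj (fourier (shifted_laplacian fa) k) * V k = cis (1 * (a \<bullet> k)) * W k"
          by (simp add: W_def cis_cnj inner_commute)
      qed
      finally show ?thesis by (simp add: fts_def)
    qed
    then have "AE k in lborel. W k = 0" by (intro fts_injective[OF W, of 1]) simp_all
    then show ?thesis
    proof eventually_elim
      case (elim k)
      have "1 + (norm k)\<^sup>2 / 2 \<noteq> 0" by (simp add: add_nonneg_eq_0_iff)
      then have "complex_of_real (1 + (norm k)\<^sup>2 / 2) \<noteq> 0" by (simp only: of_real_eq_0_iff not_False_eq_True)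
      then show ?case using elim by (simp add: W_def fourier_shifted_laplacian[OF tf])
    qed
  qed
  have "AE k in lborel. \<forall>n. fourier (\<lambda>x. complex_of_real (bump 1 (- (inverse (real (Suc n)) *\<^sub>R One)) (inverse (real (Suc n)) *\<^sub>R One) x)) k * V k = 0"
    unfolding AE_all_countable by (intro allI ann) (intro exI conjI, rule zero_less_one, rule refl)
  then have "AE k in lborel. V k = 0"
  proof eventually_elim
    case (elim k)
    then show ?case using fourier_bump_nonzero[of k] by force
  qed
  then have "FT (- 1) v = 0"
    unfolding V(2) abs_l2_zero[symmetric] by (intro abs_l2_eqI V square_integrable_zero)
  then have "norm v = 0" using FT_norms(2)[of v] by simp
  then show "v = 0" by simp
qed

definition generates :: "(real \<Rightarrow> 'n::finite phase l2 \<Rightarrow> 'n phase l2) \<Rightarrow> 'n phase l2 \<Rightarrow> 'n phase l2 \<Rightarrow> bool" where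
  "generates T w y \<longleftrightarrow> ((\<lambda>h. (1 / h) *\<^sub>R (T h w - w)) \<longlongrightarrow> y) (at_right 0)"

lemma heat_semigroup_facts:
  assumes T: "is_heat_semigroup T"
  shows hs_clinear: "0 \<le> t \<Longrightarrow> bounded_clinear (T t)" and hs_norm: "0 \<le> t \<Longrightarrow> norm (T t u) \<le> norm u"
    and hs_sym: "0 \<le> t \<Longrightarrow> cinner (T t u) v = cinner u (T t v)" and hs_0: "T 0 u = u"
    and hs_add: "0 \<le> s \<Longrightarrow> 0 \<le> t \<Longrightarrow> T (s + t) u = T s (T t u)"
    and hs_lim: "((\<lambda>t. T t u) \<longlongrightarrow> u) (at_right 0)"
    and hs_gen: "test_function f \<Longrightarrow> generates T (abs_l2 f) ((1 / 2) *\<^sub>R abs_l2 (laplacian f))"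
proof -
  note T' = T[unfolded is_heat_semigroup_def]
  show "0 \<le> t \<Longrightarrow> bounded_clinear (T t)" "0 \<le> t \<Longrightarrow> norm (T t u) \<le> norm u"
    "0 \<le> t \<Longrightarrow> cinner (T t u) v = cinner u (T t v)" "T 0 u = u"
    "0 \<le> s \<Longrightarrow> 0 \<le> t \<Longrightarrow> T (s + t) u = T s (T t u)" "((\<lambda>t. T t u) \<longlongrightarrow> u) (at_right 0)"
    using T' by simp_all
  assume f: "test_function f"
  with T' have "((\<lambda>t. (1 / t) *\<^sub>R (T t (gns_vec (bop f)) - gns_vec (bop f)))
      \<longlongrightarrow> (1 / 2) *\<^sub>R gns_vec (bop (laplacian f))) (at_right 0)" by simp
  then show "generates T (abs_l2 f) ((1 / 2) *\<^sub>R abs_l2 (laplacian f))"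
    unfolding generates_def gns_vec_test[OF f] gns_vec_test[OF test_function_laplacian[OF f]] .
qed

lemma hs_tendsto: "is_heat_semigroup T \<Longrightarrow> 0 \<le> t \<Longrightarrow> (f \<longlongrightarrow> u) F \<Longrightarrow> ((\<lambda>x. T t (f x)) \<longlongrightarrow> T t u) F"
  using hs_clinear[of T t] bounded_linear.tendsto[of "T t" f u F] by (simp add: bounded_clinear_def)

lemma hs_modulus:
  assumes T: "is_heat_semigroup T" and "0 \<le> r" "0 \<le> s"
  shows "norm (T s w - T r w) \<le> norm (T \<bar>s - r\<bar> w - w)"
  using assms(2,3)
proof (induction r s rule: linorder_wlog)
  case (le r s)
  have "T s w - T r w = T r (T (s - r) w - w)"
    using hs_add[OF T, of r "s - r" w] le bounded_clinear_diff[OF hs_clinear[OF T, of r]] by simp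
  also have "norm \<dots> \<le> norm (T (s - r) w - w)" using le by (intro hs_norm[OF T])
  finally show ?case using le by simp
next
  case (sym r s)
  then show ?case by (simp add: norm_minus_commute abs_minus_commute)
qed

lemma hs_continuous:
  assumes T: "is_heat_semigroup T"
  shows "continuous_on {0..} (\<lambda>r. T r w)"
  unfolding continuous_on_iff
proof (intro ballI allI impI)
  fix r :: real and e :: real assume r: "r \<in> {0..}" and e: "0 < e"
  from tendstoD[OF hs_lim[OF T, of w] e] obtain d where d: "d > 0" "\<And>h. 0 < h \<Longrightarrow> h < d \<Longrightarrow> dist (T h w) w < e"
    unfolding eventually_at_right_field by auto
  have "dist (T s w) (T r w) < e" if "s \<in> {0..}" "dist s r < d" for s
  proof -
    have "norm (T \<bar>s - r\<bar> w - w) < e"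
      using d(2)[of "\<bar>s - r\<bar>"] that(2) hs_0[OF T, of w] e by (cases "s = r") (auto simp: dist_norm)
    then show ?thesis using hs_modulus[OF T, of r s w] r that(1) by (simp add: dist_norm)
  qed
  with d(1) show "\<exists>d>0. \<forall>s\<in>{0..}. dist s r < d \<longrightarrow> dist (T s w) (T r w) < e" by blast
qed

lemma generates_shift:
  assumes T: "is_heat_semigroup T" and g: "generates T w y" and r: "0 \<le> r"
  shows "generates T (T r w) (T r y)"
proof -
  note c = hs_clinear[OF T r]
  have "((\<lambda>h. T r ((1 / h) *\<^sub>R (T h w - w))) \<longlongrightarrow> T r y) (at_right 0)"
    using g unfolding generates_def by (rule hs_tendsto[OF T r])
  moreover have "T r ((1 / h) *\<^sub>R (T h w - w)) = (1 / h) *\<^sub>R (T h (T r w) - T r w)" if "h > 0" for h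
    using hs_add[OF T r, of h w] hs_add[OF T _ r, of h w] that
    by (simp add: bounded_clinear_scaleR[OF c] bounded_clinear_diff[OF c] add.commute)
  ultimately show ?thesis
    unfolding generates_def by (auto elim!: Lim_transform_eventually simp: eventually_at_filter)
qed

text \<open>
  The generator of a symmetric semigroup is symmetric, as a limit of symmetric difference quotients.
\<close>

lemma generates_symmetric:
  assumes T: "is_heat_semigroup T" and a: "generates T a y" and b: "generates T b z"
  shows "cinner y b = cinner a z"
proof (rule tendsto_unique[OF trivial_limit_at_right_real])
  show "((\<lambda>h. cinner ((1 / h) *\<^sub>R (T h a - a)) b) \<longlongrightarrow> cinner y b) (at_right 0)"
    using a unfolding generates_def by (intro tendsto_cinner tendsto_const)
  have "((\<lambda>h. cinner a ((1 / h) *\<^sub>R (T h b - b))) \<longlongrightarrow> cinner a z) (at_right 0)"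
    using b unfolding generates_def by (intro tendsto_cinner tendsto_const)
  moreover have "cinner a ((1 / h) *\<^sub>R (T h b - b)) = cinner ((1 / h) *\<^sub>R (T h a - a)) b" if "h > 0" for h
    using hs_sym[OF T, of h a b] that by (simp add: scaleR_scaleC cinner_diff_left cinner_diff_right)
  ultimately show "((\<lambda>h. cinner ((1 / h) *\<^sub>R (T h a - a)) b) \<longlongrightarrow> cinner a z) (at_right 0)"
    by (auto elim!: Lim_transform_eventually simp: eventually_at_filter)
qed

lemma generates_vector_derivative:
  assumes T: "is_heat_semigroup T" and g: "generates T w y" and r: "r > 0"
  shows "((\<lambda>r. T r w) has_vector_derivative T r y) (at r)"
  unfolding has_vector_derivative_quotient
proof (rule filterlim_split_at)
  have r0: "0 \<le> r" using r by simp
  have q: "((\<lambda>h. (1 / h) *\<^sub>R (T h w - w)) \<longlongrightarrow> y) (at_right 0)" using g by (simp add: generates_def)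
  have "((\<lambda>h. T r ((1 / h) *\<^sub>R (T h w - w))) \<longlongrightarrow> T r y) (at_right 0)"
    by (rule hs_tendsto[OF T r0 q])
  moreover have "T r ((1 / h) *\<^sub>R (T h w - w)) = (T (r + h) w - T r w) /\<^sub>R h" if "h > 0" for h
    using hs_add[OF T r0, of h w] that
    by (simp add: bounded_clinear_scaleR[OF hs_clinear[OF T r0]] bounded_clinear_diff[OF hs_clinear[OF T r0]] inverse_eq_divide)
  ultimately show "((\<lambda>h. (T (r + h) w - T r w) /\<^sub>R h) \<longlongrightarrow> T r y) (at_right 0)"
    by (auto elim!: Lim_transform_eventually simp: eventually_at_filter)
  have "((\<lambda>h. (T (r + - h) w - T r w) /\<^sub>R (- h)) \<longlongrightarrow> T r y) (at_right 0)"
  proof (rule LIM_zero_cancel, rule Lim_null_comparison)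
    have "((\<lambda>h. norm ((1 / h) *\<^sub>R (T h w - w) - T h y)) \<longlongrightarrow> norm (y - y)) (at_right 0)"
      by (intro tendsto_intros q hs_lim[OF T])
    then show "((\<lambda>h. norm ((1 / h) *\<^sub>R (T h w - w) - T h y)) \<longlongrightarrow> 0) (at_right 0)" by simp
    have "norm ((T (r + - h) w - T r w) /\<^sub>R (- h) - T r y) \<le> norm ((1 / h) *\<^sub>R (T h w - w) - T h y)" if h: "0 < h" "h < r" for h
    proof -
      have rh: "0 \<le> r - h" and h0: "0 \<le> h" using h by auto
      note c = hs_clinear[OF T rh]
      have "T r u = T (r - h) (T h u)" for u using hs_add[OF T rh h0, of u] by simp
      then have "(T (r + - h) w - T r w) /\<^sub>R (- h) - T r y = T (r - h) ((1 / h) *\<^sub>R (T h w - w) - T h y)"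
        using h by (simp add: bounded_clinear_scaleR[OF c] bounded_clinear_diff[OF c] inverse_eq_divide scaleR_diff_right)
      then show ?thesis using hs_norm[OF T rh] by simp
    qed
    then show "\<forall>\<^sub>F h in at_right 0. norm ((T (r + - h) w - T r w) /\<^sub>R (- h) - T r y) \<le> norm ((1 / h) *\<^sub>R (T h w - w) - T h y)"
      unfolding eventually_at_right_field using r by blast
  qed
  then show "((\<lambda>h. (T (r + h) w - T r w) /\<^sub>R h) \<longlongrightarrow> T r y) (at_left 0)"
    by (subst filterlim_at_left_to_right) simp
qed

text \<open>
  The mean value inequality for \<open>r \<mapsto> T r w - r y\<close>.  The bound involves \<open>y\<close> only, which makes the generator closed.
\<close>

lemma generates_estimate:
  assumes T: "is_heat_semigroup T" and g: "generates T w y" and h: "h > 0"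
    and e: "\<And>r. 0 < r \<Longrightarrow> r < h \<Longrightarrow> norm (T r y - y) \<le> e"
  shows "norm (T h w - w - h *\<^sub>R y) \<le> h * e"
proof -
  define G where "G = (\<lambda>r. T r w - r *\<^sub>R y)"
  have "continuous_on {0..h} G"
    unfolding G_def by (intro continuous_intros continuous_on_subset[OF hs_continuous[OF T]]) auto
  moreover have "(G has_derivative (\<lambda>d. d *\<^sub>R (T r y - y))) (at r)" if "0 < r" for r
  proof -
    have "(G has_vector_derivative T r y - 1 *\<^sub>R y) (at r)"
      unfolding G_def
      by (intro has_vector_derivative_diff generates_vector_derivative[OF T g that]) (auto intro!: derivative_eq_intros)
    then show ?thesis by (simp add: has_vector_derivative_def)
  qed
  ultimately obtain r where r: "r \<in> {0<..<h}" "norm (G h - G 0) \<le> norm ((h - 0) *\<^sub>R (T r y - y))"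
    using mvt_general[OF h, of G "\<lambda>r d. d *\<^sub>R (T r y - y)"] by auto
  have "norm ((h - 0) *\<^sub>R (T r y - y)) \<le> h * e"
    using e[of r] r(1) h by simp
  moreover have "G h - G 0 = T h w - w - h *\<^sub>R y" by (simp add: G_def hs_0[OF T])
  ultimately show ?thesis using r(2) by simp
qed

text \<open>
  The generator is closed, and on the dense range of \<open>1 - \<Delta>/2\<close> it is known; hence it is known on the whole range of
  the resolvent.
\<close>

lemma generates_res:
  assumes T: "is_heat_semigroup T"
  shows "generates T (res z) (res z - z)"
  unfolding generates_def
proof (rule tendstoI)
  fix e :: real assume e: "e > 0"
  define y where "y = res z - z"
  have "e / 2 > 0" using e by simp
  from tendstoD[OF hs_lim[OF T, of y] this] obtain d where d: "d > 0" "\<And>h. 0 < h \<Longrightarrow> h < d \<Longrightarrow> dist (T h y) y < e / 2"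
    unfolding eventually_at_right_field by auto
  have res_lin: "bounded_linear (res :: 'a phase l2 \<Rightarrow> _)"
    using res_bounded_clinear[where 'a = 'a] by (simp add: bounded_clinear_def)
  have "z \<in> closure (abs_l2 ` shifted_laplacian ` {f. test_function f})"
    unfolding shifted_laplacian_range_dense by simp
  then obtain Z where Z: "\<And>n. Z n \<in> abs_l2 ` shifted_laplacian ` {f. test_function f}" "Z \<longlonglongrightarrow> z"
    unfolding closure_sequential by blast
  define Y where "Y = (\<lambda>n. res (Z n) - Z n)"
  have Rlim: "(\<lambda>n. res (Z n)) \<longlonglongrightarrow> res z" by (rule bounded_linear.tendsto[OF res_lin Z(2)])
  have Ylim: "Y \<longlonglongrightarrow> y" unfolding Y_def y_def by (intro tendsto_diff Rlim Z)
  have gen: "generates T (res (Z n)) (Y n)" for n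
  proof -
    obtain f where f: "test_function f" "Z n = abs_l2 (shifted_laplacian f)" using Z(1)[of n] by blast
    show ?thesis
      using hs_gen[OF T f(1)] unfolding Y_def f(2) res_shifted_laplacian_diff[OF f(1)] unfolding res_shifted_laplacian[OF f(1)] .
  qed
  have main: "norm (T h (res z) - res z - h *\<^sub>R y) \<le> h * (e / 2)" if h: "0 < h" "h < d" for h
  proof -
    have h0: "0 \<le> h" using h by simp
    have est: "norm (T h (res (Z n)) - res (Z n) - h *\<^sub>R Y n) \<le> h * (e / 2 + 2 * norm (Y n - y))" for n
    proof (rule generates_estimate[OF T gen h(1)])
      fix r assume r: "0 < r" "r < h"
      then have r0: "0 \<le> r" by simp
      have "T r (Y n) - Y n = T r (Y n - y) + (T r y - y) - (Y n - y)"
        by (simp add: bounded_clinear_diff[OF hs_clinear[OF T r0]])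
      also have "norm \<dots> \<le> norm (T r (Y n - y)) + norm (T r y - y) + norm (Y n - y)"
        by (intro order_trans[OF norm_triangle_ineq4] add_right_mono norm_triangle_ineq)
      also have "\<dots> \<le> e / 2 + 2 * norm (Y n - y)"
        using hs_norm[OF T r0, of "Y n - y"] d(2)[of r] r h by (simp add: dist_norm)
      finally show "norm (T r (Y n) - Y n) \<le> e / 2 + 2 * norm (Y n - y)" .
    qed
    have l: "(\<lambda>n. norm (T h (res (Z n)) - res (Z n) - h *\<^sub>R Y n)) \<longlonglongrightarrow> norm (T h (res z) - res z - h *\<^sub>R y)"
      by (intro tendsto_intros hs_tendsto[OF T h0] Rlim Ylim)
    have "(\<lambda>n. h * (e / 2 + 2 * norm (Y n - y))) \<longlonglongrightarrow> h * (e / 2 + 2 * norm (y - y))"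
      by (intro tendsto_intros Ylim)
    then have "(\<lambda>n. h * (e / 2 + 2 * norm (Y n - y))) \<longlonglongrightarrow> h * (e / 2)" by simp
    from LIMSEQ_le[OF l this] est show ?thesis by blast
  qed
  have "dist ((1 / h) *\<^sub>R (T h (res z) - res z)) y < e" if h: "0 < h" "h < d" for h
  proof -
    have "(1 / h) *\<^sub>R (T h (res z) - res z) - y = (1 / h) *\<^sub>R (T h (res z) - res z - h *\<^sub>R y)"
      using h by (simp add: scaleR_diff_right)
    then have "norm ((1 / h) *\<^sub>R (T h (res z) - res z) - y) = (1 / h) * norm (T h (res z) - res z - h *\<^sub>R y)"
      using h by simp
    also have "\<dots> \<le> (1 / h) * (h * (e / 2))" using h by (intro mult_left_mono main) simp_all
    finally have "norm ((1 / h) *\<^sub>R (T h (res z) - res z) - y) \<le> e / 2" using h by simp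
    then show ?thesis using e by (simp add: dist_norm)
  qed
  then show "\<forall>\<^sub>F h in at_right 0. dist ((1 / h) *\<^sub>R (T h (res z) - res z)) (res z - z) < e"
    unfolding eventually_at_right_field y_def[symmetric] using d(1) by blast
qed

text \<open>
  For \<open>u\<close> and \<open>w\<close> in the domain, the derivative of \<open>s \<mapsto> \<langle>T\<^bsub>t-s\<^esub> u, S\<^bsub>s\<^esub> w\<rangle>\<close> vanishes because the generator of \<open>T\<close> is
  symmetric and agrees with that of the Gaussian semigroup \<open>S\<close> at \<open>S\<^bsub>s\<^esub> w\<close>, which stays in the range of the resolvent.
\<close>

lemma heat_semigroup_unique:
  assumes T: "is_heat_semigroup T" and t: "0 \<le> t"
  shows "T t = gauss_semigroup t"
proof (cases "t = 0")
  case True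
  show ?thesis by (rule ext) (simp only: True hs_0[OF T] hs_0[OF gauss_is_heat_semigroup])
next
  case False
  with t have t0: "t > 0" by simp
  let ?S = "gauss_semigroup :: real \<Rightarrow> 'a phase l2 \<Rightarrow> 'a phase l2"
  note S = gauss_is_heat_semigroup[where 'a = 'a]
  have eq: "cinner u (T t w) = cinner u (?S t w)" if uw: "u \<in> tests_l2" "w \<in> tests_l2" for u w
  proof -
    have "\<exists>z. v = res z" if "v \<in> tests_l2" for v :: "'a phase l2"
      using that res_shifted_laplacian unfolding tests_l2_def by (metis (mono_tags, lifting) imageE mem_Collect_eq)
    then obtain zu zw where z: "u = res zu" "w = res zw" using uw by metis
    define yu yw where "yu = u - zu" and "yw = w - zw"
    have gu: "generates T u yu" and gw: "generates ?S w yw"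
      using generates_res[OF T, of zu] generates_res[OF S, of zw] by (simp_all add: yu_def yw_def z)
    define \<phi> where "\<phi> = (\<lambda>s. cinner (T (t - s) u) (?S s w))"
    have "continuous_on {0..t} \<phi>"
      unfolding \<phi>_def
      by (intro bounded_bilinear.continuous_on[OF bounded_bilinear_cinner] continuous_on_subset[OF hs_continuous[OF S]]
          continuous_on_compose2[OF hs_continuous[OF T]] continuous_intros) auto
    moreover have "(\<phi> has_derivative (\<lambda>d. 0)) (at s)" if s: "0 < s" "s < t" for s
    proof -
      have ts: "t - s > 0" "t - s \<ge> 0" and s0: "0 \<le> s" using s by auto
      have "((\<lambda>s. t - s) has_vector_derivative - 1) (at s)"
        by (auto intro!: derivative_eq_intros)
      from vector_diff_chain_at[OF this generates_vector_derivative[OF T gu ts(1)]]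
      have dT: "((\<lambda>s. T (t - s) u) has_vector_derivative - T (t - s) yu) (at s)" by (simp add: comp_def)
      from bounded_bilinear.has_vector_derivative[OF bounded_bilinear_cinner dT generates_vector_derivative[OF S gw s(1)]]
      have d: "(\<phi> has_vector_derivative cinner (T (t - s) u) (?S s yw) + cinner (- T (t - s) yu) (?S s w)) (at s)"
        by (simp add: \<phi>_def)
      have "generates T (?S s w) (?S s yw)"
        using generates_res[OF T, of "?S s zw"]
        by (simp add: z yw_def gauss_semigroup_res[OF s0] bounded_clinear_diff[OF hs_clinear[OF S s0]])
      from generates_symmetric[OF T generates_shift[OF T gu ts(2)] this]
      have "cinner (T (t - s) u) (?S s yw) + cinner (- T (t - s) yu) (?S s w) = 0" by simp
      with d show ?thesis by (simp add: has_vector_derivative_def)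
    qed
    ultimately obtain s where "norm (\<phi> t - \<phi> 0) \<le> norm (0 :: complex)"
      using mvt_general[OF t0, of \<phi> "\<lambda>s d. 0"] by auto
    then have "\<phi> t = \<phi> 0" by simp
    then show ?thesis by (simp add: \<phi>_def hs_0[OF T] hs_0[OF S] hs_sym[OF T t])
  qed
  show ?thesis
  proof (rule bounded_clinear_eq_on_dense[OF hs_clinear[OF T t] hs_clinear[OF S t] tests_dense])
    fix w :: "'a phase l2" assume w: "w \<in> tests_l2"
    have "T t w - ?S t w = 0"
      by (rule cinner_tests_eq_0) (use eq[OF _ w] in \<open>auto simp: cinner_diff_right tests_l2_def\<close>)
    then show "T t w = ?S t w" by simp
  qed
qed

lemma heat_eq_gauss_semigroup:
  assumes "0 \<le> t"
  shows "heat t = gauss_semigroup t"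
proof -
  have "is_heat_semigroup heat"
    unfolding heat_def by (rule someI[of is_heat_semigroup, OF gauss_is_heat_semigroup])
  then show ?thesis using assms by (rule heat_semigroup_unique)
qed

section \<open>Operators with square integrable kernels\<close>

definition l2_kernel :: "('b::euclidean_space \<times> 'a::euclidean_space \<Rightarrow> complex) \<Rightarrow> bool" where
  "l2_kernel \<kappa> \<longleftrightarrow> \<kappa> \<in> borel_measurable (borel \<Otimes>\<^sub>M borel) \<and> integrable (lborel \<Otimes>\<^sub>M lborel) (\<lambda>p. (cmod (\<kappa> p))\<^sup>2)"

definition Kop :: "('b::euclidean_space \<times> 'a::euclidean_space \<Rightarrow> complex) \<Rightarrow> 'a l2 \<Rightarrow> 'b l2" where
  "Kop \<kappa> u = abs_l2 (\<lambda>y. \<integral>x. \<kappa> (y, x) * rep_l2 u x \<partial>lborel)"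

text \<open>
  The rows are conjugated because \<open>cinner\<close> is antilinear on the left; \<open>Kop \<kappa> u\<close> at \<open>y\<close> is then \<open>cinner (krow \<kappa> y) u\<close>.
\<close>

definition krow :: "('b::euclidean_space \<times> 'a::euclidean_space \<Rightarrow> complex) \<Rightarrow> 'b \<Rightarrow> 'a l2" where
  "krow \<kappa> y = abs_l2 (\<lambda>x. cnj (\<kappa> (y, x)))"

lemma l2_kernel_measurable: "l2_kernel \<kappa> \<Longrightarrow> \<kappa> \<in> borel_measurable (borel \<Otimes>\<^sub>M borel)"
  by (simp add: l2_kernel_def)

lemma AE_square_integrable_row:
  assumes k: "l2_kernel \<kappa>"
  shows "AE y in lborel. square_integrable (\<lambda>x. cnj (\<kappa> (y, x)))"
proof -
  note [measurable] = l2_kernel_measurable[OF k]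
  have "AE y in lborel. integrable lborel (\<lambda>x. (cmod (\<kappa> (y, x)))\<^sup>2)"
    using k lborel_pair.AE_integrable_fst'[of "\<lambda>p. (cmod (\<kappa> p))\<^sup>2"] by (simp add: l2_kernel_def)
  then show ?thesis
    by eventually_elim (simp add: square_integrable_def)
qed

lemma cinner_krow:
  assumes "square_integrable (\<lambda>x. cnj (\<kappa> (y, x)))"
  shows "cinner (krow \<kappa> y) u = (\<integral>x. \<kappa> (y, x) * rep_l2 u x \<partial>lborel)"
    and "(norm (krow \<kappa> y))\<^sup>2 = (\<integral>x. (cmod (\<kappa> (y, x)))\<^sup>2 \<partial>lborel)"
  unfolding krow_def
  using cinner_abs[OF assms square_integrable_rep, of u] norm_abs_l2[OF assms] by simp_all

lemma Kop_square_integrable: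
  assumes k: "l2_kernel \<kappa>"
  shows "square_integrable (\<lambda>y. \<integral>x. \<kappa> (y, x) * rep_l2 u x \<partial>lborel)"
    and "(norm (Kop \<kappa> u))\<^sup>2 \<le> (\<integral>p. (cmod (\<kappa> p))\<^sup>2 \<partial>(lborel \<Otimes>\<^sub>M lborel)) * (norm u)\<^sup>2"
proof -
  note [measurable] = l2_kernel_measurable[OF k]
  have ki: "integrable (lborel \<Otimes>\<^sub>M lborel) (\<lambda>p. (cmod (\<kappa> p))\<^sup>2)" using k by (simp add: l2_kernel_def)
  have i: "integrable lborel (\<lambda>y. (\<integral>x. (cmod (\<kappa> (y, x)))\<^sup>2 \<partial>lborel) * (norm u)\<^sup>2)"
    using lborel_pair.integrable_fst'[OF ki] by (intro integrable_mult_left)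
  have le: "AE y in lborel. (cmod (\<integral>x. \<kappa> (y, x) * rep_l2 u x \<partial>lborel))\<^sup>2 \<le> (\<integral>x. (cmod (\<kappa> (y, x)))\<^sup>2 \<partial>lborel) * (norm u)\<^sup>2"
    using AE_square_integrable_row[OF k]
  proof eventually_elim
    case (elim y)
    have "cmod (cinner (krow \<kappa> y) u) \<le> norm (krow \<kappa> y) * norm u" by (rule cmod_cinner_le)
    from power_mono[OF this norm_ge_zero, of 2] show ?case
      by (simp add: cinner_krow[OF elim] power_mult_distrib)
  qed
  have m: "(\<lambda>y. \<integral>x. \<kappa> (y, x) * rep_l2 u x \<partial>lborel) \<in> borel_measurable borel" by measurable
  have i2: "integrable lborel (\<lambda>y. (cmod (\<integral>x. \<kappa> (y, x) * rep_l2 u x \<partial>lborel))\<^sup>2)"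
    by (rule Bochner_Integration.integrable_bound[OF i]) (use m le in \<open>auto elim!: AE_mp intro!: AE_I2\<close>)
  then show sq: "square_integrable (\<lambda>y. \<integral>x. \<kappa> (y, x) * rep_l2 u x \<partial>lborel)"
    using m by (simp add: square_integrable_def)
  have "(norm (Kop \<kappa> u))\<^sup>2 \<le> (\<integral>y. (\<integral>x. (cmod (\<kappa> (y, x)))\<^sup>2 \<partial>lborel) * (norm u)\<^sup>2 \<partial>lborel)"
    unfolding Kop_def norm_abs_l2[OF sq] by (rule integral_mono_AE[OF i2 i le])
  also have "\<dots> = (\<integral>p. (cmod (\<kappa> p))\<^sup>2 \<partial>(lborel \<Otimes>\<^sub>M lborel)) * (norm u)\<^sup>2"
    using lborel_pair.integral_fst'[OF ki] by simp
  finally show "(norm (Kop \<kappa> u))\<^sup>2 \<le> (\<integral>p. (cmod (\<kappa> p))\<^sup>2 \<partial>(lborel \<Otimes>\<^sub>M lborel)) * (norm u)\<^sup>2" .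
qed

lemma Kop_bounded_clinear:
  assumes k: "l2_kernel \<kappa>"
  shows "bounded_clinear (Kop \<kappa>)"
proof (rule bounded_clinearI[where K = "sqrt (\<integral>p. (cmod (\<kappa> p))\<^sup>2 \<partial>(lborel \<Otimes>\<^sub>M lborel))"])
  fix u v c
  note sq = Kop_square_integrable(1)[OF k]
  show "Kop \<kappa> (u + v) = Kop \<kappa> u + Kop \<kappa> v"
    unfolding Kop_def abs_l2_add[OF sq sq]
  proof (rule abs_l2_eqI[OF sq square_integrable_add[OF sq sq]])
    show "AE y in lborel. (\<integral>x. \<kappa> (y, x) * rep_l2 (u + v) x \<partial>lborel) = (\<integral>x. \<kappa> (y, x) * rep_l2 u x \<partial>lborel) + (\<integral>x. \<kappa> (y, x) * rep_l2 v x \<partial>lborel)"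
      using AE_square_integrable_row[OF k]
      by eventually_elim (simp only: cinner_krow(1)[symmetric] cinner_add_right)
  qed
  show "Kop \<kappa> (c *\<^sub>C u) = c *\<^sub>C Kop \<kappa> u"
    unfolding Kop_def abs_l2_scaleC[OF sq]
  proof (rule abs_l2_eqI[OF sq square_integrable_scale[OF sq]])
    show "AE y in lborel. (\<integral>x. \<kappa> (y, x) * rep_l2 (c *\<^sub>C u) x \<partial>lborel) = c * (\<integral>x. \<kappa> (y, x) * rep_l2 u x \<partial>lborel)"
      using AE_square_integrable_row[OF k]
      by eventually_elim (simp only: cinner_krow(1)[symmetric] cinner_scaleC_right)
  qed
  have "sqrt ((norm (Kop \<kappa> u))\<^sup>2) \<le> sqrt ((\<integral>p. (cmod (\<kappa> p))\<^sup>2 \<partial>(lborel \<Otimes>\<^sub>M lborel)) * (norm u)\<^sup>2)"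
    by (rule real_sqrt_le_mono[OF Kop_square_integrable(2)[OF k]])
  then show "norm (Kop \<kappa> u) \<le> sqrt (\<integral>p. (cmod (\<kappa> p))\<^sup>2 \<partial>(lborel \<Otimes>\<^sub>M lborel)) * norm u"
    by (simp add: real_sqrt_mult)
qed

lemma cmod_cinner_commute: "cmod (cinner u v) = cmod (cinner v u)"
  by (subst cinner_commute) simp

text \<open>Bessel's inequality in the second variable of the kernel, integrated over the first.\<close>

lemma Kop_summable:
  assumes k: "l2_kernel \<kappa>" and E: "orthonormal E"
  shows "(\<lambda>e. (norm (Kop \<kappa> e))\<^sup>2) summable_on E"
proof (rule nonneg_bdd_above_summable_on)
  have ki: "integrable (lborel \<Otimes>\<^sub>M lborel) (\<lambda>p. (cmod (\<kappa> p))\<^sup>2)" using k by (simp add: l2_kernel_def)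
  note sq = Kop_square_integrable(1)[OF k]
  have "(\<Sum>e\<in>F. (norm (Kop \<kappa> e))\<^sup>2) \<le> (\<integral>p. (cmod (\<kappa> p))\<^sup>2 \<partial>(lborel \<Otimes>\<^sub>M lborel))" if F: "finite F" "F \<subseteq> E" for F
  proof -
    have i: "integrable lborel (\<lambda>y. (cmod (\<integral>x. \<kappa> (y, x) * rep_l2 e x \<partial>lborel))\<^sup>2)" for e
      using sq[of e] by (simp add: square_integrable_def)
    have "(\<Sum>e\<in>F. (norm (Kop \<kappa> e))\<^sup>2) = (\<integral>y. (\<Sum>e\<in>F. (cmod (\<integral>x. \<kappa> (y, x) * rep_l2 e x \<partial>lborel))\<^sup>2) \<partial>lborel)"
      unfolding Kop_def norm_abs_l2[OF sq] by (rule Bochner_Integration.integral_sum[symmetric]) (rule i)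
    also have "\<dots> \<le> (\<integral>y. (\<integral>x. (cmod (\<kappa> (y, x)))\<^sup>2 \<partial>lborel) \<partial>lborel)"
    proof (rule integral_mono_AE)
      show "integrable lborel (\<lambda>y. \<Sum>e\<in>F. (cmod (\<integral>x. \<kappa> (y, x) * rep_l2 e x \<partial>lborel))\<^sup>2)"
        by (intro Bochner_Integration.integrable_sum i)
      show "integrable lborel (\<lambda>y. \<integral>x. (cmod (\<kappa> (y, x)))\<^sup>2 \<partial>lborel)" by (rule lborel_pair.integrable_fst'[OF ki])
      show "AE y in lborel. (\<Sum>e\<in>F. (cmod (\<integral>x. \<kappa> (y, x) * rep_l2 e x \<partial>lborel))\<^sup>2) \<le> (\<integral>x. (cmod (\<kappa> (y, x)))\<^sup>2 \<partial>lborel)"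
        using AE_square_integrable_row[OF k]
      proof eventually_elim
        case (elim y)
        have "(\<Sum>e\<in>F. (cmod (cinner e (krow \<kappa> y)))\<^sup>2) \<le> (norm (krow \<kappa> y))\<^sup>2" by (rule bessel[OF E F])
        then show ?case
          by (simp only: cmod_cinner_commute[of _ "krow \<kappa> y"] cinner_krow[OF elim])
      qed
    qed
    also have "\<dots> = (\<integral>p. (cmod (\<kappa> p))\<^sup>2 \<partial>(lborel \<Otimes>\<^sub>M lborel))" by (rule lborel_pair.integral_fst'[OF ki])
    finally show ?thesis .
  qed
  then show "bdd_above (sum (\<lambda>e. (norm (Kop \<kappa> e))\<^sup>2) ` {F. F \<subseteq> E \<and> finite F})"
    by (intro bdd_aboveI2[where M = "\<integral>p. (cmod (\<kappa> p))\<^sup>2 \<partial>(lborel \<Otimes>\<^sub>M lborel)"]) simp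
qed simp

text \<open>
  Dominated convergence is about sequences, unconditional sums about nets; for countable sets this sequence is cofinal.
\<close>

lemma exhausting_finite_subsets:
  assumes "countable E"
  shows "finite {e \<in> E. to_nat_on E e < n}"
    and "filterlim (\<lambda>n. {e \<in> E. to_nat_on E e < n}) (finite_subsets_at_top E) sequentially"
proof -
  have "inj_on (to_nat_on E) {e \<in> E. to_nat_on E e < n}" for n
    by (rule inj_on_subset[OF inj_on_to_nat_on[OF assms]]) auto
  then show fin: "finite {e \<in> E. to_nat_on E e < n}" for n
    by (rule inj_on_finite[of _ _ "{..<n}"]) auto
  show "filterlim (\<lambda>n. {e \<in> E. to_nat_on E e < n}) (finite_subsets_at_top E) sequentially"
    unfolding filterlim_iff eventually_finite_subsets_at_top
  proof (intro allI impI)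
    fix P assume "\<exists>X. finite X \<and> X \<subseteq> E \<and> (\<forall>Y. finite Y \<and> X \<subseteq> Y \<and> Y \<subseteq> E \<longrightarrow> P Y)"
    then obtain X where X: "finite X" "X \<subseteq> E" "\<forall>Y. finite Y \<and> X \<subseteq> Y \<and> Y \<subseteq> E \<longrightarrow> P Y"
      by (elim exE conjE) (rule that)
    have "P {e \<in> E. to_nat_on E e < n}" if "Suc (Max (to_nat_on E ` X)) \<le> n" for n
    proof (rule X(3)[rule_format], intro conjI fin)
      show "X \<subseteq> {e \<in> E. to_nat_on E e < n}"
      proof
        fix e assume e: "e \<in> X"
        then have "to_nat_on E e \<le> Max (to_nat_on E ` X)" using X(1) by simp
        then show "e \<in> {e \<in> E. to_nat_on E e < n}" using e X(2) that by auto
      qed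
    qed auto
    then show "\<forall>\<^sub>F n in sequentially. P {e \<in> E. to_nat_on E e < n}"
      unfolding eventually_sequentially by blast
  qed
qed

text \<open>
  For almost every \<open>y\<close> the summands are those of Parseval's identity for the rows at \<open>y\<close>, and Bessel's inequality
  dominates the partial sums, so that the sum and the integral over \<open>y\<close> can be exchanged.
\<close>

lemma Kop_trace_pairing:
  assumes k1: "l2_kernel \<kappa>\<^sub>1" and k2: "l2_kernel \<kappa>\<^sub>2" and E: "onb E" "countable E"
  shows "((\<lambda>e. cinner (Kop \<kappa>\<^sub>1 e) (Kop \<kappa>\<^sub>2 e)) has_sum (\<integral>y. (\<integral>x. cnj (\<kappa>\<^sub>1 (y, x)) * \<kappa>\<^sub>2 (y, x) \<partial>lborel) \<partial>lborel)) E"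
proof -
  note o = onb_orthonormal[OF E(1)]
  note [measurable] = l2_kernel_measurable[OF k1] l2_kernel_measurable[OF k2]
  have ki: "integrable (lborel \<Otimes>\<^sub>M lborel) (\<lambda>p. (cmod (\<kappa>\<^sub>1 p))\<^sup>2)" "integrable (lborel \<Otimes>\<^sub>M lborel) (\<lambda>p. (cmod (\<kappa>\<^sub>2 p))\<^sup>2)"
    using k1 k2 by (simp_all add: l2_kernel_def)
  define t where "t = (\<lambda>e. cinner (Kop \<kappa>\<^sub>1 e) (Kop \<kappa>\<^sub>2 e))"
  have amgm: "a * b \<le> a\<^sup>2 + b\<^sup>2" if "0 \<le> a" "0 \<le> b" for a b :: real
    using sum_squares_bound[of a b] mult_nonneg_nonneg[OF that] by linarith
  have "(\<lambda>e. norm (t e)) summable_on E"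
  proof (rule summable_on_comparison_test)
    show "(\<lambda>e. (norm (Kop \<kappa>\<^sub>1 e))\<^sup>2 + (norm (Kop \<kappa>\<^sub>2 e))\<^sup>2) summable_on E"
      by (intro summable_on_add Kop_summable k1 k2 o)
    show "norm (t e) \<le> (norm (Kop \<kappa>\<^sub>1 e))\<^sup>2 + (norm (Kop \<kappa>\<^sub>2 e))\<^sup>2" for e
      unfolding t_def by (rule order_trans[OF cmod_cinner_le amgm]) simp_all
    show "0 \<le> norm (t e)" for e by simp
  qed
  then have hs: "(t has_sum infsum t E) E"
    by (rule has_sum_infsum[OF abs_summable_summable])
  define F where "F = (\<lambda>n. {e \<in> E. to_nat_on E e < n})"
  have Ff: "finite (F n)" "F n \<subseteq> E" for n
    unfolding F_def by (rule exhausting_finite_subsets(1)[OF E(2)], rule Collect_restrict)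
  have Flim: "filterlim F (finite_subsets_at_top E) sequentially"
    unfolding F_def by (rule exhausting_finite_subsets(2)[OF E(2)])
  have lim1: "(\<lambda>n. \<Sum>e\<in>F n. t e) \<longlonglongrightarrow> infsum t E"
    using hs unfolding has_sum_def by (rule filterlim_compose[OF _ Flim])
  define s where "s = (\<lambda>e y. cnj (\<integral>x. \<kappa>\<^sub>1 (y, x) * rep_l2 e x \<partial>lborel) * (\<integral>x. \<kappa>\<^sub>2 (y, x) * rep_l2 e x \<partial>lborel))"
  have s_eq: "s e y = cinner (krow \<kappa>\<^sub>2 y) e * cinner e (krow \<kappa>\<^sub>1 y)"
    if "square_integrable (\<lambda>x. cnj (\<kappa>\<^sub>1 (y, x)))" "square_integrable (\<lambda>x. cnj (\<kappa>\<^sub>2 (y, x)))" for e y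
    using cinner_krow(1)[OF that(1), of e] cinner_krow(1)[OF that(2), of e] cinner_commute[of e "krow \<kappa>\<^sub>1 y"]
    by (simp add: s_def)
  have si: "integrable lborel (s e)" and t_eq: "t e = (\<integral>y. s e y \<partial>lborel)" for e
    unfolding s_def t_def Kop_def
    by (rule square_integrable_inner cinner_abs; rule Kop_square_integrable(1)[OF k1] Kop_square_integrable(1)[OF k2])+
  have lim2: "(\<lambda>n. \<integral>y. (\<Sum>e\<in>F n. s e y) \<partial>lborel) \<longlonglongrightarrow> (\<integral>y. (\<integral>x. cnj (\<kappa>\<^sub>1 (y, x)) * \<kappa>\<^sub>2 (y, x) \<partial>lborel) \<partial>lborel)"
  proof (rule integral_dominated_convergence[where w = "\<lambda>y. (\<integral>x. (cmod (\<kappa>\<^sub>1 (y, x)))\<^sup>2 \<partial>lborel) + (\<integral>x. (cmod (\<kappa>\<^sub>2 (y, x)))\<^sup>2 \<partial>lborel)"])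
    show "integrable lborel (\<lambda>y. (\<integral>x. (cmod (\<kappa>\<^sub>1 (y, x)))\<^sup>2 \<partial>lborel) + (\<integral>x. (cmod (\<kappa>\<^sub>2 (y, x)))\<^sup>2 \<partial>lborel))"
      using lborel_pair.integrable_fst'[OF ki(1)] lborel_pair.integrable_fst'[OF ki(2)]
      by (rule Bochner_Integration.integrable_add)
    show "AE y in lborel. (\<lambda>n. \<Sum>e\<in>F n. s e y) \<longlonglongrightarrow> (\<integral>x. cnj (\<kappa>\<^sub>1 (y, x)) * \<kappa>\<^sub>2 (y, x) \<partial>lborel)"
      using AE_square_integrable_row[OF k1] AE_square_integrable_row[OF k2]
    proof eventually_elim
      case (elim y)
      have "((\<lambda>e. s e y) has_sum cinner (krow \<kappa>\<^sub>2 y) (krow \<kappa>\<^sub>1 y)) E"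
        unfolding s_eq[OF elim] by (rule parseval[OF E(1)])
      then have "(\<lambda>n. \<Sum>e\<in>F n. s e y) \<longlonglongrightarrow> cinner (krow \<kappa>\<^sub>2 y) (krow \<kappa>\<^sub>1 y)"
        unfolding has_sum_def by (rule filterlim_compose[OF _ Flim])
      moreover have "cinner (krow \<kappa>\<^sub>2 y) (krow \<kappa>\<^sub>1 y) = (\<integral>x. cnj (\<kappa>\<^sub>1 (y, x)) * \<kappa>\<^sub>2 (y, x) \<partial>lborel)"
        unfolding krow_def cinner_abs[OF elim(2) elim(1)] by (simp add: mult.commute)
      ultimately show ?case by simp
    qed
    show "AE y in lborel. norm (\<Sum>e\<in>F n. s e y) \<le> (\<integral>x. (cmod (\<kappa>\<^sub>1 (y, x)))\<^sup>2 \<partial>lborel) + (\<integral>x. (cmod (\<kappa>\<^sub>2 (y, x)))\<^sup>2 \<partial>lborel)" for n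
      using AE_square_integrable_row[OF k1] AE_square_integrable_row[OF k2]
    proof eventually_elim
      case (elim y)
      have "norm (\<Sum>e\<in>F n. s e y) \<le> (\<Sum>e\<in>F n. (cmod (cinner e (krow \<kappa>\<^sub>1 y)))\<^sup>2 + (cmod (cinner e (krow \<kappa>\<^sub>2 y)))\<^sup>2)"
      proof (rule sum_norm_le)
        fix e
        have "norm (s e y) = cmod (cinner e (krow \<kappa>\<^sub>1 y)) * cmod (cinner e (krow \<kappa>\<^sub>2 y))"
          unfolding s_eq[OF elim] norm_mult by (simp add: cmod_cinner_commute[of e "krow \<kappa>\<^sub>2 y"])
        also have "\<dots> \<le> (cmod (cinner e (krow \<kappa>\<^sub>1 y)))\<^sup>2 + (cmod (cinner e (krow \<kappa>\<^sub>2 y)))\<^sup>2"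
          by (rule amgm) simp_all
        finally show "norm (s e y) \<le> (cmod (cinner e (krow \<kappa>\<^sub>1 y)))\<^sup>2 + (cmod (cinner e (krow \<kappa>\<^sub>2 y)))\<^sup>2" .
      qed
      also have "\<dots> \<le> (norm (krow \<kappa>\<^sub>1 y))\<^sup>2 + (norm (krow \<kappa>\<^sub>2 y))\<^sup>2"
        unfolding sum.distrib by (intro add_mono bessel[OF o] Ff)
      finally show ?case by (simp only: cinner_krow(2)[OF elim(1)] cinner_krow(2)[OF elim(2)])
    qed
    show "(\<lambda>y. \<Sum>e\<in>F n. s e y) \<in> borel_measurable lborel" for n
      using si by (intro borel_measurable_sum) (auto intro: borel_measurable_integrable)
  qed measurable
  have "(\<Sum>e\<in>F n. t e) = (\<integral>y. (\<Sum>e\<in>F n. s e y) \<partial>lborel)" for n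
    unfolding t_eq by (rule Bochner_Integration.integral_sum[symmetric]) (rule si)
  with lim1 lim2 have "infsum t E = (\<integral>y. (\<integral>x. cnj (\<kappa>\<^sub>1 (y, x)) * \<kappa>\<^sub>2 (y, x) \<partial>lborel) \<partial>lborel)"
    by (simp add: LIMSEQ_unique)
  with hs show ?thesis by (simp add: t_def)
qed

section \<open>Symbols of the iterated commutators\<close>

lemma mult_le_exp_quadratic:
  fixes t N s :: real
  assumes "t > 0"
  shows "N * s \<le> N\<^sup>2 / t + t * s\<^sup>2 / 4"
proof -
  have "0 \<le> (N - t * s / 2)\<^sup>2" by simp
  also have "\<dots> = t * (N\<^sup>2 / t + t * s\<^sup>2 / 4 - N * s)"
    using assms by (simp add: power2_eq_square field_simps)
  finally show ?thesis using assms by (simp add: zero_le_mult_iff)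
qed

lemma exp_mult_gauss_le:
  assumes "t > 0"
  shows "exp (a + N * norm x) * gauss t x \<le> exp (a + N\<^sup>2 / t) * gauss (t / 2) x"
proof -
  have "a + N * norm x + - t * (norm x)\<^sup>2 / 2 \<le> a + N\<^sup>2 / t + - (t / 2) * (norm x)\<^sup>2 / 2"
    using mult_le_exp_quadratic[OF assms, of N "norm x"] by simp
  then show ?thesis unfolding gauss_def exp_add[symmetric] by simp
qed

lemma gauss_square_integrable:
  assumes "t > 0"
  shows "square_integrable (\<lambda>x::'a::euclidean_space. complex_of_real (gauss t x))"
proof -
  have "(gauss t x)\<^sup>2 = exp (- (2 * t) * (norm x)\<^sup>2 / 2)" for x :: 'a
    by (simp add: gauss_def power2_eq_square exp_add[symmetric])
  then show ?thesis
    using gaussian_integral(1)[of "2 * t", where 'a = 'a] assms by (simp add: square_integrable_def)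
qed

lemma norm_rot [simp]: "norm (rot x) = norm x"
  by (simp add: norm_eq_sqrt_inner rot_def inner_prod_def add.commute)

text \<open>
  The symbols that arise when powers of \<open>1 - \<Delta>\<close> are commuted with left multiplication by a test function, on a plane
  wave of frequency \<open>x\<close>: polynomials in \<open>x\<close> with test functions of \<open>y\<close> as coefficients.
\<close>

inductive polytest :: "('n::finite phase \<times> 'n phase \<Rightarrow> complex) \<Rightarrow> bool" where
  test: "test_function g \<Longrightarrow> polytest (\<lambda>p. g (fst p))"
| coord: "polytest h \<Longrightarrow> polytest (\<lambda>p. complex_of_real (snd p \<bullet> j) * h p)"
| scale: "polytest h \<Longrightarrow> polytest (\<lambda>p. c * h p)"
| add: "polytest h \<Longrightarrow> polytest h' \<Longrightarrow> polytest (\<lambda>p. h p + h' p)"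

lemma polytest_sum:
  "(\<And>i. i \<in> I \<Longrightarrow> polytest (f i)) \<Longrightarrow> polytest (\<lambda>p. \<Sum>i\<in>I. f i p)"
proof (induction I rule: infinite_finite_induct)
  case (insert i I)
  then show ?case by (simp add: polytest.add)
qed (use polytest.test[OF test_function_zero] in simp_all)

lemma polytest_test_function: "polytest h \<Longrightarrow> test_function (\<lambda>y. h (y, x))"
proof (induction rule: polytest.induct)
  case (test g)
  then show ?case by simp
next
  case (coord h j)
  then show ?case by (simp add: test_function_cmult)
next
  case (scale h c)
  then show ?case by (simp add: test_function_cmult)
next
  case (add h h')
  then show ?case by (simp add: test_function_add)
qed

lemma polytest_measurable: "polytest h \<Longrightarrow> h \<in> borel_measurable (borel \<Otimes>\<^sub>M borel)"
proof (induction rule: polytest.induct)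
  case (test g)
  note [measurable] = test_function_borel[OF test]
  show ?case by measurable
next
  case (coord h j)
  note [measurable] = coord.IH
  show ?case by measurable
next
  case (scale h c)
  note [measurable] = scale.IH
  show ?case by measurable
next
  case (add h h')
  note [measurable] = add.IH
  show ?case by measurable
qed

lemma polytest_bound:
  "polytest h \<Longrightarrow> \<exists>C N R. 0 \<le> C \<and> 0 \<le> N \<and> 0 \<le> R \<and>
     (\<forall>y x. cmod (h (y, x)) \<le> C * exp (N * norm x) \<and> (h (y, x) \<noteq> 0 \<longrightarrow> norm y \<le> R))"
proof (induction rule: polytest.induct)
  case (test g)
  obtain C where C: "C > 0" "\<And>x. cmod (g x) \<le> C" using test_function_bounded[OF test] by blast
  obtain R where R: "R > 0" "\<And>x. g x \<noteq> 0 \<Longrightarrow> norm x \<le> R" using test_function_support[OF test] by blast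
  show ?case
    by (intro exI[of _ C] exI[of _ 0] exI[of _ R]) (use C R in auto)
next
  case (coord h j)
  then obtain C N R where h: "0 \<le> C" "0 \<le> N" "0 \<le> R" "\<And>y x. cmod (h (y, x)) \<le> C * exp (N * norm x)"
    "\<And>y x. h (y, x) \<noteq> 0 \<Longrightarrow> norm y \<le> R" by blast
  have "cmod (complex_of_real (x \<bullet> j) * h (y, x)) \<le> norm j * C * exp ((N + 1) * norm x)" for y x
  proof -
    have "\<bar>x \<bullet> j\<bar> \<le> norm x * norm j" by (rule Cauchy_Schwarz_ineq2)
    also have "\<dots> \<le> exp (norm x) * norm j"
      using exp_ge_add_one_self[of "norm x"] by (intro mult_right_mono) (linarith, simp)
    finally have "\<bar>x \<bullet> j\<bar> * cmod (h (y, x)) \<le> (exp (norm x) * norm j) * (C * exp (N * norm x))"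
      by (intro mult_mono h) simp_all
    also have "\<dots> = norm j * C * exp ((N + 1) * norm x)"
      by (simp add: distrib_right exp_add)
    finally show ?thesis by (simp add: norm_mult)
  qed
  then show ?case
    by (intro exI[of _ "norm j * C"] exI[of _ "N + 1"] exI[of _ R]) (use h in auto)
next
  case (scale h c)
  then obtain C N R where h: "0 \<le> C" "0 \<le> N" "0 \<le> R" "\<And>y x. cmod (h (y, x)) \<le> C * exp (N * norm x)"
    "\<And>y x. h (y, x) \<noteq> 0 \<Longrightarrow> norm y \<le> R" by blast
  have "cmod (c * h (y, x)) \<le> cmod c * C * exp (N * norm x)" for y x
    using mult_left_mono[OF h(4)[of y x], of "cmod c"] by (simp add: norm_mult mult.assoc)
  then show ?case
    by (intro exI[of _ "cmod c * C"] exI[of _ N] exI[of _ R]) (use h in auto)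
next
  case (add h h')
  from add.IH(1) obtain C N R where h: "0 \<le> C" "0 \<le> N" "0 \<le> R" "\<And>y x. cmod (h (y, x)) \<le> C * exp (N * norm x)"
    "\<And>y x. h (y, x) \<noteq> 0 \<Longrightarrow> norm y \<le> R" by blast
  from add.IH(2) obtain C' N' R' where h': "0 \<le> C'" "0 \<le> N'" "0 \<le> R'" "\<And>y x. cmod (h' (y, x)) \<le> C' * exp (N' * norm x)"
    "\<And>y x. h' (y, x) \<noteq> 0 \<Longrightarrow> norm y \<le> R'" by blast
  have "cmod (h (y, x) + h' (y, x)) \<le> (C + C') * exp ((N + N') * norm x)" for y x
  proof -
    have "C * exp (N * norm x) \<le> C * exp ((N + N') * norm x)" "C' * exp (N' * norm x) \<le> C' * exp ((N + N') * norm x)"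
      using h h' by (auto intro!: mult_left_mono mult_right_mono)
    then show ?thesis
      using norm_triangle_ineq[of "h (y, x)" "h' (y, x)"] h(4)[of y x] h'(4)[of y x] unfolding distrib_right[of C] by linarith
  qed
  moreover have "norm y \<le> max R R'" if "h (y, x) + h' (y, x) \<noteq> 0" for y x
  proof -
    have "h (y, x) \<noteq> 0 \<or> h' (y, x) \<noteq> 0" using that by auto
    then have "norm y \<le> R \<or> norm y \<le> R'" using h(5)[of y x] h'(5)[of y x] by blast
    then show ?thesis by (simp only: le_max_iff_disj)
  qed
  ultimately show ?case
    by (intro exI[of _ "C + C'"] exI[of _ "N + N'"] exI[of _ "max R R'"]) (use h h' in auto)
qed

lemma fourier_partial_deriv:
  assumes "test_function g" "j \<in> Basis"
  shows "fourier (partial_deriv j g) k = \<i> * complex_of_real (k \<bullet> j) * fourier g k"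
  unfolding fourier_eq_fts by (simp add: fts_partial_deriv[OF assms])

lemma fourier_laplacian:
  assumes "test_function g"
  shows "fourier (laplacian g) k = - complex_of_real ((norm k)\<^sup>2) * fourier g k"
  unfolding fourier_eq_fts by (rule fts_laplacian[OF assms]) simp

lemma fourier_sum:
  assumes "\<And>i. i \<in> I \<Longrightarrow> test_function (f i)"
  shows "fourier (\<lambda>x. \<Sum>i\<in>I. f i x) k = (\<Sum>i\<in>I. fourier (f i) k)"
  using assms
proof (induction I rule: infinite_finite_induct)
  case (insert i I)
  then show ?case
    by (simp add: fourier_add test_function_integrable test_function_sum)
qed (simp_all add: fourier_def)

text \<open>
  Conjugation by the plane wave of frequency \<open>x\<close> turns \<open>1 - \<Delta>\<close> into \<open>1 - \<Sum>j. (\<partial>\<^bsub>j\<^esub> + \<i> x\<^bsub>j\<^esub>)\<^sup>2\<close>, a polynomial in \<open>x\<close>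
  with derivatives as coefficients; on transforms it is multiplication by \<open>1 + \<parallel>k + x\<parallel>\<^sup>2\<close>.
\<close>

lemma polytest_one_minus_laplacian:
  "polytest h \<Longrightarrow> \<exists>h'. polytest h' \<and>
     (\<forall>x k. fourier (\<lambda>y. h' (y, x)) k = complex_of_real (1 + (norm (k + x))\<^sup>2) * fourier (\<lambda>y. h (y, x)) k)"
proof (induction rule: polytest.induct)
  case (test g)
  define h' where "h' = (\<lambda>p. g (fst p) + ((- 1) * laplacian g (fst p) +
     ((\<Sum>j\<in>Basis. (- 2 * \<i>) * (complex_of_real (snd p \<bullet> j) * partial_deriv j g (fst p)))
      + (\<Sum>j\<in>Basis. complex_of_real (snd p \<bullet> j) * (complex_of_real (snd p \<bullet> j) * g (fst p))))))"
  have "polytest h'"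
    unfolding h'_def
    by (intro polytest.add polytest_sum polytest.scale polytest.coord polytest.test test test_function_laplacian test_function_partial_deriv)
  moreover have "fourier (\<lambda>y. h' (y, x)) k = complex_of_real (1 + (norm (k + x))\<^sup>2) * fourier g k" for x k
  proof -
    have t1: "test_function (\<lambda>y. (- 1) * laplacian g y)"
      by (intro test_function_cmult test_function_laplacian test)
    have t2: "test_function (\<lambda>y. (- 2 * \<i>) * (complex_of_real (x \<bullet> j) * partial_deriv j g y))" if "j \<in> Basis" for j
      by (intro test_function_cmult test_function_partial_deriv test that)
    have t3: "test_function (\<lambda>y. complex_of_real (x \<bullet> j) * (complex_of_real (x \<bullet> j) * g y))" for j
      by (intro test_function_cmult test)
    have "fourier (\<lambda>y. h' (y, x)) k = fourier g k + ((- 1) * fourier (laplacian g) k +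
       ((\<Sum>j\<in>Basis. (- 2 * \<i>) * (complex_of_real (x \<bullet> j) * fourier (partial_deriv j g) k))
        + (\<Sum>j\<in>Basis. complex_of_real (x \<bullet> j) * (complex_of_real (x \<bullet> j) * fourier g k))))"
      unfolding h'_def fst_conv snd_conv
      apply (subst fourier_add)
        apply (intro test_function_integrable test)
       apply (intro test_function_integrable test_function_add test_function_sum t1 t2 t3, assumption)
      apply (subst fourier_add)
        apply (intro test_function_integrable t1)
       apply (intro test_function_integrable test_function_add test_function_sum t1 t2 t3, assumption)
      apply (subst fourier_add)
        apply (intro test_function_integrable test_function_sum t2, assumption)
       apply (intro test_function_integrable test_function_sum t3)
      apply (simp only: fourier_sum[OF t2] fourier_sum[OF t3] fourier_cmult)
      done
    also have "(\<Sum>j\<in>Basis. (- 2 * \<i>) * (complex_of_real (x \<bullet> j) * fourier (partial_deriv j g) k))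
       = complex_of_real (2 * (x \<bullet> k)) * fourier g k"
    proof -
      have "(- 2 * \<i>) * (complex_of_real (x \<bullet> j) * fourier (partial_deriv j g) k)
          = complex_of_real (2 * ((x \<bullet> j) * (k \<bullet> j))) * fourier g k" if "j \<in> Basis" for j
      proof -
        have "(- 2 * \<i>) * (a * (\<i> * b * z)) = 2 * (a * b) * z" for a b z :: complex
        proof -
          have "(- 2 * \<i>) * (a * (\<i> * b * z)) = (- 2) * (\<i> * \<i>) * (a * b * z)" by (simp only: ac_simps)
          then show ?thesis by simp
        qed
        then show ?thesis
          unfolding fourier_partial_deriv[OF test that] by (simp only: of_real_mult of_real_numeral)
      qed
      then show ?thesis
        unfolding euclidean_inner[of x k]
        by (simp add: sum_distrib_right[symmetric] sum_distrib_left[symmetric] flip: of_real_sum of_real_mult)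
    qed
    also have "(\<Sum>j\<in>Basis. complex_of_real (x \<bullet> j) * (complex_of_real (x \<bullet> j) * fourier g k))
       = complex_of_real ((norm x)\<^sup>2) * fourier g k"
      unfolding norm_power2_Basis by (simp add: sum_distrib_right power2_eq_square mult.assoc)
    also have "fourier g k + ((- 1) * fourier (laplacian g) k + (complex_of_real (2 * (x \<bullet> k)) * fourier g k + complex_of_real ((norm x)\<^sup>2) * fourier g k))
       = complex_of_real (1 + ((norm k)\<^sup>2 + 2 * (x \<bullet> k) + (norm x)\<^sup>2)) * fourier g k"
      unfolding fourier_laplacian[OF test] by (simp add: algebra_simps)
    also have "(norm k)\<^sup>2 + 2 * (x \<bullet> k) + (norm x)\<^sup>2 = (norm (k + x))\<^sup>2"
      by (simp add: power2_norm_eq_inner inner_add_left inner_add_right inner_commute)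
    finally show ?thesis .
  qed
  ultimately show ?case by auto
next
  case (coord h j)
  then obtain h' where h': "polytest h'" "\<And>x k. fourier (\<lambda>y. h' (y, x)) k = complex_of_real (1 + (norm (k + x))\<^sup>2) * fourier (\<lambda>y. h (y, x)) k" by blast
  show ?case
    by (rule exI[of _ "\<lambda>p. complex_of_real (snd p \<bullet> j) * h' p"]) (simp add: fourier_cmult h' polytest.coord)
next
  case (scale h c)
  then obtain h' where h': "polytest h'" "\<And>x k. fourier (\<lambda>y. h' (y, x)) k = complex_of_real (1 + (norm (k + x))\<^sup>2) * fourier (\<lambda>y. h (y, x)) k" by blast
  show ?case
    by (rule exI[of _ "\<lambda>p. c * h' p"]) (simp add: fourier_cmult h' polytest.scale)
next
  case (add h k)
  from add.IH(1) obtain h' where h': "polytest h'" "\<And>x q. fourier (\<lambda>y. h' (y, x)) q = complex_of_real (1 + (norm (q + x))\<^sup>2) * fourier (\<lambda>y. h (y, x)) q" by blast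
  from add.IH(2) obtain k' where k': "polytest k'" "\<And>x q. fourier (\<lambda>y. k' (y, x)) q = complex_of_real (1 + (norm (q + x))\<^sup>2) * fourier (\<lambda>y. k (y, x)) q" by blast
  have t: "integrable lborel (\<lambda>y. h (y, x))" "integrable lborel (\<lambda>y. k (y, x))" "integrable lborel (\<lambda>y. h' (y, x))" "integrable lborel (\<lambda>y. k' (y, x))" for x
    using add.hyps h'(1) k'(1) by (intro test_function_integrable polytest_test_function; simp)+
  show ?case
    by (rule exI[of _ "\<lambda>p. h' p + k' p"]) (simp add: fourier_add t h' k' polytest.add distrib_left)
qed

lemma ex_polytest_power:
  assumes f: "test_function f"
  shows "\<exists>h. polytest h \<and> (\<forall>x k. fourier (\<lambda>y. h (y, x)) k = complex_of_real ((1 + (norm (k + x))\<^sup>2) ^ m) * fourier f k)"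
proof (induction m)
  case 0
  show ?case by (rule exI[of _ "\<lambda>p. f (fst p)"]) (simp add: polytest.test f)
next
  case (Suc m)
  then obtain h where h: "polytest h" "\<And>x k. fourier (\<lambda>y. h (y, x)) k = complex_of_real ((1 + (norm (k + x))\<^sup>2) ^ m) * fourier f k" by blast
  from polytest_one_minus_laplacian[OF h(1)] obtain h'
    where h': "polytest h'" "\<And>x k. fourier (\<lambda>y. h' (y, x)) k = complex_of_real (1 + (norm (k + x))\<^sup>2) * fourier (\<lambda>y. h (y, x)) k" by blast
  show ?case
    by (intro exI[of _ h'] conjI allI h'(1)) (simp only: h'(2) h(2) power_Suc of_real_mult mult.assoc)
qed

section \<open>Factorisation into Hilbert-Schmidt operators\<close>

text \<open>
  The kernel of the Fourier transform, made square integrable by a weight in each variable.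
\<close>

definition fourier_kernel :: "real \<Rightarrow> 'n::finite phase \<times> 'n phase \<Rightarrow> complex" where
  "fourier_kernel s p = complex_of_real (decay (fst p) * decay (snd p) / (2 * pi) ^ CARD('n)) * cis (s * (fst p \<bullet> snd p))"

lemma bounded_borel_decay: "bounded_borel decay"
  by (rule bounded_borelI[where C = 1]) (simp_all add: decay_le_1 less_imp_le[OF decay_pos])

lemma l2_kernel_fourier: "l2_kernel (fourier_kernel s :: 'n::finite phase \<times> 'n phase \<Rightarrow> complex)"
proof -
  have m: "(fourier_kernel s :: 'n phase \<times> 'n phase \<Rightarrow> complex) \<in> borel_measurable (borel \<Otimes>\<^sub>M borel)"
    unfolding fourier_kernel_def[abs_def] by measurable
  have d: "integrable lborel (\<lambda>x :: 'n phase. (decay x)\<^sup>2)"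
    using decay_square_integrable[where 'a = "'n phase"] by (simp add: square_integrable_def)
  have "integrable (lborel \<Otimes>\<^sub>M lborel) (\<lambda>(y :: 'n phase, x :: 'n phase). (1 / ((2 * pi) ^ CARD('n))\<^sup>2) * ((decay x)\<^sup>2 * (decay y)\<^sup>2))"
    using integrable_pair_shear[OF d d, of "\<lambda>_. 0" "\<lambda>_. 1 / ((2 * pi) ^ CARD('n))\<^sup>2" "1 / ((2 * pi) ^ CARD('n))\<^sup>2"] by simp
  moreover have "(\<lambda>(y :: 'n phase, x :: 'n phase). (1 / ((2 * pi) ^ CARD('n))\<^sup>2) * ((decay x)\<^sup>2 * (decay y)\<^sup>2))
      = (\<lambda>p. (cmod (fourier_kernel s p))\<^sup>2)"
    unfolding fourier_kernel_def norm_mult norm_of_real norm_cis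
    by (simp add: fun_eq_iff split_beta power_divide power_mult_distrib)
  ultimately show ?thesis using m by (simp add: l2_kernel_def)
qed

lemma integrable_mult_square_integrable:
  assumes "square_integrable f" "square_integrable g"
  shows "integrable lborel (\<lambda>x. f x * g x)"
proof -
  have [measurable]: "f \<in> borel_measurable borel" "g \<in> borel_measurable borel"
    using assms by (simp_all add: square_integrable_def)
  have "square_integrable (\<lambda>x. cnj (f x))" using assms(1) by (simp add: square_integrable_def)
  from square_integrable_inner[OF this assms(2)] show ?thesis by simp
qed

lemma Kop_fourier_kernel:
  assumes s: "s * s = 1"
  shows "Kop (fourier_kernel s) w = mulop decay (FT s (mulop decay w))"
proof -
  define g where "g = (\<lambda>x. complex_of_real (decay x) * rep_l2 w x)"
  have g: "integrable lborel g" "square_integrable g"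
    unfolding g_def
    by (rule integrable_mult_square_integrable[OF decay_square_integrable square_integrable_rep],
        rule mulop_square_integrable[OF bounded_borel_decay square_integrable_rep])
  have "mulop decay (FT s (mulop decay w)) = abs_l2 (\<lambda>k. complex_of_real (decay k) * fts s g k)"
    unfolding mulop_def[of decay w] g_def[symmetric] FT_abs[OF s g]
    by (rule mulop_abs[OF bounded_borel_decay fts_contraction(1)[OF g s]])
  also have "(\<lambda>k. complex_of_real (decay k) * fts s g k) = (\<lambda>k. \<integral>x. fourier_kernel s (k, x) * rep_l2 w x \<partial>lborel)"
  proof
    fix k
    have "fourier_kernel s (k, x) * rep_l2 w x
        = complex_of_real (decay k) * (complex_of_real (1 / (2 * pi) ^ CARD('a)) * (cis (s * (k \<bullet> x)) * g x))" for x
      by (simp add: fourier_kernel_def g_def)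
    then show "complex_of_real (decay k) * fts s g k = (\<integral>x. fourier_kernel s (k, x) * rep_l2 w x \<partial>lborel)"
      unfolding fts_def by (simp only: Bochner_Integration.integral_mult_right_zero)
  qed
  finally show ?thesis by (simp add: Kop_def)
qed

text \<open>
  From frequencies \<open>snd p\<close> to positions \<open>fst p\<close>.  The growing factor \<open>inverse (decay y)\<close> compensates one of the weights
  of the first Hilbert-Schmidt factor, the symbol \<open>h\<close> the other.
\<close>

definition heat_kernel :: "('n::finite phase \<times> 'n phase \<Rightarrow> complex) \<Rightarrow> real \<Rightarrow> 'n phase \<times> 'n phase \<Rightarrow> complex" where
  "heat_kernel h t p = complex_of_real (inverse (decay (fst p)) * gauss t (snd p)) *
     (cis (snd p \<bullet> fst p) * h (fst p + (1/2) *\<^sub>R rot (snd p), snd p))"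

lemma heat_kernel_measurable:
  assumes "polytest h"
  shows "heat_kernel h t \<in> borel_measurable (borel \<Otimes>\<^sub>M borel)"
proof -
  note [measurable] = polytest_measurable[OF assms]
  show ?thesis unfolding heat_kernel_def[abs_def] by measurable
qed

lemma integrable_indicator_cball: "integrable lborel (\<lambda>x::'a::euclidean_space. indicator (cball 0 R) x :: real)"
  by (intro integrable_real_indicator emeasure_lborel_cball_finite) simp

text \<open>
  On the support of the kernel \<open>\<parallel>y\<parallel> \<le> R + \<parallel>x\<parallel>\<close>, so the growing weight in \<open>y\<close> is at most exponential in \<open>\<parallel>x\<parallel>\<close>, and half of
  the Gaussian absorbs it.
\<close>

lemma l2_kernel_heat:
  fixes h :: "'n::finite phase \<times> 'n phase \<Rightarrow> complex"
  assumes h: "polytest h" and t: "t > 0"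
  shows "l2_kernel (heat_kernel h t)"
proof -
  note [measurable] = heat_kernel_measurable[OF h]
  obtain C N R where b: "0 \<le> C" "0 \<le> N" "0 \<le> R" "\<And>y x. cmod (h (y, x)) \<le> C * exp (N * norm x)"
    "\<And>y x. h (y, x) \<noteq> 0 \<Longrightarrow> norm y \<le> R" using polytest_bound[OF h] by blast
  define d where "d = real (2 * DIM('n phase))"
  define M where "M = C * exp (d * R + (d + N)\<^sup>2 / t)"
  have sq: "integrable lborel (\<lambda>x::'n phase. (M * gauss (t / 2) x)\<^sup>2)"
    using square_integrable_scale[OF gauss_square_integrable[of "t / 2", where 'a = "'n phase"], of "complex_of_real M"] t
    by (simp add: square_integrable_def norm_mult power_mult_distrib)
  have dom: "integrable (lborel \<Otimes>\<^sub>M lborel) (\<lambda>(x :: 'n phase, y). indicator (cball 0 R) (y + (1/2) *\<^sub>R rot x) * (M * gauss (t / 2) x)\<^sup>2)"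
    using integrable_pair_shear[OF integrable_indicator_cball sq, of "\<lambda>x. (1/2) *\<^sub>R rot x" "\<lambda>_. 1" 1] by simp
  have dom': "integrable (lborel \<Otimes>\<^sub>M lborel) (\<lambda>(y, x :: 'n phase). indicator (cball 0 R) (y + (1/2) *\<^sub>R rot x) * (M * gauss (t / 2) x)\<^sup>2)"
    using lborel_pair.integrable_product_swap[OF dom] by (simp add: split_beta')
  have le: "(cmod (heat_kernel h t (y, x)))\<^sup>2 \<le> indicator (cball 0 R) (y + (1/2) *\<^sub>R rot x) * (M * gauss (t / 2) x)\<^sup>2" for y x
  proof (cases "h (y + (1/2) *\<^sub>R rot x, x) = 0")
    case True
    then show ?thesis by (simp add: heat_kernel_def)
  next
    case False
    then have R: "norm (y + (1/2) *\<^sub>R rot x) \<le> R" by (rule b(5))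
    have "norm y \<le> norm (y + (1/2) *\<^sub>R rot x) + norm ((1/2) *\<^sub>R rot x)"
      using norm_triangle_ineq4[of "y + (1/2) *\<^sub>R rot x" "(1/2) *\<^sub>R rot x"] by simp
    also have "norm ((1/2) *\<^sub>R rot x) \<le> norm x" by simp
    finally have y: "norm y \<le> R + norm x" using R by linarith
    have "1 + (norm y)\<^sup>2 \<le> (1 + norm y)\<^sup>2" by (simp add: power2_sum)
    also have "\<dots> \<le> (exp (norm y))\<^sup>2"
      using exp_ge_add_one_self[of "norm y"] by (intro power_mono) simp_all
    finally have "(1 + (norm y)\<^sup>2) ^ DIM('n phase) \<le> ((exp (norm y))\<^sup>2) ^ DIM('n phase)"
      by (intro power_mono) (simp_all add: add_nonneg_nonneg)
    also have "\<dots> = exp (d * norm y)"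
      unfolding power_mult[symmetric] d_def exp_of_nat_mult ..
    also have "\<dots> \<le> exp (d * (R + norm x))"
      using y by (simp add: d_def mult_left_mono)
    finally have inv: "inverse (decay y) \<le> exp (d * (R + norm x))" by (simp add: decay_def)
    have "cmod (heat_kernel h t (y, x)) = inverse (decay y) * gauss t x * cmod (h (y + (1/2) *\<^sub>R rot x, x))"
      using decay_pos[of y] gauss_pos[of t x] by (simp add: heat_kernel_def norm_mult norm_inverse)
    also have "\<dots> \<le> exp (d * (R + norm x)) * gauss t x * (C * exp (N * norm x))"
      using decay_pos[of y] gauss_pos[of t x] by (intro mult_mono inv b(4)) simp_all
    also have "\<dots> = C * (exp (d * R + (d + N) * norm x) * gauss t x)"
      by (simp add: distrib_left distrib_right exp_add)
    also have "\<dots> \<le> C * (exp (d * R + (d + N)\<^sup>2 / t) * gauss (t / 2) x)"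
      by (intro mult_left_mono exp_mult_gauss_le t b(1))
    finally have "cmod (heat_kernel h t (y, x)) \<le> M * gauss (t / 2) x" by (simp add: M_def)
    from power_mono[OF this norm_ge_zero, of 2] show ?thesis using R by simp
  qed
  have "integrable (lborel \<Otimes>\<^sub>M lborel) (\<lambda>p. (cmod (heat_kernel h t p))\<^sup>2)"
    by (rule integrable_boundI[OF dom']) (use le in \<open>auto simp: split_beta'\<close>)
  then show ?thesis by (simp add: l2_kernel_def)
qed

text \<open>
  Left multiplication by \<open>f\<close> maps the plane wave of frequency \<open>x\<close> to its product with a translate of \<open>f\<close> by \<open>rot x / 2\<close>,
  so composing with the Gaussian multiplier gives the kernel with \<open>h = f\<close>; the symbol \<open>h\<close> absorbs the inverse of the
  first Hilbert-Schmidt factor.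
\<close>

lemma heat_kernel_factorisation:
  fixes f :: "'n::finite phase \<Rightarrow> complex"
  assumes f: "test_function f" and h: "polytest h" and t: "t > 0"
    and hf: "\<And>x k. fourier (\<lambda>y. h (y, x)) k = complex_of_real ((1 + (norm (k + x))\<^sup>2) ^ DIM('n phase)) * fourier f k"
  shows "mulop decay (FT (- 1) (mulop decay (Kop (heat_kernel h t) v))) = average twist (fourier f) (mulop (gauss t) v)"
proof -
  note [measurable] = polytest_measurable[OF h]
  note k = l2_kernel_heat[OF h t]
  have tg: "bounded_borel (gauss t :: 'n phase \<Rightarrow> real)" using t by (simp add: bounded_borel_gauss)
  define \<psi> where "\<psi> = (\<lambda>x. complex_of_real (gauss t x) * rep_l2 v x)"
  have \<psi>: "integrable lborel \<psi>" "square_integrable \<psi>"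
    unfolding \<psi>_def
    by (rule integrable_mult_square_integrable[OF gauss_square_integrable[OF t] square_integrable_rep],
        rule mulop_square_integrable[OF tg square_integrable_rep])
  have [measurable]: "\<psi> \<in> borel_measurable borel" using \<psi>(1) by simp
  define P where "P = (\<lambda>x y. cis (x \<bullet> y) * h (y + (1/2) *\<^sub>R rot x, x) * \<psi> x)"
  define \<Psi> where "\<Psi> = (\<lambda>y. \<integral>x. P x y \<partial>lborel)"
  obtain C N R where b: "0 \<le> C" "0 \<le> N" "0 \<le> R" "\<And>y x. cmod (h (y, x)) \<le> C * exp (N * norm x)"
    "\<And>y x. h (y, x) \<noteq> 0 \<Longrightarrow> norm y \<le> R" using polytest_bound[OF h] by blast
  define M where "M = C * exp (N\<^sup>2 / t)"
  have "integrable lborel (\<lambda>x::'n phase. complex_of_real (gauss (t / 2) x) * rep_l2 v x)"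
    by (rule integrable_mult_square_integrable[OF gauss_square_integrable square_integrable_rep]) (use t in simp)
  from integrable_mult_right[OF integrable_norm[OF this], of M]
  have Gi: "integrable lborel (\<lambda>x::'n phase. M * (gauss (t / 2) x * cmod (rep_l2 v x)))"
    by (simp add: norm_mult abs_of_pos[OF gauss_pos])
  have dom: "integrable (lborel \<Otimes>\<^sub>M lborel) (\<lambda>(x :: 'n phase, y). indicator (cball 0 R) (y + (1/2) *\<^sub>R rot x) * (M * (gauss (t / 2) x * cmod (rep_l2 v x))))"
    using integrable_pair_shear[OF integrable_indicator_cball Gi, of "\<lambda>x. (1/2) *\<^sub>R rot x" "\<lambda>_. 1" 1] by simp
  have le: "cmod (P x y) \<le> indicator (cball 0 R) (y + (1/2) *\<^sub>R rot x) * (M * (gauss (t / 2) x * cmod (rep_l2 v x)))" for x y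
  proof (cases "h (y + (1/2) *\<^sub>R rot x, x) = 0")
    case True
    then show ?thesis using b(1) less_imp_le[OF gauss_pos[of "t / 2" x]] by (simp add: P_def M_def)
  next
    case False
    then have R: "norm (y + (1/2) *\<^sub>R rot x) \<le> R" by (rule b(5))
    have "cmod (h (y + (1/2) *\<^sub>R rot x, x)) * gauss t x \<le> C * exp (N * norm x) * gauss t x"
      by (intro mult_right_mono b(4) less_imp_le[OF gauss_pos])
    also have "\<dots> \<le> C * (exp (0 + N\<^sup>2 / t) * gauss (t / 2) x)"
      using mult_left_mono[OF exp_mult_gauss_le[OF t, of 0 N x] b(1)] by (simp add: mult.assoc)
    finally have "cmod (h (y + (1/2) *\<^sub>R rot x, x)) * gauss t x \<le> M * gauss (t / 2) x" by (simp add: M_def)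
    from mult_right_mono[OF this norm_ge_zero[of "rep_l2 v x"]]
    show ?thesis using R gauss_pos[of t x] by (simp add: P_def \<psi>_def norm_mult mult.assoc)
  qed
  have P: "integrable (lborel \<Otimes>\<^sub>M lborel) (\<lambda>(x, y). P x y)"
    by (rule integrable_boundI[OF dom]) (use le in \<open>auto simp: split_beta' P_def\<close>)
  have \<Psi>i: "integrable lborel \<Psi>"
    unfolding \<Psi>_def by (rule lborel_pair.integrable_snd[OF P])
  have \<Psi>_eq: "\<Psi> y = complex_of_real (decay y) * (\<integral>x. heat_kernel h t (y, x) * rep_l2 v x \<partial>lborel)" for y
  proof -
    have "complex_of_real (decay y) * complex_of_real (inverse (decay y)) = 1"
      using decay_pos[of y] by (simp flip: of_real_mult)
    then have "P x y = complex_of_real (decay y) * (heat_kernel h t (y, x) * rep_l2 v x)" for x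
      unfolding P_def \<psi>_def heat_kernel_def fst_conv snd_conv of_real_mult mult.assoc[symmetric] by (simp add: ac_simps)
    then show ?thesis unfolding \<Psi>_def by (simp only: Bochner_Integration.integral_mult_right_zero)
  qed
  have \<Psi>sq: "square_integrable \<Psi>"
    unfolding \<Psi>_eq[abs_def] by (rule mulop_square_integrable[OF bounded_borel_decay Kop_square_integrable(1)[OF k]])
  have fl: "fourier_l1 f" using f by (rule test_function_fourier_l1)
  have \<phi>: "integrable lborel (fourier f)" using fl by (simp add: fourier_l1_def)
  have bd: "cmod (fourier f x) \<le> 1 / (2 * pi) ^ CARD('n) * (\<integral>x. cmod (f x) \<partial>lborel)" for x
    unfolding fourier_eq_fts using fl by (intro fts_bound) (simp add: fourier_l1_def)
  note tw = average_twist_abs[OF \<phi> bd \<psi>]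
  have F\<Psi>: "complex_of_real (decay k) * fourier \<Psi> k = tconv (fourier f) \<psi> k" for k
  proof -
    define c where "c = complex_of_real (1 / (2 * pi) ^ CARD('n))"
    have Pc: "integrable (lborel \<Otimes>\<^sub>M lborel) (\<lambda>(x, y). cis (- (k \<bullet> y)) * P x y)"
      by (rule Bochner_Integration.integrable_bound[OF P]) (auto simp: split_beta' P_def norm_mult)
    have "fourier \<Psi> k = c * (\<integral>y. (\<integral>x. cis (- (k \<bullet> y)) * P x y \<partial>lborel) \<partial>lborel)"
      by (simp add: fourier_def \<Psi>_def c_def)
    also have "(\<integral>y. (\<integral>x. cis (- (k \<bullet> y)) * P x y \<partial>lborel) \<partial>lborel) = (\<integral>x. (\<integral>y. cis (- (k \<bullet> y)) * P x y \<partial>lborel) \<partial>lborel)"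
      by (rule lborel_pair.Fubini_integral[OF Pc])
    also have "c * \<dots> = (\<integral>x. c * (\<integral>y. cis (- (k \<bullet> y)) * P x y \<partial>lborel) \<partial>lborel)" by simp
    also have "\<dots> = (\<integral>x. inverse (complex_of_real (decay k)) * (cis ((k \<bullet> rot x) / 2) * (fourier f (k - x) * \<psi> x)) \<partial>lborel)"
    proof (rule Bochner_Integration.integral_cong[OF refl])
      fix x
      have hm: "(\<lambda>y. h (y, x)) \<in> borel_measurable borel" by measurable
      have "c * (\<integral>y. cis (- (k \<bullet> y)) * P x y \<partial>lborel)
         = fourier (\<lambda>y. cis (x \<bullet> y) * h (y + (1/2) *\<^sub>R rot x, x)) k * \<psi> x"
      proof -
        have "cis (- (k \<bullet> y)) * P x y = cis (- (k \<bullet> y)) * (cis (x \<bullet> y) * h (y + (1/2) *\<^sub>R rot x, x)) * \<psi> x" for y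
          by (simp add: P_def)
        then show ?thesis
          by (simp only: fourier_def c_def Bochner_Integration.integral_mult_left_zero) (simp only: mult.assoc)
      qed
      also have "\<dots> = cis ((k \<bullet> rot x) / 2) * fourier (\<lambda>y. h (y, x)) (k - x) * \<psi> x"
        unfolding fourier_plane_wave_shift[OF hm, of x k] ..
      also have "fourier (\<lambda>y. h (y, x)) (k - x) = inverse (complex_of_real (decay k)) * fourier f (k - x)"
        unfolding hf decay_def by simp
      finally show "c * (\<integral>y. cis (- (k \<bullet> y)) * P x y \<partial>lborel)
        = inverse (complex_of_real (decay k)) * (cis ((k \<bullet> rot x) / 2) * (fourier f (k - x) * \<psi> x))" by simp
    qed
    also have "\<dots> = inverse (complex_of_real (decay k)) * tconv (fourier f) \<psi> k"
      by (simp add: tconv_def)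
    finally show ?thesis using decay_pos[of k] by simp
  qed
  have "mulop decay (Kop (heat_kernel h t) v) = abs_l2 \<Psi>"
    unfolding Kop_def mulop_abs[OF bounded_borel_decay Kop_square_integrable(1)[OF k]] \<Psi>_eq[abs_def] ..
  then have "mulop decay (FT (- 1) (mulop decay (Kop (heat_kernel h t) v))) = mulop decay (abs_l2 (fourier \<Psi>))"
    by (simp add: FT_abs \<Psi>i \<Psi>sq fourier_eq_fts)
  also have "\<dots> = abs_l2 (tconv (fourier f) \<psi>)"
    using mulop_abs[OF bounded_borel_decay fts_contraction(1)[OF \<Psi>i \<Psi>sq, of "- 1"]]
    by (simp add: fourier_eq_fts[symmetric] F\<Psi>)
  also have "\<dots> = average twist (fourier f) (mulop (gauss t) v)"
    unfolding mulop_def \<psi>_def[symmetric] tw(2) ..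
  finally show ?thesis .
qed

text \<open>
  All phases and the weights in \<open>y\<close> cancel.  The integral over \<open>y\<close> is then the transform of \<open>h\<close> at 0, where the power
  of \<open>1 + \<parallel>x\<parallel>\<^sup>2\<close> cancels the weight in \<open>x\<close>, and a Gaussian integral remains.
\<close>

lemma heat_kernel_trace:
  fixes f :: "'n::finite phase \<Rightarrow> complex"
  assumes h: "polytest h" and t: "t > 0"
    and hf: "\<And>x k. fourier (\<lambda>y. h (y, x)) k = complex_of_real ((1 + (norm (k + x))\<^sup>2) ^ DIM('n phase)) * fourier f k"
  shows "(\<integral>y. (\<integral>x. cnj (fourier_kernel 1 (y, x)) * heat_kernel h t (y, x) \<partial>lborel) \<partial>lborel)
     = (\<integral>x. f x \<partial>lborel) / complex_of_real (t ^ CARD('n))"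
proof -
  note k1 = l2_kernel_fourier[of 1, where 'n = 'n] and k2 = l2_kernel_heat[OF h t]
  note [measurable] = polytest_measurable[OF h] l2_kernel_measurable[OF k1] l2_kernel_measurable[OF k2]
  define c where "c = complex_of_real (1 / (2 * pi) ^ CARD('n))"
  define Q where "Q = (\<lambda>y x. cnj (fourier_kernel 1 (y, x)) * heat_kernel h t (y, x))"
  have Qi: "integrable (lborel \<Otimes>\<^sub>M lborel) (\<lambda>(y, x). Q y x)"
  proof (rule integrable_boundI)
    show "integrable (lborel \<Otimes>\<^sub>M lborel) (\<lambda>p. (cmod (fourier_kernel 1 p :: complex))\<^sup>2 + (cmod (heat_kernel h t p))\<^sup>2)"
      using k1 k2 by (intro Bochner_Integration.integrable_add) (simp_all add: l2_kernel_def)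
    have "a * b \<le> a\<^sup>2 + b\<^sup>2" if "0 \<le> a" "0 \<le> b" for a b :: real
      using sum_squares_bound[of a b] mult_nonneg_nonneg[OF that] by linarith
    then show "norm (case p of (y, x) \<Rightarrow> Q y x) \<le> (cmod (fourier_kernel 1 p))\<^sup>2 + (cmod (heat_kernel h t p))\<^sup>2" for p
      by (simp add: Q_def split_beta norm_mult)
  qed (simp add: Q_def split_beta')
  have Q_eq: "Q y x = complex_of_real (decay x * gauss t x) * (c * h (y + (1/2) *\<^sub>R rot x, x))" for y x
  proof -
    have "cnj (cis (y \<bullet> x)) * cis (x \<bullet> y) = 1" by (simp add: cis_cnj cis_mult inner_commute)
    moreover have "complex_of_real (decay y) * complex_of_real (inverse (decay y)) = 1"
      using decay_pos[of y] by (simp flip: of_real_mult)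
    moreover have "cnj (complex_of_real (a * b / K) * z) * (complex_of_real (a' * g) * (z' * H))
        = (complex_of_real a * complex_of_real a') * (cnj z * z') * (complex_of_real (b * g) * (complex_of_real (1 / K) * H))"
      for a a' b g K :: real and z z' H :: complex
      by (simp add: divide_inverse ac_simps)
    ultimately show ?thesis
      unfolding Q_def fourier_kernel_def heat_kernel_def c_def fst_conv snd_conv mult_1 by (simp only: mult_1)
  qed
  have "(\<integral>y. (\<integral>x. Q y x \<partial>lborel) \<partial>lborel) = (\<integral>x. (\<integral>y. Q y x \<partial>lborel) \<partial>lborel)"
    by (rule lborel_pair.Fubini_integral[OF Qi, symmetric])
  also have "\<dots> = (\<integral>x. fourier f 0 * complex_of_real (gauss t (x :: 'n phase)) \<partial>lborel)"
  proof (rule Bochner_Integration.integral_cong[OF refl])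
    fix x
    have hm: "(\<lambda>y. h (y, x)) \<in> borel_measurable borel" by measurable
    have "(\<integral>y. Q y x \<partial>lborel) = complex_of_real (decay x * gauss t x) * (c * (\<integral>y. h (y + (1/2) *\<^sub>R rot x, x) \<partial>lborel))"
      unfolding Q_eq by simp
    also have "(\<integral>y. h (y + (1/2) *\<^sub>R rot x, x) \<partial>lborel) = (\<integral>y. h (y, x) \<partial>lborel)"
      by (rule lborel_integral_translate[OF hm])
    also have "c * \<dots> = fourier (\<lambda>y. h (y, x)) 0" by (simp add: fourier_def c_def)
    also have "\<dots> = inverse (complex_of_real (decay x)) * fourier f 0" unfolding hf decay_def by simp
    finally show "(\<integral>y. Q y x \<partial>lborel) = fourier f 0 * complex_of_real (gauss t x)"
      using decay_pos[of x] by simp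
  qed
  also have "\<dots> = fourier f 0 * complex_of_real (\<integral>x. gauss t (x :: 'n phase) \<partial>lborel)"
    by (simp only: Bochner_Integration.integral_mult_right_zero integral_complex_of_real)
  also have "(\<integral>x. gauss t (x :: 'n phase) \<partial>lborel) = (2 * pi / t) ^ CARD('n)"
  proof -
    have "sqrt (2 * pi / t) ^ DIM('n phase) = (2 * pi / t) ^ CARD('n)"
      unfolding DIM_phase power_mult using t by simp
    then show ?thesis unfolding gauss_def gaussian_integral(2)[OF t] .
  qed
  also have "fourier f 0 * complex_of_real ((2 * pi / t) ^ CARD('n)) = (\<integral>x. f x \<partial>lborel) / complex_of_real (t ^ CARD('n))"
    by (simp add: fourier_def power_divide field_simps)
  finally show ?thesis by (simp add: Q_def)
qed

section \<open>The trace\<close>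

lemma onb_FT_image:
  assumes s: "s * s = 1" and E: "onb E"
  shows "onb (FT s ` E)"
  unfolding onb_def
proof (intro conjI ballI allI impI)
  fix a b assume "a \<in> FT s ` E" "b \<in> FT s ` E"
  then obtain e e' where e: "e \<in> E" "e' \<in> E" "a = FT s e" "b = FT s e'" by blast
  have "FT s e = FT s e' \<longleftrightarrow> e = e'" by (metis FT_inverse[OF s])
  then show "cinner a b = (if a = b then 1 else 0)"
    using E e by (simp add: FT_isometry[OF s] onb_def)
next
  fix u assume u: "\<forall>e\<in>FT s ` E. cinner e u = 0"
  have "FT (- s) u = 0"
    using E u by (auto simp: onb_def FT_adjoint[OF s])
  then have "norm u = 0" using FT_norm[of "- s" u] s by simp
  then show "u = 0" by simp
qed

lemma inj_on_FT: "s * s = 1 \<Longrightarrow> inj_on (FT s) E"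
  by (intro inj_onI) (metis FT_inverse)

lemma mulop_decay_eq_0:
  assumes "mulop decay u = 0"
  shows "u = 0"
proof -
  obtain g where g: "square_integrable g" "u = abs_l2 g" by (metis l2_cases)
  have "abs_l2 (\<lambda>x. complex_of_real (decay x) * g x) = abs_l2 (\<lambda>x. 0)"
    using assms unfolding g(2) mulop_abs[OF bounded_borel_decay g(1)] abs_l2_zero .
  then have "AE x in lborel. complex_of_real (decay x) * g x = 0"
    by (subst (asm) abs_l2_eq_iff[OF mulop_square_integrable[OF bounded_borel_decay g(1)] square_integrable_zero])
  then have "AE x in lborel. g x = 0"
    by eventually_elim (simp add: less_imp_neq[OF decay_pos, symmetric])
  then show ?thesis unfolding g(2) abs_l2_zero[symmetric] by (intro abs_l2_eqI g square_integrable_zero)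
qed

text \<open>
  An injective Hilbert-Schmidt operator maps only countably many basis vectors to something nonzero.
\<close>

lemma onb_countable:
  fixes E :: "'n::finite phase l2 set"
  assumes E: "onb E"
  shows "countable E"
proof -
  have "countable {e \<in> E. (norm (Kop (fourier_kernel 1) e))\<^sup>2 \<noteq> 0}"
    by (rule summable_countable_real[OF Kop_summable[OF l2_kernel_fourier onb_orthonormal[OF E]]])
  moreover have "Kop (fourier_kernel 1) e \<noteq> 0" if "e \<in> E" for e
  proof
    assume "Kop (fourier_kernel 1) e = 0"
    then have "mulop decay (FT 1 (mulop decay e)) = 0" by (simp add: Kop_fourier_kernel)
    then have "FT 1 (mulop decay e) = 0" by (rule mulop_decay_eq_0)
    then have "norm (mulop decay e) = 0" using FT_norms(1)[of "mulop decay e"] by simp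
    then have "e = 0" by (simp add: mulop_decay_eq_0)
    moreover have "cinner e e = 1" using E that by (simp add: onb_def)
    ultimately show False by simp
  qed
  ultimately show ?thesis by (auto elim: countable_subset[rotated])
qed

text \<open>
  Moving the first factor to the left of the inner product turns the diagonal matrix elements into the pairing of
  two operators with square integrable kernels.
\<close>

lemma left_mult_heat_trace:
  fixes f :: "'n::finite phase \<Rightarrow> complex"
  assumes f: "test_function f" and t: "t > 0"
  shows "trace_class (left_mult (bop f) \<circ> heat t)"
    and "op_trace (left_mult (bop f) \<circ> heat t) = (\<integral>x. f x \<partial>lborel) / complex_of_real (t ^ CARD('n))"
proof -
  obtain h where h: "polytest h"
    and hf: "\<And>x k. fourier (\<lambda>y. h (y, x)) k = complex_of_real ((1 + (norm (k + x))\<^sup>2) ^ DIM('n phase)) * fourier f k"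
    using ex_polytest_power[OF f] by blast
  define A where "A = left_mult (bop f) \<circ> heat t"
  define B where "B = (\<lambda>w :: 'n phase l2. FT 1 (mulop decay (FT (- 1) (mulop decay w))))"
  define C where "C = (\<lambda>u. Kop (heat_kernel h t) (FT (- 1) u))"
  note k = l2_kernel_heat[OF h t]
  obtain E0 :: "'n phase l2 set" where E0: "onb E0" using ex_onb by blast
  have AB: "A u = B (C u)" for u
    using t unfolding A_def B_def C_def heat_kernel_factorisation[OF f h t hf]
    by (simp add: left_mult_bop[OF f] heat_eq_gauss_semigroup gauss_semigroup_def fmult_def)
  have "hilbert_schmidt B"
    unfolding hilbert_schmidt_def
  proof (intro conjI exI)
    show "bounded_clinear B"
      using bounded_clinear_compose[OF fmult_bounded_clinear[OF bounded_borel_decay] mulop_bounded_clinear[OF bounded_borel_decay]]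
      by (simp add: B_def fmult_def comp_def)
    have "norm (B e) = norm (Kop (fourier_kernel (- 1)) e)" for e
      by (simp add: B_def Kop_fourier_kernel)
    then show "(\<lambda>e. (norm (B e))\<^sup>2) summable_on E0"
      using Kop_summable[OF l2_kernel_fourier onb_orthonormal[OF E0], of "- 1"] by simp
  qed (rule E0)
  moreover have "hilbert_schmidt C"
    unfolding hilbert_schmidt_def
  proof (intro conjI exI)
    show "bounded_clinear C"
      using bounded_clinear_compose[OF Kop_bounded_clinear[OF k] bounded_clinear_FT(2)] by (simp add: C_def comp_def)
    show "onb (FT 1 ` E0)" by (rule onb_FT_image[OF _ E0]) simp
    show "(\<lambda>e. (norm (C e))\<^sup>2) summable_on FT 1 ` E0"
      using Kop_summable[OF k onb_orthonormal[OF E0]]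
      by (subst summable_on_reindex) (simp_all add: inj_on_FT C_def comp_def)
  qed
  moreover have "A = B \<circ> C" using AB by (simp add: fun_eq_iff)
  ultimately show "trace_class (left_mult (bop f) \<circ> heat t)"
    unfolding trace_class_def A_def by blast
  define I where "I = (\<integral>x. f x \<partial>lborel) / complex_of_real (t ^ CARD('n))"
  have tr: "((\<lambda>e. cinner e (A e)) has_sum I) E" if E: "onb E" for E
  proof -
    have E': "onb (FT (- 1) ` E)" by (rule onb_FT_image[OF _ E]) simp
    have "cinner e (A e) = cinner (Kop (fourier_kernel 1) (FT (- 1) e)) (Kop (heat_kernel h t) (FT (- 1) e))" for e
    proof -
      have "cinner e (A e) = cinner (mulop decay (FT 1 (mulop decay (FT (- 1) e)))) (C e)"
        unfolding AB B_def by (simp only: FT_adj(2)[symmetric] FT_adj(1) mulop_symmetric[OF bounded_borel_decay])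
      then show ?thesis by (simp add: Kop_fourier_kernel C_def)
    qed
    moreover have "((\<lambda>e. cinner (Kop (fourier_kernel 1) e) (Kop (heat_kernel h t) e)) has_sum I) (FT (- 1) ` E)"
      using Kop_trace_pairing[OF l2_kernel_fourier k E' onb_countable[OF E'], of 1]
      unfolding heat_kernel_trace[OF h t hf] I_def .
    ultimately show ?thesis
      by (subst (asm) has_sum_reindex) (simp_all add: inj_on_FT comp_def)
  qed
  have "op_trace A = I"
    unfolding op_trace_def
  proof (rule the_equality)
    fix c assume "\<forall>E. onb E \<longrightarrow> ((\<lambda>e. cinner e (A e)) has_sum c) E"
    then have "((\<lambda>e. cinner e (A e)) has_sum c) E0" using E0 by blast
    then show "c = I" using tr[OF E0] by (rule has_sum_unique)
  qed (use tr in blast)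
  then show "op_trace (left_mult (bop f) \<circ> heat t) = (\<integral>x. f x \<partial>lborel) / complex_of_real (t ^ CARD('n))"
    by (simp add: A_def I_def)
qed

theorem theorem5p5:
  fixes f :: "'n::finite phase \<Rightarrow> complex"
  assumes "test_function f"
  shows "(\<forall>t>0. trace_class (left_mult (bop f) \<circ> heat t)) \<and>
    ((\<lambda>t. complex_of_real (t ^ CARD('n)) * op_trace (left_mult (bop f) \<circ> heat t))
       \<longlongrightarrow> nc_volume (bop f)) (at_right 0) \<and>
    nc_volume (bop f) = (\<integral>x. f x \<partial>lborel)"
proof -
  have lim: "((\<lambda>t. complex_of_real (t ^ CARD('n)) * op_trace (left_mult (bop f) \<circ> heat t))
      \<longlongrightarrow> (\<integral>x. f x \<partial>lborel)) (at_right 0)"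
  proof (rule tendsto_eventually)
    have "complex_of_real (t ^ CARD('n)) * op_trace (left_mult (bop f) \<circ> heat t) = (\<integral>x. f x \<partial>lborel)" if "t > 0" for t
      using that by (simp add: left_mult_heat_trace(2)[OF assms that])
    then show "\<forall>\<^sub>F t in at_right 0. complex_of_real (t ^ CARD('n)) * op_trace (left_mult (bop f) \<circ> heat t) = (\<integral>x. f x \<partial>lborel)"
      by (auto simp: eventually_at_filter)
  qed
  have "nc_volume (bop f) = (\<integral>x. f x \<partial>lborel)"
    unfolding nc_volume_def by (rule tendsto_Lim[OF trivial_limit_at_right_real lim])
  with lim left_mult_heat_trace(1)[OF assms] show ?thesis by simp
qed

end
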